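(* Let $\Bbbk$ be a commutative ring and let $A$ be a differential graded (unital associative) $\Bbbk$-algebra. Let $B$ denote Connes' boundary on $HH_*(A,A)$. Then: 1) The graded algebra $\mathrm{End}(HH_*(A,A))$ of graded endomorphisms, with composition, equipped with the derived bracket $[a,b]_B=[[a,B],b]$, is a generalized Loday-Gerstenhaber algebra. 2) The morphism of graded algebras induced by the action $$\Phi:HH^*(A,A)\to\mathrm{End}(HH_*(A,A)),\quad a\mapsto i_a,$$ is a morphism of generalized Loday-Gerstenhaber algebras. In particular, its image $\Phi(HH^*(A,A))$ is a Gerstenhaber algebra.
   Context: $[f,g]=f\circ g-(-1)^{|f||g|}g\circ f$ is the graded commutator. Grading: lower degree $i$ is upper degree $-i$; $HH^p$ has lower degree $-p$. $\mathcal C_*(A,A)=(A\otimes T(sA),d_0+d_1)$ is the Hochschild chain complex, with elements $m[a_1|\dots|a_n]$, $(sA)_i=A_{i-1}$, and $\mathcal C^*(A,A)=(\mathrm{Hom}(T(sA),A),D_0+D_1)$ the Hochschild cochain complex; $HH_*(A,A)$, $HH^*(A,A)$ are their homologies. Connes' boundary $B:HH_*(A,A)\to HH_{*+1}(A,A)$ satisfies $B\circ B=0$. The action is $$i_f(m[a_1|\dots|a_n])=\sum_{p=0}^n(-1)^{|m||f|}\,m f([a_1|\dots|a_p])[a_{p+1}|\dots|a_n].$$ $HH^*(A,A)$ carries its canonical Gerstenhaber algebra structure: the cup product, $(f\cup g)([a_1|\dots|a_n])=\sum_p(-1)^{|g|(|sa_1|+\dots+|sa_p|)}f([a_1|\dots|a_p])g([a_{p+1}|\dots|a_n])$,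 and the Gerstenhaber bracket $\{f,g\}=f\circ g-(-1)^{(|f|+1)(|g|+1)}g\circ f$, where $(f\circ g)([a_1|\dots|a_n])=\sum(-1)^{(|g|+1)(|sa_1|+\dots+|sa_j|)}f([a_1|\dots|a_j|g([a_{j+1}|\dots|a_k])|a_{k+1}|\dots|a_n])$ (standard sign conventions). A generalized Loday-Gerstenhaber algebra is a (not necessarily commutative) graded algebra $E$ with a linear map $\{-,-\}:E_i\otimes E_j\to E_{i+j+1}$ satisfying $\{a,\{b,c\}\}=\{\{a,b\},c\}+(-1)^{(|a|+1)(|b|+1)}\{b,\{a,c\}\}$ and $\{a,bc\}=\{a,b\}c+(-1)^{(|a|+1)|b|}b\{a,c\}$. A Gerstenhaber algebra is a generalized Loday-Gerstenhaber algebra which is graded commutative and satisfies $\{a,b\}=-(-1)^{(|a|+1)(|b|+1)}\{b,a\}$. *)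

theory Defs
  imports
    "HOL-Library.Poly_Mapping"
    "HOL-Library.Function_Algebras"
    "HOL-Library.Set_Algebras"
    "HOL-Library.FuncSet"
    "HOL-Algebra.Module"
    "HOL-Algebra.Algebraic_Closure_Type"
begin

section \<open>Generalized Loday-Gerstenhaber algebras\<close>

text \<open>
  Graded objects are families indexed by the (lower) degree; an element does not carry its degree,
  so the operations take the degrees of their arguments as additional arguments.
  The \<open>mult\<close> and \<open>one\<close> fields of a \<open>module\<close> record play no role.
\<close>

record ('k, 'e) graded_alg =
  gpart :: "int \<Rightarrow> ('k, 'e) module"
  gmul :: "int \<Rightarrow> int \<Rightarrow> 'e \<Rightarrow> 'e \<Rightarrow> 'e"
  gone :: 'e

record ('k, 'e) lg_alg = "('k, 'e) graded_alg" +
  gbr :: "int \<Rightarrow> int \<Rightarrow> 'e \<Rightarrow> 'e \<Rightarrow> 'e"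

definition linear_map ::
  "'k ring \<Rightarrow> ('k, 'e) module \<Rightarrow> ('k, 'f) module \<Rightarrow> ('e \<Rightarrow> 'f) \<Rightarrow> bool"
  where "linear_map R M N f \<longleftrightarrow>
    f \<in> carrier M \<rightarrow> carrier N \<and>
    (\<forall>x\<in>carrier M. \<forall>y\<in>carrier M. f (x \<oplus>\<^bsub>M\<^esub> y) = f x \<oplus>\<^bsub>N\<^esub> f y) \<and>
    (\<forall>r\<in>carrier R. \<forall>x\<in>carrier M. f (r \<odot>\<^bsub>M\<^esub> x) = r \<odot>\<^bsub>N\<^esub> f x)"

definition bilinear_map ::
  "'k ring \<Rightarrow> ('k, 'e) module \<Rightarrow> ('k, 'f) module \<Rightarrow> ('k, 'g) module \<Rightarrow> ('e \<Rightarrow> 'f \<Rightarrow> 'g) \<Rightarrow> bool"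
  where "bilinear_map R M N P f \<longleftrightarrow>
    (\<forall>x\<in>carrier M. linear_map R N P (f x)) \<and>
    (\<forall>y\<in>carrier N. linear_map R M P (\<lambda>x. f x y))"

definition gsgn :: "('k, 'e) module \<Rightarrow> int \<Rightarrow> 'e \<Rightarrow> 'e"
  where "gsgn M n x = (if even n then x else \<ominus>\<^bsub>M\<^esub> x)"

locale graded_algebra =
  fixes R :: "'k ring" and E :: "('k, 'e, 'z) graded_alg_scheme"
  assumes gpart_module: "Module.module R (gpart E i)"
    and gmul_bilinear: "bilinear_map R (gpart E i) (gpart E j) (gpart E (i + j)) (gmul E i j)"
    and gone_closed: "gone E \<in> carrier (gpart E 0)"
    and gmul_assoc: "\<lbrakk>a \<in> carrier (gpart E i); b \<in> carrier (gpart E j); c \<in> carrier (gpart E k)\<rbrakk> \<Longrightarrow>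
      gmul E (i + j) k (gmul E i j a b) c = gmul E i (j + k) a (gmul E j k b c)"
    and gone_left: "a \<in> carrier (gpart E i) \<Longrightarrow> gmul E 0 i (gone E) a = a"
    and gone_right: "a \<in> carrier (gpart E i) \<Longrightarrow> gmul E i 0 a (gone E) = a"

locale loday_gerstenhaber_algebra = graded_algebra R E
  for R :: "'k ring" and E :: "('k, 'e, 'z) lg_alg_scheme" +
  assumes gbr_bilinear:
      "bilinear_map R (gpart E i) (gpart E j) (gpart E (i + j + 1)) (gbr E i j)"
    and gbr_jacobi:
      "\<lbrakk>a \<in> carrier (gpart E i); b \<in> carrier (gpart E j); c \<in> carrier (gpart E k)\<rbrakk> \<Longrightarrow>
       gbr E i (j + k + 1) a (gbr E j k b c) =
         gbr E (i + j + 1) k (gbr E i j a b) c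
         \<oplus>\<^bsub>gpart E (i + j + k + 2)\<^esub>
         gsgn (gpart E (i + j + k + 2)) ((i + 1) * (j + 1))
           (gbr E j (i + k + 1) b (gbr E i k a c))"
    and gbr_leibniz:
      "\<lbrakk>a \<in> carrier (gpart E i); b \<in> carrier (gpart E j); c \<in> carrier (gpart E k)\<rbrakk> \<Longrightarrow>
       gbr E i (j + k) a (gmul E j k b c) =
         gmul E (i + j + 1) k (gbr E i j a b) c
         \<oplus>\<^bsub>gpart E (i + j + k + 1)\<^esub>
         gsgn (gpart E (i + j + k + 1)) ((i + 1) * j)
           (gmul E j (i + k + 1) b (gbr E i k a c))"

locale gerstenhaber_algebra = loday_gerstenhaber_algebra R E
  for R :: "'k ring" and E :: "('k, 'e, 'z) lg_alg_scheme" +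
  assumes gmul_commute:
      "\<lbrakk>a \<in> carrier (gpart E i); b \<in> carrier (gpart E j)\<rbrakk> \<Longrightarrow>
       gmul E i j a b = gsgn (gpart E (i + j)) (i * j) (gmul E j i b a)"
    and gbr_antisym:
      "\<lbrakk>a \<in> carrier (gpart E i); b \<in> carrier (gpart E j)\<rbrakk> \<Longrightarrow>
       gbr E i j a b =
         \<ominus>\<^bsub>gpart E (i + j + 1)\<^esub> gsgn (gpart E (i + j + 1)) ((i + 1) * (j + 1)) (gbr E j i b a)"

locale lg_morphism =
  source: loday_gerstenhaber_algebra R E + target: loday_gerstenhaber_algebra R F
  for R :: "'k ring" and E :: "('k, 'e, 'y) lg_alg_scheme" and F :: "('k, 'f, 'z) lg_alg_scheme"
    and \<phi> :: "int \<Rightarrow> 'e \<Rightarrow> 'f" +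
  assumes mor_linear: "linear_map R (gpart E i) (gpart F i) (\<phi> i)"
    and mor_one: "\<phi> 0 (gone E) = gone F"
    and mor_mul: "\<lbrakk>a \<in> carrier (gpart E i); b \<in> carrier (gpart E j)\<rbrakk> \<Longrightarrow>
      \<phi> (i + j) (gmul E i j a b) = gmul F i j (\<phi> i a) (\<phi> j b)"
    and mor_br: "\<lbrakk>a \<in> carrier (gpart E i); b \<in> carrier (gpart E j)\<rbrakk> \<Longrightarrow>
      \<phi> (i + j + 1) (gbr E i j a b) = gbr F i j (\<phi> i a) (\<phi> j b)"

definition lg_image ::
  "('k, 'e) lg_alg \<Rightarrow> ('k, 'f) lg_alg \<Rightarrow> (int \<Rightarrow> 'e \<Rightarrow> 'f) \<Rightarrow> ('k, 'f) lg_alg"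
  where "lg_image E F \<phi> =
    F\<lparr>gpart := (\<lambda>i. (gpart F i)\<lparr>carrier := \<phi> i ` carrier (gpart E i)\<rparr>)\<rparr>"


section \<open>Graded endomorphisms and derived brackets\<close>

text \<open>
  An endomorphism of degree \<open>i\<close> of a graded module \<open>M\<close> is a family of linear maps
  \<open>M N \<rightarrow> M (N + i)\<close>; each member is extensional, so that equality of families is equality
  of endomorphisms.
\<close>

definition End_part ::
  "'k ring \<Rightarrow> (int \<Rightarrow> ('k, 'm) module) \<Rightarrow> int \<Rightarrow> ('k, int \<Rightarrow> 'm \<Rightarrow> 'm) module"
  where "End_part R M i =
    \<lparr>carrier = {\<phi>. \<forall>N. \<phi> N \<in> extensional (carrier (M N)) \<and> linear_map R (M N) (M (N + i)) (\<phi> N)},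
     monoid.mult = undefined, monoid.one = undefined,
     ring.zero = (\<lambda>N. \<lambda>x\<in>carrier (M N). \<zero>\<^bsub>M (N + i)\<^esub>),
     ring.add = (\<lambda>\<phi> \<psi> N. \<lambda>x\<in>carrier (M N). \<phi> N x \<oplus>\<^bsub>M (N + i)\<^esub> \<psi> N x),
     Module.module.smult = (\<lambda>r \<phi> N. \<lambda>x\<in>carrier (M N). r \<odot>\<^bsub>M (N + i)\<^esub> \<phi> N x)\<rparr>"

definition End_alg ::
  "'k ring \<Rightarrow> (int \<Rightarrow> ('k, 'm) module) \<Rightarrow> ('k, int \<Rightarrow> 'm \<Rightarrow> 'm) graded_alg"
  where "End_alg R M =
    \<lparr>gpart = End_part R M,
     gmul = (\<lambda>i j \<phi> \<psi> N. compose (carrier (M N)) (\<phi> (N + j)) (\<psi> N)),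
     gone = (\<lambda>N. \<lambda>x\<in>carrier (M N). x)\<rparr>"

definition gcomm ::
  "('k, 'e, 'z) graded_alg_scheme \<Rightarrow> int \<Rightarrow> int \<Rightarrow> 'e \<Rightarrow> 'e \<Rightarrow> 'e"
  where "gcomm E i j a b =
    gmul E i j a b \<ominus>\<^bsub>gpart E (i + j)\<^esub> gsgn (gpart E (i + j)) (i * j) (gmul E j i b a)"

text \<open>The bracket \<open>[[a, B], b]\<close>, for \<open>B\<close> of degree 1.\<close>

definition derived_bracket ::
  "('k, 'e, 'z) graded_alg_scheme \<Rightarrow> 'e \<Rightarrow> int \<Rightarrow> int \<Rightarrow> 'e \<Rightarrow> 'e \<Rightarrow> 'e"
  where "derived_bracket E B i j a b = gcomm E (i + 1) j (gcomm E i 1 a B) b"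

definition derived_lg :: "('k, 'e) graded_alg \<Rightarrow> 'e \<Rightarrow> ('k, 'e) lg_alg"
  where "derived_lg E B =
    \<lparr>gpart = gpart E, gmul = gmul E, gone = gone E, gbr = derived_bracket E B\<rparr>"


section \<open>Differential graded algebras\<close>

text \<open>
  The ground ring is the type \<open>'k\<close>. The differential has lower degree \<open>-1\<close>.
  The unit is a component of the record, and \<open>'a\<close> is only required to be a ring without unit,
  because the class \<open>ring_1\<close> would exclude the zero algebra.
\<close>

record ('k, 'a) dga =
  scal :: "'k \<Rightarrow> 'a \<Rightarrow> 'a"
  homog :: "int \<Rightarrow> 'a set"
  unity :: 'a
  diff :: "'a \<Rightarrow> 'a"

definition koszul :: "int \<Rightarrow> 'b::ab_group_add \<Rightarrow> 'b"
  where "koszul n x = (if even n then x else - x)"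

locale dg_algebra =
  fixes A :: "('k::comm_ring_1, 'a::ring) dga"
  assumes scal_module: "Modules.module (scal A)"
    and scal_mult_left: "scal A r x * y = scal A r (x * y)"
    and scal_mult_right: "x * scal A r y = scal A r (x * y)"
    and unity_left: "unity A * x = x"
    and unity_right: "x * unity A = x"
    and homog_subspace: "module.subspace (scal A) (homog A i)"
    and homog_direct_sum: "\<exists>!c :: int \<Rightarrow>\<^sub>0 'a.
      (\<forall>i. Poly_Mapping.lookup c i \<in> homog A i) \<and>
      x = (\<Sum>i\<in>Poly_Mapping.keys c. Poly_Mapping.lookup c i)"
    and unity_homog: "unity A \<in> homog A 0"
    and mult_homog: "\<lbrakk>x \<in> homog A i; y \<in> homog A j\<rbrakk> \<Longrightarrow> x * y \<in> homog A (i + j)"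
    and diff_linear: "Modules.module_hom (scal A) (scal A) (diff A)"
    and diff_homog: "x \<in> homog A i \<Longrightarrow> diff A x \<in> homog A (i - 1)"
    and diff_diff: "diff A (diff A x) = 0"
    and diff_mult: "x \<in> homog A i \<Longrightarrow> diff A (x * y) = diff A x * y + koszul i (x * diff A y)"


section \<open>Words of homogeneous elements\<close>

text \<open>
  A pair \<open>(i, x)\<close> stands for \<open>x\<close> regarded as an element of degree \<open>i\<close> (the degree is recorded
  because \<open>0\<close> lies in every degree). Depending on the context, a list of such pairs is a word
  \<open>[a\<^sub>1|\<dots>|a\<^sub>n]\<close> of \<open>T(sA)\<close>, or, if it is not empty, a word \<open>m[a\<^sub>1|\<dots>|a\<^sub>n]\<close> of \<open>A \<otimes> T(sA)\<close> with
  \<open>m\<close> at its head.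
\<close>

type_synonym 'a hword = "(int \<times> 'a) list"

definition is_hword :: "('k, 'a) dga \<Rightarrow> 'a hword \<Rightarrow> bool"
  where "is_hword A w \<longleftrightarrow> (\<forall>(i, x)\<in>set w. x \<in> homog A i)"

definition sdeg :: "'a hword \<Rightarrow> int"
  where "sdeg w = (\<Sum>(i, x)\<leftarrow>w. i + 1)"

fun hdiff :: "('k, 'a) dga \<Rightarrow> int \<times> 'a \<Rightarrow> int \<times> 'a"
  where "hdiff A (i, x) = (i - 1, diff A x)"

fun hmult :: "int \<times> 'a \<Rightarrow> int \<times> 'a \<Rightarrow> int \<times> 'a::times"
  where "hmult (i, x) (j, y) = (i + j, x * y)"

fun hscal :: "('k, 'a) dga \<Rightarrow> 'k \<Rightarrow> int \<times> 'a \<Rightarrow> int \<times> 'a"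
  where "hscal A r (i, x) = (i, scal A r x)"

text \<open>
  \<open>diff_at A w i\<close> applies the differential to the letter \<open>w ! i\<close>;
  \<open>mult_at w i\<close> multiplies the neighbours \<open>w ! i\<close> and \<open>w ! (i + 1)\<close>.
\<close>

definition diff_at :: "('k, 'a) dga \<Rightarrow> 'a hword \<Rightarrow> nat \<Rightarrow> 'a hword"
  where "diff_at A w i = take i w @ hdiff A (w ! i) # drop (i + 1) w"

definition mult_at :: "'a::times hword \<Rightarrow> nat \<Rightarrow> 'a hword"
  where "mult_at w i = take i w @ hmult (w ! i) (w ! (i + 1)) # drop (i + 2) w"


section \<open>Subquotient modules\<close>

definition subquotient ::
  "('k \<Rightarrow> 'b \<Rightarrow> 'b) \<Rightarrow> 'b set \<Rightarrow> 'b set \<Rightarrow> ('k, 'b::ab_group_add set) module"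
  where "subquotient act Z B =
    \<lparr>carrier = (\<lambda>z. z +o B) ` Z, monoid.mult = undefined, monoid.one = undefined,
     ring.zero = B, ring.add = (+), Module.module.smult = (\<lambda>r U. \<Union>x\<in>U. act r x +o B)\<rparr>"


section \<open>The Hochschild chain complex\<close>

text \<open>
  The degree \<open>N\<close> part of \<open>A \<otimes> T(sA)\<close>, a tensor product over \<open>'k\<close>, is the quotient of the free
  abelian group on the words \<open>m[a\<^sub>1|\<dots>|a\<^sub>n]\<close> of degree \<open>N = |m| + |sa\<^sub>1| + \<dots> + |sa\<^sub>n|\<close> by the subgroup
  \<open>tensor_rel A N\<close>. The operators on this quotient are given by formulas on words; homology is
  expressed by cycles and boundaries in the free abelian group, both taken modulo \<open>tensor_rel\<close>.
\<close>

definition chain_words :: "('k, 'a) dga \<Rightarrow> int \<Rightarrow> 'a hword set"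
  where "chain_words A N = {w. w \<noteq> [] \<and> is_hword A w \<and> sdeg w = N + 1}"

definition free_chains :: "('k, 'a) dga \<Rightarrow> int \<Rightarrow> ('a hword \<Rightarrow>\<^sub>0 int) set"
  where "free_chains A N = {c. Poly_Mapping.keys c \<subseteq> chain_words A N}"

inductive_set tensor_rel :: "('k, 'a::ring) dga \<Rightarrow> int \<Rightarrow> ('a hword \<Rightarrow>\<^sub>0 int) set"
  for A :: "('k, 'a) dga" and N :: int where
  zero: "0 \<in> tensor_rel A N"
| minus: "\<lbrakk>a \<in> tensor_rel A N; b \<in> tensor_rel A N\<rbrakk> \<Longrightarrow> a - b \<in> tensor_rel A N"
| additive: "\<lbrakk>u @ (i, x) # v \<in> chain_words A N; y \<in> homog A i\<rbrakk> \<Longrightarrow>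
    frag_of (u @ (i, x + y) # v) - frag_of (u @ (i, x) # v) - frag_of (u @ (i, y) # v)
      \<in> tensor_rel A N"
| balanced: "u @ (i, x) # v @ (j, y) # w \<in> chain_words A N \<Longrightarrow>
    frag_of (u @ (i, scal A r x) # v @ (j, y) # w) - frag_of (u @ (i, x) # v @ (j, scal A r y) # w)
      \<in> tensor_rel A N"

fun chain_d0 :: "('k, 'a) dga \<Rightarrow> 'a hword \<Rightarrow> 'a hword \<Rightarrow>\<^sub>0 int"
  where
    "chain_d0 A [] = 0"
  | "chain_d0 A (m # as) =
      frag_of (hdiff A m # as)
      - (\<Sum>i<length as. koszul (fst m + sdeg (take i as)) (frag_of (m # diff_at A as i)))"

fun chain_d1 :: "'a::times hword \<Rightarrow> 'a hword \<Rightarrow>\<^sub>0 int"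
  where
    "chain_d1 [] = 0"
  | "chain_d1 [m] = 0"
  | "chain_d1 (m # a # as) =
      koszul (fst m) (frag_of (hmult m a # as))
      + (\<Sum>i<length as. koszul (fst m + sdeg (take (i + 1) (a # as))) (frag_of (m # mult_at (a # as) i)))
      - koszul (sdeg [last (a # as)] * (fst m + sdeg (butlast (a # as))))
          (frag_of (hmult (last (a # as)) m # butlast (a # as)))"

definition chain_diff :: "('k, 'a::ring) dga \<Rightarrow> ('a hword \<Rightarrow>\<^sub>0 int) \<Rightarrow> ('a hword \<Rightarrow>\<^sub>0 int)"
  where "chain_diff A = frag_extend (\<lambda>w. chain_d0 A w + chain_d1 w)"

definition chain_scal :: "('k, 'a) dga \<Rightarrow> 'k \<Rightarrow> ('a hword \<Rightarrow>\<^sub>0 int) \<Rightarrow> ('a hword \<Rightarrow>\<^sub>0 int)"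
  where "chain_scal A r = frag_extend (\<lambda>w. frag_of (hscal A r (hd w) # tl w))"

definition chain_cycles :: "('k, 'a::ring) dga \<Rightarrow> int \<Rightarrow> ('a hword \<Rightarrow>\<^sub>0 int) set"
  where "chain_cycles A N = {c \<in> free_chains A N. chain_diff A c \<in> tensor_rel A (N - 1)}"

definition chain_boundaries :: "('k, 'a::ring) dga \<Rightarrow> int \<Rightarrow> ('a hword \<Rightarrow>\<^sub>0 int) set"
  where "chain_boundaries A N = chain_diff A ` free_chains A (N + 1) + tensor_rel A N"

definition HH_hom :: "('k, 'a::ring) dga \<Rightarrow> int \<Rightarrow> ('k, ('a hword \<Rightarrow>\<^sub>0 int) set) module"
  where "HH_hom A N = subquotient (chain_scal A) (chain_cycles A N) (chain_boundaries A N)"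

text \<open>
  Connes' boundary on the (unnormalized) complex is \<open>(1 - t) s N\<close>. The Koszul signs of the cyclic
  permutations are those of \<open>sm \<otimes> sa\<^sub>1 \<otimes> \<dots> \<otimes> sa\<^sub>n\<close>, all letters being suspended, so that for \<open>A\<close>
  concentrated in degree 0 the rotation \<open>t\<close> carries the usual sign \<open>(-1)\<^sup>n\<close>. The factor \<open>1 - t\<close> is
  needed because degenerate words have not been divided out; on the normalized complex only
  \<open>\<Sum>\<^sub>i \<plusminus> 1[a\<^sub>i|\<dots>|a\<^sub>n|m|a\<^sub>1|\<dots>|a\<^sub>i\<^sub>-\<^sub>1]\<close> remains.
\<close>

definition cyc_norm :: "'a hword \<Rightarrow> 'a hword \<Rightarrow>\<^sub>0 int"
  where "cyc_norm w =
    (\<Sum>i<length w. koszul (sdeg (take i w) * sdeg (drop i w)) (frag_of (drop i w @ take i w)))"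

definition cyc_rotate :: "'a hword \<Rightarrow> 'a hword \<Rightarrow>\<^sub>0 int"
  where "cyc_rotate w = koszul (sdeg [last w] * sdeg (butlast w)) (frag_of (last w # butlast w))"

definition extra_degeneracy :: "('k, 'a) dga \<Rightarrow> 'a hword \<Rightarrow> 'a hword \<Rightarrow>\<^sub>0 int"
  where "extra_degeneracy A w = frag_of ((0, unity A) # w)"

definition connes_chain :: "('k, 'a) dga \<Rightarrow> ('a hword \<Rightarrow>\<^sub>0 int) \<Rightarrow> ('a hword \<Rightarrow>\<^sub>0 int)"
  where "connes_chain A c =
    (let b = frag_extend (extra_degeneracy A) (frag_extend cyc_norm c) in b - frag_extend cyc_rotate b)"

definition connes :: "('k, 'a::ring) dga \<Rightarrow> int \<Rightarrow> ('a hword \<Rightarrow>\<^sub>0 int) set \<Rightarrow> ('a hword \<Rightarrow>\<^sub>0 int) set"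
  where "connes A N =
    (\<lambda>U\<in>carrier (HH_hom A N). \<Union>x\<in>U. connes_chain A x +o chain_boundaries A (N + 1))"


section \<open>The Hochschild cochain complex\<close>

text \<open>
  By the universal property of the tensor product, an element of \<open>Hom(T(sA), A)\<close> of lower degree
  \<open>p\<close> is a function of words \<open>[a\<^sub>1|\<dots>|a\<^sub>n]\<close> that is \<open>'k\<close>-linear in each letter and raises the degree
  by \<open>p\<close>. It is normalized to vanish on lists that are not words of homogeneous elements.
\<close>

definition cochains :: "('k, 'a::ring) dga \<Rightarrow> int \<Rightarrow> ('a hword \<Rightarrow> 'a) set"
  where "cochains A p = {f.
    (\<forall>w. \<not> is_hword A w \<longrightarrow> f w = 0) \<and>
    (\<forall>w. is_hword A w \<longrightarrow> f w \<in> homog A (sdeg w + p)) \<and>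
    (\<forall>u i x y v. is_hword A (u @ (i, x) # v) \<and> y \<in> homog A i \<longrightarrow>
       f (u @ (i, x + y) # v) = f (u @ (i, x) # v) + f (u @ (i, y) # v)) \<and>
    (\<forall>u i x v r. is_hword A (u @ (i, x) # v) \<longrightarrow>
       f (u @ (i, scal A r x) # v) = scal A r (f (u @ (i, x) # v)))}"

definition cochain_d0 :: "('k, 'a::ring) dga \<Rightarrow> int \<Rightarrow> ('a hword \<Rightarrow> 'a) \<Rightarrow> 'a hword \<Rightarrow> 'a"
  where "cochain_d0 A p f w =
    diff A (f w) + (\<Sum>i<length w. koszul (p + sdeg (take i w)) (f (diff_at A w i)))"

definition cochain_d1 :: "int \<Rightarrow> ('a hword \<Rightarrow> 'a) \<Rightarrow> 'a hword \<Rightarrow> 'a::ring"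
  where "cochain_d1 p f w = (if w = [] then 0 else
    - koszul (sdeg [hd w] * p) (snd (hd w) * f (tl w))
    - (\<Sum>i<length w - 1. koszul (p + sdeg (take (i + 1) w)) (f (mult_at w i)))
    + koszul (p + sdeg (butlast w)) (f (butlast w) * snd (last w)))"

definition cochain_diff :: "('k, 'a::ring) dga \<Rightarrow> int \<Rightarrow> ('a hword \<Rightarrow> 'a) \<Rightarrow> 'a hword \<Rightarrow> 'a"
  where "cochain_diff A p f w =
    (if is_hword A w then cochain_d0 A p f w + cochain_d1 p f w else 0)"

definition cochain_scal :: "('k, 'a) dga \<Rightarrow> 'k \<Rightarrow> ('a hword \<Rightarrow> 'a) \<Rightarrow> 'a hword \<Rightarrow> 'a"
  where "cochain_scal A r f w = scal A r (f w)"

definition cocycles :: "('k, 'a::ring) dga \<Rightarrow> int \<Rightarrow> ('a hword \<Rightarrow> 'a) set"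
  where "cocycles A p = {f \<in> cochains A p. cochain_diff A p f = 0}"

definition coboundaries :: "('k, 'a::ring) dga \<Rightarrow> int \<Rightarrow> ('a hword \<Rightarrow> 'a) set"
  where "coboundaries A p = cochain_diff A (p + 1) ` cochains A (p + 1)"

text \<open>\<open>HH_cohom A p\<close> is the part of lower degree \<open>p\<close>, that is, \<open>HH\<^sup>-\<^sup>p\<close> in upper grading.\<close>

definition HH_cohom :: "('k, 'a::ring) dga \<Rightarrow> int \<Rightarrow> ('k, ('a hword \<Rightarrow> 'a) set) module"
  where "HH_cohom A p = subquotient (cochain_scal A) (cocycles A p) (coboundaries A p)"

definition cup :: "int \<Rightarrow> ('a hword \<Rightarrow> 'a) \<Rightarrow> ('a hword \<Rightarrow> 'a) \<Rightarrow> 'a hword \<Rightarrow> 'a::ring"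
  where "cup q f g w =
    (\<Sum>j\<le>length w. koszul (q * sdeg (take j w)) (f (take j w) * g (drop j w)))"

definition unit_cochain :: "('k, 'a::ring) dga \<Rightarrow> 'a hword \<Rightarrow> 'a"
  where "unit_cochain A w = (if w = [] then unity A else 0)"

text \<open>
  The letter \<open>g[a\<^sub>j\<^sub>+\<^sub>1|\<dots>|a\<^sub>k]\<close> inserted into the argument of \<open>f\<close> has degree
  \<open>|sa\<^sub>j\<^sub>+\<^sub>1| + \<dots> + |sa\<^sub>k| + |g|\<close>.
\<close>

definition circ :: "int \<Rightarrow> ('a hword \<Rightarrow> 'a) \<Rightarrow> ('a hword \<Rightarrow> 'a) \<Rightarrow> 'a hword \<Rightarrow> 'a::ring"
  where "circ q f g w =
    (\<Sum>k\<le>length w. \<Sum>j\<le>k.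
       let v = drop j (take k w) in
       koszul ((q + 1) * sdeg (take j w)) (f (take j w @ (sdeg v + q, g v) # drop k w)))"

definition gerst_bracket ::
  "int \<Rightarrow> int \<Rightarrow> ('a hword \<Rightarrow> 'a) \<Rightarrow> ('a hword \<Rightarrow> 'a) \<Rightarrow> 'a hword \<Rightarrow> 'a::ring"
  where "gerst_bracket p q f g = circ q f g - koszul ((p + 1) * (q + 1)) (circ p g f)"

definition HH_cohom_lg :: "('k, 'a::ring) dga \<Rightarrow> ('k, ('a hword \<Rightarrow> 'a) set) lg_alg"
  where "HH_cohom_lg A =
    \<lparr>gpart = HH_cohom A,
     gmul = (\<lambda>p q U V. \<Union>f\<in>U. \<Union>g\<in>V. cup q f g +o coboundaries A (p + q)),
     gone = unit_cochain A +o coboundaries A 0,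
     gbr = (\<lambda>p q U V. \<Union>f\<in>U. \<Union>g\<in>V. gerst_bracket p q f g +o coboundaries A (p + q + 1))\<rparr>"


section \<open>The action of Hochschild cohomology on Hochschild homology\<close>

fun action_word :: "int \<Rightarrow> ('a hword \<Rightarrow> 'a) \<Rightarrow> 'a hword \<Rightarrow> 'a::ring hword \<Rightarrow>\<^sub>0 int"
  where
    "action_word p f [] = 0"
  | "action_word p f (m # as) =
      (\<Sum>j\<le>length as. koszul (fst m * p)
         (frag_of (hmult m (sdeg (take j as) + p, f (take j as)) # drop j as)))"

definition HH_action ::
  "('k, 'a::ring) dga \<Rightarrow> int \<Rightarrow> ('a hword \<Rightarrow> 'a) set \<Rightarrow>
   int \<Rightarrow> ('a hword \<Rightarrow>\<^sub>0 int) set \<Rightarrow> ('a hword \<Rightarrow>\<^sub>0 int) set"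
  where "HH_action A p U N =
    (\<lambda>V\<in>carrier (HH_hom A N).
       \<Union>f\<in>U. \<Union>y\<in>V. frag_extend (action_word p f) y +o chain_boundaries A (N + p))"

definition End_HH_lg ::
  "('k::comm_ring_1, 'a::ring) dga \<Rightarrow>
   ('k, int \<Rightarrow> ('a hword \<Rightarrow>\<^sub>0 int) set \<Rightarrow> ('a hword \<Rightarrow>\<^sub>0 int) set) lg_alg"
  where "End_HH_lg A = derived_lg (End_alg ring_of_type_algebra (HH_hom A)) (connes A)"

end

theory Submission
  imports Defs
begin

text \<open>
  Let \<open>mu\<close> be the cochain formed by the differential and the multiplication of \<open>A\<close>. On cochains, the
  differential is \<open>-{mu, -}\<close>; on chains, it is \<open>-L\<^sub>m\<^sub>u\<close>, where \<open>L\<^sub>f\<close> inserts \<open>f\<close> at all cyclic positions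
  of a word; and, up to a sign, \<open>i\<^sub>f\<close> inserts \<open>f\<close> and then applies \<open>mu\<close> to a cyclic segment that contains
  the head and the value of \<open>f\<close>. So everything reduces to composing insertions, and each
  composition splits according to the relative position of the inserted cochains.

  For cochains these composition rules are the pre-Lie identity, whose deviation for \<open>mu\<close> gives the
  commutativity of the cup product up to homotopy, and its analogue for the brace \<open>f{g, h}\<close>, which
  gives the Poisson rule. For chains, commuting \<open>L\<^sub>f\<close> past \<open>i\<^sub>g\<close> shows that \<open>[L\<^sub>f, i\<^sub>g]\<close> is homotopic to
  \<open>i\<^sub>{\<^sub>f\<^sub>,\<^sub>g\<^sub>}\<close>. Connes' boundary \<open>B = (1 - t) s N\<close> satisfies \<open>B \<circ> B = 0\<close> exactly because \<open>N (1 - t) = 0\<close>, and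
  \<open>[i\<^sub>f, B]\<close> is homotopic to \<open>L\<^sub>f\<close> by Cartan's formula: evaluating \<open>f\<close> on the front of a cyclic sum
  gives \<open>L\<^sub>f\<close> up to the image of \<open>1 - t\<close>. Together, \<open>[[i\<^sub>f, B], i\<^sub>g]\<close> and \<open>i\<^sub>{\<^sub>f\<^sub>,\<^sub>g\<^sub>}\<close> agree on homology.

  For the derived bracket itself, \<open>B \<circ> B = 0\<close> gives \<open>[[a, B], B] = 0\<close>, so \<open>[-, B]\<close> turns the derived
  bracket into the commutator and both axioms follow from the graded Jacobi and Leibniz rules.
\<close>

section \<open>Signs\<close>

text \<open>Chains live in a free abelian group on words, where a word with a sum in one letter is
  not the sum of words. An identity that only rearranges insertions, every cochain keeping a letter
  of its own, holds exactly and is proved by comparing sums over factorizations. Replacing a nested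
  insertion by the insertion of a composite cochain is valid only modulo the tensor relations. Hence
  the nested operations have their own names (\<open>ins_nest\<close>, \<open>cap_nest1\<close>,
  \<open>slide_nest\<close> and so on), and each has a second lemma that folds it into a composite
  cochain up to a congruence. The action multiplies on the right of the head, so on chains
  \<open>i\<^sub>f \<circ> i\<^sub>g\<close> is, up to sign, the action of the cup product in the
  opposite order. The map of the theorem respects products only on homology, and that already uses
  the homotopy commutativity of the cup product. The ground ring is arbitrary, so nothing may be
  divided by 2: squares of odd operators are shown to vanish by cancelling terms, never from a
  doubled Jacobi identity.\<close>

lemma koszul_0 [simp]: "koszul 0 x = x"
  by (simp add: koszul_def)

lemma koszul_zero [simp]: "koszul n 0 = 0"
  by (simp add: koszul_def)

lemma koszul_1: "koszul 1 x = - x"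
  by (simp add: koszul_def)

lemma koszul_plus: "koszul (m + n) x = koszul m (koszul n x)"
  by (auto simp: koszul_def)

lemma koszul_minus: "koszul (m - n) x = koszul m (koszul n x)"
  by (auto simp: koszul_def)

lemma koszul_neg: "koszul (- m) x = koszul m x"
  by (auto simp: koszul_def)

lemma koszul_bit0: "koszul (numeral (num.Bit0 n)) x = x"
  by (auto simp: koszul_def)

lemma koszul_bit1: "koszul (numeral (num.Bit1 n)) x = - x"
  by (auto simp: koszul_def)

lemma koszul_mult_bit0:
  "koszul (numeral (num.Bit0 n) * m) x = x" "koszul (m * numeral (num.Bit0 n)) x = x"
  by (auto simp: koszul_def)

lemma koszul_mult_bit1:
  "koszul (numeral (num.Bit1 n) * m) x = koszul m x" "koszul (m * numeral (num.Bit1 n)) x = koszul m x"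
  by (auto simp: koszul_def)

lemma koszul_twice: "koszul m (koszul m x) = x"
  by (auto simp: koszul_def)

lemma koszul_left_commute: "koszul m (koszul n x) = koszul n (koszul m x)"
  by (auto simp: koszul_def)

lemma koszul_add: "koszul m (x + y) = koszul m x + koszul m y"
  by (auto simp: koszul_def)

lemma koszul_diff: "koszul m (x - y) = koszul m x - koszul m y"
  by (auto simp: koszul_def)

lemma koszul_uminus: "koszul m (- x) = - koszul m x"
  by (auto simp: koszul_def)

lemma koszul_sum: "koszul m (sum F I) = (\<Sum>i\<in>I. koszul m (F i))"
  by (auto simp: koszul_def sum_negf)

text \<open>
  Rewriting with these rules turns a sign into an ordered composition of the signs
  \<open>koszul t\<close> of pairwise distinct monomials \<open>t\<close>, which makes equality of signs syntactic.
\<close>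

lemmas koszul_norm =
  koszul_plus koszul_minus koszul_neg koszul_1 koszul_bit0 koszul_bit1 koszul_mult_bit0
  koszul_mult_bit1 koszul_twice koszul_left_commute
  koszul_add koszul_diff koszul_uminus
  distrib_left[where ?'a = int] distrib_right[where ?'a = int]
  left_diff_distrib[where ?'a = int] right_diff_distrib[where ?'a = int]
  mult.assoc[where ?'a = int] mult.commute[where ?'a = int] mult.left_commute[where ?'a = int]

lemma sdeg_Nil [simp]: "sdeg [] = 0"
  by (simp add: sdeg_def)

lemma sdeg_Cons [simp]: "sdeg (x # w) = fst x + 1 + sdeg w"
  by (simp add: sdeg_def case_prod_beta)

lemma sdeg_append [simp]: "sdeg (u @ v) = sdeg u + sdeg v"
  by (simp add: sdeg_def)


section \<open>Sums over the factorizations of a word\<close>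

definition split2 :: "'b list \<Rightarrow> ('b list \<Rightarrow> 'b list \<Rightarrow> 'g) \<Rightarrow> 'g::comm_monoid_add"
  where "split2 w F = (\<Sum>i\<le>length w. F (take i w) (drop i w))"

definition split3 :: "'b list \<Rightarrow> ('b list \<Rightarrow> 'b list \<Rightarrow> 'b list \<Rightarrow> 'g) \<Rightarrow> 'g::comm_monoid_add"
  where "split3 w F = split2 w (\<lambda>a w. split2 w (F a))"

definition split4 :: "'b list \<Rightarrow> ('b list \<Rightarrow> 'b list \<Rightarrow> 'b list \<Rightarrow> 'b list \<Rightarrow> 'g) \<Rightarrow> 'g::comm_monoid_add"
  where "split4 w F = split2 w (\<lambda>a w. split3 w (F a))"

definition split5 :: "'b list \<Rightarrow> ('b list \<Rightarrow> 'b list \<Rightarrow> 'b list \<Rightarrow> 'b list \<Rightarrow> 'b list \<Rightarrow> 'g) \<Rightarrow> 'g::comm_monoid_add"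
  where "split5 w F = split2 w (\<lambda>a w. split4 w (F a))"

definition split6 :: "'b list \<Rightarrow> ('b list \<Rightarrow> 'b list \<Rightarrow> 'b list \<Rightarrow> 'b list \<Rightarrow> 'b list \<Rightarrow> 'b list \<Rightarrow> 'g) \<Rightarrow> 'g::comm_monoid_add"
  where "split6 w F = split2 w (\<lambda>a w. split5 w (F a))"

definition split7 :: "'b list \<Rightarrow> ('b list \<Rightarrow> 'b list \<Rightarrow> 'b list \<Rightarrow> 'b list \<Rightarrow> 'b list \<Rightarrow> 'b list \<Rightarrow> 'b list \<Rightarrow> 'g) \<Rightarrow> 'g::comm_monoid_add"
  where "split7 w F = split2 w (\<lambda>a w. split6 w (F a))"

lemmas split_defs = split3_def split4_def split5_def split6_def split7_def

text \<open>The premise \<open>w' = a @ b\<close> is what allows degrees and homogeneity of the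
  pieces to be read off from the whole word under the sum.\<close>

lemma split2_cong [cong]:
  "w = w' \<Longrightarrow> (\<And>a b. w' = a @ b \<Longrightarrow> F a b = G a b) \<Longrightarrow> split2 w F = split2 w' G"
  unfolding split2_def by (auto intro!: sum.cong)

lemma split2_Nil [simp]: "split2 [] F = F [] []"
  by (simp add: split2_def)

lemma split2_Cons: "split2 (x # v) F = F [] (x # v) + split2 v (\<lambda>a b. F (x # a) b)"
  by (simp add: split2_def sum.atMost_Suc_shift del: sum.atMost_Suc)

lemma split2_append_Cons:
  "split2 (u @ x # v) F = split2 u (\<lambda>a b. F a (b @ x # v)) + split2 v (\<lambda>a b. F (u @ x # a) b)"
  by (induction u arbitrary: F) (simp_all add: split2_Cons add.assoc)

lemma split2_swap:
  "split2 v (\<lambda>a b. split2 w (\<lambda>c d. F a b c d)) = split2 w (\<lambda>c d. split2 v (\<lambda>a b. F a b c d))"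
  unfolding split2_def by (rule sum.swap)

lemma split2_hom:
  assumes "h 0 = 0" and "\<And>x y. h (x + y) = h x + h y"
  shows "h (split2 w F) = split2 w (\<lambda>a b. h (F a b))"
  unfolding split2_def using sum_comp_morphism[of h, OF assms, of "\<lambda>i. F (take i w) (drop i w)"] by (simp add: o_def)

lemma split3_cong [cong]:
  "w = w' \<Longrightarrow> (\<And>a b c. w' = a @ b @ c \<Longrightarrow> F a b c = G a b c) \<Longrightarrow> split3 w F = split3 w' G"
  unfolding split3_def by (auto intro!: split2_cong split2_cong)

lemma split4_cong [cong]:
  "w = w' \<Longrightarrow> (\<And>a b c d. w' = a @ b @ c @ d \<Longrightarrow> F a b c d = G a b c d) \<Longrightarrow> split4 w F = split4 w' G"
  unfolding split4_def by (auto intro!: split2_cong split3_cong)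

lemma split5_cong [cong]:
  "w = w' \<Longrightarrow> (\<And>a b c d e. w' = a @ b @ c @ d @ e \<Longrightarrow> F a b c d e = G a b c d e) \<Longrightarrow> split5 w F = split5 w' G"
  unfolding split5_def by (auto intro!: split2_cong split4_cong)

lemma split6_cong [cong]:
  "w = w' \<Longrightarrow> (\<And>a b c d e f. w' = a @ b @ c @ d @ e @ f \<Longrightarrow> F a b c d e f = G a b c d e f) \<Longrightarrow> split6 w F = split6 w' G"
  unfolding split6_def by (auto intro!: split2_cong split5_cong)

lemma split7_cong [cong]:
  "w = w' \<Longrightarrow> (\<And>a b c d e f g. w' = a @ b @ c @ d @ e @ f @ g \<Longrightarrow> F a b c d e f g = G a b c d e f g) \<Longrightarrow> split7 w F = split7 w' G"
  unfolding split7_def by (auto intro!: split2_cong split6_cong)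

lemma split3_hom:
  assumes "h 0 = 0" and "\<And>x y. h (x + y) = h x + h y"
  shows "h (split3 w F) = split3 w (\<lambda>a b c. h (F a b c))"
  unfolding split3_def by (simp add: split2_hom[OF assms] split2_hom[OF assms])

lemma split4_hom:
  assumes "h 0 = 0" and "\<And>x y. h (x + y) = h x + h y"
  shows "h (split4 w F) = split4 w (\<lambda>a b c d. h (F a b c d))"
  unfolding split4_def by (simp add: split2_hom[OF assms] split3_hom[OF assms])

lemma split5_hom:
  assumes "h 0 = 0" and "\<And>x y. h (x + y) = h x + h y"
  shows "h (split5 w F) = split5 w (\<lambda>a b c d e. h (F a b c d e))"
  unfolding split5_def by (simp add: split2_hom[OF assms] split4_hom[OF assms])

lemma split2_linear:
  "split2 w (\<lambda>a b. F a b + G a b) = split2 w F + split2 w G"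
  "split2 w (\<lambda>a b. - F' a b) = - split2 w F'"
  "split2 w (\<lambda>a b. F' a b - G' a b) = split2 w F' - split2 w G'"
  "koszul n (split2 w F') = split2 w (\<lambda>a b. koszul n (F' a b))"
  for F G :: "_ \<Rightarrow> _ \<Rightarrow> 'g::comm_monoid_add" and F' G' :: "_ \<Rightarrow> _ \<Rightarrow> 'h::ab_group_add"
  unfolding split2_def
  by (simp_all add: sum.distrib sum_negf sum_subtractf koszul_sum)

lemma split3_linear:
  "split3 w (\<lambda>a b c. F a b c + G a b c) = split3 w F + split3 w G"
  "split3 w (\<lambda>a b c. - F' a b c) = - split3 w F'"
  "split3 w (\<lambda>a b c. F' a b c - G' a b c) = split3 w F' - split3 w G'"
  "koszul n (split3 w F') = split3 w (\<lambda>a b c. koszul n (F' a b c))"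
  for F G :: "_ \<Rightarrow> _ \<Rightarrow> _ \<Rightarrow> 'g::comm_monoid_add" and F' G' :: "_ \<Rightarrow> _ \<Rightarrow> _ \<Rightarrow> 'h::ab_group_add"
  unfolding split3_def
  by (simp_all add: split2_linear split2_linear)

lemma split4_linear:
  "split4 w (\<lambda>a b c d. F a b c d + G a b c d) = split4 w F + split4 w G"
  "split4 w (\<lambda>a b c d. - F' a b c d) = - split4 w F'"
  "split4 w (\<lambda>a b c d. F' a b c d - G' a b c d) = split4 w F' - split4 w G'"
  "koszul n (split4 w F') = split4 w (\<lambda>a b c d. koszul n (F' a b c d))"
  for F G :: "_ \<Rightarrow> _ \<Rightarrow> _ \<Rightarrow> _ \<Rightarrow> 'g::comm_monoid_add" and F' G' :: "_ \<Rightarrow> _ \<Rightarrow> _ \<Rightarrow> _ \<Rightarrow> 'h::ab_group_add"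
  unfolding split4_def
  by (simp_all add: split3_linear split2_linear)

lemma split5_linear:
  "split5 w (\<lambda>a b c d e. F a b c d e + G a b c d e) = split5 w F + split5 w G"
  "split5 w (\<lambda>a b c d e. - F' a b c d e) = - split5 w F'"
  "split5 w (\<lambda>a b c d e. F' a b c d e - G' a b c d e) = split5 w F' - split5 w G'"
  "koszul n (split5 w F') = split5 w (\<lambda>a b c d e. koszul n (F' a b c d e))"
  for F G :: "_ \<Rightarrow> _ \<Rightarrow> _ \<Rightarrow> _ \<Rightarrow> _ \<Rightarrow> 'g::comm_monoid_add" and F' G' :: "_ \<Rightarrow> _ \<Rightarrow> _ \<Rightarrow> _ \<Rightarrow> _ \<Rightarrow> 'h::ab_group_add"
  unfolding split5_def
  by (simp_all add: split4_linear split2_linear)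

lemma split6_linear:
  "split6 w (\<lambda>a b c d e f. F a b c d e f + G a b c d e f) = split6 w F + split6 w G"
  "split6 w (\<lambda>a b c d e f. - F' a b c d e f) = - split6 w F'"
  "split6 w (\<lambda>a b c d e f. F' a b c d e f - G' a b c d e f) = split6 w F' - split6 w G'"
  "koszul n (split6 w F') = split6 w (\<lambda>a b c d e f. koszul n (F' a b c d e f))"
  for F G :: "_ \<Rightarrow> _ \<Rightarrow> _ \<Rightarrow> _ \<Rightarrow> _ \<Rightarrow> _ \<Rightarrow> 'g::comm_monoid_add" and F' G' :: "_ \<Rightarrow> _ \<Rightarrow> _ \<Rightarrow> _ \<Rightarrow> _ \<Rightarrow> _ \<Rightarrow> 'h::ab_group_add"
  unfolding split6_def
  by (simp_all add: split5_linear split2_linear)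

lemma split7_linear:
  "split7 w (\<lambda>a b c d e f g. F a b c d e f g + G a b c d e f g) = split7 w F + split7 w G"
  "split7 w (\<lambda>a b c d e f g. - F' a b c d e f g) = - split7 w F'"
  "split7 w (\<lambda>a b c d e f g. F' a b c d e f g - G' a b c d e f g) = split7 w F' - split7 w G'"
  "koszul n (split7 w F') = split7 w (\<lambda>a b c d e f g. koszul n (F' a b c d e f g))"
  for F G :: "_ \<Rightarrow> _ \<Rightarrow> _ \<Rightarrow> _ \<Rightarrow> _ \<Rightarrow> _ \<Rightarrow> _ \<Rightarrow> 'g::comm_monoid_add" and F' G' :: "_ \<Rightarrow> _ \<Rightarrow> _ \<Rightarrow> _ \<Rightarrow> _ \<Rightarrow> _ \<Rightarrow> _ \<Rightarrow> 'h::ab_group_add"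
  unfolding split7_def
  by (simp_all add: split6_linear split2_linear)

text \<open>Both sides run over the factorizations of \<open>w\<close> into three pieces. Every
  later refinement rule is reduced to this one and to the exchange of independent sums.\<close>

lemma split2_assoc:
  "split2 w (\<lambda>u c. split2 u (\<lambda>a b. F a b c)) = split2 w (\<lambda>a u. split2 u (\<lambda>b c. F a b c))"
proof (induction w arbitrary: F)
  case (Cons x w)
  show ?case
    by (simp add: split2_Cons split2_linear add.assoc Cons.IH)
qed simp

lemma split2_zero [simp]: "split2 w (\<lambda>a b. 0) = 0"
  by (simp add: split2_def)

lemma split3_zero [simp]: "split3 w (\<lambda>a b c. 0) = 0"
  by (simp add: split_defs)

lemma split4_zero [simp]: "split4 w (\<lambda>a b c d. 0) = 0"
  by (simp add: split_defs)

lemma split5_zero [simp]: "split5 w (\<lambda>a b c d e. 0) = 0"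
  by (simp add: split_defs)

lemmas split_linear = split2_linear split3_linear split4_linear split5_linear split6_linear split7_linear

section \<open>Refinement of factorizations into more pieces\<close>

lemma split3_swap:
  "split3 v (\<lambda>a b c. split2 w (\<lambda>x y. F a b c x y)) = split2 w (\<lambda>x y. split3 v (\<lambda>a b c. F a b c x y))"
  unfolding split3_def by (rule trans[OF split2_cong[OF refl split2_swap] split2_swap])

lemma split4_swap:
  "split4 v (\<lambda>a b c d. split2 w (\<lambda>x y. F a b c d x y)) = split2 w (\<lambda>x y. split4 v (\<lambda>a b c d. F a b c d x y))"
  unfolding split4_def by (rule trans[OF split2_cong[OF refl split3_swap] split2_swap])

lemma split5_swap:
  "split5 v (\<lambda>a b c d e. split2 w (\<lambda>x y. F a b c d e x y)) = split2 w (\<lambda>x y. split5 v (\<lambda>a b c d e. F a b c d e x y))"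
  unfolding split5_def by (rule trans[OF split2_cong[OF refl split4_swap] split2_swap])

lemma split2_refine2:
  "split2 w (\<lambda>a b. split2 a (\<lambda>x y. F x y b)) = split3 w F"
  "split2 w (\<lambda>a b. split2 b (\<lambda>x y. F a x y)) = split3 w F"
  by (simp_all add: split3_def split2_assoc)

lemma split3_refine2:
  "split3 w (\<lambda>a b c. split2 a (\<lambda>x y. F x y b c)) = split4 w F"
  "split3 w (\<lambda>a b c. split2 b (\<lambda>x y. F a x y c)) = split4 w F"
  "split3 w (\<lambda>a b c. split2 c (\<lambda>x y. F a b x y)) = split4 w F"
proof -
  show "split3 w (\<lambda>a b c. split2 a (\<lambda>x y. F x y b c)) = split4 w F"
    unfolding split4_def split3_def
    by (rule trans[OF split2_cong[OF refl split2_swap] split2_assoc])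
qed (simp_all only: split4_def split3_def[of w] split2_refine2)

lemma split4_refine2:
  "split4 w (\<lambda>a b c d. split2 a (\<lambda>x y. F x y b c d)) = split5 w F"
  "split4 w (\<lambda>a b c d. split2 b (\<lambda>x y. F a x y c d)) = split5 w F"
  "split4 w (\<lambda>a b c d. split2 c (\<lambda>x y. F a b x y d)) = split5 w F"
  "split4 w (\<lambda>a b c d. split2 d (\<lambda>x y. F a b c x y)) = split5 w F"
proof -
  show "split4 w (\<lambda>a b c d. split2 a (\<lambda>x y. F x y b c d)) = split5 w F"
    unfolding split5_def split4_def
    by (rule trans[OF split2_cong[OF refl split3_swap] split2_assoc])
qed (simp_all only: split5_def split4_def[of w] split3_refine2)

lemma split5_refine2:
  "split5 w (\<lambda>a b c d e. split2 a (\<lambda>x y. F x y b c d e)) = split6 w F"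
  "split5 w (\<lambda>a b c d e. split2 b (\<lambda>x y. F a x y c d e)) = split6 w F"
  "split5 w (\<lambda>a b c d e. split2 c (\<lambda>x y. F a b x y d e)) = split6 w F"
  "split5 w (\<lambda>a b c d e. split2 d (\<lambda>x y. F a b c x y e)) = split6 w F"
  "split5 w (\<lambda>a b c d e. split2 e (\<lambda>x y. F a b c d x y)) = split6 w F"
proof -
  show "split5 w (\<lambda>a b c d e. split2 a (\<lambda>x y. F x y b c d e)) = split6 w F"
    unfolding split6_def split5_def
    by (rule trans[OF split2_cong[OF refl split4_swap] split2_assoc])
qed (simp_all only: split6_def split5_def[of w] split4_refine2)

lemma split6_refine2:
  "split6 w (\<lambda>a b c d e f. split2 a (\<lambda>x y. F x y b c d e f)) = split7 w F"
  "split6 w (\<lambda>a b c d e f. split2 b (\<lambda>x y. F a x y c d e f)) = split7 w F"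
  "split6 w (\<lambda>a b c d e f. split2 c (\<lambda>x y. F a b x y d e f)) = split7 w F"
  "split6 w (\<lambda>a b c d e f. split2 d (\<lambda>x y. F a b c x y e f)) = split7 w F"
  "split6 w (\<lambda>a b c d e f. split2 e (\<lambda>x y. F a b c d x y f)) = split7 w F"
  "split6 w (\<lambda>a b c d e f. split2 f (\<lambda>x y. F a b c d e x y)) = split7 w F"
proof -
  show "split6 w (\<lambda>a b c d e f. split2 a (\<lambda>x y. F x y b c d e f)) = split7 w F"
    unfolding split7_def split6_def
    by (rule trans[OF split2_cong[OF refl split5_swap] split2_assoc])
qed (simp_all only: split7_def split6_def[of w] split5_refine2)

lemma split2_refine3:
  "split2 w (\<lambda>a b. split3 a (\<lambda>x y z. F x y z b)) = split4 w F"
  "split2 w (\<lambda>a b. split3 b (\<lambda>x y z. F a x y z)) = split4 w F"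
   apply (rule trans[OF split2_cong[OF refl split3_def] trans[OF split2_refine2(1) split3_refine2(2)]])
   apply (rule trans[OF split2_cong[OF refl split3_def] trans[OF split2_refine2(2) split3_refine2(3)]])
  done

lemma split3_refine3:
  "split3 w (\<lambda>a b c. split3 a (\<lambda>x y z. F x y z b c)) = split5 w F"
  "split3 w (\<lambda>a b c. split3 b (\<lambda>x y z. F a x y z c)) = split5 w F"
  "split3 w (\<lambda>a b c. split3 c (\<lambda>x y z. F a b x y z)) = split5 w F"
   apply (rule trans[OF split3_cong[OF refl split3_def] trans[OF split3_refine2(1) split4_refine2(2)]])
   apply (rule trans[OF split3_cong[OF refl split3_def] trans[OF split3_refine2(2) split4_refine2(3)]])
   apply (rule trans[OF split3_cong[OF refl split3_def] trans[OF split3_refine2(3) split4_refine2(4)]])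
  done

lemma split4_refine3:
  "split4 w (\<lambda>a b c d. split3 a (\<lambda>x y z. F x y z b c d)) = split6 w F"
  "split4 w (\<lambda>a b c d. split3 b (\<lambda>x y z. F a x y z c d)) = split6 w F"
  "split4 w (\<lambda>a b c d. split3 c (\<lambda>x y z. F a b x y z d)) = split6 w F"
  "split4 w (\<lambda>a b c d. split3 d (\<lambda>x y z. F a b c x y z)) = split6 w F"
   apply (rule trans[OF split4_cong[OF refl split3_def] trans[OF split4_refine2(1) split5_refine2(2)]])
   apply (rule trans[OF split4_cong[OF refl split3_def] trans[OF split4_refine2(2) split5_refine2(3)]])
   apply (rule trans[OF split4_cong[OF refl split3_def] trans[OF split4_refine2(3) split5_refine2(4)]])
   apply (rule trans[OF split4_cong[OF refl split3_def] trans[OF split4_refine2(4) split5_refine2(5)]])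
  done

lemma split5_refine3:
  "split5 w (\<lambda>a b c d e. split3 a (\<lambda>x y z. F x y z b c d e)) = split7 w F"
  "split5 w (\<lambda>a b c d e. split3 b (\<lambda>x y z. F a x y z c d e)) = split7 w F"
  "split5 w (\<lambda>a b c d e. split3 c (\<lambda>x y z. F a b x y z d e)) = split7 w F"
  "split5 w (\<lambda>a b c d e. split3 d (\<lambda>x y z. F a b c x y z e)) = split7 w F"
  "split5 w (\<lambda>a b c d e. split3 e (\<lambda>x y z. F a b c d x y z)) = split7 w F"
   apply (rule trans[OF split5_cong[OF refl split3_def] trans[OF split5_refine2(1) split6_refine2(2)]])
   apply (rule trans[OF split5_cong[OF refl split3_def] trans[OF split5_refine2(2) split6_refine2(3)]])
   apply (rule trans[OF split5_cong[OF refl split3_def] trans[OF split5_refine2(3) split6_refine2(4)]])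
   apply (rule trans[OF split5_cong[OF refl split3_def] trans[OF split5_refine2(4) split6_refine2(5)]])
   apply (rule trans[OF split5_cong[OF refl split3_def] trans[OF split5_refine2(5) split6_refine2(6)]])
  done

lemma split2_refine4:
  "split2 w (\<lambda>a b. split4 a (\<lambda>x y z t. F x y z t b)) = split5 w F"
  "split2 w (\<lambda>a b. split4 b (\<lambda>x y z t. F a x y z t)) = split5 w F"
   apply (rule trans[OF split2_cong[OF refl split4_def] trans[OF split2_refine2(1) split3_refine3(2)]])
   apply (rule trans[OF split2_cong[OF refl split4_def] trans[OF split2_refine2(2) split3_refine3(3)]])
  done

lemma split3_refine4:
  "split3 w (\<lambda>a b c. split4 a (\<lambda>x y z t. F x y z t b c)) = split6 w F"
  "split3 w (\<lambda>a b c. split4 b (\<lambda>x y z t. F a x y z t c)) = split6 w F"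
  "split3 w (\<lambda>a b c. split4 c (\<lambda>x y z t. F a b x y z t)) = split6 w F"
   apply (rule trans[OF split3_cong[OF refl split4_def] trans[OF split3_refine2(1) split4_refine3(2)]])
   apply (rule trans[OF split3_cong[OF refl split4_def] trans[OF split3_refine2(2) split4_refine3(3)]])
   apply (rule trans[OF split3_cong[OF refl split4_def] trans[OF split3_refine2(3) split4_refine3(4)]])
  done

lemma split4_refine4:
  "split4 w (\<lambda>a b c d. split4 a (\<lambda>x y z t. F x y z t b c d)) = split7 w F"
  "split4 w (\<lambda>a b c d. split4 b (\<lambda>x y z t. F a x y z t c d)) = split7 w F"
  "split4 w (\<lambda>a b c d. split4 c (\<lambda>x y z t. F a b x y z t d)) = split7 w F"
  "split4 w (\<lambda>a b c d. split4 d (\<lambda>x y z t. F a b c x y z t)) = split7 w F"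
   apply (rule trans[OF split4_cong[OF refl split4_def] trans[OF split4_refine2(1) split5_refine3(2)]])
   apply (rule trans[OF split4_cong[OF refl split4_def] trans[OF split4_refine2(2) split5_refine3(3)]])
   apply (rule trans[OF split4_cong[OF refl split4_def] trans[OF split4_refine2(3) split5_refine3(4)]])
   apply (rule trans[OF split4_cong[OF refl split4_def] trans[OF split4_refine2(4) split5_refine3(5)]])
  done

lemma split3_refine5:
  "split3 w (\<lambda>a b c. split5 a (\<lambda>x y z t s. F x y z t s b c)) = split7 w F"
  "split3 w (\<lambda>a b c. split5 b (\<lambda>x y z t s. F a x y z t s c)) = split7 w F"
  "split3 w (\<lambda>a b c. split5 c (\<lambda>x y z t s. F a b x y z t s)) = split7 w F"
   apply (rule trans[OF split3_cong[OF refl split5_def] trans[OF split3_refine2(1) split4_refine4(2)]])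
   apply (rule trans[OF split3_cong[OF refl split5_def] trans[OF split3_refine2(2) split4_refine4(3)]])
   apply (rule trans[OF split3_cong[OF refl split5_def] trans[OF split3_refine2(3) split4_refine4(4)]])
  done

lemmas split_refine = split2_refine2 split3_refine2 split4_refine2 split5_refine2 split6_refine2 split2_refine3 split3_refine3 split4_refine3 split5_refine3 split2_refine4 split3_refine4 split4_refine4 split3_refine5

text \<open>The marked letter lies in exactly one piece. It stands for the head or for an inserted
  value, so these rules separate the segments that swallow it from those that avoid it.\<close>

lemma split3_append_Cons:
  "split3 (u @ x # v) F =
    split2 v (\<lambda>r0 w. split2 w (\<lambda>r1 r2. F (u @ x # r0) r1 r2))
    + split2 u (\<lambda>l0 l1. split2 v (\<lambda>r0 r1. F l0 (l1 @ x # r0) r1))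
    + split2 u (\<lambda>l0 w. split2 w (\<lambda>l1 l2. F l0 l1 (l2 @ x # v)))"
  by (simp add: split_defs split2_append_Cons split2_linear ac_simps)

lemma split4_append_Cons:
  "split4 (u @ x # v) F =
    split2 v (\<lambda>r0 w. split2 w (\<lambda>r1 w. split2 w (\<lambda>r2 r3. F (u @ x # r0) r1 r2 r3)))
    + split2 u (\<lambda>l0 l1. split2 v (\<lambda>r0 w. split2 w (\<lambda>r1 r2. F l0 (l1 @ x # r0) r1 r2)))
    + split2 u (\<lambda>l0 w. split2 w (\<lambda>l1 l2. split2 v (\<lambda>r0 r1. F l0 l1 (l2 @ x # r0) r1)))
    + split2 u (\<lambda>l0 w. split2 w (\<lambda>l1 w. split2 w (\<lambda>l2 l3. F l0 l1 l2 (l3 @ x # v))))"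
  by (simp add: split_defs split2_append_Cons split2_linear ac_simps)

lemma split5_append_Cons:
  "split5 (u @ x # v) F =
    split2 v (\<lambda>r0 w. split2 w (\<lambda>r1 w. split2 w (\<lambda>r2 w. split2 w (\<lambda>r3 r4. F (u @ x # r0) r1 r2 r3 r4))))
    + split2 u (\<lambda>l0 l1. split2 v (\<lambda>r0 w. split2 w (\<lambda>r1 w. split2 w (\<lambda>r2 r3. F l0 (l1 @ x # r0) r1 r2 r3))))
    + split2 u (\<lambda>l0 w. split2 w (\<lambda>l1 l2. split2 v (\<lambda>r0 w. split2 w (\<lambda>r1 r2. F l0 l1 (l2 @ x # r0) r1 r2))))
    + split2 u (\<lambda>l0 w. split2 w (\<lambda>l1 w. split2 w (\<lambda>l2 l3. split2 v (\<lambda>r0 r1. F l0 l1 l2 (l3 @ x # r0) r1))))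
    + split2 u (\<lambda>l0 w. split2 w (\<lambda>l1 w. split2 w (\<lambda>l2 w. split2 w (\<lambda>l3 l4. F l0 l1 l2 l3 (l4 @ x # v)))))"
  by (simp add: split_defs split2_append_Cons split2_linear ac_simps)

lemma split3_Cons:
  "split3 (x # v) F = split2 v (\<lambda>a0 w. split2 w (\<lambda>a1 a2. F (x # a0) a1 a2))
    + split2 v (\<lambda>a0 a1. F [] (x # a0) a1)
    + F [] [] (x # v)"
  using split3_append_Cons[of "[]" x v F] by (simp add: split_defs)

lemma split4_Cons:
  "split4 (x # v) F = split2 v (\<lambda>a0 w. split2 w (\<lambda>a1 w. split2 w (\<lambda>a2 a3. F (x # a0) a1 a2 a3)))
    + split2 v (\<lambda>a0 w. split2 w (\<lambda>a1 a2. F [] (x # a0) a1 a2))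
    + split2 v (\<lambda>a0 a1. F [] [] (x # a0) a1)
    + F [] [] [] (x # v)"
  using split4_append_Cons[of "[]" x v F] by (simp add: split_defs)

lemma split5_Cons:
  "split5 (x # v) F = split2 v (\<lambda>a0 w. split2 w (\<lambda>a1 w. split2 w (\<lambda>a2 w. split2 w (\<lambda>a3 a4. F (x # a0) a1 a2 a3 a4))))
    + split2 v (\<lambda>a0 w. split2 w (\<lambda>a1 w. split2 w (\<lambda>a2 a3. F [] (x # a0) a1 a2 a3)))
    + split2 v (\<lambda>a0 w. split2 w (\<lambda>a1 a2. F [] [] (x # a0) a1 a2))
    + split2 v (\<lambda>a0 a1. F [] [] [] (x # a0) a1)
    + F [] [] [] [] (x # v)"
  using split5_append_Cons[of "[]" x v F] by (simp add: split_defs)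

lemma split3_Nil [simp]: "split3 [] F = F [] [] []"
  by (simp add: split_defs)

lemma split4_Nil [simp]: "split4 [] F = F [] [] [] []"
  by (simp add: split_defs)

lemma split5_Nil [simp]: "split5 [] F = F [] [] [] [] []"
  by (simp add: split_defs)

lemmas split_Cons = split2_Cons split3_Cons split4_Cons split5_Cons

lemmas split_append_Cons = split2_append_Cons split3_append_Cons split4_append_Cons split5_append_Cons

section \<open>Sums in which few factorizations contribute\<close>

lemma split2_only_Nil_left:
  assumes "\<And>a b. w = a @ b \<Longrightarrow> a \<noteq> [] \<Longrightarrow> F a b = 0"
  shows "split2 w F = F [] w"
proof (cases w)
  case (Cons x w')
  have "split2 w' (\<lambda>a b. F (x # a) b) = split2 w' (\<lambda>a b. 0)"
    by (rule split2_cong) (auto intro: assms simp: Cons)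
  then show ?thesis
    by (simp add: Cons split2_Cons)
qed simp

lemma split2_only_Nil_right:
  assumes "\<And>a b. w = a @ b \<Longrightarrow> b \<noteq> [] \<Longrightarrow> F a b = 0"
  shows "split2 w F = F w []"
proof (cases w rule: rev_cases)
  case (snoc w' l)
  have "split2 w' (\<lambda>a b. F a (b @ [l])) = split2 w' (\<lambda>a b. 0)"
    by (rule split2_cong) (auto intro: assms simp: snoc)
  then show ?thesis
    using split2_append_Cons[of w' l "[]" F] by (simp add: snoc)
qed simp

text \<open>Moving the last letter of \<open>a\<close> across the cut matches the cuts with nonempty
  \<open>a\<close> with those whose right piece is nonempty; the cut that is missed contributes
  \<open>H w []\<close>. This is how a rotation by one letter telescopes.\<close>

lemma split2_shift:
  "split2 w (\<lambda>a b. if a = [] then F b else H (butlast a) (last a # b)) = F w + split2 w H - H w []"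
  for H :: "_ \<Rightarrow> _ \<Rightarrow> 'g::ab_group_add"
proof (induction w arbitrary: F H)
  case (Cons x w)
  have "split2 w (\<lambda>a b. H (butlast (x # a)) (last (x # a) # b)) =
      split2 w (\<lambda>a b. if a = [] then H [] (x # b) else H (x # butlast a) (last a # b))"
    by (rule split2_cong) auto
  then show ?case
    using Cons.IH[of "\<lambda>b. H [] (x # b)" "\<lambda>a. H (x # a)"] by (simp add: split2_Cons)
qed simp

section \<open>Inserting cochains into words\<close>

text \<open>
  All operations are defined on functions \<open>G\<close> of words with values in an abelian group. For a
  cochain \<open>G\<close> they are the operations of the Hochschild cochain complex, \<open>ins p f G\<close> being \<open>G \<circ> f\<close>;
  for \<open>G = frag_of\<close> they are operators from words to chains, and composition of operators becomes
  substitution for \<open>G\<close> in reverse order. In \<open>lie\<close>, \<open>cap\<close> and \<open>slide\<close> the head of the word is a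
  separate argument because the segment fed to \<open>f\<close> may wrap around it cyclically.
\<close>

definition letter :: "int \<Rightarrow> ('a hword \<Rightarrow> 'a) \<Rightarrow> 'a hword \<Rightarrow> int \<times> 'a"
  where "letter p f v = (sdeg v + p, f v)"

lemma fst_letter [simp]: "fst (letter p f v) = sdeg v + p"
  by (simp add: letter_def)

definition ins :: "int \<Rightarrow> ('a hword \<Rightarrow> 'a) \<Rightarrow> ('a hword \<Rightarrow> 'g) \<Rightarrow> 'a hword \<Rightarrow> 'g::ab_group_add"
  where "ins p f G w = split3 w (\<lambda>u v x. koszul ((p + 1) * sdeg u) (G (u @ letter p f v # x)))"

text \<open>In brace notation \<open>G{f, g}\<close>. The exponent of \<open>g\<close> uses the
  degree of the segment \<open>b\<close> itself and not that of the letter replacing it, as if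
  \<open>g\<close> had been inserted before \<open>f\<close>.\<close>

definition ins2 :: "int \<Rightarrow> ('a hword \<Rightarrow> 'a) \<Rightarrow> int \<Rightarrow> ('a hword \<Rightarrow> 'a) \<Rightarrow> ('a hword \<Rightarrow> 'g) \<Rightarrow> 'a hword \<Rightarrow> 'g::ab_group_add"
  where "ins2 p f q g G w = split5 w (\<lambda>a b c d e.
    koszul ((p + 1) * sdeg a + (q + 1) * (sdeg a + sdeg b + sdeg c)) (G (a @ letter p f b # c @ letter q g d # e)))"

text \<open>The term \<open>G{f{g}}\<close> with both values kept as separate letters. Modulo 2,
  \<open>p + q\<close> is the suspended degree of the composite, whose degree is
  \<open>p + q + 1\<close>.\<close>

definition ins_nest :: "int \<Rightarrow> ('a hword \<Rightarrow> 'a) \<Rightarrow> int \<Rightarrow> ('a hword \<Rightarrow> 'a) \<Rightarrow> ('a hword \<Rightarrow> 'g) \<Rightarrow> 'a hword \<Rightarrow> 'g::ab_group_add"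
  where "ins_nest p f q g G w = split5 w (\<lambda>a b c d e.
    koszul ((p + q) * sdeg a + (q + 1) * sdeg b) (G (a @ letter p f (b @ letter q g c # d) # e)))"

text \<open>The first sum leaves the head alone. In the second the segment contains the head and may
  begin with the end \<open>z\<close> of the word, at the cost of the Koszul sign for rotating
  \<open>z\<close> to the front.\<close>

definition lie :: "int \<Rightarrow> ('a hword \<Rightarrow> 'a) \<Rightarrow> ('a hword \<Rightarrow> 'g) \<Rightarrow> int \<times> 'a \<Rightarrow> 'a hword \<Rightarrow> 'g::ab_group_add"
  where "lie p f G m r =
    split3 r (\<lambda>x v y. koszul ((p + 1) * sdeg (m # x)) (G (m # x @ letter p f v # y)))
    + split3 r (\<lambda>x y z. koszul (sdeg z * sdeg (m # x @ y)) (G (letter p f (z @ m # x) # y)))"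

text \<open>A common generalization of the actions: \<open>f\<close> is applied to a cyclic segment
  that holds the head and, to its right, the value of \<open>g\<close>. Since \<open>mu\<close>
  accepts at most two letters, \<open>f = mu\<close> leaves just the head times the value of
  \<open>g\<close>.\<close>

definition cap :: "int \<Rightarrow> ('a hword \<Rightarrow> 'a) \<Rightarrow> int \<Rightarrow> ('a hword \<Rightarrow> 'a) \<Rightarrow> ('a hword \<Rightarrow> 'g) \<Rightarrow> int \<times> 'a \<Rightarrow> 'a hword \<Rightarrow> 'g::ab_group_add"
  where "cap p f q g G m r =
    split5 r (\<lambda>u v x y z. koszul ((q + 1) * sdeg (m # u) + sdeg z * (sdeg (m # u @ v @ x @ y) + q + 1))
      (G (letter p f (z @ m # u @ letter q g v # x) # y)))"

definition cap_nest1 :: "int \<Rightarrow> ('a hword \<Rightarrow> 'a) \<Rightarrow> int \<Rightarrow> ('a hword \<Rightarrow> 'a) \<Rightarrow> int \<Rightarrow> ('a hword \<Rightarrow> 'a) \<Rightarrow> ('a hword \<Rightarrow> 'g) \<Rightarrow> int \<times> 'a \<Rightarrow> 'a hword \<Rightarrow> 'g::ab_group_add"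
  where "cap_nest1 p f s h q g G m r =
    split5 r (\<lambda>u v x y z. koszul ((q + 1) * sdeg (m # u) + sdeg z * (sdeg (m # u @ v @ x @ y) + q + 1))
     (split3 (z @ m # u @ letter q g v # x) (\<lambda>a b c. koszul ((s + 1) * sdeg a)
      (G (letter p f (a @ letter s h b # c) # y)))))"

definition cap_nest2 :: "int \<Rightarrow> ('a hword \<Rightarrow> 'a) \<Rightarrow> int \<Rightarrow> ('a hword \<Rightarrow> 'a) \<Rightarrow> int \<Rightarrow> ('a hword \<Rightarrow> 'a) \<Rightarrow> ('a hword \<Rightarrow> 'g) \<Rightarrow> int \<times> 'a \<Rightarrow> 'a hword \<Rightarrow> 'g::ab_group_add"
  where "cap_nest2 p f q g s h G m r =
    split5 r (\<lambda>u v x y z. koszul ((q + s) * sdeg (m # u) + sdeg z * (sdeg (m # u @ v @ x @ y) + q + s))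
     (split3 v (\<lambda>a b c. koszul ((s + 1) * sdeg a)
      (G (letter p f (z @ m # u @ letter q g (a @ letter s h b # c) # x) # y)))))"

abbreviation at_head :: "(int \<times> 'a \<Rightarrow> 'a hword \<Rightarrow> 'g) \<Rightarrow> 'a hword \<Rightarrow> 'g"
  where "at_head F w \<equiv> F (hd w) (tl w)"

text \<open>After \<open>cap\<close> the value of \<open>f\<close> is the head, so a cochain
  \<open>h\<close> that swallows it is described by the second sum of \<open>lie\<close>
  alone.\<close>

definition cap_out :: "int \<Rightarrow> ('a hword \<Rightarrow> 'a) \<Rightarrow> int \<Rightarrow> ('a hword \<Rightarrow> 'a) \<Rightarrow> int \<Rightarrow> ('a hword \<Rightarrow> 'a) \<Rightarrow> ('a hword \<Rightarrow> 'g) \<Rightarrow> int \<times> 'a \<Rightarrow> 'a hword \<Rightarrow> 'g::ab_group_add"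
  where "cap_out s h p f q g G m r =
    cap p f q g (at_head (\<lambda>m r. split3 r (\<lambda>x y z. koszul (sdeg z * sdeg (m # x @ y)) (G (letter s h (z @ m # x) # y))))) m r"

text \<open>
  The identities below are proved by normalization: these rules turn both sides into sums, over
  the factorizations of a word into a fixed number of pieces, of terms with signs in normal form.
\<close>

lemmas word_norm = split_append_Cons split_linear split_refine koszul_norm letter_def

text \<open>Substitution for \<open>G\<close> reverses the order: \<open>h\<close> is inserted
  first. The segment then given to \<open>g\<close> contains the value of \<open>h\<close>, lies to
  its left, or lies to its right.\<close>

lemma ins_ins: "ins r h (ins q g G) w =
  ins_nest q g r h G w + ins2 q g r h G w + koszul ((q + 1) * (r + 1)) (ins2 r h q g G w)"
  unfolding ins_def ins2_def ins_nest_def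
  by (simp add: word_norm ac_simps)

text \<open>Solved for the terms with \<open>h\<close> inside the argument of \<open>f\<close>.
  There the segment of \<open>h\<close> avoids the value of \<open>g\<close>, contains it without
  the head, or contains both. The first kind is \<open>lie\<close> followed by \<open>cap\<close>,
  less the terms with \<open>h\<close> inside \<open>g\<close> and those with \<open>h\<close> away
  from \<open>f\<close>; the latter are \<open>cap\<close> followed by \<open>lie\<close>, less the
  terms in which \<open>h\<close> swallows the value of \<open>f\<close>.\<close>

lemma cap_lie:
  "cap_nest1 p f s h q g G m r =
     koszul ((s + 1) * (q + 1)) (lie s h (at_head (cap p f q g G)) m r
       - cap_nest2 p f q g s h G m r)
     - koszul ((s + 1) * (p + 1)) (cap p f q g (at_head (lie s h G)) m r - cap_out s h p f q g G m r)
     + cap_nest2 p f s h q g G m r + cap_out p f s h q g G m r"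
  unfolding cap_nest1_def cap_nest2_def cap_out_def lie_def cap_def
  by (simp add: word_norm ac_simps)

definition ins2_nest1 :: "int \<Rightarrow> ('a hword \<Rightarrow> 'a) \<Rightarrow> int \<Rightarrow> ('a hword \<Rightarrow> 'a) \<Rightarrow> int \<Rightarrow> ('a hword \<Rightarrow> 'a) \<Rightarrow> ('a hword \<Rightarrow> 'g) \<Rightarrow> 'a hword \<Rightarrow> 'g::ab_group_add"
  where "ins2_nest1 p f s h q g G w = split5 w (\<lambda>a b c d e.
    koszul ((p + s) * sdeg a + (q + 1) * (sdeg a + sdeg b + sdeg c))
     (split3 b (\<lambda>x y z. koszul ((s + 1) * sdeg x)
       (G (a @ letter p f (x @ letter s h y # z) # c @ letter q g d # e)))))"

definition ins2_nest2 :: "int \<Rightarrow> ('a hword \<Rightarrow> 'a) \<Rightarrow> int \<Rightarrow> ('a hword \<Rightarrow> 'a) \<Rightarrow> int \<Rightarrow> ('a hword \<Rightarrow> 'a) \<Rightarrow> ('a hword \<Rightarrow> 'g) \<Rightarrow> 'a hword \<Rightarrow> 'g::ab_group_add"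
  where "ins2_nest2 p f q g s h G w = split5 w (\<lambda>a b c d e.
    koszul ((p + 1) * sdeg a + (q + s) * (sdeg a + sdeg b + sdeg c))
     (split3 d (\<lambda>x y z. koszul ((s + 1) * sdeg x)
       (G (a @ letter p f b # c @ letter q g (x @ letter s h y # z) # e)))))"

definition ins_nest2 :: "int \<Rightarrow> ('a hword \<Rightarrow> 'a) \<Rightarrow> int \<Rightarrow> ('a hword \<Rightarrow> 'a) \<Rightarrow> int \<Rightarrow> ('a hword \<Rightarrow> 'a) \<Rightarrow> ('a hword \<Rightarrow> 'g) \<Rightarrow> 'a hword \<Rightarrow> 'g::ab_group_add"
  where "ins_nest2 s h p f q g G w = split3 w (\<lambda>u v x. koszul ((s + p + q + 1) * sdeg u)
     (split5 v (\<lambda>a b c d e.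
    koszul ((p + 1) * sdeg a + (q + 1) * (sdeg a + sdeg b + sdeg c))
      (G (u @ letter s h (a @ letter p f b # c @ letter q g d # e) # x)))))"

text \<open>The argument of \<open>h\<close> contains both other values, only that of
  \<open>f\<close>, only that of \<open>g\<close>, or neither. The last kind is obtained by
  inserting \<open>h\<close> first and discarding the terms in which it ends up inside
  \<open>f\<close> or \<open>g\<close>.\<close>

lemma ins2_ins: "ins2 p f q g (ins s h G) w =
  ins_nest2 s h p f q g G w + ins2_nest1 s h p f q g G w
  + koszul ((s + 1) * (p + 1)) (ins2_nest2 p f s h q g G w)
  + koszul ((s + 1) * (p + q)) (ins s h (ins2 p f q g G) w - ins2_nest2 p f q g s h G w
     - koszul ((s + 1) * (q + 1)) (ins2_nest1 p f s h q g G w))"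
  unfolding ins_def ins2_def ins_nest2_def ins2_nest1_def ins2_nest2_def
  by (simp add: word_norm ac_simps)

section \<open>Rotations, the cyclic norm and the ingredients of Cartan's formula\<close>

definition cyclic_norm :: "('a hword \<Rightarrow> 'g) \<Rightarrow> int \<times> 'a \<Rightarrow> 'a hword \<Rightarrow> 'g::ab_group_add"
  where "cyclic_norm G m r = split2 r (\<lambda>u v. koszul (sdeg v * sdeg (m # u)) (G (v @ m # u)))"

definition rot :: "('a hword \<Rightarrow> 'g) \<Rightarrow> 'a hword \<Rightarrow> 'g::ab_group_add"
  where "rot G w = koszul (sdeg [last w] * sdeg (butlast w)) (G (last w # butlast w))"

definition eval_front :: "int \<Rightarrow> ('a hword \<Rightarrow> 'a) \<Rightarrow> ('a hword \<Rightarrow> 'g) \<Rightarrow> 'a hword \<Rightarrow> 'g::ab_group_add"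
  where "eval_front p f G w = split2 w (\<lambda>a b. G (letter p f a # b))"

definition eval_front_nest :: "int \<Rightarrow> ('a hword \<Rightarrow> 'a) \<Rightarrow> int \<Rightarrow> ('a hword \<Rightarrow> 'a) \<Rightarrow> ('a hword \<Rightarrow> 'g) \<Rightarrow> 'a hword \<Rightarrow> 'g::ab_group_add"
  where "eval_front_nest p f s h G w = split2 w (\<lambda>a b. split3 a (\<lambda>x y z. koszul ((s + 1) * sdeg x) (G (letter p f (x @ letter s h y # z) # b))))"

text \<open>The cochain acts to the right of the head, and a final segment \<open>z\<close> is then
  rotated to the front. This is the classical homotopy of Cartan's formula before a unit is put in
  front of the word.\<close>

definition slide :: "int \<Rightarrow> ('a hword \<Rightarrow> 'a) \<Rightarrow> ('a hword \<Rightarrow> 'g) \<Rightarrow> int \<times> 'a \<Rightarrow> 'a hword \<Rightarrow> 'g::ab_group_add"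
  where "slide p f G m r = split4 r (\<lambda>x v y z.
    koszul ((p + 1) * sdeg (m # x) + sdeg z * (sdeg (m # x @ v @ y) + p + 1)) (G (z @ m # x @ letter p f v # y)))"

definition slide_nest :: "int \<Rightarrow> ('a hword \<Rightarrow> 'a) \<Rightarrow> int \<Rightarrow> ('a hword \<Rightarrow> 'a) \<Rightarrow> ('a hword \<Rightarrow> 'g) \<Rightarrow> int \<times> 'a \<Rightarrow> 'a hword \<Rightarrow> 'g::ab_group_add"
  where "slide_nest p f s h G m r = split4 r (\<lambda>x v y z.
    koszul ((p + s) * sdeg (m # x) + sdeg z * (sdeg (m # x @ v @ y) + p + s))
     (split3 v (\<lambda>a b c. koszul ((s + 1) * sdeg a) (G (z @ m # x @ letter p f (a @ letter s h b # c) # y)))))"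

text \<open>The segment of \<open>h\<close> contains the value of \<open>f\<close> together with the
  old head (the \<open>cap\<close> term, with all rotations), that value without the head
  (\<open>slide_nest s h p f\<close>), or avoids it. The last kind is \<open>lie\<close> followed by
  \<open>slide\<close>, less the terms with \<open>h\<close> inside \<open>f\<close>.\<close>

lemma slide_ins: "slide p f (ins s h G) m r = koszul ((s + 1) * (p + 1)) (lie s h (at_head (slide p f G)) m r)
   + slide_nest s h p f G m r - koszul ((s + 1) * (p + 1)) (slide_nest p f s h G m r)
   + cap s h p f (at_head (cyclic_norm G)) m r"
  unfolding slide_def slide_nest_def ins_def lie_def cap_def cyclic_norm_def
  by (simp add: word_norm ac_simps)

text \<open>The relation \<open>N b = b' N\<close> of the cyclic bicomplex, with \<open>lie\<close>
  as \<open>b\<close> and \<open>ins\<close> as \<open>b'\<close>. Each cyclic segment becomes a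
  plain one after rotation, except when the cut falls inside it, and such cuts have no counterpart
  once the segment is a single letter.\<close>

lemma lie_norm: "lie s h (at_head (cyclic_norm G)) m r = cyclic_norm (ins s h G) m r"
  unfolding ins_def lie_def cyclic_norm_def
  by (simp add: word_norm ac_simps)

text \<open>A rotation by one letter moves the cut one place to the left, and the rotation that
  brings \<open>m\<close> back to the front closes the circle. In operators,
  \<open>t N = N\<close>.\<close>

lemma norm_rot: "cyclic_norm (rot G) m r = cyclic_norm G m r"
proof -
  have "cyclic_norm (rot G) m r = split2 r (\<lambda>u v. if u = [] then G (m # v) else
      (\<lambda>u v. koszul (sdeg v * sdeg (m # u)) (G (v @ m # u))) (butlast u) (last u # v))"
    unfolding cyclic_norm_def
  proof (rule split2_cong[OF refl])
    fix u v show "koszul (sdeg v * sdeg (m # u)) (rot G (v @ m # u)) = (if u = [] then G (m # v) else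
      (\<lambda>u v. koszul (sdeg v * sdeg (m # u)) (G (v @ m # u))) (butlast u) (last u # v))"
      by (cases u rule: rev_cases) (simp_all add: rot_def word_norm butlast_append ac_simps)
  qed
  also have "\<dots> = cyclic_norm G m r"
    by (subst split2_shift[where H = "\<lambda>u v. koszul (sdeg v * sdeg (m # u)) (G (v @ m # u))"]) (simp add: cyclic_norm_def)
  finally show ?thesis .
qed

text \<open>In operators, \<open>E N = L - (1 - t) S\<close>. The factor \<open>1 - t\<close>
  telescopes along the cut of \<open>slide\<close>. The words starting with \<open>m\<close> that it
  leaves cancel the first sum of \<open>lie\<close>; those starting with the value of
  \<open>f\<close> join the second sum to form \<open>E N\<close>.\<close>

lemma norm_eval_front: "cyclic_norm (eval_front p f G) m r = lie p f G m r - slide p f (\<lambda>w. G w - rot G w) m r"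
proof -
  have "slide p f (rot G) m r = split3 r (\<lambda>x v y. split2 y (\<lambda>y z. koszul ((p + 1) * sdeg (m # x) + sdeg z * (sdeg (m # x @ v @ y) + p + 1)) (rot G (z @ m # x @ letter p f v # y))))"
    unfolding slide_def by (simp only: split3_refine2)
  \<comment> \<open>For \<open>y = []\<close> the last letter is the value of \<open>f\<close>, and
    rotating it gives a word of another shape; otherwise the cut moves by one letter, as
    \<open>split2_shift\<close> requires.\<close>
  also have "\<dots> = split3 r (\<lambda>x v y. split2 y (\<lambda>y z. if y = [] then koszul (sdeg (m # x) * (sdeg v + sdeg z)) (G (letter p f v # z @ m # x)) else
     (\<lambda>y z. koszul ((p + 1) * sdeg (m # x) + sdeg z * (sdeg (m # x @ v @ y) + p + 1)) (G (z @ m # x @ letter p f v # y))) (butlast y) (last y # z)))"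
  proof (intro split3_cong[OF refl] split2_cong[OF refl])
    fix x v y z
    show "koszul ((p + 1) * sdeg (m # x) + sdeg z * (sdeg (m # x @ v @ y) + p + 1)) (rot G (z @ m # x @ letter p f v # y)) =
     (if y = [] then koszul (sdeg (m # x) * (sdeg v + sdeg z)) (G (letter p f v # z @ m # x)) else
     (\<lambda>y z. koszul ((p + 1) * sdeg (m # x) + sdeg z * (sdeg (m # x @ v @ y) + p + 1)) (G (z @ m # x @ letter p f v # y))) (butlast y) (last y # z))"
      by (cases y rule: rev_cases) (simp_all add: rot_def word_norm butlast_append ac_simps)
  qed
  also have "\<dots> = split3 r (\<lambda>x v y. koszul (sdeg (m # x) * (sdeg v + sdeg y)) (G (letter p f v # y @ m # x))
      + split2 y (\<lambda>y z. koszul ((p + 1) * sdeg (m # x) + sdeg z * (sdeg (m # x @ v @ y) + p + 1)) (G (z @ m # x @ letter p f v # y)))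
      - koszul ((p + 1) * sdeg (m # x)) (G (m # x @ letter p f v # y)))"
    by (intro split3_cong[OF refl] trans[OF split2_shift[where H = "\<lambda>y z. koszul ((p + 1) * sdeg (m # x) + sdeg z * (sdeg (m # x @ v @ y) + p + 1)) (G (z @ m # x @ letter p f v # y))" for x v]]) simp
  finally have *: "slide p f (rot G) m r = split3 r (\<lambda>x v y. koszul (sdeg (m # x) * (sdeg v + sdeg y)) (G (letter p f v # y @ m # x)))
    + slide p f G m r - split3 r (\<lambda>x v y. koszul ((p + 1) * sdeg (m # x)) (G (m # x @ letter p f v # y)))"
    unfolding slide_def by (simp only: split_linear split_refine)
  have "slide p f (\<lambda>w. G w - rot G w) m r = slide p f G m r - slide p f (rot G) m r"
    by (simp add: slide_def koszul_diff split_linear)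
  then show ?thesis
    unfolding * unfolding cyclic_norm_def eval_front_def lie_def
    by (simp add: word_norm ac_simps)
qed

lemma norm_at_rot:
  assumes "w \<noteq> []"
  shows "at_head (cyclic_norm G) w = rot (at_head (cyclic_norm G)) w"
proof -
  obtain m r where w: "w = m # r" using assms by (cases w) auto
  show ?thesis
    unfolding w by (cases r rule: rev_cases) (simp_all add: cyclic_norm_def rot_def word_norm split_Cons ac_simps)
qed

text \<open>The relation \<open>b (1 - t) = (1 - t) b'\<close>. The segments joining the end of
  \<open>w\<close> to its head are seen by \<open>lie\<close> both on \<open>w\<close> and on its
  rotation, and cancel.\<close>

lemma lie_rot:
  assumes "w \<noteq> []"
  shows "at_head (lie s h G) w - rot (at_head (lie s h G)) w = ins s h (\<lambda>w. G w - rot G w) w"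
proof -
  obtain m r where w: "w = m # r" using assms by (cases w) auto
  show ?thesis
    unfolding w by (cases r rule: rev_cases) (simp_all add: lie_def ins_def rot_def word_norm split_Cons butlast_append ac_simps)
qed

text \<open>In \<open>cap\<close> composed with \<open>1 - t\<close> everything cancels except two
  ends: the argument of \<open>h\<close> begins with the head of \<open>w\<close>, or the head of
  the rotated word stands directly before the segment given to \<open>f\<close>. The first end
  cancels part of \<open>eval_front_nest s h p f\<close>; the second supplies the wrapping terms of
  \<open>lie\<close>.\<close>

lemma eval_front_lie:
  assumes "w \<noteq> []"
  shows "eval_front p f (at_head (lie s h G)) w = koszul ((s + 1) * (p + 1)) (ins s h (eval_front p f G) w)
    + eval_front_nest s h p f G w - koszul ((s + 1) * (p + 1)) (eval_front_nest p f s h G w)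
    - (at_head (cap s h p f G) w - rot (at_head (cap s h p f G)) w)"
proof -
  obtain m r where w: "w = m # r" using assms by (cases w) auto
  show ?thesis
    unfolding w by (cases r rule: rev_cases) (simp_all add: lie_def ins_def rot_def cap_def eval_front_def eval_front_nest_def word_norm split_Cons ac_simps)
qed

section \<open>Multilinear functions of words\<close>

text \<open>
  An element \<open>(i, \<phi>)\<close> of \<open>word_vars A\<close> is a word with a hole of degree \<open>i\<close>, \<open>\<phi> y\<close> being the word with
  \<open>y\<close> in the hole; for \<open>letter_vars\<close> the word is the single letter \<open>y\<close>. A function \<open>F\<close> is \<open>mlin\<close>
  if it is linear in the content of every such hole, up to elements of \<open>H\<close>; a substitution \<open>W\<close> is
  a \<open>slot\<close> if the content of the hole enters \<open>W (\<phi> y)\<close> linearly and through one letter only.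
\<close>

definition word_vars :: "('k, 'a) dga \<Rightarrow> (int \<times> ('a \<Rightarrow> 'a hword)) set"
  where "word_vars A = (\<lambda>(u, i, v). (i, \<lambda>y. u @ (i, y) # v)) ` {(u, i, v). is_hword A u \<and> is_hword A v}"

definition letter_vars :: "(int \<times> ('a \<Rightarrow> int \<times> 'a)) set"
  where "letter_vars = range (\<lambda>i. (i, Pair i))"

definition degree_only :: "(int \<times> ('a \<Rightarrow> 'w)) set \<Rightarrow> ('w \<Rightarrow> int) \<Rightarrow> bool"
  where "degree_only V e \<longleftrightarrow> (\<forall>(i, \<phi>)\<in>V. \<forall>x y. e (\<phi> x) = e (\<phi> y))"

lemma degree_only_words [intro!]:
  "(\<And>u i x y v. e (u @ (i, x) # v) = e (u @ (i, y) # v)) \<Longrightarrow> degree_only (word_vars A) e"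
  by (auto simp: degree_only_def word_vars_def)

lemma degree_only_letters [intro!]:
  "(\<And>i x y. e (i, x) = e (i, y)) \<Longrightarrow> degree_only letter_vars e"
  by (auto simp: degree_only_def letter_vars_def)

definition slot :: "('k, 'a::ring) dga \<Rightarrow> (int \<times> ('a \<Rightarrow> 'w)) set \<Rightarrow> ('w \<Rightarrow> 'a hword) \<Rightarrow> bool"
  where "slot A V W \<longleftrightarrow> (\<forall>(i, \<phi>)\<in>V. \<exists>P j Y Q. is_hword A P \<and> is_hword A Q \<and>
    (\<forall>y\<in>homog A i. W (\<phi> y) = P @ (j, Y y) # Q \<and> Y y \<in> homog A j) \<and>
    (\<forall>x\<in>homog A i. (\<forall>y\<in>homog A i. Y (x + y) = Y x + Y y) \<and> (\<forall>r. Y (scal A r x) = scal A r (Y x))))"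

definition mlin :: "('k, 'a::ring) dga \<Rightarrow> ('k \<Rightarrow> 'g \<Rightarrow> 'g) \<Rightarrow> 'g set \<Rightarrow> (int \<times> ('a \<Rightarrow> 'w)) set \<Rightarrow> ('w \<Rightarrow> 'g::ab_group_add) \<Rightarrow> bool"
  where "mlin A act H V F \<longleftrightarrow> (\<forall>(i, \<phi>)\<in>V. \<forall>x\<in>homog A i.
    (\<forall>y\<in>homog A i. F (\<phi> (x + y)) - (F (\<phi> x) + F (\<phi> y)) \<in> H) \<and>
    (\<forall>r. F (\<phi> (scal A r x)) - act r (F (\<phi> x)) \<in> H))"

lemma mlin_words_iff:
  "mlin A act H (word_vars A) F \<longleftrightarrow>
    (\<forall>u i v x. is_hword A u \<and> is_hword A v \<and> x \<in> homog A i \<longrightarrow>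
      (\<forall>y\<in>homog A i. F (u @ (i, x + y) # v) - (F (u @ (i, x) # v) + F (u @ (i, y) # v)) \<in> H) \<and>
      (\<forall>r. F (u @ (i, scal A r x) # v) - act r (F (u @ (i, x) # v)) \<in> H))"
  by (simp add: mlin_def word_vars_def case_prod_beta) blast

lemma is_hword_Nil [simp]: "is_hword A []"
  by (simp add: is_hword_def)

lemma is_hword_Cons [simp]: "is_hword A (c # w) \<longleftrightarrow> snd c \<in> homog A (fst c) \<and> is_hword A w"
  by (auto simp: is_hword_def)

lemma is_hword_append [simp]: "is_hword A (u @ v) \<longleftrightarrow> is_hword A u \<and> is_hword A v"
  by (auto simp: is_hword_def)

lemma snd_letter [simp]: "snd (letter p f v) = f v"
  by (simp add: letter_def)

section \<open>Homogeneous parts, cochains and substitutions into words\<close>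

context dg_algebra
begin

sublocale scal: Modules.module "scal A"
  by (rule scal_module)

lemma homog_zero [simp]: "0 \<in> homog A i"
  using homog_subspace by (rule scal.subspace_0)

lemma homog_add: "x \<in> homog A i \<Longrightarrow> y \<in> homog A i \<Longrightarrow> x + y \<in> homog A i"
  using homog_subspace by (rule scal.subspace_add)

lemma homog_scal: "x \<in> homog A i \<Longrightarrow> scal A r x \<in> homog A i"
  using homog_subspace by (rule scal.subspace_scale)

lemma homog_uminus: "x \<in> homog A i \<Longrightarrow> - x \<in> homog A i"
  using homog_subspace by (rule scal.subspace_neg)

lemma homog_diff: "x \<in> homog A i \<Longrightarrow> y \<in> homog A i \<Longrightarrow> x - y \<in> homog A i"
  using homog_subspace by (rule scal.subspace_diff)

lemma homog_koszul: "x \<in> homog A i \<Longrightarrow> koszul n x \<in> homog A i"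
  by (simp add: koszul_def homog_uminus)

lemma homog_sum: "(\<And>x. x \<in> I \<Longrightarrow> F x \<in> homog A i) \<Longrightarrow> sum F I \<in> homog A i"
  using homog_subspace by (rule scal.subspace_sum)

lemma homog_split2: "(\<And>a b. w = a @ b \<Longrightarrow> F a b \<in> homog A i) \<Longrightarrow> split2 w F \<in> homog A i"
  unfolding split2_def by (rule homog_sum) simp

lemma homog_split3: "(\<And>a b c. w = a @ b @ c \<Longrightarrow> F a b c \<in> homog A i) \<Longrightarrow> split3 w F \<in> homog A i"
  unfolding split3_def by (intro homog_split2 homog_split2) auto

lemma homog_split4: "(\<And>a b c d. w = a @ b @ c @ d \<Longrightarrow> F a b c d \<in> homog A i) \<Longrightarrow> split4 w F \<in> homog A i"
  unfolding split4_def by (intro homog_split2 homog_split3) auto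

lemma homog_split5: "(\<And>a b c d e. w = a @ b @ c @ d @ e \<Longrightarrow> F a b c d e \<in> homog A i) \<Longrightarrow> split5 w F \<in> homog A i"
  unfolding split5_def by (intro homog_split2 homog_split4) auto

lemma cochains_iff:
  "f \<in> cochains A p \<longleftrightarrow> (\<forall>w. \<not> is_hword A w \<longrightarrow> f w = 0) \<and>
    (\<forall>w. is_hword A w \<longrightarrow> f w \<in> homog A (sdeg w + p)) \<and> mlin A (scal A) {0} (word_vars A) f"
  unfolding mlin_words_iff by (auto simp: cochains_def)

lemma cochain_homog [simp]:
  "f \<in> cochains A p \<Longrightarrow> is_hword A w \<Longrightarrow> n = sdeg w + p \<Longrightarrow> f w \<in> homog A n"
  by (simp add: cochains_iff)

lemma cochain_outside: "f \<in> cochains A p \<Longrightarrow> \<not> is_hword A w \<Longrightarrow> f w = 0"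
  by (simp add: cochains_iff)

lemma cochain_add:
  "f \<in> cochains A p \<Longrightarrow> is_hword A u \<Longrightarrow> is_hword A v \<Longrightarrow> x \<in> homog A i \<Longrightarrow> y \<in> homog A i \<Longrightarrow>
    f (u @ (i, x + y) # v) = f (u @ (i, x) # v) + f (u @ (i, y) # v)"
  unfolding cochains_iff mlin_words_iff by simp

lemma cochain_scale:
  "f \<in> cochains A p \<Longrightarrow> is_hword A u \<Longrightarrow> is_hword A v \<Longrightarrow> x \<in> homog A i \<Longrightarrow>
    f (u @ (i, scal A r x) # v) = scal A r (f (u @ (i, x) # v))"
  unfolding cochains_iff mlin_words_iff by simp

text \<open>Additivity at \<open>0 + 0\<close> covers homogeneous surroundings; elsewhere a cochain
  vanishes by convention.\<close>

lemma cochain_letter_0: "f \<in> cochains A p \<Longrightarrow> f (u @ (i, 0) # v) = 0"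
  using cochain_add[of f p u v 0 i 0] cochain_outside[of f p "u @ (i, 0) # v"] by auto

lemma slot_word: "slot A (word_vars A) (\<lambda>w. w)"
  unfolding slot_def
proof safe
  fix i \<phi> assume "(i, \<phi>) \<in> word_vars A"
  then obtain u v where "is_hword A u" "is_hword A v" "\<phi> = (\<lambda>y. u @ (i, y) # v)"
    by (auto simp: word_vars_def)
  then show "\<exists>P j Y Q. is_hword A P \<and> is_hword A Q \<and>
    (\<forall>y\<in>homog A i. \<phi> y = P @ (j, Y y) # Q \<and> Y y \<in> homog A j) \<and>
    (\<forall>x\<in>homog A i. (\<forall>y\<in>homog A i. Y (x + y) = Y x + Y y) \<and> (\<forall>r. Y (scal A r x) = scal A r (Y x)))"
    by (intro exI[of _ u] exI[of _ i] exI[of _ "\<lambda>y. y"] exI[of _ v]) auto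
qed

lemma slot_letter_Cons: "slot A letter_vars (\<lambda>m. m # Q)" if "is_hword A Q"
  unfolding slot_def
proof safe
  fix i :: int and \<phi> :: "'a \<Rightarrow> int \<times> 'a" assume "(i, \<phi>) \<in> letter_vars"
  then have "\<phi> = Pair i"
    by (auto simp: letter_vars_def)
  with that show "\<exists>P j Y P'. is_hword A P \<and> is_hword A P' \<and>
    (\<forall>y\<in>homog A i. \<phi> y # Q = P @ (j, Y y) # P' \<and> Y y \<in> homog A j) \<and>
    (\<forall>x\<in>homog A i. (\<forall>y\<in>homog A i. Y (x + y) = Y x + Y y) \<and> (\<forall>r. Y (scal A r x) = scal A r (Y x)))"
    by (intro exI[of _ "[]"] exI[of _ i] exI[of _ "\<lambda>y. y"] exI[of _ Q]) auto
qed

lemma slot_append_left: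
  assumes "is_hword A P'" and "slot A V W"
  shows "slot A V (\<lambda>w. P' @ W w)"
  unfolding slot_def
proof safe
  fix i \<phi> assume "(i, \<phi>) \<in> V"
  then obtain P j Y Q where "is_hword A P" "is_hword A Q"
    "\<forall>y\<in>homog A i. W (\<phi> y) = P @ (j, Y y) # Q \<and> Y y \<in> homog A j"
    "\<forall>x\<in>homog A i. (\<forall>y\<in>homog A i. Y (x + y) = Y x + Y y) \<and> (\<forall>r. Y (scal A r x) = scal A r (Y x))"
    using assms(2) unfolding slot_def by blast
  with assms(1) show "\<exists>P j Y Q. is_hword A P \<and> is_hword A Q \<and>
    (\<forall>y\<in>homog A i. P' @ W (\<phi> y) = P @ (j, Y y) # Q \<and> Y y \<in> homog A j) \<and>
    (\<forall>x\<in>homog A i. (\<forall>y\<in>homog A i. Y (x + y) = Y x + Y y) \<and> (\<forall>r. Y (scal A r x) = scal A r (Y x)))"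
    by (intro exI[of _ "P' @ P"] exI[of _ j] exI[of _ Y] exI[of _ Q]) auto
qed

lemma slot_append_right:
  assumes "slot A V W" and "is_hword A Q'"
  shows "slot A V (\<lambda>w. W w @ Q')"
  unfolding slot_def
proof safe
  fix i \<phi> assume "(i, \<phi>) \<in> V"
  then obtain P j Y Q where "is_hword A P" "is_hword A Q"
    "\<forall>y\<in>homog A i. W (\<phi> y) = P @ (j, Y y) # Q \<and> Y y \<in> homog A j"
    "\<forall>x\<in>homog A i. (\<forall>y\<in>homog A i. Y (x + y) = Y x + Y y) \<and> (\<forall>r. Y (scal A r x) = scal A r (Y x))"
    using assms(1) unfolding slot_def by blast
  with assms(2) show "\<exists>P j Y Q. is_hword A P \<and> is_hword A Q \<and>
    (\<forall>y\<in>homog A i. W (\<phi> y) @ Q' = P @ (j, Y y) # Q \<and> Y y \<in> homog A j) \<and>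
    (\<forall>x\<in>homog A i. (\<forall>y\<in>homog A i. Y (x + y) = Y x + Y y) \<and> (\<forall>r. Y (scal A r x) = scal A r (Y x)))"
    by (intro exI[of _ P] exI[of _ j] exI[of _ Y] exI[of _ "Q @ Q'"]) auto
qed

lemma slot_Cons: "snd c \<in> homog A (fst c) \<Longrightarrow> slot A V W \<Longrightarrow> slot A V (\<lambda>w. c # W w)"
  using slot_append_left[of "[c]" V W] by simp

text \<open>The value of \<open>f\<close> becomes the new hole; its content depends linearly on the
  old one because \<open>f\<close> is linear in each letter.\<close>

lemma slot_letter:
  assumes f: "f \<in> cochains A p" and "slot A V W" and Q': "is_hword A Q'"
  shows "slot A V (\<lambda>w. letter p f (W w) # Q')"
  unfolding slot_def
proof safe
  fix i \<phi> assume "(i, \<phi>) \<in> V"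
  then obtain P j Y Q where *: "is_hword A P" "is_hword A Q"
    "\<forall>y\<in>homog A i. W (\<phi> y) = P @ (j, Y y) # Q \<and> Y y \<in> homog A j"
    "\<forall>x\<in>homog A i. (\<forall>y\<in>homog A i. Y (x + y) = Y x + Y y) \<and> (\<forall>r. Y (scal A r x) = scal A r (Y x))"
    using assms(2) unfolding slot_def by blast
  show "\<exists>P j Y Q. is_hword A P \<and> is_hword A Q \<and>
    (\<forall>y\<in>homog A i. letter p f (W (\<phi> y)) # Q' = P @ (j, Y y) # Q \<and> Y y \<in> homog A j) \<and>
    (\<forall>x\<in>homog A i. (\<forall>y\<in>homog A i. Y (x + y) = Y x + Y y) \<and> (\<forall>r. Y (scal A r x) = scal A r (Y x)))"
    using * Q' cochain_homog[OF f, of "P @ (j, Y _) # Q"]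
    by (intro exI[of _ "[]"] exI[of _ "sdeg P + (j + 1 + sdeg Q) + p"] exI[of _ "\<lambda>y. f (P @ (j, Y y) # Q)"] exI[of _ Q'])
      (auto simp: letter_def cochain_add[OF f] cochain_scale[OF f])
qed

lemmas slot_intros = slot_letter slot_letter_Cons slot_Cons slot_append_left slot_append_right slot_word

end

text \<open>One argument serves two targets: values in \<open>A\<close> with \<open>H = {0}\<close>,
  where congruence is equality, and chains modulo \<open>chain_null\<close>. Scalars on the free
  abelian group of words distribute over \<open>r + s\<close> only modulo relations, so
  \<open>act\<close> is merely additive and compatible with \<open>H\<close>.\<close>

locale linear_target = dg_algebra A for A :: "('k::comm_ring_1, 'a::ring) dga" +
  fixes act :: "'k \<Rightarrow> 'g::ab_group_add \<Rightarrow> 'g" and H :: "'g set"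
  assumes null_zero: "0 \<in> H"
    and null_diff: "x \<in> H \<Longrightarrow> y \<in> H \<Longrightarrow> x - y \<in> H"
    and act_add: "act r (x + y) = act r x + act r y"
    and act_null: "x \<in> H \<Longrightarrow> act r x \<in> H"
begin

definition eqv :: "'g \<Rightarrow> 'g \<Rightarrow> bool" (infix "\<approx>" 50)
  where "x \<approx> y \<longleftrightarrow> x - y \<in> H"

abbreviation "mult_linear \<equiv> mlin A act H (word_vars A)"

lemma null_uminus: "x \<in> H \<Longrightarrow> - x \<in> H"
  using null_diff[OF null_zero] by fastforce

lemma null_add: "x \<in> H \<Longrightarrow> y \<in> H \<Longrightarrow> x + y \<in> H"
  using null_diff[of x "- y"] null_uminus[of y] by simp

lemma null_sum: "(\<And>x. x \<in> I \<Longrightarrow> F x \<in> H) \<Longrightarrow> sum F I \<in> H"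
  by (induction I rule: infinite_finite_induct) (auto intro: null_add null_zero)

lemma null_koszul: "x \<in> H \<Longrightarrow> koszul n x \<in> H"
  by (simp add: koszul_def null_uminus)

lemma act_0 [simp]: "act r 0 = 0"
  using act_add[of r 0 0] by simp

lemma act_uminus: "act r (- x) = - act r x"
  using act_add[of r x "- x"] by (simp add: eq_neg_iff_add_eq_0 add.commute)

lemma act_diff: "act r (x - y) = act r x - act r y"
  using act_add[of r x "- y"] by (simp add: act_uminus)

lemma act_koszul: "act r (koszul n x) = koszul n (act r x)"
  by (simp add: koszul_def act_uminus)

lemma eqv_refl [simp]: "x \<approx> x"
  by (simp add: eqv_def null_zero)

lemma eqv_sym: "x \<approx> y \<Longrightarrow> y \<approx> x"
  using null_uminus[of "x - y"] by (simp add: eqv_def)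

lemma eqv_trans [trans]: "x \<approx> y \<Longrightarrow> y \<approx> z \<Longrightarrow> x \<approx> z"
  using null_add[of "x - y" "y - z"] by (simp add: eqv_def)

lemma eq_eqv_trans [trans]: "x = y \<Longrightarrow> y \<approx> z \<Longrightarrow> x \<approx> z"
  by simp

lemma eqv_eq_trans [trans]: "x \<approx> y \<Longrightarrow> y = z \<Longrightarrow> x \<approx> z"
  by simp

lemma eqv_add: "x \<approx> y \<Longrightarrow> x' \<approx> y' \<Longrightarrow> x + x' \<approx> y + y'"
  using null_add[of "x - y" "x' - y'"] by (simp add: eqv_def algebra_simps)

lemma eqv_uminus: "x \<approx> y \<Longrightarrow> - x \<approx> - y"
  using null_uminus[of "x - y"] by (simp add: eqv_def algebra_simps)

lemma eqv_diff: "x \<approx> y \<Longrightarrow> x' \<approx> y' \<Longrightarrow> x - x' \<approx> y - y'"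
  using null_diff[of "x - y" "x' - y'"] by (simp add: eqv_def algebra_simps)

lemma eqv_koszul: "x \<approx> y \<Longrightarrow> koszul n x \<approx> koszul n y"
  using null_koszul[of "x - y"] by (simp add: eqv_def koszul_diff)

lemma eqv_act: "x \<approx> y \<Longrightarrow> act r x \<approx> act r y"
  using act_null[of "x - y"] by (simp add: eqv_def act_diff)

lemma eqv_sum: "(\<And>x. x \<in> I \<Longrightarrow> F x \<approx> G x) \<Longrightarrow> sum F I \<approx> sum G I"
  by (simp add: eqv_def null_sum flip: sum_subtractf)

lemma eqv_split2: "(\<And>a b. w = a @ b \<Longrightarrow> F a b \<approx> G a b) \<Longrightarrow> split2 w F \<approx> split2 w G"
  unfolding split2_def by (rule eqv_sum) simp

lemma eqv_split3: "(\<And>a b c. w = a @ b @ c \<Longrightarrow> F a b c \<approx> G a b c) \<Longrightarrow> split3 w F \<approx> split3 w G"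
  unfolding split3_def by (intro eqv_split2 eqv_split2) auto

lemma eqv_split4: "(\<And>a b c d. w = a @ b @ c @ d \<Longrightarrow> F a b c d \<approx> G a b c d) \<Longrightarrow> split4 w F \<approx> split4 w G"
  unfolding split4_def by (intro eqv_split2 eqv_split3) auto

lemma eqv_split5: "(\<And>a b c d e. w = a @ b @ c @ d @ e \<Longrightarrow> F a b c d e \<approx> G a b c d e) \<Longrightarrow> split5 w F \<approx> split5 w G"
  unfolding split5_def by (intro eqv_split2 eqv_split4) auto

lemma act_split2: "act r (split2 w F) = split2 w (\<lambda>a b. act r (F a b))"
  by (rule split2_hom) (simp_all add: act_add)

lemma mlin_add:
  assumes "mlin A act H V F" and "mlin A act H V G"
  shows "mlin A act H V (\<lambda>w. F w + G w)"
  unfolding mlin_def eqv_def[symmetric]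
proof safe
  fix i \<phi> x assume *: "(i, \<phi>) \<in> V" "x \<in> homog A i"
  { fix y assume "y \<in> homog A i"
    with * assms have "F (\<phi> (x + y)) \<approx> F (\<phi> x) + F (\<phi> y)" "G (\<phi> (x + y)) \<approx> G (\<phi> x) + G (\<phi> y)"
      unfolding mlin_def eqv_def by blast+
    from eqv_add[OF this] show "F (\<phi> (x + y)) + G (\<phi> (x + y)) \<approx> F (\<phi> x) + G (\<phi> x) + (F (\<phi> y) + G (\<phi> y))"
      by (simp add: ac_simps) }
  fix r
  from * assms have "F (\<phi> (scal A r x)) \<approx> act r (F (\<phi> x))" "G (\<phi> (scal A r x)) \<approx> act r (G (\<phi> x))"
    unfolding mlin_def eqv_def by blast+
  from eqv_add[OF this] show "F (\<phi> (scal A r x)) + G (\<phi> (scal A r x)) \<approx> act r (F (\<phi> x) + G (\<phi> x))"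
    by (simp add: act_add)
qed

lemma mlin_uminus:
  assumes "mlin A act H V F"
  shows "mlin A act H V (\<lambda>w. - F w)"
  unfolding mlin_def eqv_def[symmetric]
proof safe
  fix i \<phi> x assume *: "(i, \<phi>) \<in> V" "x \<in> homog A i"
  { fix y assume "y \<in> homog A i"
    with * assms have "F (\<phi> (x + y)) \<approx> F (\<phi> x) + F (\<phi> y)"
      unfolding mlin_def eqv_def by blast
    from eqv_uminus[OF this] show "- F (\<phi> (x + y)) \<approx> - F (\<phi> x) + - F (\<phi> y)"
      by simp }
  fix r
  from * assms have "F (\<phi> (scal A r x)) \<approx> act r (F (\<phi> x))"
    unfolding mlin_def eqv_def by blast
  from eqv_uminus[OF this] show "- F (\<phi> (scal A r x)) \<approx> act r (- F (\<phi> x))"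
    by (simp add: act_uminus)
qed

lemma mlin_diff: "mlin A act H V F \<Longrightarrow> mlin A act H V G \<Longrightarrow> mlin A act H V (\<lambda>w. F w - G w)"
  using mlin_add[of V F "\<lambda>w. - G w"] mlin_uminus[of V G] by simp

lemma mlin_koszul:
  assumes e: "degree_only V e" and F: "mlin A act H V F"
  shows "mlin A act H V (\<lambda>w. koszul (e w) (F w))"
  unfolding mlin_def eqv_def[symmetric]
proof safe
  fix i \<phi> x assume *: "(i, \<phi>) \<in> V" "x \<in> homog A i"
  have e': "e (\<phi> y) = e (\<phi> x)" for y
    using e * unfolding degree_only_def by blast
  { fix y assume "y \<in> homog A i"
    with * F have "F (\<phi> (x + y)) \<approx> F (\<phi> x) + F (\<phi> y)"
      unfolding mlin_def eqv_def by blast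
    from eqv_koszul[OF this] show "koszul (e (\<phi> (x + y))) (F (\<phi> (x + y))) \<approx> koszul (e (\<phi> x)) (F (\<phi> x)) + koszul (e (\<phi> y)) (F (\<phi> y))"
      unfolding e'[of "x + y"] e'[of y] koszul_add by blast }
  fix r
  from * F have "F (\<phi> (scal A r x)) \<approx> act r (F (\<phi> x))"
    unfolding mlin_def eqv_def by blast
  from eqv_koszul[OF this] show "koszul (e (\<phi> (scal A r x))) (F (\<phi> (scal A r x))) \<approx> act r (koszul (e (\<phi> x)) (F (\<phi> x)))"
    unfolding e'[of "scal A r x"] act_koszul by blast
qed

lemma mlin_slot:
  assumes G: "mult_linear G" and W: "slot A V W"
  shows "mlin A act H V (\<lambda>w. G (W w))"
  unfolding mlin_def eqv_def[symmetric]
proof safe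
  fix i \<phi> x assume *: "(i, \<phi>) \<in> V" "x \<in> homog A i"
  with W obtain P j Y Q where W': "is_hword A P" "is_hword A Q"
    "\<forall>y\<in>homog A i. W (\<phi> y) = P @ (j, Y y) # Q \<and> Y y \<in> homog A j"
    "\<forall>x\<in>homog A i. (\<forall>y\<in>homog A i. Y (x + y) = Y x + Y y) \<and> (\<forall>r. Y (scal A r x) = scal A r (Y x))"
    unfolding slot_def by blast
  have G': "G (P @ (j, x + y) # Q) \<approx> G (P @ (j, x) # Q) + G (P @ (j, y) # Q)"
      if "x \<in> homog A j" "y \<in> homog A j" for x y
    using G W' that unfolding mlin_words_iff eqv_def by blast
  have G'': "G (P @ (j, scal A r x) # Q) \<approx> act r (G (P @ (j, x) # Q))" if "x \<in> homog A j" for x r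
    using G W' that unfolding mlin_words_iff eqv_def by blast
  { fix y assume "y \<in> homog A i"
    with * W' show "G (W (\<phi> (x + y))) \<approx> G (W (\<phi> x)) + G (W (\<phi> y))"
      by (simp add: homog_add G') }
  fix r
  from * W' show "G (W (\<phi> (scal A r x))) \<approx> act r (G (W (\<phi> x)))"
    by (simp add: homog_scal G'')
qed

lemma mlin_koszul_slot:
  "degree_only V e \<Longrightarrow> mult_linear G \<Longrightarrow> slot A V W \<Longrightarrow> mlin A act H V (\<lambda>w. koszul (e w) (G (W w)))"
  by (rule mlin_koszul) (auto intro: mlin_slot)

lemma mlin_const_split2:
  assumes "\<And>a b. is_hword A a \<Longrightarrow> is_hword A b \<Longrightarrow> mlin A act H V (\<lambda>w. F w a b)" and "is_hword A r"
  shows "mlin A act H V (\<lambda>w. split2 r (F w))"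
  unfolding mlin_def eqv_def[symmetric]
proof safe
  fix i \<phi> x assume *: "(i, \<phi>) \<in> V" "x \<in> homog A i"
  { fix y assume "y \<in> homog A i"
    with * assms have "split2 r (F (\<phi> (x + y))) \<approx> split2 r (\<lambda>a b. F (\<phi> x) a b + F (\<phi> y) a b)"
      unfolding mlin_def eqv_def by (intro eqv_split2[unfolded eqv_def]) fastforce
    then show "split2 r (F (\<phi> (x + y))) \<approx> split2 r (F (\<phi> x)) + split2 r (F (\<phi> y))"
      by (simp add: split_linear) }
  fix s
  from * assms have "split2 r (F (\<phi> (scal A s x))) \<approx> split2 r (\<lambda>a b. act s (F (\<phi> x) a b))"
    unfolding mlin_def eqv_def by (intro eqv_split2[unfolded eqv_def]) fastforce
  then show "split2 r (F (\<phi> (scal A s x))) \<approx> act s (split2 r (F (\<phi> x)))"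
    by (simp add: act_split2)
qed

text \<open>For a fixed hole, the cuts after it put the hole into the left piece and the cuts before
  it into the right piece. The sum is separated accordingly, and in each part only one piece varies
  with the content of the hole.\<close>

lemma mlin_split2:
  assumes left: "\<And>b. is_hword A b \<Longrightarrow> mult_linear (\<lambda>a. F a b)"
    and right: "\<And>a. is_hword A a \<Longrightarrow> mult_linear (\<lambda>b. F a b)"
  shows "mult_linear (\<lambda>w. split2 w F)"
proof -
  have 1: "mlin A act H {(i, \<lambda>y. y)} (\<lambda>y. F (u @ (i, y) # a) b)" if "is_hword A u" "is_hword A a" "is_hword A b" for i u a b
    using left[of b] that unfolding mlin_words_iff eqv_def by (simp add: mlin_def)
  have 2: "mlin A act H {(i, \<lambda>y. y)} (\<lambda>y. F a (b @ (i, y) # v))" if "is_hword A v" "is_hword A a" "is_hword A b" for i v a b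
    using right[of a] that unfolding mlin_words_iff eqv_def by (simp add: mlin_def)
  have "mlin A act H {(i, \<lambda>y. y)} (\<lambda>y. split2 (u @ (i, y) # v) F)" if "is_hword A u" "is_hword A v" for i u v
    unfolding split2_append_Cons by (intro mlin_add mlin_const_split2 1 2 that)
  then show ?thesis
    unfolding mlin_words_iff eqv_def by (simp add: mlin_def)
qed

lemma mlin_const_split3:
  assumes "\<And>a b c. is_hword A a \<Longrightarrow> is_hword A b \<Longrightarrow> is_hword A c \<Longrightarrow> mlin A act H V (\<lambda>w. F w a b c)" and "is_hword A r"
  shows "mlin A act H V (\<lambda>w. split3 r (F w))"
  unfolding split3_def by (intro mlin_const_split2 mlin_const_split2 assms)

lemma mlin_split3:
  assumes "\<And>b c. is_hword A b \<Longrightarrow> is_hword A c \<Longrightarrow> mult_linear (\<lambda>a. F a b c)"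
    and "\<And>a c. is_hword A a \<Longrightarrow> is_hword A c \<Longrightarrow> mult_linear (\<lambda>b. F a b c)"
    and "\<And>a b. is_hword A a \<Longrightarrow> is_hword A b \<Longrightarrow> mult_linear (\<lambda>c. F a b c)"
  shows "mult_linear (\<lambda>w. split3 w F)"
  unfolding split3_def by (intro mlin_split2 mlin_split2 mlin_const_split2 assms)

lemma mlin_const_split4:
  assumes "\<And>a b c d. is_hword A a \<Longrightarrow> is_hword A b \<Longrightarrow> is_hword A c \<Longrightarrow> is_hword A d \<Longrightarrow> mlin A act H V (\<lambda>w. F w a b c d)" and "is_hword A r"
  shows "mlin A act H V (\<lambda>w. split4 r (F w))"
  unfolding split4_def by (intro mlin_const_split2 mlin_const_split3 assms)

lemma mlin_split4:
  assumes "\<And>b c d. is_hword A b \<Longrightarrow> is_hword A c \<Longrightarrow> is_hword A d \<Longrightarrow> mult_linear (\<lambda>a. F a b c d)"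
    and "\<And>a c d. is_hword A a \<Longrightarrow> is_hword A c \<Longrightarrow> is_hword A d \<Longrightarrow> mult_linear (\<lambda>b. F a b c d)"
    and "\<And>a b d. is_hword A a \<Longrightarrow> is_hword A b \<Longrightarrow> is_hword A d \<Longrightarrow> mult_linear (\<lambda>c. F a b c d)"
    and "\<And>a b c. is_hword A a \<Longrightarrow> is_hword A b \<Longrightarrow> is_hword A c \<Longrightarrow> mult_linear (\<lambda>d. F a b c d)"
  shows "mult_linear (\<lambda>w. split4 w F)"
  unfolding split4_def by (intro mlin_split2 mlin_split3 mlin_const_split3 assms)

lemma mlin_const_split5:
  assumes "\<And>a b c d e. is_hword A a \<Longrightarrow> is_hword A b \<Longrightarrow> is_hword A c \<Longrightarrow> is_hword A d \<Longrightarrow> is_hword A e \<Longrightarrow> mlin A act H V (\<lambda>w. F w a b c d e)" and "is_hword A r"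
  shows "mlin A act H V (\<lambda>w. split5 r (F w))"
  unfolding split5_def by (intro mlin_const_split2 mlin_const_split4 assms)

lemma mlin_split5:
  assumes "\<And>b c d e. is_hword A b \<Longrightarrow> is_hword A c \<Longrightarrow> is_hword A d \<Longrightarrow> is_hword A e \<Longrightarrow> mult_linear (\<lambda>a. F a b c d e)"
    and "\<And>a c d e. is_hword A a \<Longrightarrow> is_hword A c \<Longrightarrow> is_hword A d \<Longrightarrow> is_hword A e \<Longrightarrow> mult_linear (\<lambda>b. F a b c d e)"
    and "\<And>a b d e. is_hword A a \<Longrightarrow> is_hword A b \<Longrightarrow> is_hword A d \<Longrightarrow> is_hword A e \<Longrightarrow> mult_linear (\<lambda>c. F a b c d e)"
    and "\<And>a b c e. is_hword A a \<Longrightarrow> is_hword A b \<Longrightarrow> is_hword A c \<Longrightarrow> is_hword A e \<Longrightarrow> mult_linear (\<lambda>d. F a b c d e)"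
    and "\<And>a b c d. is_hword A a \<Longrightarrow> is_hword A b \<Longrightarrow> is_hword A c \<Longrightarrow> is_hword A d \<Longrightarrow> mult_linear (\<lambda>e. F a b c d e)"
  shows "mult_linear (\<lambda>w. split5 w F)"
  unfolding split5_def by (intro mlin_split2 mlin_split4 mlin_const_split4 assms)

lemma mlin_at_head:
  assumes tl: "\<And>m. snd m \<in> homog A (fst m) \<Longrightarrow> mult_linear (F m)"
    and hd: "\<And>r. is_hword A r \<Longrightarrow> mlin A act H letter_vars (\<lambda>m. F m r)"
  shows "mult_linear (at_head F)"
proof -
  have "mlin A act H {(i, \<lambda>y. u @ (i, y) # v)} (at_head F)" if *: "is_hword A u" "is_hword A v" for i u v
  proof (cases u)
    case Nil
    with hd[OF *(2)] show ?thesis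
      by (simp add: mlin_def letter_vars_def)
  next
    case (Cons m u')
    with tl[of m] * show ?thesis
      unfolding mlin_words_iff eqv_def by (simp add: mlin_def)
  qed
  then show ?thesis
    unfolding mlin_words_iff eqv_def by (simp add: mlin_def)
qed

lemmas mlin_intros = mlin_at_head mlin_add mlin_diff mlin_split2 mlin_split3 mlin_split4 mlin_split5
  mlin_const_split2 mlin_const_split3 mlin_const_split4 mlin_const_split5

lemma mlin_ins:
  assumes "f \<in> cochains A p" and "mult_linear G"
  shows "mult_linear (ins p f G)"
  unfolding ins_def[abs_def] using assms
  by (intro mlin_intros mlin_koszul_slot[OF _ assms(2)] degree_only_words degree_only_letters slot_intros) simp_all

lemma mlin_ins2:
  assumes "f \<in> cochains A p" and "g \<in> cochains A q" and "mult_linear G"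
  shows "mult_linear (ins2 p f q g G)"
  unfolding ins2_def[abs_def] using assms
  by (intro mlin_intros mlin_koszul_slot[OF _ assms(3)] degree_only_words degree_only_letters slot_intros) simp_all

lemma mlin_eval_front:
  assumes "f \<in> cochains A p" and "mult_linear G"
  shows "mult_linear (eval_front p f G)"
  unfolding eval_front_def[abs_def] using assms
  by (intro mlin_intros mlin_slot[OF assms(2)] degree_only_words degree_only_letters slot_intros) simp_all

lemma mlin_lie:
  assumes "f \<in> cochains A p" and "mult_linear G"
  shows "mult_linear (at_head (lie p f G))"
  unfolding lie_def using assms
  by (intro mlin_intros mlin_koszul_slot[OF _ assms(2)] degree_only_words degree_only_letters slot_intros) simp_all

lemma mlin_cap:
  assumes "f \<in> cochains A p" and "g \<in> cochains A q" and "mult_linear G"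
  shows "mult_linear (at_head (cap p f q g G))"
  unfolding cap_def using assms
  by (intro mlin_intros mlin_koszul_slot[OF _ assms(3)] degree_only_words degree_only_letters slot_intros) simp_all

lemma mlin_slide:
  assumes "f \<in> cochains A p" and "mult_linear G"
  shows "mult_linear (at_head (slide p f G))"
  unfolding slide_def using assms
  by (intro mlin_intros mlin_koszul_slot[OF _ assms(2)] degree_only_words degree_only_letters slot_intros) simp_all

lemma mlin_norm:
  assumes "mult_linear G"
  shows "mult_linear (at_head (cyclic_norm G))"
  unfolding cyclic_norm_def using assms
  by (intro mlin_intros mlin_koszul_slot[OF _ assms(1)] degree_only_words degree_only_letters slot_intros) simp_all

text \<open>The last letter changes its place under \<open>rot\<close>, so a hole at the end becomes
  the head and is treated apart from a hole elsewhere.\<close>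

lemma mlin_rot:
  assumes "mult_linear G"
  shows "mult_linear (rot G)"
proof -
  have "mlin A act H {(i, \<lambda>y. u @ (i, y) # v)} (rot G)" if *: "is_hword A u" "is_hword A v" for i u v
  proof (cases v rule: rev_cases)
    case Nil
    have "mlin A act H letter_vars (\<lambda>m. koszul (sdeg [m] * sdeg u) (G (m # u)))"
      using * by (intro mlin_koszul_slot[OF _ assms] degree_only_letters slot_intros) simp_all
    with Nil show ?thesis
      by (simp add: mlin_def letter_vars_def rot_def)
  next
    case (snoc v' l)
    have "mult_linear (\<lambda>w. koszul (sdeg [l] * sdeg w) (G (l # w)))"
      using * snoc by (intro mlin_koszul_slot[OF _ assms] degree_only_words slot_intros) simp_all
    with snoc * show ?thesis
      unfolding mlin_words_iff eqv_def by (simp add: mlin_def rot_def butlast_append)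
  qed
  then show ?thesis
    unfolding mlin_words_iff eqv_def by (simp add: mlin_def)
qed

end

section \<open>Letters that hold sums or composite cochains\<close>

context linear_target
begin

context
  fixes G :: "'a hword \<Rightarrow> 'g" and P Q :: "'a hword"
  assumes G: "mult_linear G" and P: "is_hword A P" and Q: "is_hword A Q"
begin

lemma slot_value_add:
  "x \<in> homog A j \<Longrightarrow> y \<in> homog A j \<Longrightarrow> G (P @ (j, x + y) # Q) \<approx> G (P @ (j, x) # Q) + G (P @ (j, y) # Q)"
  using G P Q unfolding mlin_words_iff eqv_def by blast

lemma slot_value_scale:
  "x \<in> homog A j \<Longrightarrow> G (P @ (j, scal A r x) # Q) \<approx> act r (G (P @ (j, x) # Q))"
  using G P Q unfolding mlin_words_iff eqv_def by blast

lemma slot_value_zero: "G (P @ (j, 0) # Q) \<approx> 0"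
  using slot_value_add[of 0 j 0] null_uminus[of "- G (P @ (j, 0) # Q)"] by (simp add: eqv_def)

lemma slot_value_uminus:
  assumes "x \<in> homog A j"
  shows "G (P @ (j, - x) # Q) \<approx> - G (P @ (j, x) # Q)"
  using eqv_trans[OF eqv_sym[OF slot_value_add[OF assms homog_uminus[OF assms]]], of 0] slot_value_zero[of j]
  by (simp add: add.commute eqv_def)

lemma slot_value_koszul:
  "x \<in> homog A j \<Longrightarrow> G (P @ (j, koszul n x) # Q) \<approx> koszul n (G (P @ (j, x) # Q))"
  using slot_value_uminus by (simp add: koszul_def)

lemma slot_value_sum:
  "(\<And>i. i \<in> I \<Longrightarrow> F i \<in> homog A j) \<Longrightarrow> G (P @ (j, sum F I) # Q) \<approx> (\<Sum>i\<in>I. G (P @ (j, F i) # Q))"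
proof (induction I rule: infinite_finite_induct)
  case (insert i I)
  then have "G (P @ (j, F i + sum F I) # Q) \<approx> G (P @ (j, F i) # Q) + G (P @ (j, sum F I) # Q)"
    by (intro slot_value_add homog_sum) auto
  also have "\<dots> \<approx> G (P @ (j, F i) # Q) + (\<Sum>i\<in>I. G (P @ (j, F i) # Q))"
    using insert by (intro eqv_add) auto
  finally show ?case
    using insert by simp
qed (use slot_value_zero in simp_all)

lemma slot_value_split2:
  "(\<And>a b. w = a @ b \<Longrightarrow> F a b \<in> homog A j) \<Longrightarrow>
    G (P @ (j, split2 w F) # Q) \<approx> split2 w (\<lambda>a b. G (P @ (j, F a b) # Q))"
  unfolding split2_def by (rule slot_value_sum) simp

lemma slot_value_split3:
  assumes "\<And>a b c. w = a @ b @ c \<Longrightarrow> F a b c \<in> homog A j"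
  shows "G (P @ (j, split3 w F) # Q) \<approx> split3 w (\<lambda>a b c. G (P @ (j, F a b c) # Q))"
  unfolding split3_def
  by (rule eqv_trans[OF slot_value_split2 eqv_split2[OF slot_value_split2]]) (auto intro!: homog_split2 assms)

lemma slot_value_split4:
  assumes "\<And>a b c d. w = a @ b @ c @ d \<Longrightarrow> F a b c d \<in> homog A j"
  shows "G (P @ (j, split4 w F) # Q) \<approx> split4 w (\<lambda>a b c d. G (P @ (j, F a b c d) # Q))"
  unfolding split4_def
  by (rule eqv_trans[OF slot_value_split2 eqv_split2[OF slot_value_split3]]) (auto intro!: homog_split3 assms)

lemma slot_value_split5:
  assumes "\<And>a b c d e. w = a @ b @ c @ d @ e \<Longrightarrow> F a b c d e \<in> homog A j"
  shows "G (P @ (j, split5 w F) # Q) \<approx> split5 w (\<lambda>a b c d e. G (P @ (j, F a b c d e) # Q))"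
  unfolding split5_def
  by (rule eqv_trans[OF slot_value_split2 eqv_split2[OF slot_value_split4]]) (auto intro!: homog_split4 assms)

lemma slot_letter_diff:
  assumes "f \<in> cochains A p" and "g \<in> cochains A p" and "is_hword A w"
  shows "G (P @ letter p (\<lambda>w. f w - koszul n (g w)) w # Q) \<approx>
    G (P @ letter p f w # Q) - koszul n (G (P @ letter p g w # Q))"
proof -
  let ?j = "sdeg w + p"
  have fg: "f w \<in> homog A ?j" "g w \<in> homog A ?j"
    using assms by simp_all
  then have "G (P @ (?j, f w + - koszul n (g w)) # Q) \<approx> G (P @ (?j, f w) # Q) + G (P @ (?j, - koszul n (g w)) # Q)"
    by (intro slot_value_add) (auto intro: homog_uminus homog_koszul)
  also have "\<dots> \<approx> G (P @ (?j, f w) # Q) + - koszul n (G (P @ (?j, g w) # Q))"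
    using fg by (intro eqv_add eqv_refl eqv_trans[OF slot_value_uminus eqv_uminus[OF slot_value_koszul]])
      (auto intro: homog_koszul)
  finally show ?thesis
    by (simp add: letter_def)
qed

text \<open>The value of a composite cochain is a sum inside one letter. Pulling it out of the word
  is allowed only modulo \<open>H\<close>; here exact identities between nested insertions turn into
  congruences.\<close>

lemma slot_letter_ins:
  assumes f: "f \<in> cochains A p" and h: "h \<in> cochains A s" and w: "is_hword A w" and n: "n = p + s + 1"
  shows "G (P @ letter n (ins s h f) w # Q) \<approx>
    split3 w (\<lambda>x y z. koszul ((s + 1) * sdeg x) (G (P @ letter p f (x @ letter s h y # z) # Q)))"
proof -
  let ?j = "sdeg w + n"
  have fh: "f (x @ letter s h y # z) \<in> homog A ?j" if "w = x @ y @ z" for x y z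
    using that f h w n by (auto simp: algebra_simps)
  have "G (P @ (?j, ins s h f w) # Q) \<approx>
      split3 w (\<lambda>x y z. G (P @ (?j, koszul ((s + 1) * sdeg x) (f (x @ letter s h y # z))) # Q))"
    unfolding ins_def by (intro slot_value_split3 homog_koszul fh)
  also have "\<dots> \<approx> split3 w (\<lambda>x y z. koszul ((s + 1) * sdeg x) (G (P @ (?j, f (x @ letter s h y # z)) # Q)))"
    by (intro eqv_split3 slot_value_koszul fh)
  also have "\<dots> = split3 w (\<lambda>x y z. koszul ((s + 1) * sdeg x) (G (P @ letter p f (x @ letter s h y # z) # Q)))"
    by (rule split3_cong) (auto simp: letter_def n algebra_simps)
  finally show ?thesis
    by (simp add: letter_def)
qed

lemma slot_letter_ins2:
  assumes f: "f \<in> cochains A p" and g: "g \<in> cochains A q" and h: "h \<in> cochains A s"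
    and w: "is_hword A w" and n: "n = s + p + q + 2"
  shows "G (P @ letter n (ins2 p f q g h) w # Q) \<approx>
    split5 w (\<lambda>a b c d e. koszul ((p + 1) * sdeg a + (q + 1) * (sdeg a + sdeg b + sdeg c))
      (G (P @ letter s h (a @ letter p f b # c @ letter q g d # e) # Q)))"
proof -
  let ?j = "sdeg w + n"
  have fg: "h (a @ letter p f b # c @ letter q g d # e) \<in> homog A ?j" if "w = a @ b @ c @ d @ e" for a b c d e
    using that f g h w n by (auto simp: algebra_simps)
  have "G (P @ (?j, ins2 p f q g h w) # Q) \<approx>
      split5 w (\<lambda>a b c d e. G (P @ (?j, koszul ((p + 1) * sdeg a + (q + 1) * (sdeg a + sdeg b + sdeg c))
        (h (a @ letter p f b # c @ letter q g d # e))) # Q))"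
    unfolding ins2_def by (intro slot_value_split5 homog_koszul fg)
  also have "\<dots> \<approx> split5 w (\<lambda>a b c d e. koszul ((p + 1) * sdeg a + (q + 1) * (sdeg a + sdeg b + sdeg c))
      (G (P @ (?j, h (a @ letter p f b # c @ letter q g d # e)) # Q)))"
    by (intro eqv_split5 slot_value_koszul fg)
  also have "\<dots> = split5 w (\<lambda>a b c d e. koszul ((p + 1) * sdeg a + (q + 1) * (sdeg a + sdeg b + sdeg c))
      (G (P @ letter s h (a @ letter p f b # c @ letter q g d # e) # Q)))"
    by (rule split5_cong) (auto simp: letter_def n algebra_simps)
  finally show ?thesis
    by (simp add: letter_def)
qed

end

context
  fixes G :: "'a hword \<Rightarrow> 'g" and w :: "'a hword"
  assumes G: "mult_linear G" and w: "is_hword A w"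
begin

lemma ins_comp:
  assumes "f \<in> cochains A p" and "h \<in> cochains A s" and n: "n = p + s + 1"
  shows "ins n (ins s h f) G w \<approx> ins_nest p f s h G w"
proof -
  have "ins n (ins s h f) G w \<approx> split3 w (\<lambda>u v x. koszul ((n + 1) * sdeg u)
      (split3 v (\<lambda>a b c. koszul ((s + 1) * sdeg a) (G (u @ letter p f (a @ letter s h b # c) # x)))))"
    unfolding ins_def[of n] by (intro eqv_split3 eqv_koszul slot_letter_ins[OF G]) (use assms w in auto)
  also have "\<dots> = ins_nest p f s h G w"
    by (simp add: ins_nest_def n word_norm ac_simps)
  finally show ?thesis .
qed

lemma ins_comp2:
  assumes "f \<in> cochains A p" and "g \<in> cochains A q" and "h \<in> cochains A s" and n: "n = s + p + q + 2"
  shows "ins n (ins2 p f q g h) G w \<approx> ins_nest2 s h p f q g G w"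
proof -
  have "ins n (ins2 p f q g h) G w \<approx> split3 w (\<lambda>u v x. koszul ((n + 1) * sdeg u)
      (split5 v (\<lambda>a b c d e. koszul ((p + 1) * sdeg a + (q + 1) * (sdeg a + sdeg b + sdeg c))
        (G (u @ letter s h (a @ letter p f b # c @ letter q g d # e) # x)))))"
    unfolding ins_def[of n] by (intro eqv_split3 eqv_koszul slot_letter_ins2[OF G]) (use assms w in auto)
  also have "\<dots> = ins_nest2 s h p f q g G w"
    by (simp add: ins_nest2_def n word_norm ac_simps)
  finally show ?thesis .
qed

lemma ins2_comp1:
  assumes "f \<in> cochains A p" and "h \<in> cochains A s" and "g \<in> cochains A q" and n: "n = p + s + 1"
  shows "ins2 n (ins s h f) q g G w \<approx> ins2_nest1 p f s h q g G w"
proof -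
  have "ins2 n (ins s h f) q g G w \<approx> split5 w (\<lambda>a b c d e. koszul ((n + 1) * sdeg a + (q + 1) * (sdeg a + sdeg b + sdeg c))
     (split3 b (\<lambda>x y z. koszul ((s + 1) * sdeg x)
       (G (a @ letter p f (x @ letter s h y # z) # c @ letter q g d # e)))))"
    unfolding ins2_def[of n] by (intro eqv_split5 eqv_koszul slot_letter_ins[OF G]) (use assms w in auto)
  also have "\<dots> = ins2_nest1 p f s h q g G w"
    by (simp add: ins2_nest1_def n word_norm ac_simps)
  finally show ?thesis .
qed

lemma ins2_comp2:
  assumes "f \<in> cochains A p" and "g \<in> cochains A q" and "h \<in> cochains A s" and n: "n = q + s + 1"
  shows "ins2 p f n (ins s h g) G w \<approx> ins2_nest2 p f q g s h G w"
proof -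
  have "ins2 p f n (ins s h g) G w = split5 w (\<lambda>a b c d e. koszul ((p + 1) * sdeg a + (n + 1) * (sdeg a + sdeg b + sdeg c))
     (G ((a @ letter p f b # c) @ letter n (ins s h g) d # e)))"
    by (simp add: ins2_def)
  also have "\<dots> \<approx> split5 w (\<lambda>a b c d e. koszul ((p + 1) * sdeg a + (n + 1) * (sdeg a + sdeg b + sdeg c))
     (split3 d (\<lambda>x y z. koszul ((s + 1) * sdeg x)
       (G ((a @ letter p f b # c) @ letter q g (x @ letter s h y # z) # e)))))"
    by (intro eqv_split5 eqv_koszul slot_letter_ins[OF G]) (use assms w in auto)
  also have "\<dots> = ins2_nest2 p f q g s h G w"
    by (simp add: ins2_nest2_def n word_norm ac_simps)
  finally show ?thesis .
qed

lemma eval_front_comp: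
  assumes "f \<in> cochains A p" and "h \<in> cochains A s" and n: "n = p + s + 1"
  shows "eval_front n (ins s h f) G w \<approx> eval_front_nest p f s h G w"
proof -
  have "eval_front n (ins s h f) G w = split2 w (\<lambda>a b. G ([] @ letter n (ins s h f) a # b))"
    by (simp add: eval_front_def)
  also have "\<dots> \<approx> split2 w (\<lambda>a b. split3 a (\<lambda>x y z. koszul ((s + 1) * sdeg x)
       (G ([] @ letter p f (x @ letter s h y # z) # b))))"
    by (intro eqv_split2 slot_letter_ins[OF G]) (use assms w in auto)
  finally show ?thesis
    by (simp add: eval_front_nest_def)
qed

lemma ins_letter_diff:
  assumes "f \<in> cochains A p" and "g \<in> cochains A p"
  shows "ins p (\<lambda>w. f w - koszul n (g w)) G w \<approx> ins p f G w - koszul n (ins p g G w)"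
proof -
  have "ins p (\<lambda>w. f w - koszul n (g w)) G w \<approx> split3 w (\<lambda>u v x. koszul ((p + 1) * sdeg u)
      (G (u @ letter p f v # x) - koszul n (G (u @ letter p g v # x))))"
    unfolding ins_def by (intro eqv_split3 eqv_koszul slot_letter_diff[OF G]) (use assms w in auto)
  then show ?thesis
    by (simp add: ins_def koszul_diff split_linear koszul_left_commute[of n])
qed

lemma ins2_letter_diff1:
  assumes "f \<in> cochains A p" and "g \<in> cochains A p" and "h \<in> cochains A q"
  shows "ins2 p (\<lambda>w. f w - koszul n (g w)) q h G w \<approx> ins2 p f q h G w - koszul n (ins2 p g q h G w)"
proof -
  have "ins2 p (\<lambda>w. f w - koszul n (g w)) q h G w \<approx> split5 w (\<lambda>a b c d e. koszul ((p + 1) * sdeg a + (q + 1) * (sdeg a + sdeg b + sdeg c))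
      (G (a @ letter p f b # c @ letter q h d # e) - koszul n (G (a @ letter p g b # c @ letter q h d # e))))"
    unfolding ins2_def by (intro eqv_split5 eqv_koszul slot_letter_diff[OF G]) (use assms w in auto)
  then show ?thesis
    by (simp add: ins2_def koszul_diff split_linear koszul_left_commute[of n])
qed

lemma ins2_letter_diff2:
  assumes "f \<in> cochains A q" and "g \<in> cochains A q" and "h \<in> cochains A p"
  shows "ins2 p h q (\<lambda>w. f w - koszul n (g w)) G w \<approx> ins2 p h q f G w - koszul n (ins2 p h q g G w)"
proof -
  have "ins2 p h q (\<lambda>w. f w - koszul n (g w)) G w = split5 w (\<lambda>a b c d e. koszul ((p + 1) * sdeg a + (q + 1) * (sdeg a + sdeg b + sdeg c))
      (G ((a @ letter p h b # c) @ letter q (\<lambda>w. f w - koszul n (g w)) d # e)))"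
    by (simp add: ins2_def)
  also have "\<dots> \<approx> split5 w (\<lambda>a b c d e. koszul ((p + 1) * sdeg a + (q + 1) * (sdeg a + sdeg b + sdeg c))
      (G ((a @ letter p h b # c) @ letter q f d # e) - koszul n (G ((a @ letter p h b # c) @ letter q g d # e))))"
    by (intro eqv_split5 eqv_koszul slot_letter_diff[OF G]) (use assms w in auto)
  finally show ?thesis
    by (simp add: ins2_def koszul_diff split_linear koszul_left_commute[of n])
qed

lemma eval_front_letter_diff:
  assumes "f \<in> cochains A p" and "g \<in> cochains A p"
  shows "eval_front p (\<lambda>w. f w - koszul n (g w)) G w \<approx> eval_front p f G w - koszul n (eval_front p g G w)"
proof -
  have "split2 w (\<lambda>a b. G ([] @ letter p (\<lambda>w. f w - koszul n (g w)) a # b)) \<approx>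
      split2 w (\<lambda>a b. G ([] @ letter p f a # b) - koszul n (G ([] @ letter p g a # b)))"
    by (intro eqv_split2 slot_letter_diff[OF G]) (use assms w in auto)
  then show ?thesis
    by (simp add: eval_front_def koszul_diff split_linear)
qed

end

context
  fixes G :: "'a hword \<Rightarrow> 'g" and m :: "int \<times> 'a" and r :: "'a hword"
  assumes G: "mult_linear G" and w: "is_hword A (m # r)"
begin

lemma cap_comp1:
  assumes "f \<in> cochains A p" and "h \<in> cochains A s" and "g \<in> cochains A q" and n: "n = p + s + 1"
  shows "cap n (ins s h f) q g G m r \<approx> cap_nest1 p f s h q g G m r"
proof -
  have "cap n (ins s h f) q g G m r = split5 r (\<lambda>u v x y z.
      koszul ((q + 1) * sdeg (m # u) + sdeg z * (sdeg (m # u @ v @ x @ y) + q + 1))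
      (G ([] @ letter n (ins s h f) (z @ m # u @ letter q g v # x) # y)))"
    by (simp add: cap_def)
  also have "\<dots> \<approx> split5 r (\<lambda>u v x y z.
      koszul ((q + 1) * sdeg (m # u) + sdeg z * (sdeg (m # u @ v @ x @ y) + q + 1))
      (split3 (z @ m # u @ letter q g v # x) (\<lambda>a b c. koszul ((s + 1) * sdeg a)
      (G ([] @ letter p f (a @ letter s h b # c) # y)))))"
    by (intro eqv_split5 eqv_koszul slot_letter_ins[OF G]) (use assms w in auto)
  finally show ?thesis
    by (simp add: cap_nest1_def)
qed

lemma cap_comp2:
  assumes f: "f \<in> cochains A p" and "g \<in> cochains A q" and "h \<in> cochains A s" and n: "n = q + s + 1"
  shows "cap p f n (ins s h g) G m r \<approx> cap_nest2 p f q g s h G m r"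
proof -
  have 1: "G (letter p f (z @ m # u @ letter n (ins s h g) v # x) # y) \<approx>
      split3 v (\<lambda>a b c. koszul ((s + 1) * sdeg a) (G (letter p f (z @ m # u @ letter q g (a @ letter s h b # c) # x) # y)))"
    if "r = u @ v @ x @ y @ z" for u v x y z
  proof -
    \<comment> \<open>The letter to be expanded sits inside the argument of \<open>f\<close>, so the
      expansion rule is applied to \<open>w \<mapsto> G (letter p f w # y)\<close>; the trivial sign
      \<open>koszul 0\<close> makes it an instance of \<open>mlin_koszul_slot\<close>.\<close>
    have "mult_linear (\<lambda>w. koszul 0 (G (letter p f w # y)))"
      by (intro mlin_koszul_slot[OF _ G] degree_only_words slot_letter[OF f] slot_word) (use w that in auto)
    from slot_letter_ins[OF this, of "z @ m # u" x g q h s v n] show ?thesis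
      using assms w that by simp
  qed
  have "cap p f n (ins s h g) G m r \<approx> split5 r (\<lambda>u v x y z.
      koszul ((n + 1) * sdeg (m # u) + sdeg z * (sdeg (m # u @ v @ x @ y) + n + 1))
      (split3 v (\<lambda>a b c. koszul ((s + 1) * sdeg a) (G (letter p f (z @ m # u @ letter q g (a @ letter s h b # c) # x) # y)))))"
    unfolding cap_def by (intro eqv_split5 eqv_koszul 1)
  also have "\<dots> = cap_nest2 p f q g s h G m r"
    unfolding cap_nest2_def by (simp add: n word_norm ac_simps)
  finally show ?thesis .
qed

lemma cap_letter_diff1:
  assumes "f \<in> cochains A p" and "g \<in> cochains A p" and "h \<in> cochains A q"
  shows "cap p (\<lambda>w. f w - koszul n (g w)) q h G m r \<approx> cap p f q h G m r - koszul n (cap p g q h G m r)"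
proof -
  have "cap p (\<lambda>w. f w - koszul n (g w)) q h G m r = split5 r (\<lambda>u v x y z.
      koszul ((q + 1) * sdeg (m # u) + sdeg z * (sdeg (m # u @ v @ x @ y) + q + 1))
      (G ([] @ letter p (\<lambda>w. f w - koszul n (g w)) (z @ m # u @ letter q h v # x) # y)))"
    by (simp add: cap_def)
  also have "\<dots> \<approx> split5 r (\<lambda>u v x y z.
      koszul ((q + 1) * sdeg (m # u) + sdeg z * (sdeg (m # u @ v @ x @ y) + q + 1))
      (G ([] @ letter p f (z @ m # u @ letter q h v # x) # y) - koszul n (G ([] @ letter p g (z @ m # u @ letter q h v # x) # y))))"
    by (intro eqv_split5 eqv_koszul slot_letter_diff[OF G]) (use assms w in auto)
  finally show ?thesis
    by (simp add: cap_def koszul_diff split_linear koszul_left_commute[of n])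
qed

lemma cap_letter_diff2:
  assumes "f \<in> cochains A q" and "g \<in> cochains A q" and h: "h \<in> cochains A p"
  shows "cap p h q (\<lambda>w. f w - koszul n (g w)) G m r \<approx> cap p h q f G m r - koszul n (cap p h q g G m r)"
proof -
  have 1: "G (letter p h (z @ m # u @ letter q (\<lambda>w. f w - koszul n (g w)) v # x) # y) \<approx>
      G (letter p h (z @ m # u @ letter q f v # x) # y) - koszul n (G (letter p h (z @ m # u @ letter q g v # x) # y))"
    if "r = u @ v @ x @ y @ z" for u v x y z
  proof -
    have "mult_linear (\<lambda>w. koszul 0 (G (letter p h w # y)))"
      by (intro mlin_koszul_slot[OF _ G] degree_only_words slot_letter[OF h] slot_word) (use w that in auto)
    from slot_letter_diff[OF this, of "z @ m # u" x f q g v n] show ?thesis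
      using assms w that by simp
  qed
  have "cap p h q (\<lambda>w. f w - koszul n (g w)) G m r \<approx> split5 r (\<lambda>u v x y z.
      koszul ((q + 1) * sdeg (m # u) + sdeg z * (sdeg (m # u @ v @ x @ y) + q + 1))
      (G (letter p h (z @ m # u @ letter q f v # x) # y) - koszul n (G (letter p h (z @ m # u @ letter q g v # x) # y))))"
    unfolding cap_def by (intro eqv_split5 eqv_koszul 1)
  then show ?thesis
    by (simp add: cap_def koszul_diff split_linear koszul_left_commute[of n])
qed

lemma slide_comp:
  assumes "f \<in> cochains A p" and "h \<in> cochains A s" and n: "n = p + s + 1"
  shows "slide n (ins s h f) G m r \<approx> slide_nest p f s h G m r"
proof -
  have "slide n (ins s h f) G m r = split4 r (\<lambda>x v y z.
      koszul ((n + 1) * sdeg (m # x) + sdeg z * (sdeg (m # x @ v @ y) + n + 1))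
      (G ((z @ m # x) @ letter n (ins s h f) v # y)))"
    by (simp add: slide_def)
  also have "\<dots> \<approx> split4 r (\<lambda>x v y z.
      koszul ((n + 1) * sdeg (m # x) + sdeg z * (sdeg (m # x @ v @ y) + n + 1))
      (split3 v (\<lambda>a b c. koszul ((s + 1) * sdeg a) (G ((z @ m # x) @ letter p f (a @ letter s h b # c) # y)))))"
    by (intro eqv_split4 eqv_koszul slot_letter_ins[OF G]) (use assms w in auto)
  also have "\<dots> = slide_nest p f s h G m r"
    unfolding slide_nest_def by (simp add: n word_norm ac_simps)
  finally show ?thesis .
qed

lemma slide_letter_diff:
  assumes "f \<in> cochains A p" and "g \<in> cochains A p"
  shows "slide p (\<lambda>w. f w - koszul n (g w)) G m r \<approx> slide p f G m r - koszul n (slide p g G m r)"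
proof -
  have "slide p (\<lambda>w. f w - koszul n (g w)) G m r = split4 r (\<lambda>x v y z.
      koszul ((p + 1) * sdeg (m # x) + sdeg z * (sdeg (m # x @ v @ y) + p + 1))
      (G ((z @ m # x) @ letter p (\<lambda>w. f w - koszul n (g w)) v # y)))"
    by (simp add: slide_def)
  also have "\<dots> \<approx> split4 r (\<lambda>x v y z.
      koszul ((p + 1) * sdeg (m # x) + sdeg z * (sdeg (m # x @ v @ y) + p + 1))
      (G ((z @ m # x) @ letter p f v # y) - koszul n (G ((z @ m # x) @ letter p g v # y))))"
    by (intro eqv_split4 eqv_koszul slot_letter_diff[OF G]) (use assms w in auto)
  finally show ?thesis
    by (simp add: slide_def koszul_diff split_linear koszul_left_commute[of n])
qed

end

end

section \<open>The multiplication as a cochain\<close>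

text \<open>
  \<open>mu\<close> has the differential as its unary and the multiplication as its binary component. The signs
  are such that \<open>mu \<circ> mu = 0\<close>, the differential of a cochain \<open>f\<close> is \<open>-{mu, f}\<close>, and the differential
  of a chain is the negative of the Lie derivative \<open>lie\<close> along \<open>mu\<close>.
\<close>

definition mu :: "('k, 'a::ring) dga \<Rightarrow> 'a hword \<Rightarrow> 'a"
  where "mu A w = (if is_hword A w then
    (case w of [a] \<Rightarrow> - diff A (snd a) | [a, b] \<Rightarrow> koszul (fst a + 1) (snd a * snd b) | _ \<Rightarrow> 0) else 0)"

lemma mu_simps [simp]:
  "mu A [] = 0"
  "snd a \<in> homog A (fst a) \<Longrightarrow> mu A [a] = - diff A (snd a)"
  "snd a \<in> homog A (fst a) \<Longrightarrow> snd b \<in> homog A (fst b) \<Longrightarrow> mu A [a, b] = koszul (fst a + 1) (snd a * snd b)"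
  "mu A (a # b # c # w) = 0"
  by (simp_all add: mu_def)

lemma mu_long: "2 < length w \<Longrightarrow> mu A w = 0"
  by (auto simp: mu_def split: list.split)

text \<open>Tailored to inserting \<open>mu\<close> into a word, where only segments of one or two
  letters count.\<close>

lemma split3_short:
  assumes "\<And>u v x. w = u @ v @ x \<Longrightarrow> length v \<noteq> 1 \<Longrightarrow> length v \<noteq> 2 \<Longrightarrow> F u v x = 0"
  shows "split3 w F = (\<Sum>i<length w. F (take i w) [w ! i] (drop (i + 1) w))
    + (\<Sum>i<length w - 1. F (take i w) [w ! i, w ! (i + 1)] (drop (i + 2) w))"
  using assms
proof (induction w arbitrary: F)
  case (Cons c w)
  have F0: "F [] [] (c # w) = 0"
    using Cons.prems[of "[]" "[]" "c # w"] by simp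
  have F3: "split2 w (\<lambda>a b. F [] (c # a) b) = F [] [c] w + (case w of [] \<Rightarrow> 0 | d # w' \<Rightarrow> F [] [c, d] w')"
  proof (cases w)
    case (Cons d w')
    have "split2 w' (\<lambda>a b. F [] (c # d # a) b) = F [] [c, d] w'"
      by (rule split2_only_Nil_left, rule Cons.prems) (auto simp: Cons)
    then show ?thesis
      by (simp add: Cons split2_Cons)
  qed simp
  have IH: "split3 w (F' :: _ \<Rightarrow> _ \<Rightarrow> _ \<Rightarrow> 'b) = (\<Sum>i<length w. F' (take i w) [w ! i] (drop (i + 1) w))
    + (\<Sum>i<length w - 1. F' (take i w) [w ! i, w ! (i + 1)] (drop (i + 2) w))" if "F' = (\<lambda>a. F (c # a))" for F'
    by (rule Cons.IH) (use Cons.prems[of "c # _"] that in auto)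
  have "split3 (c # w) F = F [] [c] w + (case w of [] \<Rightarrow> 0 | d # w' \<Rightarrow> F [] [c, d] w') + split3 w (\<lambda>a. F (c # a))"
    using F0 F3 by (simp add: split3_def split2_Cons)
  also have "\<dots> = (\<Sum>i<length (c # w). F (take i (c # w)) [(c # w) ! i] (drop (i + 1) (c # w)))
    + (\<Sum>i<length (c # w) - 1. F (take i (c # w)) [(c # w) ! i, (c # w) ! (i + 1)] (drop (i + 2) (c # w)))"
    unfolding IH[OF refl] by (cases w) (simp_all add: sum.lessThan_Suc_shift add.assoc add.left_commute del: sum.lessThan_Suc)
  finally show ?case .
qed simp_all

text \<open>Tailored to inserting a cochain into \<open>mu\<close>: the value is one of at most two
  letters, so at most one letter remains outside the segment.\<close>

lemma split3_corner:
  assumes "\<And>u v x. w = u @ v @ x \<Longrightarrow> length u + length x > 1 \<Longrightarrow> F u v x = 0"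
  shows "split3 w F = F [] w [] + (if w = [] then 0 else F [hd w] (tl w) [] + F [] (butlast w) [last w])"
proof (cases w)
  case (Cons c w')
  have 1: "split2 w' (\<lambda>a r. split2 r (F (c # a))) = F [c] w' []"
  proof (rule trans[OF split2_only_Nil_left split2_only_Nil_right])
    fix a b assume ab: "w' = a @ b" "a \<noteq> []"
    then have "split2 b (F (c # a)) = split2 b (\<lambda>_ _. 0)"
      by (intro split2_cong refl assms) (auto simp: Cons)
    then show "split2 b (F (c # a)) = 0" by simp
  qed (auto intro!: assms simp: Cons neq_Nil_conv)
  obtain b l where bl: "w = b @ [l]"
    using Cons by (metis rev_exhaust list.distinct(1))
  have "split2 b (\<lambda>a x. F [] a (x @ [l])) = F [] b ([] @ [l])"
    by (rule split2_only_Nil_right) (auto intro!: assms simp: bl neq_Nil_conv)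
  then have 2: "split2 w (F []) = F [] w [] + F [] b [l]"
    unfolding bl using split2_append_Cons[of b l "[]" "F []"] by (simp add: add.commute)
  have "split3 w F = split2 w (F []) + split2 w' (\<lambda>a r. split2 r (F (c # a)))"
    unfolding split3_def by (simp add: Cons split2_Cons)
  moreover have "hd w = c" "tl w = w'"
    by (simp_all add: Cons)
  moreover have "butlast w = b" "last w = l" "w \<noteq> []"
    by (simp_all add: bl)
  ultimately show ?thesis
    unfolding 1 2 by (simp add: ac_simps)
qed simp

lemma circ_eq: "circ q f g = ins q g f"
proof
  fix w
  have "ins q g f w = split2 w (\<lambda>u c. split2 u (\<lambda>a b. koszul ((q + 1) * sdeg a) (f (a @ letter q g b # c))))"
    by (simp add: ins_def split3_def split2_assoc)
  also have "\<dots> = circ q f g w"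
    unfolding circ_def split2_def by (auto simp: Let_def letter_def min_def intro!: sum.cong)
  finally show "circ q f g w = ins q g f w" ..
qed

lemma gerst_bracket_eq:
  "gerst_bracket p q f g = (\<lambda>w. ins q g f w - koszul ((p + 1) * (q + 1)) (ins p f g w))"
  by (rule ext) (simp add: gerst_bracket_def circ_eq koszul_def)

lemma ins_diff_koszul: "ins p f (\<lambda>w. F w - koszul n (G w)) w = ins p f F w - koszul n (ins p f G w)"
  by (simp add: ins_def koszul_diff split_linear koszul_left_commute[of n])

context dg_algebra
begin

sublocale cochain: linear_target A "scal A" "{0}"
  by unfold_locales (auto simp: scal.scale_right_distrib)

lemma cochain_eqv [simp]: "cochain.eqv x y \<longleftrightarrow> x = y"
  by (simp add: cochain.eqv_def)

lemma cochain_mult_linear: "f \<in> cochains A p \<Longrightarrow> cochain.mult_linear f"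
  by (simp add: cochains_iff)

lemma cochain_eqI: "f \<in> cochains A p \<Longrightarrow> g \<in> cochains A q \<Longrightarrow> (\<And>w. is_hword A w \<Longrightarrow> f w = g w) \<Longrightarrow> f = g"
  by (rule ext) (metis cochain_outside)

lemma cochain_diff_koszul: "(\<lambda>w. f w - koszul n (g w)) \<in> cochains A p"
  if f: "f \<in> cochains A p" and g: "g \<in> cochains A p"
  unfolding cochains_iff
proof (intro conjI allI impI)
  show "cochain.mult_linear (\<lambda>w. f w - koszul n (g w))"
    by (rule cochain.mlin_diff[OF cochain_mult_linear[OF f] cochain.mlin_koszul[OF _ cochain_mult_linear[OF g]]])
      (simp add: degree_only_def case_prod_beta)
next
  fix w assume "is_hword A w"
  then show "f w - koszul n (g w) \<in> homog A (sdeg w + p)"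
    by (intro homog_diff homog_koszul cochain_homog[OF f] cochain_homog[OF g]) auto
qed (simp add: cochain_outside[OF f] cochain_outside[OF g])

lemma zero_cochain: "(\<lambda>w. 0) \<in> cochains A p"
  unfolding cochains_iff mlin_words_iff by simp

lemma cochain_scal_closed: "f \<in> cochains A p \<Longrightarrow> (\<lambda>w. scal A r (f w)) \<in> cochains A p"
  unfolding cochains_iff mlin_words_iff by (simp add: homog_scal scal.scale_right_distrib mult.commute)

lemma ins_cochain:
  assumes f: "f \<in> cochains A p" and g: "g \<in> cochains A q" and n: "n = p + q + 1"
  shows "ins p f g \<in> cochains A n"
  unfolding cochains_iff
proof (intro conjI allI impI)
  fix w assume w: "\<not> is_hword A w"
  have "ins p f g w = split3 w (\<lambda>u v x. 0)"
    unfolding ins_def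
  proof (rule split3_cong[OF refl])
    fix u v x assume w': "w = u @ v @ x"
    show "koszul ((p + 1) * sdeg u) (g (u @ letter p f v # x)) = 0"
    proof (cases "is_hword A v")
      case True
      then show ?thesis
        using w w' cochain_outside[OF g, of "u @ letter p f v # x"] by auto
    next
      \<comment> \<open>The segment is not a homogeneous word, so \<open>f\<close> vanishes on it by
        convention and leaves a letter with content 0.\<close>
      case False
      then show ?thesis
        by (simp add: letter_def cochain_outside[OF f] cochain_letter_0[OF g])
    qed
  qed
  then show "ins p f g w = 0" by simp
next
  fix w assume "is_hword A w"
  then show "ins p f g w \<in> homog A (sdeg w + n)"
    unfolding ins_def by (intro homog_split3 homog_koszul) (use f g n in auto)
next
  show "cochain.mult_linear (ins p f g)"
    by (rule cochain.mlin_ins[OF f cochain_mult_linear[OF g]])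
qed

lemma ins2_cochain:
  assumes f: "f \<in> cochains A p" and g: "g \<in> cochains A q" and h: "h \<in> cochains A s" and n: "n = s + p + q + 2"
  shows "ins2 p f q g h \<in> cochains A n"
  unfolding cochains_iff
proof (intro conjI allI impI)
  fix w assume w: "\<not> is_hword A w"
  have "ins2 p f q g h w = split5 w (\<lambda>a b c d e. 0)"
    unfolding ins2_def
  proof (rule split5_cong[OF refl])
    fix a b c d e assume w': "w = a @ b @ c @ d @ e"
    have "h (a @ letter p f b # c @ letter q g d # e) = 0"
    proof (cases "is_hword A b \<and> is_hword A d")
      case True
      then show ?thesis
        using w w' cochain_outside[OF h, of "a @ letter p f b # c @ letter q g d # e"] by auto
    next
      case False
      then show ?thesis
        using cochain_letter_0[OF h, of a] cochain_letter_0[OF h, of "a @ letter p f b # c"]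
        by (auto simp: letter_def cochain_outside[OF f] cochain_outside[OF g])
    qed
    then show "koszul ((p + 1) * sdeg a + (q + 1) * (sdeg a + sdeg b + sdeg c)) (h (a @ letter p f b # c @ letter q g d # e)) = 0"
      by simp
  qed
  then show "ins2 p f q g h w = 0" by simp
next
  fix w assume "is_hword A w"
  then show "ins2 p f q g h w \<in> homog A (sdeg w + n)"
    unfolding ins2_def by (intro homog_split5 homog_koszul) (use f g h n in auto)
next
  show "cochain.mult_linear (ins2 p f q g h)"
    by (rule cochain.mlin_ins2[OF f g cochain_mult_linear[OF h]])
qed

lemma gerst_bracket_cochain:
  "f \<in> cochains A p \<Longrightarrow> g \<in> cochains A q \<Longrightarrow> n = p + q + 1 \<Longrightarrow> gerst_bracket p q f g \<in> cochains A n"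
  unfolding gerst_bracket_eq by (intro cochain_diff_koszul ins_cochain) auto

sublocale diff: module_hom "scal A" "scal A" "diff A"
  by (rule diff_linear)

lemma diff_homog' [simp]: "x \<in> homog A i \<Longrightarrow> n = i - 1 \<Longrightarrow> diff A x \<in> homog A n"
  by (simp add: diff_homog)

lemma mult_homog' [simp]: "x \<in> homog A i \<Longrightarrow> y \<in> homog A j \<Longrightarrow> n = i + j \<Longrightarrow> x * y \<in> homog A n"
  by (simp add: mult_homog)

lemma scal_koszul: "scal A r (koszul n x) = koszul n (scal A r x)"
  by (simp add: koszul_def)

text \<open>Both components have degree -2: \<open>[a]\<close> has degree \<open>|a| + 1\<close> and
  goes to degree \<open>|a| - 1\<close>, while \<open>[a, b]\<close> has degree
  \<open>|a| + |b| + 2\<close> and goes to \<open>|a| + |b|\<close>.\<close>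

lemma mu_cochain: "mu A \<in> cochains A (-2)"
  unfolding cochains_iff mlin_words_iff
proof (intro conjI allI impI ballI)
  fix w assume "is_hword A w"
  then show "mu A w \<in> homog A (sdeg w + -2)"
    by (auto simp: mu_def homog_uminus homog_koszul split: list.split)
next
  fix u i v x y assume "is_hword A u \<and> is_hword A v \<and> x \<in> homog A i" "y \<in> homog A i"
  then have *: "is_hword A (u @ (i, x) # v)" "is_hword A (u @ (i, y) # v)" "is_hword A (u @ (i, x + y) # v)"
    by (auto intro: homog_add)
  then show "mu A (u @ (i, x + y) # v) - (mu A (u @ (i, x) # v) + mu A (u @ (i, y) # v)) \<in> {0}"
  proof (cases "length u + length v > 1")
    case False
    then have "u = [] \<and> v = [] \<or> (\<exists>a. u = [a] \<and> v = []) \<or> (\<exists>b. u = [] \<and> v = [b])"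
      by (cases u; cases v) auto
    with * show ?thesis
      by (auto simp: mu_def diff.add distrib_left distrib_right koszul_add)
  qed (simp add: mu_long)
next
  fix u i v x r assume "is_hword A u \<and> is_hword A v \<and> x \<in> homog A i"
  then have *: "is_hword A (u @ (i, x) # v)" "is_hword A (u @ (i, scal A r x) # v)"
    by (auto intro: homog_scal)
  then show "mu A (u @ (i, scal A r x) # v) - scal A r (mu A (u @ (i, x) # v)) \<in> {0}"
  proof (cases "length u + length v > 1")
    case False
    then have "u = [] \<and> v = [] \<or> (\<exists>a. u = [a] \<and> v = []) \<or> (\<exists>b. u = [] \<and> v = [b])"
      by (cases u; cases v) auto
    with * show ?thesis
      by (auto simp: mu_def diff.scale scal_mult_left scal_mult_right scal_koszul)
  qed (simp add: mu_long)
qed (simp add: mu_def)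

end

lemma (in linear_target) ins_mu_eqv:
  assumes G: "mult_linear G" and w: "is_hword A w"
  shows "ins (- 2) (mu A) G w \<approx>
    (\<Sum>i<length w. koszul (1 + sdeg (take i w)) (G (diff_at A w i))) +
    (\<Sum>i<length w - 1. koszul (sdeg (take (i + 1) w)) (G (mult_at w i)))"
proof -
  let ?F = "\<lambda>u v x. koszul ((- 2 + 1) * sdeg u) (G (u @ letter (- 2) (mu A) v # x))"
  have wi: "snd (w ! i) \<in> homog A (fst (w ! i))" "is_hword A (take i w)" "is_hword A (drop j w)" if "i < length w" for i j
    using w that by (auto simp: is_hword_def dest: in_set_takeD in_set_dropD intro: nth_mem)
  have d: "G (take i w @ letter (- 2) (mu A) [w ! i] # drop (i + 1) w) \<approx> - G (diff_at A w i)" if i: "i < length w" for i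
  proof -
    obtain j x where jx: "w ! i = (j, x)" by (cases "w ! i")
    have h: "diff A x \<in> homog A (j - 1)"
      using wi(1)[OF i] by (simp add: jx)
    show ?thesis
      using slot_value_uminus[OF G wi(2)[OF i] wi(3)[OF i, of "i + 1"] h] wi(1)[OF i]
      by (simp add: jx letter_def diff_at_def)
  qed
  have e: "G (take i w @ letter (- 2) (mu A) [w ! i, w ! (i + 1)] # drop (i + 2) w) \<approx> koszul (fst (w ! i) + 1) (G (mult_at w i))"
    if i: "i < length w - 1" for i
  proof -
    obtain j x k y where jx: "w ! i = (j, x)" "w ! (i + 1) = (k, y)" by (cases "w ! i", cases "w ! (i + 1)")
    have i': "i < length w" "i + 1 < length w" using i by auto
    have h: "x * y \<in> homog A (j + k)"
      using wi(1)[OF i'(1)] wi(1)[OF i'(2)] unfolding jx by simp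
    show ?thesis
      using slot_value_koszul[OF G wi(2)[OF i'(1)] wi(3)[OF i'(1), of "i + 2"] h, of "j + 1"]
        wi(1)[OF i'(1)] wi(1)[OF i'(2)]
      unfolding jx by (simp add: jx jx[simplified] letter_def mult_at_def algebra_simps)
  qed
  have s: "sdeg (take (i + 1) w) = sdeg (take i w) + (fst (w ! i) + 1)" if "i < length w" for i
    using that by (simp add: take_Suc_conv_app_nth)
  \<comment> \<open>Segments of other lengths produce a letter with content 0. The value of
    \<open>G\<close> there is null rather than literally zero, so they are removed by a
    congruence.\<close>
  have "ins (- 2) (mu A) G w \<approx> split3 w (\<lambda>u v x. if length v = 1 \<or> length v = 2 then ?F u v x else 0)"
    unfolding ins_def
  proof (rule eqv_split3)
    fix u v x assume uvx: "w = u @ v @ x"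
    show "?F u v x \<approx> (if length v = 1 \<or> length v = 2 then ?F u v x else 0)"
    proof (cases "length v = 1 \<or> length v = 2")
      case False
      then have "mu A v = 0"
        using mu_long[of v A] by (cases "v = []") (auto simp: neq_Nil_conv)
      moreover have "G (u @ (sdeg v + -2, 0) # x) \<approx> 0"
        using w uvx by (intro slot_value_zero[OF G]) auto
      ultimately show ?thesis
        using False eqv_koszul[of "G (u @ (sdeg v + -2, 0) # x)" 0] by (auto simp: letter_def)
    qed simp
  qed
  also have "\<dots> = (\<Sum>i<length w. ?F (take i w) [w ! i] (drop (i + 1) w))
    + (\<Sum>i<length w - 1. ?F (take i w) [w ! i, w ! (i + 1)] (drop (i + 2) w))"
    by (subst split3_short) simp_all
  also have "\<dots> \<approx> (\<Sum>i<length w. koszul ((- 2 + 1) * sdeg (take i w)) (- G (diff_at A w i))) +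
      (\<Sum>i<length w - 1. koszul ((- 2 + 1) * sdeg (take i w)) (koszul (fst (w ! i) + 1) (G (mult_at w i))))"
    by (intro eqv_add eqv_sum eqv_koszul d e) simp_all
  also have "\<dots> = (\<Sum>i<length w. koszul (1 + sdeg (take i w)) (G (diff_at A w i))) +
      (\<Sum>i<length w - 1. koszul (sdeg (take (i + 1) w)) (G (mult_at w i)))"
    using s by (intro arg_cong2[where f = "(+)"] sum.cong refl) (simp_all add: koszul_norm)
  finally show ?thesis .
qed

context dg_algebra
begin

lemmas ins_mu = cochain.ins_mu_eqv[OF cochain_mult_linear, unfolded cochain_eqv]

lemma ins_into_mu:
  assumes f: "f \<in> cochains A p" and w: "is_hword A w"
  shows "ins p f (mu A) w = - diff A (f w) + (if w = [] then 0 else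
    koszul (sdeg [hd w] * p) (snd (hd w) * f (tl w)) + koszul (p + 1 + sdeg (butlast w)) (f (butlast w) * snd (last w)))"
proof -
  let ?F = "\<lambda>u v x. koszul ((p + 1) * sdeg u) (mu A (u @ letter p f v # x))"
  have 1: "mu A [letter p f w] = - diff A (f w)"
    using f w by (simp add: letter_def)
  have 2: "?F [hd w] (tl w) [] = koszul (sdeg [hd w] * p) (snd (hd w) * f (tl w))" if "w \<noteq> []"
    using that f w by (cases w) (simp_all add: letter_def koszul_norm)
  have 3: "?F [] (butlast w) [last w] = koszul (p + 1 + sdeg (butlast w)) (f (butlast w) * snd (last w))" if "w \<noteq> []"
    using that f w by (cases w rule: rev_cases) (simp_all add: letter_def koszul_norm)
  have "ins p f (mu A) w = ?F [] w [] + (if w = [] then 0 else ?F [hd w] (tl w) [] + ?F [] (butlast w) [last w])"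
    unfolding ins_def by (rule split3_corner) (simp add: mu_long)
  with 1 2 3 show ?thesis
    by (cases "w = []") simp_all
qed

text \<open>On words of one, two and three letters this is \<open>d d = 0\<close>, the Leibniz rule
  and associativity. An insertion of \<open>mu\<close> into a longer word leaves at least three
  letters, too many for the outer \<open>mu\<close>.\<close>

lemma mu_mu:
  assumes w: "is_hword A w"
  shows "ins (- 2) (mu A) (mu A) w = 0"
proof -
  consider "w = []" | a where "w = [a]" | a b where "w = [a, b]" | a b c where "w = [a, b, c]" | "length w > 3"
    by (cases w; cases "tl w"; cases "tl (tl w)"; cases "tl (tl (tl w))") auto
  then show ?thesis
  proof cases
    case 5
    then have "mu A (diff_at A w i) = 0" if "i < length w" for i
      using that by (intro mu_long) (auto simp: diff_at_def)
    moreover from 5 have "mu A (mult_at w i) = 0" if "i < length w - 1" for i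
      using that by (intro mu_long) (auto simp: mult_at_def)
    ultimately show ?thesis
      unfolding ins_mu[OF mu_cochain w] by simp
  next
    case 1
    then show ?thesis by (simp add: ins_mu[OF mu_cochain])
  next
    case (2 a)
    with w show ?thesis by (cases a) (simp add: ins_mu[OF mu_cochain] diff_at_def diff_diff)
  next
    case (3 a b)
    with w show ?thesis
      by (cases a; cases b) (auto simp: ins_mu[OF mu_cochain] diff_at_def mult_at_def diff_mult
        lessThan_Suc koszul_norm)
  next
    case (4 a b c)
    with w show ?thesis
      by (cases a; cases b; cases c) (auto simp: ins_mu[OF mu_cochain] diff_at_def mult_at_def mu_long numeral_2_eq_2
        lessThan_Suc koszul_norm mult.assoc)
  qed
qed

end

section \<open>The Gerstenhaber structure on cochains\<close>

text \<open>This is \<open>{mu, f}\<close>, the differential up to the sign -1. In this form the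
  derivation rule for the bracket is an instance of the Jacobi identity.\<close>

definition cobd :: "('k, 'a::ring) dga \<Rightarrow> int \<Rightarrow> ('a hword \<Rightarrow> 'a) \<Rightarrow> 'a hword \<Rightarrow> 'a"
  where "cobd A p f = (\<lambda>w. ins p f (mu A) w - koszul (p + 1) (ins (- 2) (mu A) f w))"

text \<open>The pre-Lie symmetry: in the commutator of two insertions the terms with disjoint
  segments cancel in pairs, and only the nested terms survive.\<close>

lemma (in linear_target) ins_gerst_bracket:
  assumes g: "g \<in> cochains A q" and h: "h \<in> cochains A r" and n: "n = q + r + 1"
    and G: "mult_linear G" and w: "is_hword A w"
  shows "ins n (gerst_bracket q r g h) G w \<approx>
    ins r h (ins q g G) w - koszul ((q + 1) * (r + 1)) (ins q g (ins r h G) w)"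
proof -
  have "ins n (gerst_bracket q r g h) G w \<approx>
      ins n (ins r h g) G w - koszul ((q + 1) * (r + 1)) (ins n (ins q g h) G w)"
    unfolding gerst_bracket_eq using g h n by (intro ins_letter_diff[OF G w] ins_cochain) auto
  also have "\<dots> \<approx> ins_nest q g r h G w - koszul ((q + 1) * (r + 1)) (ins_nest r h q g G w)"
    using g h n by (intro eqv_diff eqv_koszul ins_comp[OF G w]) auto
  also have "\<dots> = ins r h (ins q g G) w - koszul ((q + 1) * (r + 1)) (ins q g (ins r h G) w)"
    unfolding ins_ins by (simp add: koszul_norm)
  finally show ?thesis .
qed

context dg_algebra
begin

lemmas cochain_ins_gerst_bracket = cochain.ins_gerst_bracket[OF _ _ _ cochain_mult_linear, unfolded cochain_eqv]

lemma gerst_bracket_mu: "gerst_bracket (- 2) p (mu A) f = cobd A p f"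
  by (rule ext) (simp add: gerst_bracket_eq cobd_def koszul_norm)

lemma cobd_cochain: "f \<in> cochains A p \<Longrightarrow> n = p - 1 \<Longrightarrow> cobd A p f \<in> cochains A n"
  unfolding cobd_def by (intro cochain_diff_koszul ins_cochain[OF _ mu_cochain] ins_cochain[OF mu_cochain]) auto

lemma cochain_diff_eq:
  assumes f: "f \<in> cochains A p"
  shows "cochain_diff A p f = (\<lambda>w. - cobd A p f w)"
proof
  fix w
  show "cochain_diff A p f w = - cobd A p f w"
  proof (cases "is_hword A w")
    case True
    then show ?thesis
      by (simp add: cochain_diff_def cobd_def ins_mu[OF f] ins_into_mu[OF f] cochain_d0_def cochain_d1_def
          koszul_sum koszul_plus koszul_1 koszul_uminus koszul_add koszul_diff sum_negf algebra_simps)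
  next
    case False
    then show ?thesis
      using cochain_outside[OF cobd_cochain[OF f refl]] by (simp add: cochain_diff_def)
  qed
qed

text \<open>Inserting a bracket is a commutator of insertions, so all three double brackets become
  signed sums of iterated insertions, and these match term by term.\<close>

lemma gerst_bracket_jacobi:
  assumes f: "f \<in> cochains A p" and g: "g \<in> cochains A q" and h: "h \<in> cochains A r"
  shows "gerst_bracket p (q + r + 1) f (gerst_bracket q r g h) w =
    gerst_bracket (p + q + 1) r (gerst_bracket p q f g) h w
    + koszul ((p + 1) * (q + 1)) (gerst_bracket q (p + r + 1) g (gerst_bracket p r f h) w)"
    (is "?l w = ?r w")
proof (cases "is_hword A w")
  case True
  note b = cochain_ins_gerst_bracket[OF _ _ refl _ True]
  show ?thesis
    unfolding gerst_bracket_eq[of p "q + r + 1"] gerst_bracket_eq[of "p + q + 1" r] gerst_bracket_eq[of q "p + r + 1"]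
      b[OF g h f] b[OF f g h] b[OF f h g]
    unfolding gerst_bracket_eq ins_diff_koszul by (simp add: koszul_norm)
next
  case False
  have c: "gerst_bracket q (p + r + 1) g (gerst_bracket p r f h) \<in> cochains A (p + q + r + 2)"
    "gerst_bracket (p + q + 1) r (gerst_bracket p q f g) h \<in> cochains A (p + q + r + 2)"
    "gerst_bracket p (q + r + 1) f (gerst_bracket q r g h) \<in> cochains A (p + q + r + 2)"
    using f g h gerst_bracket_cochain[OF _ _ refl] by (auto intro!: gerst_bracket_cochain)
  show ?thesis
    using False by (simp add: cochain_outside[OF c(1)] cochain_outside[OF c(2)] cochain_outside[OF c(3)])
qed

text \<open>The Jacobi identity for \<open>mu\<close>, \<open>mu\<close> and \<open>f\<close> yields
  only twice this equation. Directly: two insertions of the odd \<open>mu\<close> at disjoint places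
  cancel, and nested ones insert \<open>mu \<circ> mu = 0\<close>.\<close>

lemma cobd_cobd:
  assumes f: "f \<in> cochains A p"
  shows "cobd A (p - 1) (cobd A p f) w = 0"
proof (cases "is_hword A w")
  case True
  have cm: "cochain.mult_linear (mu A)" "cochain.mult_linear f" "cochain.mult_linear (ins (- 2) (mu A) f)"
    using f by (auto intro: cochain_mult_linear mu_cochain ins_cochain)
  have mm: "ins (- 2) (mu A) (mu A) = (\<lambda>w. 0)"
    using mu_mu cochain_outside[OF ins_cochain[OF mu_cochain mu_cochain refl]] by blast
  have "ins_nest (- 2) (mu A) (- 2) (mu A) f w = ins (- 3) (\<lambda>w. 0) f w"
    using cochain.ins_comp[OF cm(2) True mu_cochain mu_cochain, of "-3"] by (simp add: mm)
  also have "\<dots> = 0"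
    using cochain.ins_letter_diff[OF cm(2) True zero_cochain zero_cochain, of "-3" 0] by simp
  finally have n: "ins_nest (- 2) (mu A) (- 2) (mu A) f w = 0" .
  have z: "ins p f (\<lambda>w. 0) w = 0" by (simp add: ins_def)
  show ?thesis
    unfolding cobd_def[of A "p - 1"]
    unfolding gerst_bracket_mu[symmetric] cochain_ins_gerst_bracket[OF mu_cochain f _ mu_cochain True, of "p - 1", simplified]
    unfolding gerst_bracket_mu cobd_def ins_diff_koszul ins_ins[of "- 2" _ "- 2"]
    by (simp add: n mm z koszul_norm)
next
  case False
  then show ?thesis
    using cochain_outside[OF cobd_cochain[OF cobd_cochain[OF f refl] refl]] by simp
qed

lemma cobd_gerst_bracket:
  assumes f: "f \<in> cochains A p" and g: "g \<in> cochains A q"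
  shows "cobd A (p + q + 1) (gerst_bracket p q f g) w =
    gerst_bracket (p - 1) q (cobd A p f) g w + koszul (p + 1) (gerst_bracket p (q - 1) f (cobd A q g) w)"
  using gerst_bracket_jacobi[OF mu_cochain f g, of w]
  by (simp add: gerst_bracket_mu koszul_norm)

text \<open>The circle product fails to be compatible with the differential because \<open>f\<close>
  and \<open>g\<close> can both be inserted into \<open>mu\<close>, in either order. These two terms
  are the cup products up to sign, which makes the circle product the homotopy for
  commutativity.\<close>

lemma cobd_ins:
  assumes f: "f \<in> cochains A p" and g: "g \<in> cochains A q" and w: "is_hword A w"
  shows "cobd A (p + q + 1) (ins q g f) w = ins q g (cobd A p f) w + koszul (p + 1) (ins (q - 1) (cobd A q g) f w)
    - ins2 p f q g (mu A) w - koszul ((p + 1) * (q + 1)) (ins2 q g p f (mu A) w)"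
proof -
  have 1: "ins (p + q + 1) (ins q g f) (mu A) w = ins_nest p f q g (mu A) w"
    using cochain.ins_comp[OF cochain_mult_linear[OF mu_cochain] w f g refl] by simp
  have 2: "ins (q - 1) (cobd A q g) f w = ins q g (ins (- 2) (mu A) f) w - koszul (q + 1) (ins (- 2) (mu A) (ins q g f) w)"
    using cochain_ins_gerst_bracket[OF mu_cochain g _ f w, of "q - 1"] by (simp add: gerst_bracket_mu koszul_norm)
  have 3: "ins q g (ins p f (mu A)) w = ins_nest p f q g (mu A) w + ins2 p f q g (mu A) w + koszul ((p + 1) * (q + 1)) (ins2 q g p f (mu A) w)"
    by (rule ins_ins)
  show ?thesis
    unfolding cobd_def[of A "p + q + 1"] cobd_def[of A p] 1 2 ins_diff_koszul 3
    by (simp add: koszul_norm)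
qed

text \<open>The nested terms of \<open>ins2_ins\<close> are folded into composite cochains, so that
  taking \<open>mu\<close> for \<open>G\<close> or \<open>h\<close> exhibits the two halves of each
  \<open>cobd\<close>.\<close>

lemma ins2_cobd_expand:
  assumes f: "f \<in> cochains A p" and g: "g \<in> cochains A q" and G: "G \<in> cochains A t" and h: "h \<in> cochains A s" and w: "is_hword A w"
  shows "ins2 p f q g (ins s h G) w =
    ins (s + p + q + 2) (ins2 p f q g h) G w + ins2 (p + s + 1) (ins p f h) q g G w
    + koszul ((s + 1) * (p + 1)) (ins2 p f (q + s + 1) (ins q g h) G w)
    + koszul ((s + 1) * (p + q)) (ins s h (ins2 p f q g G) w - ins2 p f (q + s + 1) (ins s h g) G w
      - koszul ((s + 1) * (q + 1)) (ins2 (p + s + 1) (ins s h f) q g G w))"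
proof -
  note G' = cochain_mult_linear[OF G]
  have "ins (s + p + q + 2) (ins2 p f q g h) G w = ins_nest2 s h p f q g G w"
    using cochain.ins_comp2[OF G' w f g h refl] by simp
  moreover have "ins2 (p + s + 1) (ins p f h) q g G w = ins2_nest1 s h p f q g G w"
    using cochain.ins2_comp1[OF G' w h f g, of "p + s + 1"] by simp
  moreover have "ins2 p f (q + s + 1) (ins q g h) G w = ins2_nest2 p f s h q g G w"
    using cochain.ins2_comp2[OF G' w f h g, of "q + s + 1"] by simp
  moreover have "ins2 p f (q + s + 1) (ins s h g) G w = ins2_nest2 p f q g s h G w"
    using cochain.ins2_comp2[OF G' w f g h refl] by simp
  moreover have "ins2 (p + s + 1) (ins s h f) q g G w = ins2_nest1 p f s h q g G w"
    using cochain.ins2_comp1[OF G' w f h g refl] by simp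
  ultimately show ?thesis
    using ins2_ins[of p f q g s h G w] by simp
qed

text \<open>With \<open>mu\<close> for both \<open>G\<close> and \<open>h\<close> the left side of
  the expansion vanishes because \<open>mu \<circ> mu = 0\<close>. What remains is the derivation
  rule for \<open>mu{f, g}\<close>, hence for the cup product.\<close>

lemma cobd_ins2:
  assumes f: "f \<in> cochains A p" and g: "g \<in> cochains A q" and w: "is_hword A w"
  shows "cobd A (p + q) (ins2 p f q g (mu A)) w =
    - ins2 (p - 1) (cobd A p f) q g (mu A) w - koszul (p + 1) (ins2 p f (q - 1) (cobd A q g) (mu A) w)"
proof -
  note mc = cochain_mult_linear[OF mu_cochain]
  have mm: "ins (- 2) (mu A) (mu A) = (\<lambda>w. 0)"
    using mu_mu cochain_outside[OF ins_cochain[OF mu_cochain mu_cochain refl]] by blast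
  have z: "ins2 p f q g (\<lambda>w. 0) w = 0"
    by (simp add: ins2_def)
  have 1: "ins2 (p - 1) (cobd A p f) q g (mu A) w =
      ins2 (p - 1) (ins p f (mu A)) q g (mu A) w - koszul (p + 1) (ins2 (p - 1) (ins (- 2) (mu A) f) q g (mu A) w)"
    unfolding cobd_def
    by (rule cochain.ins2_letter_diff1[OF mc w, unfolded cochain_eqv])
      (auto intro!: ins_cochain[OF f mu_cochain] ins_cochain[OF mu_cochain f] g)
  have 2: "ins2 p f (q - 1) (cobd A q g) (mu A) w =
      ins2 p f (q - 1) (ins q g (mu A)) (mu A) w - koszul (q + 1) (ins2 p f (q - 1) (ins (- 2) (mu A) g) (mu A) w)"
    unfolding cobd_def
    by (rule cochain.ins2_letter_diff2[OF mc w, unfolded cochain_eqv])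
      (auto intro!: ins_cochain[OF g mu_cochain] ins_cochain[OF mu_cochain g] f)
  have a: "p + - 2 + 1 = p - 1" "q + - 2 + 1 = q - 1" "- 2 + p + q + 2 = p + q" by simp_all
  show ?thesis
    using ins2_cobd_expand[OF f g mu_cochain mu_cochain w]
    unfolding cobd_def[of A "p + q"] 1 2 mm z a
    by (simp add: koszul_norm algebra_simps)
qed

text \<open>Two expansions are compared, with \<open>f\<close> inserted into \<open>mu\<close> and
  with \<open>mu\<close> inserted into \<open>f\<close>. The terms in which \<open>mu\<close> is
  composed with just one of the three cochains cancel by the cocycle conditions; the rest are the
  three terms of the Poisson rule.\<close>

lemma cobd_brace:
  assumes f: "f \<in> cochains A p" and g: "g \<in> cochains A q" and h: "h \<in> cochains A r" and w: "is_hword A w"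
    and cf: "cobd A p f = (\<lambda>w. 0)" and cg: "cobd A q g = (\<lambda>w. 0)" and ch: "cobd A r h = (\<lambda>w. 0)"
  shows "cobd A (p + q + r + 2) (ins2 q g r h f) w = koszul (p + 1) (gerst_bracket p (q + r) f (ins2 q g r h (mu A)) w)
    - ins2 (p + q + 1) (gerst_bracket p q f g) r h (mu A) w
    - koszul ((p + 1) * (q + 1)) (ins2 q g (p + r + 1) (gerst_bracket p r f h) (mu A) w)"
proof -
  note mc = cochain_mult_linear[OF mu_cochain]
  have c0: "ins q g (mu A) = (\<lambda>w. koszul (q + 1) (ins (- 2) (mu A) g w))" if "cobd A q g = (\<lambda>w. 0)" for q g
    using that unfolding cobd_def by (auto simp: fun_eq_iff)
  have 1: "ins2 (p + q + 1) (gerst_bracket p q f g) r h (mu A) w =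
      ins2 (p + q + 1) (ins q g f) r h (mu A) w - koszul ((p + 1) * (q + 1)) (ins2 (p + q + 1) (ins p f g) r h (mu A) w)"
    unfolding gerst_bracket_eq
    by (rule cochain.ins2_letter_diff1[OF mc w, unfolded cochain_eqv]) (auto intro!: ins_cochain[OF f g] ins_cochain[OF g f] h)
  have 2: "ins2 q g (p + r + 1) (gerst_bracket p r f h) (mu A) w =
      ins2 q g (p + r + 1) (ins r h f) (mu A) w - koszul ((p + 1) * (r + 1)) (ins2 q g (p + r + 1) (ins p f h) (mu A) w)"
    unfolding gerst_bracket_eq
    by (rule cochain.ins2_letter_diff2[OF mc w, unfolded cochain_eqv]) (auto intro!: ins_cochain[OF f h] ins_cochain[OF h f] g)
  \<comment> \<open>The sign sits inside a letter and leaves it only by linearity in that letter,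
    hence the detour through \<open>cobd A q g\<close>.\<close>
  have 3: "ins2 (q - 1) (ins q g (mu A)) r h f w = koszul (q + 1) (ins2 (q - 1) (ins (- 2) (mu A) g) r h f w)"
  proof -
    have "ins2 (q - 1) (\<lambda>w. ins q g (mu A) w - koszul (q + 1) (ins (- 2) (mu A) g w)) r h f w =
      ins2 (q - 1) (ins q g (mu A)) r h f w - koszul (q + 1) (ins2 (q - 1) (ins (- 2) (mu A) g) r h f w)"
      by (rule cochain.ins2_letter_diff1[OF cochain_mult_linear[OF f] w, unfolded cochain_eqv])
        (auto intro!: ins_cochain[OF g mu_cochain] ins_cochain[OF mu_cochain g] h)
    then show ?thesis
      using cg unfolding cobd_def by (simp add: ins2_def letter_def cochain_letter_0[OF f])
  qed
  have 4: "ins2 q g (r - 1) (ins r h (mu A)) f w = koszul (r + 1) (ins2 q g (r - 1) (ins (- 2) (mu A) h) f w)"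
  proof -
    have "ins2 q g (r - 1) (\<lambda>w. ins r h (mu A) w - koszul (r + 1) (ins (- 2) (mu A) h w)) f w =
      ins2 q g (r - 1) (ins r h (mu A)) f w - koszul (r + 1) (ins2 q g (r - 1) (ins (- 2) (mu A) h) f w)"
      by (rule cochain.ins2_letter_diff2[OF cochain_mult_linear[OF f] w, unfolded cochain_eqv])
        (auto intro!: ins_cochain[OF h mu_cochain] ins_cochain[OF mu_cochain h] g)
    then show ?thesis
      using ch cochain_letter_0[OF f, of "_ @ letter q g _ # _"] unfolding cobd_def by (simp add: ins2_def letter_def)
  qed
  have 5: "ins2 q g r h (ins p f (mu A)) w = koszul (p + 1) (ins2 q g r h (ins (- 2) (mu A) f) w)"
    unfolding c0[OF cf] by (simp add: ins2_def split_linear koszul_left_commute[of "p + 1"])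
  have a: "q + - 2 + 1 = q - 1" "r + - 2 + 1 = r - 1" "- 2 + q + r + 2 = q + r" "q + p + 1 = p + q + 1" "r + p + 1 = p + r + 1" by simp_all
  show ?thesis
    using ins2_cobd_expand[OF g h mu_cochain f w, unfolded 5] ins2_cobd_expand[OF g h f mu_cochain w]
    unfolding cobd_def[of A "p + q + r + 2"] gerst_bracket_eq[of p "q + r"] 1 2 a 3 4
    by (simp add: koszul_norm algebra_simps)
qed

text \<open>The two values fill both places of \<open>mu\<close>, so no letter of \<open>w\<close>
  may remain outside the two segments.\<close>

lemma cup_eq:
  assumes f: "f \<in> cochains A p" and g: "g \<in> cochains A q"
  shows "cup q f g = (\<lambda>w. koszul (p + 1) (ins2 p f q g (mu A) w))"
proof
  fix w
  show "cup q f g w = koszul (p + 1) (ins2 p f q g (mu A) w)"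
  proof (cases "is_hword A w")
    case True
    let ?F = "\<lambda>a b c d e. koszul ((p + 1) * sdeg a + (q + 1) * (sdeg a + sdeg b + sdeg c)) (mu A (a @ letter p f b # c @ letter q g d # e))"
    have z: "?F a b c d e = 0" if "a \<noteq> [] \<or> c \<noteq> [] \<or> e \<noteq> []" for a b c d e
    proof -
      have "mu A (a @ letter p f b # c @ letter q g d # e) = 0"
        using that by (intro mu_long) (auto simp: neq_Nil_conv)
      then show ?thesis by simp
    qed
    have "ins2 p f q g (mu A) w = split4 w (?F [])"
      unfolding ins2_def split5_def by (rule split2_only_Nil_left) (simp only: z split4_zero simp_thms)
    also have "\<dots> = split2 w (\<lambda>b d. ?F [] b [] d [])"
      unfolding split4_def
    proof (rule split2_cong[OF refl])
      fix b r
      have "split3 r (?F [] b) = split2 r (?F [] b [])"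
        unfolding split3_def by (rule split2_only_Nil_left) (simp only: z split2_zero simp_thms)
      also have "\<dots> = ?F [] b [] r []"
        by (rule split2_only_Nil_right) (simp only: z simp_thms)
      finally show "split3 r (?F [] b) = ?F [] b [] r []" .
    qed
    also have "\<dots> = split2 w (\<lambda>b d. koszul (p + 1 + q * sdeg b) (f b * g d))"
      using True f g by (intro split2_cong refl) (simp add: letter_def koszul_norm)
    finally show ?thesis
      by (simp add: cup_def koszul_plus koszul_twice split_linear koszul_norm) (simp add: split2_def)
  next
    case False
    have "f (take j w) * g (drop j w) = 0" for j
      using False cochain_outside[OF f, of "take j w"] cochain_outside[OF g, of "drop j w"]
        is_hword_append[of A "take j w" "drop j w"] by auto
    then show ?thesis
      using cochain_outside[OF ins2_cochain[OF f g mu_cochain refl] False] by (simp add: cup_def)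
  qed
qed

lemma cup_cochain: "f \<in> cochains A p \<Longrightarrow> g \<in> cochains A q \<Longrightarrow> cup q f g \<in> cochains A (p + q)"
  using cochain_diff_koszul[OF zero_cochain ins2_cochain[OF _ _ mu_cochain], of f p g q "p + q" "p"]
  by (simp add: cup_eq koszul_plus koszul_1 koszul_uminus)

end

section \<open>Operators on chains\<close>

text \<open>The relations of all degrees together, so that congruences need no bookkeeping of degrees.\<close>

inductive_set chain_null :: "('k, 'a::ring) dga \<Rightarrow> ('a hword \<Rightarrow>\<^sub>0 int) set" for A where
  tensor: "c \<in> tensor_rel A N \<Longrightarrow> c \<in> chain_null A"
| minus: "c \<in> chain_null A \<Longrightarrow> d \<in> chain_null A \<Longrightarrow> c - d \<in> chain_null A"

lemma free_chains_zero: "0 \<in> free_chains A N"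
  by (simp add: free_chains_def)

lemma free_chains_diff: "c \<in> free_chains A N \<Longrightarrow> d \<in> free_chains A N \<Longrightarrow> c - d \<in> free_chains A N"
  unfolding free_chains_def using keys_diff[of c d] by auto

lemma free_chains_uminus: "c \<in> free_chains A N \<Longrightarrow> - c \<in> free_chains A N"
  using free_chains_diff[OF free_chains_zero] by fastforce

lemma free_chains_add: "c \<in> free_chains A N \<Longrightarrow> d \<in> free_chains A N \<Longrightarrow> c + d \<in> free_chains A N"
  using free_chains_diff[of c A N "- d"] free_chains_uminus[of d A N] by simp

lemma free_chains_koszul: "c \<in> free_chains A N \<Longrightarrow> koszul n c \<in> free_chains A N"
  by (simp add: koszul_def free_chains_uminus)

lemma free_chains_sum: "(\<And>i. i \<in> I \<Longrightarrow> F i \<in> free_chains A N) \<Longrightarrow> sum F I \<in> free_chains A N"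
  by (induction I rule: infinite_finite_induct) (auto intro: free_chains_add free_chains_zero)

lemma free_chains_split2: "(\<And>a b. w = a @ b \<Longrightarrow> F a b \<in> free_chains A N) \<Longrightarrow> split2 w F \<in> free_chains A N"
  unfolding split2_def by (rule free_chains_sum) simp

lemma free_chains_split3:
  "(\<And>a b c. w = a @ b @ c \<Longrightarrow> F a b c \<in> free_chains A N) \<Longrightarrow> split3 w F \<in> free_chains A N"
  unfolding split3_def by (intro free_chains_split2) auto

lemma free_chains_split4:
  "(\<And>a b c d. w = a @ b @ c @ d \<Longrightarrow> F a b c d \<in> free_chains A N) \<Longrightarrow> split4 w F \<in> free_chains A N"
  unfolding split4_def by (intro free_chains_split2 free_chains_split3) auto

lemma free_chains_split5:
  "(\<And>a b c d e. w = a @ b @ c @ d @ e \<Longrightarrow> F a b c d e \<in> free_chains A N) \<Longrightarrow> split5 w F \<in> free_chains A N"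
  unfolding split5_def by (intro free_chains_split2 free_chains_split4) auto

lemma free_chains_frag_of: "w \<noteq> [] \<Longrightarrow> is_hword A w \<Longrightarrow> sdeg w = N + 1 \<Longrightarrow> frag_of w \<in> free_chains A N"
  by (simp add: free_chains_def chain_words_def)

lemma free_chains_frag_extend:
  assumes "c \<in> free_chains A N" and "\<And>w. w \<in> chain_words A N \<Longrightarrow> F w \<in> free_chains A M"
  shows "frag_extend F c \<in> free_chains A M"
proof -
  from assms(1) have "Poly_Mapping.keys c \<subseteq> chain_words A N"
    by (simp add: free_chains_def)
  then show ?thesis
    by (induction rule: frag_induction) (auto simp: frag_extend_diff assms(2) intro: free_chains_diff free_chains_zero)
qed

lemma frag_extend_koszul: "frag_extend F (koszul n c) = koszul n (frag_extend F c)"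
  by (simp add: koszul_def frag_extend_minus)

lemma frag_extend_fun_diff: "frag_extend (\<lambda>w. F w - G w) c = frag_extend F c - frag_extend G c"
  using subset_UNIV by (induction c rule: frag_induction) (simp_all add: frag_extend_diff)

lemma frag_extend_fun_uminus: "frag_extend (\<lambda>w. - F w) c = - frag_extend F c"
  using subset_UNIV by (induction c rule: frag_induction) (simp_all add: frag_extend_diff)

lemma frag_extend_fun_add: "frag_extend (\<lambda>w. F w + G w) c = frag_extend F c + frag_extend G c"
  using subset_UNIV by (induction c rule: frag_induction) (simp_all add: frag_extend_diff)

lemma frag_extend_fun_koszul: "frag_extend (\<lambda>w. koszul n (F w)) c = koszul n (frag_extend F c)"
  by (simp add: koszul_def frag_extend_fun_uminus)

lemma frag_extend_comp: "frag_extend F (frag_extend G c) = frag_extend (\<lambda>w. frag_extend F (G w)) c"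
proof -
  have "Poly_Mapping.keys c \<subseteq> UNIV" by simp
  then show ?thesis
    by (induction rule: frag_induction) (auto simp: frag_extend_diff)
qed

lemmas frag_extend_split =
  split2_hom[of "frag_extend _", OF frag_extend_0 frag_extend_add]
  split3_hom[of "frag_extend _", OF frag_extend_0 frag_extend_add]
  split4_hom[of "frag_extend _", OF frag_extend_0 frag_extend_add]
  split5_hom[of "frag_extend _", OF frag_extend_0 frag_extend_add]

lemmas frag_extend_simps = frag_extend_split frag_extend_koszul frag_extend_add frag_extend_diff

lemma frag_extend_ops:
  "frag_extend H (ins p f frag_of w) = ins p f H w"
  "frag_extend H (lie p f frag_of m r) = lie p f H m r"
  "frag_extend H (cap p f q g frag_of m r) = cap p f q g H m r"
  "frag_extend H (slide p f frag_of m r) = slide p f H m r"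
  "frag_extend H (eval_front p f frag_of w) = eval_front p f H w"
  "frag_extend H (cyclic_norm frag_of m r) = cyclic_norm H m r"
  "frag_extend H (rot frag_of w) = rot H w"
  by (simp_all add: ins_def lie_def cap_def slide_def eval_front_def cyclic_norm_def rot_def frag_extend_simps)

section \<open>Chains modulo the tensor relations\<close>

context dg_algebra
begin

lemma tensor_rel_free: "c \<in> tensor_rel A N \<Longrightarrow> c \<in> free_chains A N"
proof (induction rule: tensor_rel.induct)
  case (additive u i x v y)
  then show ?case
    by (intro free_chains_diff free_chains_frag_of) (auto simp: chain_words_def homog_add)
next
  case (balanced u i x v j y w r)
  then show ?case
    by (intro free_chains_diff free_chains_frag_of) (auto simp: chain_words_def homog_scal)
qed (auto intro: free_chains_zero free_chains_diff)

lemma chain_null_zero: "0 \<in> chain_null A"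
  by (rule chain_null.tensor[OF tensor_rel.zero])

lemma chain_null_imp_tensor_rel:
  assumes "c \<in> chain_null A" and c: "c \<in> free_chains A N"
  shows "c \<in> tensor_rel A N"
proof -
  \<comment> \<open>Projection to the words of degree \<open>N\<close>: it fixes the relations of
    that degree, kills those of every other degree and respects differences.\<close>
  let ?P = "frag_extend (\<lambda>w. if w \<in> chain_words A N then frag_of w else 0)"
  have id: "?P d = d" if "d \<in> free_chains A N" for d
    using that unfolding free_chains_def
    by (subst (2) frag_expansion) (auto intro!: frag_extend_eq)
  have "?P c \<in> tensor_rel A N"
    using assms(1)
  proof (induction rule: chain_null.induct)
    case (tensor c M)
    show ?case
    proof (cases "M = N")
      case True
      with tensor id[OF tensor_rel_free] show ?thesis by auto
    next
      case False
      with tensor_rel_free[OF tensor] have "?P c = 0"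
        by (intro frag_extend_eq_0) (auto simp: free_chains_def chain_words_def)
      then show ?thesis by (simp add: tensor_rel.zero)
    qed
  qed (auto simp: frag_extend_diff intro: tensor_rel.minus)
  then show ?thesis
    by (simp add: id c)
qed

lemma tensor_rel_iff: "c \<in> tensor_rel A N \<longleftrightarrow> c \<in> chain_null A \<and> c \<in> free_chains A N"
  using chain_null.tensor chain_null_imp_tensor_rel tensor_rel_free by blast

lemma chain_scal_frag_of [simp]: "chain_scal A r (frag_of ((i, x) # w)) = frag_of ((i, scal A r x) # w)"
  by (simp add: chain_scal_def)

lemma chain_scal_diff: "chain_scal A r (c - d) = chain_scal A r c - chain_scal A r d"
  by (simp add: chain_scal_def frag_extend_diff)

lemma chain_scal_tensor_rel: "c \<in> tensor_rel A N \<Longrightarrow> chain_scal A r c \<in> tensor_rel A N"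
proof (induction rule: tensor_rel.induct)
  case zero
  show ?case by (simp add: chain_scal_def tensor_rel.zero)
next
  case (minus a b)
  then show ?case by (simp add: chain_scal_diff tensor_rel.minus)
next
  case (additive u i x v y)
  show ?case
  proof (cases u)
    case Nil
    with additive show ?thesis
      using tensor_rel.additive[of "[]" i "scal A r x" v A N "scal A r y"]
      by (auto simp: chain_scal_diff scal.scale_right_distrib chain_words_def homog_scal)
  next
    case (Cons c u')
    obtain k z where c: "c = (k, z)" by (cases c)
    from additive show ?thesis
      using tensor_rel.additive[of "(k, scal A r z) # u'" i x v A N y]
      by (auto simp: Cons c chain_scal_diff chain_words_def homog_scal)
  qed
next
  case (balanced u i x v j y w s)
  show ?case
  proof (cases u)
    case Nil
    with balanced show ?thesis
      using tensor_rel.balanced[of "[]" i "scal A r x" v j y w A N s]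
      by (auto simp: chain_scal_diff chain_words_def homog_scal mult.commute)
  next
    case (Cons c u')
    obtain k z where c: "c = (k, z)" by (cases c)
    from balanced show ?thesis
      using tensor_rel.balanced[of "(k, scal A r z) # u'" i x v j y w A N s]
      by (auto simp: Cons c chain_scal_diff chain_words_def homog_scal)
  qed
qed

sublocale chain: linear_target A "chain_scal A" "chain_null A"
proof unfold_locales
  show "chain_scal A r (x + y) = chain_scal A r x + chain_scal A r y" for r x y
    by (simp add: chain_scal_def frag_extend_add)
  show "chain_scal A r x \<in> chain_null A" if "x \<in> chain_null A" for r x
    using that
    by induction (auto simp: chain_scal_diff intro: chain_null.intros chain_scal_tensor_rel)
qed (auto intro: chain_null_zero chain_null.minus)

text \<open>Scalars act on the head by definition; from a later letter they are moved there by a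
  \<open>balanced\<close> relation.\<close>

lemma mult_linear_frag_of: "chain.mult_linear frag_of"
  unfolding mlin_words_iff
proof (intro allI impI conjI ballI)
  fix u i v x y assume "is_hword A u \<and> is_hword A v \<and> x \<in> homog A i" "y \<in> homog A i"
  then have "frag_of (u @ (i, x + y) # v) - frag_of (u @ (i, x) # v) - frag_of (u @ (i, y) # v)
      \<in> tensor_rel A (sdeg (u @ (i, x) # v) - 1)"
    by (intro tensor_rel.additive) (auto simp: chain_words_def)
  then show "frag_of (u @ (i, x + y) # v) - (frag_of (u @ (i, x) # v) + frag_of (u @ (i, y) # v)) \<in> chain_null A"
    by (auto simp: algebra_simps dest: chain_null.tensor)
next
  fix u i v x r assume *: "is_hword A u \<and> is_hword A v \<and> x \<in> homog A i"
  show "frag_of (u @ (i, scal A r x) # v) - chain_scal A r (frag_of (u @ (i, x) # v)) \<in> chain_null A"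
  proof (cases u)
    case Nil
    then show ?thesis by (simp add: chain_null_zero)
  next
    case (Cons c u')
    obtain k z where c: "c = (k, z)" by (cases c)
    have "frag_of ([] @ (k, scal A r z) # u' @ (i, x) # v) - frag_of ([] @ (k, z) # u' @ (i, scal A r x) # v)
      \<in> tensor_rel A (sdeg (u @ (i, x) # v) - 1)"
      using * by (intro tensor_rel.balanced) (auto simp: chain_words_def Cons c)
    from chain.null_uminus[OF chain_null.tensor[OF this]] show ?thesis
      by (simp add: Cons c)
  qed
qed

lemma frag_extend_eqv:
  assumes "c \<in> free_chains A N" and "\<And>w. w \<in> chain_words A N \<Longrightarrow> chain.eqv (F w) (G w)"
  shows "chain.eqv (frag_extend F c) (frag_extend G c)"
proof -
  from assms(1) have "Poly_Mapping.keys c \<subseteq> chain_words A N"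
    by (simp add: free_chains_def)
  then show ?thesis
    by (induction rule: frag_induction) (auto simp: frag_extend_diff assms(2) intro: chain.eqv_diff)
qed

text \<open>The universal property of the tensor product: for a \<open>balanced\<close> relation, a
  scalar in either letter can be pulled out to the same value of \<open>chain_scal\<close>.\<close>

lemma frag_extend_null:
  assumes F: "chain.mult_linear F" and c: "c \<in> chain_null A"
  shows "frag_extend F c \<in> chain_null A"
  using c
proof (induction rule: chain_null.induct)
  case (tensor c N)
  then show ?case
  proof (induction rule: tensor_rel.induct)
    case (additive u i x v y)
    then show ?case
      using F unfolding mlin_words_iff by (auto simp: frag_extend_diff frag_extend_add chain_words_def diff_diff_eq)
  next
    case (balanced u i x v j y w r)
    then have h: "is_hword A u" "is_hword A v" "is_hword A w" "x \<in> homog A i" "y \<in> homog A j"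
      by (auto simp: chain_words_def)
    have "chain.eqv (F (u @ (i, scal A r x) # v @ (j, y) # w)) (chain_scal A r (F (u @ (i, x) # v @ (j, y) # w)))"
      "chain.eqv (F ((u @ (i, x) # v) @ (j, scal A r y) # w)) (chain_scal A r (F ((u @ (i, x) # v) @ (j, y) # w)))"
      by (rule chain.slot_value_scale[OF F]; use h in simp)+
    from chain.eqv_trans[OF this(1) chain.eqv_sym[OF this(2)[simplified]]] show ?case
      by (simp add: frag_extend_diff chain.eqv_def)
  qed (auto simp: frag_extend_diff intro: chain_null.minus chain_null_zero)
qed (auto simp: frag_extend_diff intro: chain_null.minus)

lemma frag_extend_cong_eqv: "chain.mult_linear F \<Longrightarrow> chain.eqv c d \<Longrightarrow> chain.eqv (frag_extend F c) (frag_extend F d)"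
  using frag_extend_null[of F "c - d"] by (simp add: chain.eqv_def frag_extend_diff)

lemma frag_extend_chain_scal:
  assumes F: "chain.mult_linear F" and c: "c \<in> free_chains A N"
  shows "chain.eqv (frag_extend F (chain_scal A r c)) (chain_scal A r (frag_extend F c))"
proof -
  have "chain.eqv (frag_extend (\<lambda>w. frag_extend F (frag_of (hscal A r (hd w) # tl w))) c)
      (frag_extend (\<lambda>w. chain_scal A r (F w)) c)"
  proof (rule frag_extend_eqv[OF c])
    fix w assume "w \<in> chain_words A N"
    then obtain i x v where "w = (i, x) # v" "x \<in> homog A i" "is_hword A v"
      by (cases w) (auto simp: chain_words_def)
    then show "chain.eqv (frag_extend F (frag_of (hscal A r (hd w) # tl w))) (chain_scal A r (F w))"
      using F unfolding mlin_words_iff chain.eqv_def by (force dest: spec[of _ "[]"])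
  qed
  then show ?thesis
    by (simp add: chain_scal_def frag_extend_comp)
qed

end

section \<open>The operations on words extended to chains\<close>

definition lie_op where "lie_op p f = frag_extend (at_head (lie p f frag_of))"
definition cap_op where "cap_op p f q g = frag_extend (at_head (cap p f q g frag_of))"
definition slide_op where "slide_op p f = frag_extend (at_head (slide p f frag_of))"
definition front_op where "front_op p f = frag_extend (eval_front p f frag_of)"
definition ins_op where "ins_op p f = frag_extend (ins p f frag_of)"
definition norm_op where "norm_op = frag_extend (at_head (cyclic_norm frag_of))"
definition rot_op where "rot_op = frag_extend (rot frag_of)"
definition unit_op where "unit_op A = frag_extend (extra_degeneracy A)"

lemmas op_defs = lie_op_def cap_op_def slide_op_def front_op_def ins_op_def norm_op_def rot_op_def unit_op_def

lemma op_linear: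
  "lie_op p f (c - d) = lie_op p f c - lie_op p f d"
  "norm_op (c - d) = norm_op c - norm_op d"
  "rot_op (c - d) = rot_op c - rot_op d"
  "unit_op A (c - d) = unit_op A c - unit_op A d"
  "norm_op (c + d) = norm_op c + norm_op d"
  "rot_op (c + d) = rot_op c + rot_op d"
  "unit_op A (c + d) = unit_op A c + unit_op A d"
  "lie_op p f (- c) = - lie_op p f c"
  "front_op p f (- c) = - front_op p f c"
  "norm_op (- c) = - norm_op c"
  "rot_op (- c) = - rot_op c"
  "unit_op A (- c) = - unit_op A c"
  "lie_op p f (koszul n c) = koszul n (lie_op p f c)"
  "norm_op (koszul n c) = koszul n (norm_op c)"
  "rot_op (koszul n c) = koszul n (rot_op c)"
  "unit_op A (koszul n c) = koszul n (unit_op A c)"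
  by (simp_all add: op_defs frag_extend_diff frag_extend_add frag_extend_minus frag_extend_koszul)

context dg_algebra
begin

lemma chain_wordsE:
  assumes "w \<in> chain_words A N"
  obtains m r where "w = m # r" "is_hword A (m # r)" "sdeg (m # r) = N + 1"
  using assms by (cases w) (auto simp: chain_words_def)

lemmas free_intros = free_chains_add free_chains_diff free_chains_split2 free_chains_split3 free_chains_split4
  free_chains_split5 free_chains_koszul free_chains_frag_of

lemma
  assumes c: "c \<in> free_chains A N" and f: "f \<in> cochains A p"
  shows lie_op_free: "lie_op p f c \<in> free_chains A (N + p + 1)"
    and slide_op_free: "slide_op p f c \<in> free_chains A (N + p + 1)"
    and front_op_free: "front_op p f c \<in> free_chains A (N + p + 1)"
    and cap_op_free: "g \<in> cochains A q \<Longrightarrow> cap_op p f q g c \<in> free_chains A (N + p + q + 2)"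
proof -
  show "lie_op p f c \<in> free_chains A (N + p + 1)"
    unfolding op_defs using f
    by (intro free_chains_frag_extend[OF c], elim chain_wordsE) (auto simp: lie_def intro!: free_intros)
  show "slide_op p f c \<in> free_chains A (N + p + 1)"
    unfolding op_defs using f
    by (intro free_chains_frag_extend[OF c], elim chain_wordsE) (auto simp: slide_def intro!: free_intros)
  show "front_op p f c \<in> free_chains A (N + p + 1)"
    unfolding op_defs using f
    by (intro free_chains_frag_extend[OF c]) (auto simp: chain_words_def eval_front_def intro!: free_intros)
  show "cap_op p f q g c \<in> free_chains A (N + p + q + 2)" if "g \<in> cochains A q"
    unfolding op_defs using f that
    by (intro free_chains_frag_extend[OF c], elim chain_wordsE) (auto simp: cap_def intro!: free_intros)
qed

lemma
  assumes c: "c \<in> free_chains A N"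
  shows norm_op_free: "norm_op c \<in> free_chains A N"
    and rot_op_free: "rot_op c \<in> free_chains A N"
    and unit_op_free: "unit_op A c \<in> free_chains A (N + 1)"
proof -
  show "norm_op c \<in> free_chains A N"
    unfolding op_defs
    by (rule free_chains_frag_extend[OF c], erule chain_wordsE) (auto simp: cyclic_norm_def intro!: free_intros)
  show "unit_op A c \<in> free_chains A (N + 1)"
    unfolding op_defs
    by (rule free_chains_frag_extend[OF c], erule chain_wordsE)
      (auto simp: extra_degeneracy_def unity_homog intro!: free_intros)
  show "rot_op c \<in> free_chains A N"
    unfolding op_defs
  proof (rule free_chains_frag_extend[OF c])
    fix w assume w: "w \<in> chain_words A N"
    then obtain v l where "w = v @ [l]"
      by (cases w rule: rev_cases) (auto simp: chain_words_def)
    with w show "rot frag_of w \<in> free_chains A N"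
      by (auto simp: rot_def chain_words_def intro!: free_intros)
  qed
qed

lemma mult_linear_extra_degeneracy: "chain.mult_linear (extra_degeneracy A)"
  unfolding extra_degeneracy_def[abs_def]
  by (intro chain.mlin_slot[OF mult_linear_frag_of] slot_Cons slot_word) (simp add: unity_homog)

lemmas op_mlin = chain.mlin_lie chain.mlin_cap chain.mlin_slide chain.mlin_eval_front chain.mlin_ins
  chain.mlin_norm chain.mlin_rot mult_linear_extra_degeneracy mult_linear_frag_of

lemma
  assumes "chain.eqv c d"
  shows lie_op_cong: "f \<in> cochains A p \<Longrightarrow> chain.eqv (lie_op p f c) (lie_op p f d)"
    and cap_op_cong: "f \<in> cochains A p \<Longrightarrow> g \<in> cochains A q \<Longrightarrow> chain.eqv (cap_op p f q g c) (cap_op p f q g d)"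
    and slide_op_cong: "f \<in> cochains A p \<Longrightarrow> chain.eqv (slide_op p f c) (slide_op p f d)"
    and front_op_cong: "f \<in> cochains A p \<Longrightarrow> chain.eqv (front_op p f c) (front_op p f d)"
    and norm_op_cong: "chain.eqv (norm_op c) (norm_op d)"
    and rot_op_cong: "chain.eqv (rot_op c) (rot_op d)"
    and unit_op_cong: "chain.eqv (unit_op A c) (unit_op A d)"
  unfolding op_defs by (intro frag_extend_cong_eqv[OF _ assms] op_mlin; assumption)+

text \<open>Both differ by a sign from the operators of the theorem; \<open>chain_diff_eqv\<close>
  and \<open>action_op_eqv\<close> make the comparison.\<close>

abbreviation "D \<equiv> lie_op (- 2) (mu A)"
abbreviation "I p f \<equiv> cap_op (- 2) (mu A) p f"

lemma mu_mu_fun: "ins (- 2) (mu A) (mu A) = (\<lambda>w. 0)"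
  using mu_mu cochain_outside[OF ins_cochain[OF mu_cochain mu_cochain refl]] by blast

lemma chain_diff_word:
  assumes w: "is_hword A (m # r)"
  shows "chain.eqv (chain_d0 A (m # r) + chain_d1 (m # r)) (- lie (- 2) (mu A) frag_of m r)"
proof -
  \<comment> \<open>The head is carried along as a prefix, which makes the part of
    \<open>lie\<close> away from the head an instance of \<open>ins_mu_eqv\<close>.\<close>
  have G: "chain.mult_linear (\<lambda>v. frag_of (m # v))"
    using w by (intro chain.mlin_slot[OF mult_linear_frag_of] slot_Cons slot_word) simp
  have tail: "chain.eqv (split3 r (\<lambda>x v y. koszul ((- 2 + 1) * sdeg (m # x)) (frag_of (m # x @ letter (- 2) (mu A) v # y))))
     (koszul (sdeg [m]) ((\<Sum>i<length r. koszul (1 + sdeg (take i r)) (frag_of (m # diff_at A r i))) +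
      (\<Sum>i<length r - 1. koszul (sdeg (take (i + 1) r)) (frag_of (m # mult_at r i)))))"
  proof -
    have "split3 r (\<lambda>x v y. koszul ((- 2 + 1) * sdeg (m # x)) (frag_of (m # x @ letter (- 2) (mu A) v # y))) =
        koszul (sdeg [m]) (ins (- 2) (mu A) (\<lambda>v. frag_of (m # v)) r)"
      by (simp add: ins_def split_linear koszul_norm)
    then show ?thesis
      using w by (simp only: is_hword_Cons chain.eqv_koszul chain.ins_mu_eqv[OF G])
  qed
  let ?F = "\<lambda>x y z. koszul (sdeg z * sdeg (m # x @ y)) (frag_of (letter (- 2) (mu A) (z @ m # x) # y))"
  \<comment> \<open>The segment given to \<open>mu\<close> contains the head and has at most two
    letters: the head alone, the head with the first letter after it, or the last letter with the
    head.\<close>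
  have "chain.eqv (split3 r ?F) (split3 r (\<lambda>x y z. if length x + length z > 1 then 0 else ?F x y z))"
  proof (rule chain.eqv_split3)
    fix x y z assume "r = x @ y @ z"
    then have "chain.eqv (frag_of ([] @ (k, 0) # y)) 0" for k
      using w by (intro chain.slot_value_zero[OF mult_linear_frag_of]) auto
    from chain.eqv_koszul[OF this]
    show "chain.eqv (?F x y z) (if length x + length z > 1 then 0 else ?F x y z)"
      by (simp add: letter_def mu_long)
  qed
  also have "split3 r (\<lambda>x y z. if length x + length z > 1 then 0 else ?F x y z) =
      ?F [] r [] + (if r = [] then 0 else ?F [hd r] (tl r) [] + ?F [] (butlast r) [last r])"
    by (subst split3_corner) simp_all
  finally have 1: "chain.eqv (split3 r ?F) (?F [] r [] + (if r = [] then 0 else ?F [hd r] (tl r) [] + ?F [] (butlast r) [last r]))" .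
  have h1: "chain.eqv (?F [] r []) (- frag_of (hdiff A m # r))"
    using chain.slot_value_uminus[OF mult_linear_frag_of, of "[]" r "diff A (snd m)" "fst m - 1"] w
    by (cases m) (auto simp: letter_def)
  have h2: "chain.eqv (?F [hd r] (tl r) []) (koszul (fst m + 1) (frag_of (hmult m (hd r) # tl r)))" if "r \<noteq> []"
    using that chain.slot_value_koszul[OF mult_linear_frag_of, of "[]" "tl r" "snd m * snd (hd r)" "fst m + fst (hd r)" "fst m + 1"] w
    by (cases r; cases m; cases "hd r") (auto simp: letter_def algebra_simps)
  have h3: "chain.eqv (?F [] (butlast r) [last r])
      (koszul (sdeg [last r] * sdeg (m # butlast r)) (koszul (fst (last r) + 1) (frag_of (hmult (last r) m # butlast r))))" if "r \<noteq> []"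
    using that chain.slot_value_koszul[OF mult_linear_frag_of, of "[]" "butlast r" "snd (last r) * snd m" "fst (last r) + fst m" "fst (last r) + 1"] w
    by (cases r rule: rev_cases; cases m; cases "last r") (auto simp: letter_def algebra_simps intro!: chain.eqv_koszul)
  have head: "chain.eqv (split3 r ?F) (- frag_of (hdiff A m # r) + (if r = [] then 0 else koszul (fst m + 1) (frag_of (hmult m (hd r) # tl r))
     + koszul (sdeg [last r] * sdeg (m # butlast r)) (koszul (fst (last r) + 1) (frag_of (hmult (last r) m # butlast r)))))"
    using h1 h2 h3 by (intro chain.eqv_trans[OF 1] chain.eqv_add) (auto intro!: chain.eqv_add simp del: sdeg_Cons)
  have eq: "chain_d0 A (m # r) + chain_d1 (m # r) =
      - (koszul (sdeg [m]) ((\<Sum>i<length r. koszul (1 + sdeg (take i r)) (frag_of (m # diff_at A r i))) +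
      (\<Sum>i<length r - 1. koszul (sdeg (take (i + 1) r)) (frag_of (m # mult_at r i))))
      + (- frag_of (hdiff A m # r) + (if r = [] then 0 else koszul (fst m + 1) (frag_of (hmult m (hd r) # tl r))
     + koszul (sdeg [last r] * sdeg (m # butlast r)) (koszul (fst (last r) + 1) (frag_of (hmult (last r) m # butlast r))))))"
    by (cases r) (simp_all add: koszul_norm koszul_sum sum_negf algebra_simps)
  show ?thesis
    unfolding eq lie_def by (intro chain.eqv_uminus chain.eqv_add chain.eqv_sym[OF tail] chain.eqv_sym[OF head])
qed

lemma chain_diff_eqv: "c \<in> free_chains A N \<Longrightarrow> chain.eqv (chain_diff A c) (- D c)"
  unfolding chain_diff_def lie_op_def frag_extend_fun_uminus[symmetric]
  by (rule frag_extend_eqv) (auto elim!: chain_wordsE simp del: chain_d0.simps chain_d1.simps intro!: chain_diff_word)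

text \<open>A zero cochain still inserts a letter, with content 0, and such a word need not be zero
  in the free group. Additivity applied to \<open>0 - 0\<close> shows that the result is
  null.\<close>

lemma cap_zero: "chain.mult_linear G \<Longrightarrow> is_hword A (m # r) \<Longrightarrow> g \<in> cochains A q \<Longrightarrow> chain.eqv (cap p (\<lambda>w. 0) q g G m r) 0"
  using chain.cap_letter_diff1[OF _ _ zero_cochain zero_cochain, of G m r g q p 0] by simp

lemma cap_zero2: "chain.mult_linear G \<Longrightarrow> is_hword A (m # r) \<Longrightarrow> f \<in> cochains A p \<Longrightarrow> chain.eqv (cap p f q (\<lambda>w. 0) G m r) 0"
  using chain.cap_letter_diff2[OF _ _ zero_cochain zero_cochain, of G m r f p q 0] by simp

lemma cap_cobd2:
  assumes G: "chain.mult_linear G" "is_hword A (m # r)" and f: "f \<in> cochains A p" and g: "g \<in> cochains A q"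
  shows "chain.eqv (cap p f (q - 1) (cobd A q g) G m r)
    (cap_nest2 p f (- 2) (mu A) q g G m r - koszul (q + 1) (cap_nest2 p f q g (- 2) (mu A) G m r))"
proof -
  have "chain.eqv (cap p f (q - 1) (cobd A q g) G m r)
      (cap p f (q - 1) (ins q g (mu A)) G m r - koszul (q + 1) (cap p f (q - 1) (ins (- 2) (mu A) g) G m r))"
    unfolding cobd_def by (rule chain.cap_letter_diff2[OF G]) (auto intro!: ins_cochain[OF g mu_cochain] ins_cochain[OF mu_cochain g] f)
  also have "chain.eqv \<dots> (cap_nest2 p f (- 2) (mu A) q g G m r - koszul (q + 1) (cap_nest2 p f q g (- 2) (mu A) G m r))"
    by (intro chain.eqv_diff chain.eqv_koszul chain.cap_comp2[OF G] f g mu_cochain) auto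
  finally show ?thesis .
qed

text \<open>\<open>cap_lie\<close> with \<open>mu\<close> for both \<open>f\<close> and
  \<open>h\<close>: the outer terms cancel, \<open>mu\<close> inside \<open>mu\<close> vanishes, and
  the terms with \<open>mu\<close> around or inside \<open>g\<close> make up
  \<open>cobd A q g\<close>.\<close>

lemma D_I:
  assumes g: "g \<in> cochains A q" and c: "c \<in> free_chains A N"
  shows "chain.eqv (D (I q g c)) (- koszul (q + 1) (I q g (D c)) - I (q - 1) (cobd A q g) c)"
proof -
  have "chain.eqv (cap (- 2) (mu A) q g (at_head (lie (- 2) (mu A) frag_of)) m r)
      (- koszul (q + 1) (lie (- 2) (mu A) (at_head (cap (- 2) (mu A) q g frag_of)) m r)
        - cap (- 2) (mu A) (q - 1) (cobd A q g) frag_of m r)" if w: "is_hword A (m # r)" for m r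
  proof -
    note G = mult_linear_frag_of w
    have 0: "chain.eqv (cap_nest1 (- 2) (mu A) (- 2) (mu A) q g frag_of m r) 0"
      using chain.eqv_trans[OF chain.eqv_sym[OF chain.cap_comp1[OF G mu_cochain mu_cochain g refl]] cap_zero[OF G g, folded mu_mu_fun]] .
    have "cap (- 2) (mu A) q g (at_head (lie (- 2) (mu A) frag_of)) m r = cap_nest1 (- 2) (mu A) (- 2) (mu A) q g frag_of m r
       + (- koszul (q + 1) (lie (- 2) (mu A) (at_head (cap (- 2) (mu A) q g frag_of)) m r)
       - (cap_nest2 (- 2) (mu A) (- 2) (mu A) q g frag_of m r - koszul (q + 1) (cap_nest2 (- 2) (mu A) q g (- 2) (mu A) frag_of m r)))"
      using cap_lie[of "- 2" "mu A" "- 2" "mu A" q g frag_of m r] by (simp add: koszul_norm algebra_simps)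
    also have "chain.eqv \<dots> (0 + (- koszul (q + 1) (lie (- 2) (mu A) (at_head (cap (- 2) (mu A) q g frag_of)) m r)
        - cap (- 2) (mu A) (q - 1) (cobd A q g) frag_of m r))"
      by (intro chain.eqv_add chain.eqv_diff chain.eqv_refl 0 chain.eqv_sym[OF cap_cobd2[OF G mu_cochain g]])
    finally show ?thesis by simp
  qed
  then have "chain.eqv (frag_extend (at_head (cap (- 2) (mu A) q g (at_head (lie (- 2) (mu A) frag_of)))) c)
      (frag_extend (\<lambda>w. - koszul (q + 1) (at_head (lie (- 2) (mu A) (at_head (cap (- 2) (mu A) q g frag_of))) w)
        - at_head (cap (- 2) (mu A) (q - 1) (cobd A q g) frag_of) w) c)"
    by (intro frag_extend_eqv[OF c]) (auto elim!: chain_wordsE)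
  then show ?thesis
    by (simp add: op_defs frag_extend_comp frag_extend_ops frag_extend_fun_diff frag_extend_fun_uminus frag_extend_fun_koszul)
qed

text \<open>\<open>cap_lie\<close> is used twice, with the roles of \<open>f\<close> and
  \<open>mu\<close> interchanged. The outer terms cancel between the two instances, composites of
  \<open>mu\<close> with \<open>f\<close> or \<open>g\<close> drop out because both are cocycles,
  and \<open>cap_op p f q g\<close> is left as the homotopy.\<close>

lemma I_gerst_bracket:
  assumes f: "f \<in> cochains A p" and g: "g \<in> cochains A q" and c: "c \<in> free_chains A N"
    and cf: "cobd A p f = (\<lambda>w. 0)" and cg: "cobd A q g = (\<lambda>w. 0)"
  shows "chain.eqv (I (p + q + 1) (gerst_bracket p q f g) c)
    (koszul (p + 1) (lie_op p f (I q g c)) - koszul ((p + 1) * (q + 1)) (I q g (lie_op p f c))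
      + koszul (p + q) (cap_op p f q g (D c)) - D (cap_op p f q g c))"
proof -
  have "chain.eqv (cap (- 2) (mu A) (p + q + 1) (gerst_bracket p q f g) frag_of m r)
     (koszul (p + 1) (cap (- 2) (mu A) q g (at_head (lie p f frag_of)) m r)
      - koszul ((p + 1) * (q + 1)) (lie p f (at_head (cap (- 2) (mu A) q g frag_of)) m r)
      + koszul (p + q) (lie (- 2) (mu A) (at_head (cap p f q g frag_of)) m r)
      - cap p f q g (at_head (lie (- 2) (mu A) frag_of)) m r)" (is "chain.eqv _ ?R") if w: "is_hword A (m # r)" for m r
  proof -
    note G = mult_linear_frag_of w
    let ?N1 = "cap_nest1 (- 2) (mu A) p f q g frag_of m r" and ?N2 = "cap_nest1 p f (- 2) (mu A) q g frag_of m r"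
      and ?Z1 = "cap_nest2 p f (- 2) (mu A) q g frag_of m r" and ?Z2 = "cap_nest2 p f q g (- 2) (mu A) frag_of m r"
    have 1: "chain.eqv (?N1 - koszul (p + 1) ?N2) 0"
    proof -
      have "chain.eqv (?N1 - koszul (p + 1) ?N2)
          (cap (p - 1) (ins p f (mu A)) q g frag_of m r - koszul (p + 1) (cap (p - 1) (ins (- 2) (mu A) f) q g frag_of m r))"
        by (intro chain.eqv_diff chain.eqv_koszul chain.eqv_sym[OF chain.cap_comp1[OF G]] f g mu_cochain) auto
      also have "chain.eqv \<dots> (cap (p - 1) (cobd A p f) q g frag_of m r)"
        unfolding cobd_def
        by (rule chain.eqv_sym[OF chain.cap_letter_diff1[OF G]]) (auto intro!: ins_cochain[OF f mu_cochain] ins_cochain[OF mu_cochain f] g)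
      also have "chain.eqv \<dots> 0"
        unfolding cf by (rule cap_zero[OF G g])
      finally show ?thesis .
    qed
    have 2: "chain.eqv (?Z1 - koszul (q + 1) ?Z2) 0"
      using chain.eqv_trans[OF chain.eqv_sym[OF cap_cobd2[OF G f g]]] cap_zero2[OF G f] unfolding cg by blast
    have "chain.eqv (cap (- 2) (mu A) (p + q + 1) (gerst_bracket p q f g) frag_of m r)
        (cap (- 2) (mu A) (p + q + 1) (ins q g f) frag_of m r - koszul ((p + 1) * (q + 1)) (cap (- 2) (mu A) (p + q + 1) (ins p f g) frag_of m r))"
      unfolding gerst_bracket_eq by (rule chain.cap_letter_diff2[OF G]) (auto intro!: ins_cochain[OF f g] ins_cochain[OF g f] mu_cochain)
    also have "chain.eqv \<dots> (cap_nest2 (- 2) (mu A) p f q g frag_of m r - koszul ((p + 1) * (q + 1)) (cap_nest2 (- 2) (mu A) q g p f frag_of m r))"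
      by (intro chain.eqv_diff chain.eqv_koszul chain.cap_comp2[OF G] f g mu_cochain) auto
    also have "\<dots> = (?N1 - koszul (p + 1) ?N2) + koszul (p + 1) (?Z1 - koszul (q + 1) ?Z2) + ?R"
      using cap_lie[of "- 2" "mu A" p f q g frag_of m r] cap_lie[of p f "- 2" "mu A" q g frag_of m r]
      by (simp add: koszul_norm)
    also have "chain.eqv \<dots> (0 + koszul (p + 1) 0 + ?R)"
      by (intro chain.eqv_add chain.eqv_koszul chain.eqv_refl 1 2)
    finally show ?thesis by simp
  qed
  then have "chain.eqv (I (p + q + 1) (gerst_bracket p q f g) c)
     (frag_extend (\<lambda>w. koszul (p + 1) (at_head (cap (- 2) (mu A) q g (at_head (lie p f frag_of))) w)
      - koszul ((p + 1) * (q + 1)) (at_head (lie p f (at_head (cap (- 2) (mu A) q g frag_of))) w)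
      + koszul (p + q) (at_head (lie (- 2) (mu A) (at_head (cap p f q g frag_of))) w)
      - at_head (cap p f q g (at_head (lie (- 2) (mu A) frag_of))) w) c)"
    unfolding cap_op_def by (intro frag_extend_eqv[OF c]) (auto elim!: chain_wordsE)
  then show ?thesis
    by (simp add: op_defs frag_extend_comp frag_extend_ops frag_extend_fun_diff frag_extend_fun_add frag_extend_fun_koszul)
qed

lemma slide_zero: "chain.mult_linear G \<Longrightarrow> is_hword A (m # r) \<Longrightarrow> chain.eqv (slide p (\<lambda>w. 0) G m r) 0"
  using chain.slide_letter_diff[OF _ _ zero_cochain zero_cochain, of G m r p 0] by simp

lemma front_zero: "chain.mult_linear G \<Longrightarrow> is_hword A w \<Longrightarrow> chain.eqv (eval_front p (\<lambda>w. 0) G w) 0"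
  using chain.eval_front_letter_diff[OF _ _ zero_cochain zero_cochain, of G w p 0] by simp

text \<open>This lemma and \<open>D_front\<close> are the two halves of Cartan's formula: one
  produces the norm of \<open>I p f\<close>, the other \<open>I p f\<close> on the image of
  \<open>1 - t\<close>.\<close>

lemma ins_slide_op:
  assumes f: "f \<in> cochains A p" and c: "c \<in> free_chains A N" and cf: "cobd A p f = (\<lambda>w. 0)"
  shows "chain.eqv (ins_op (- 2) (mu A) (slide_op p f c)) (koszul (p + 1) (slide_op p f (D c)) + norm_op (I p f c))"
proof -
  have "chain.eqv (slide p f (ins (- 2) (mu A) frag_of) m r)
     (koszul (p + 1) (lie (- 2) (mu A) (at_head (slide p f frag_of)) m r) + cap (- 2) (mu A) p f (at_head (cyclic_norm frag_of)) m r)"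
     (is "chain.eqv _ (?a + ?b)") if w: "is_hword A (m # r)" for m r
  proof -
    note G = mult_linear_frag_of w
    let ?N1 = "slide_nest (- 2) (mu A) p f frag_of m r" and ?N2 = "slide_nest p f (- 2) (mu A) frag_of m r"
    have "chain.eqv (?N1 - koszul (p + 1) ?N2) (slide (p - 1) (ins p f (mu A)) frag_of m r - koszul (p + 1) (slide (p - 1) (ins (- 2) (mu A) f) frag_of m r))"
      by (intro chain.eqv_diff chain.eqv_koszul chain.eqv_sym[OF chain.slide_comp[OF G]] f mu_cochain) auto
    also have "chain.eqv \<dots> (slide (p - 1) (cobd A p f) frag_of m r)"
      unfolding cobd_def
      by (rule chain.eqv_sym[OF chain.slide_letter_diff[OF G]]) (auto intro!: ins_cochain[OF f mu_cochain] ins_cochain[OF mu_cochain f])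
    also have "chain.eqv \<dots> 0"
      unfolding cf by (rule slide_zero[OF G])
    finally have "chain.eqv ((?N1 - koszul (p + 1) ?N2) + (?a + ?b)) (0 + (?a + ?b))"
      by (rule chain.eqv_add) simp
    then show ?thesis
      unfolding slide_ins[of p f "- 2"] by (simp add: koszul_norm algebra_simps)
  qed
  then have "chain.eqv (frag_extend (at_head (slide p f (ins (- 2) (mu A) frag_of))) c)
     (frag_extend (\<lambda>w. koszul (p + 1) (at_head (lie (- 2) (mu A) (at_head (slide p f frag_of))) w)
        + at_head (cap (- 2) (mu A) p f (at_head (cyclic_norm frag_of))) w) c)"
    by (intro frag_extend_eqv[OF c]) (auto elim!: chain_wordsE)
  then show ?thesis
    by (simp add: op_defs frag_extend_comp frag_extend_ops frag_extend_fun_add frag_extend_fun_koszul)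
qed

lemma D_front:
  assumes f: "f \<in> cochains A p" and c: "c \<in> free_chains A N" and cf: "cobd A p f = (\<lambda>w. 0)"
  shows "chain.eqv (D (front_op p f c)) (koszul (p + 1) (front_op p f (ins_op (- 2) (mu A) c)) - I p f (c - rot_op c))"
proof -
  have "chain.eqv (eval_front p f (at_head (lie (- 2) (mu A) frag_of)) w)
     (koszul (p + 1) (ins (- 2) (mu A) (eval_front p f frag_of) w)
      - (at_head (cap (- 2) (mu A) p f frag_of) w - rot (at_head (cap (- 2) (mu A) p f frag_of)) w))"
     (is "chain.eqv _ (?a - ?b)") if w: "is_hword A w" "w \<noteq> []" for w
  proof -
    note G = mult_linear_frag_of w(1)
    let ?N1 = "eval_front_nest (- 2) (mu A) p f frag_of w" and ?N2 = "eval_front_nest p f (- 2) (mu A) frag_of w"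
    have "chain.eqv (?N1 - koszul (p + 1) ?N2) (eval_front (p - 1) (ins p f (mu A)) frag_of w - koszul (p + 1) (eval_front (p - 1) (ins (- 2) (mu A) f) frag_of w))"
      by (intro chain.eqv_diff chain.eqv_koszul chain.eqv_sym[OF chain.eval_front_comp[OF G]] f mu_cochain) auto
    also have "chain.eqv \<dots> (eval_front (p - 1) (cobd A p f) frag_of w)"
      unfolding cobd_def
      by (rule chain.eqv_sym[OF chain.eval_front_letter_diff[OF G]]) (auto intro!: ins_cochain[OF f mu_cochain] ins_cochain[OF mu_cochain f])
    also have "chain.eqv \<dots> 0"
      unfolding cf by (rule front_zero[OF G])
    finally have "chain.eqv ((?N1 - koszul (p + 1) ?N2) + (?a - ?b)) (0 + (?a - ?b))"
      by (rule chain.eqv_add) simp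
    then show ?thesis
      unfolding eval_front_lie[OF w(2), of p f "- 2"] by (simp add: koszul_norm algebra_simps)
  qed
  then have "chain.eqv (frag_extend (eval_front p f (at_head (lie (- 2) (mu A) frag_of))) c)
     (frag_extend (\<lambda>w. koszul (p + 1) (ins (- 2) (mu A) (eval_front p f frag_of) w)
      - (at_head (cap (- 2) (mu A) p f frag_of) w - rot (at_head (cap (- 2) (mu A) p f frag_of)) w)) c)"
    by (intro frag_extend_eqv[OF c]) (auto simp: chain_words_def)
  then show ?thesis
    by (simp add: op_defs frag_extend_comp frag_extend_ops frag_extend_fun_diff frag_extend_fun_koszul frag_extend_diff)
qed

section \<open>Relations between the differential, rotation, norm and unit\<close>

lemma front_norm:
  assumes c: "c \<in> free_chains A N"
  shows "front_op p f (norm_op c) = lie_op p f c - (slide_op p f c - rot_op (slide_op p f c))"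
proof -
  have "frag_extend (at_head (cyclic_norm (eval_front p f frag_of))) c =
      frag_extend (\<lambda>w. at_head (lie p f frag_of) w - (at_head (slide p f frag_of) w - at_head (slide p f (rot frag_of)) w)) c"
    by (rule frag_extend_eq) (simp add: norm_eval_front, simp add: slide_def koszul_diff split_linear)
  then show ?thesis
    by (simp add: op_defs frag_extend_comp frag_extend_ops frag_extend_fun_diff)
qed

lemma norm_D: "norm_op (D c) = ins_op (- 2) (mu A) (norm_op c)"
  by (simp add: op_defs frag_extend_comp frag_extend_ops lie_norm)

lemma rot_norm: "rot_op (norm_op c) = norm_op c"
  by (simp add: op_defs frag_extend_comp frag_extend_ops norm_rot)

lemma norm_rot_op:
  assumes c: "c \<in> free_chains A N"
  shows "norm_op (rot_op c) = norm_op c"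
proof -
  have "frag_extend (rot (at_head (cyclic_norm frag_of))) c = frag_extend (at_head (cyclic_norm frag_of)) c"
    using c by (intro frag_extend_eq norm_at_rot[symmetric]) (auto simp: free_chains_def chain_words_def)
  then show ?thesis
    by (simp add: op_defs frag_extend_comp frag_extend_ops)
qed

lemma D_rot:
  assumes c: "c \<in> free_chains A N"
  shows "D (c - rot_op c) = ins_op (- 2) (mu A) c - rot_op (ins_op (- 2) (mu A) c)"
proof -
  have "frag_extend (\<lambda>w. at_head (lie (- 2) (mu A) frag_of) w - rot (at_head (lie (- 2) (mu A) frag_of)) w) c =
      frag_extend (\<lambda>w. ins (- 2) (mu A) frag_of w - ins (- 2) (mu A) (rot frag_of) w) c"
  proof (rule frag_extend_eq)
    fix w assume "w \<in> Poly_Mapping.keys c"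
    with c have "w \<noteq> []" by (auto simp: free_chains_def chain_words_def)
    then show "at_head (lie (- 2) (mu A) frag_of) w - rot (at_head (lie (- 2) (mu A) frag_of)) w =
        ins (- 2) (mu A) frag_of w - ins (- 2) (mu A) (rot frag_of) w"
      by (simp add: lie_rot) (simp add: ins_def koszul_diff split_linear)
  qed
  then show ?thesis
    by (simp add: op_defs frag_extend_comp frag_extend_ops frag_extend_fun_diff frag_extend_diff)
qed

text \<open>Differentiating \<open>1 * 1 = 1\<close> gives \<open>d 1 + d 1 = d 1\<close>.\<close>

lemma diff_unity: "diff A (unity A) = 0"
  using diff_mult[OF unity_homog, of "unity A"] by (simp add: unity_left unity_right koszul_def)

text \<open>A unit in front is a contracting homotopy for the acyclic operator \<open>b'\<close>.
  The term \<open>- c\<close> comes from \<open>mu [1, m] = - m\<close>; the unit alone contributes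
  nothing because its differential is 0, and longer segments starting with it exceed the arity of
  \<open>mu\<close>.\<close>

lemma ins_unit_op:
  assumes c: "c \<in> free_chains A N"
  shows "chain.eqv (ins_op (- 2) (mu A) (unit_op A c)) (- c - unit_op A (ins_op (- 2) (mu A) c))"
proof -
  let ?u = "(0 :: int, unity A)"
  have "chain.eqv (ins (- 2) (mu A) frag_of (?u # w)) (- frag_of w - ins (- 2) (mu A) (extra_degeneracy A) w)"
    if w: "is_hword A w" "w \<noteq> []" for w
  proof -
    obtain m r where mr: "w = m # r" using w by (cases w) auto
    let ?F = "\<lambda>u v x. koszul ((- 2 + 1) * sdeg u) (frag_of (u @ letter (- 2) (mu A) v # x))"
    have z: "chain.eqv (?F [] v x) 0" if "mu A v = 0" "is_hword A x" for v x
      using chain.slot_value_zero[OF mult_linear_frag_of _ that(2), of "[]"] that(1) by (simp add: letter_def)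
    have "chain.eqv (split2 w (\<lambda>a b. ?F [] (?u # a) b)) (split2 w (\<lambda>a b. if length a = 1 then ?F [] (?u # a) b else 0))"
    proof (rule chain.eqv_split2)
      fix a b assume ab: "w = a @ b"
      show "chain.eqv (?F [] (?u # a) b) (if length a = 1 then ?F [] (?u # a) b else 0)"
      proof (cases "length a = 1")
        case False
        then have "mu A (?u # a) = 0"
          by (cases "a = []") (auto simp: unity_homog diff_unity neq_Nil_conv)
        with z[of "?u # a" b] False w ab show ?thesis by auto
      qed simp
    qed
    also have "split2 w (\<lambda>a b. if length a = 1 then ?F [] (?u # a) b else 0) = ?F [] [?u, m] r"
      unfolding mr split2_Cons by (subst split2_only_Nil_left) auto
    also have "chain.eqv \<dots> (- frag_of w)"
      using chain.slot_value_uminus[OF mult_linear_frag_of, of "[]" r "snd m" "fst m"] w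
      by (cases m) (auto simp: mr letter_def unity_homog unity_left koszul_1)
    finally have 1: "chain.eqv (split2 w (\<lambda>a b. ?F [] (?u # a) b)) (- frag_of w)" .
    have "ins (- 2) (mu A) frag_of (?u # w) = ?F [] [] (?u # w) + split2 w (\<lambda>a b. ?F [] (?u # a) b) + split3 w (\<lambda>a. ?F (?u # a))"
      unfolding ins_def split3_def by (simp add: split2_Cons)
    also have "split3 w (\<lambda>a. ?F (?u # a)) = - ins (- 2) (mu A) (extra_degeneracy A) w"
      by (simp add: ins_def extra_degeneracy_def split_linear koszul_norm)
    also have "chain.eqv (?F [] [] (?u # w) + split2 w (\<lambda>a b. ?F [] (?u # a) b) + - ins (- 2) (mu A) (extra_degeneracy A) w)
        (0 + - frag_of w + - ins (- 2) (mu A) (extra_degeneracy A) w)"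
      using w by (intro chain.eqv_add 1 z chain.eqv_refl) (simp_all add: unity_homog)
    finally show ?thesis by simp
  qed
  then have "chain.eqv (frag_extend (\<lambda>w. ins (- 2) (mu A) frag_of (?u # w)) c)
      (frag_extend (\<lambda>w. - frag_of w - ins (- 2) (mu A) (extra_degeneracy A) w) c)"
    by (intro frag_extend_eqv[OF c]) (auto simp: chain_words_def)
  then show ?thesis
    by (simp add: op_defs frag_extend_comp frag_extend_ops frag_extend_fun_diff frag_extend_fun_uminus
        extra_degeneracy_def[of A "_"] flip: frag_expansion)
qed

end

section \<open>Connes' boundary and the action\<close>

definition connes_op where
  "connes_op A c = unit_op A (norm_op c) - rot_op (unit_op A (norm_op c))"

definition action_op where "action_op p f = frag_extend (action_word p f)"

lemma action_word_Cons:
  "action_word p f (m # r) = split2 r (\<lambda>a b. koszul (fst m * p) (frag_of ((fst m + (sdeg a + p), snd m * f a) # b)))"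
  by (cases m) (simp add: split2_def)

lemma connes_op_linear:
  "connes_op A (c - d) = connes_op A c - connes_op A d"
  "connes_op A (c + d) = connes_op A c + connes_op A d"
  "connes_op A (koszul n c) = koszul n (connes_op A c)"
  by (simp_all add: connes_op_def op_linear koszul_diff)

lemma action_op_linear:
  "action_op p f (c - d) = action_op p f c - action_op p f d"
  "action_op p f (c + d) = action_op p f c + action_op p f d"
  "action_op p f (koszul n c) = koszul n (action_op p f c)"
  by (simp_all add: action_op_def frag_extend_diff frag_extend_add frag_extend_minus frag_extend_koszul)

lemma cyc_norm_Cons: "cyc_norm (m # r) = cyclic_norm frag_of m r"
proof -
  have "cyc_norm (m # r) = koszul 0 (frag_of (m # r)) +
      (\<Sum>i<length r. koszul (sdeg (take (Suc i) (m # r)) * sdeg (drop (Suc i) (m # r))) (frag_of (drop (Suc i) (m # r) @ take (Suc i) (m # r))))"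
    unfolding cyc_norm_def by (simp add: sum.lessThan_Suc_shift del: sum.lessThan_Suc)
  also have "\<dots> = cyclic_norm frag_of m r"
    unfolding cyclic_norm_def split2_def by (simp add: lessThan_Suc_atMost[symmetric] lessThan_Suc mult.commute)
  finally show ?thesis .
qed

lemma connes_op_zero [simp]: "connes_op A 0 = 0"
  by (simp add: connes_op_def op_defs)

context dg_algebra
begin

lemma mult_cochain_homog [simp]:
  "f \<in> cochains A p \<Longrightarrow> x \<in> homog A i \<Longrightarrow> is_hword A w \<Longrightarrow> n = i + (sdeg w + p) \<Longrightarrow> x * f w \<in> homog A n"
  using mult_homog[of x i "f w" "sdeg w + p"] by simp

lemma connes_chain_eq:
  assumes c: "c \<in> free_chains A N"
  shows "connes_chain A c = connes_op A c"
proof -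
  have "frag_extend cyc_norm c = norm_op c"
    unfolding norm_op_def
  proof (rule frag_extend_eq)
    fix w assume "w \<in> Poly_Mapping.keys c"
    with c have "w \<in> chain_words A N" by (auto simp: free_chains_def)
    then show "cyc_norm w = at_head (cyclic_norm frag_of) w"
      by (auto elim!: chain_wordsE simp: cyc_norm_Cons)
  qed
  moreover have "cyc_rotate = (rot frag_of :: 'a hword \<Rightarrow> _)"
    by (rule ext) (simp add: cyc_rotate_def rot_def)
  ultimately show ?thesis
    by (simp add: connes_chain_def connes_op_def rot_op_def unit_op_def Let_def)
qed

lemma connes_op_free: "c \<in> free_chains A N \<Longrightarrow> connes_op A c \<in> free_chains A (N + 1)"
  unfolding connes_op_def by (intro free_chains_diff rot_op_free unit_op_free norm_op_free)

lemma connes_op_cong: "chain.eqv c d \<Longrightarrow> chain.eqv (connes_op A c) (connes_op A d)"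
  unfolding connes_op_def by (intro chain.eqv_diff rot_op_cong unit_op_cong norm_op_cong)

lemma connes_op_connes_op:
  assumes c: "c \<in> free_chains A N"
  shows "connes_op A (connes_op A c) = 0"
proof -
  let ?u = "unit_op A (norm_op c)"
  have "norm_op (?u - rot_op ?u) = 0"
    using norm_rot_op[OF unit_op_free[OF norm_op_free[OF c]]] by (simp add: op_linear)
  then show ?thesis
    by (simp add: connes_op_def unit_op_def rot_op_def)
qed

lemma rot_diff_cong: "chain.eqv c d \<Longrightarrow> chain.eqv (c - rot_op c) (d - rot_op d)"
  by (intro chain.eqv_diff rot_op_cong)

text \<open>With \<open>D\<close> as \<open>b\<close>: first
  \<open>b (1 - t) s N = (1 - t) b' s N\<close>, then \<open>b' s = - 1 - s b'\<close>. The term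
  \<open>(1 - t) N\<close> vanishes, and \<open>b' N = N b\<close> finishes.\<close>

lemma D_connes_op:
  assumes c: "c \<in> free_chains A N"
  shows "chain.eqv (D (connes_op A c)) (- connes_op A (D c))"
proof -
  have n: "norm_op c \<in> free_chains A N"
    by (rule norm_op_free[OF c])
  have "D (connes_op A c) = ins_op (- 2) (mu A) (unit_op A (norm_op c)) - rot_op (ins_op (- 2) (mu A) (unit_op A (norm_op c)))"
    unfolding connes_op_def by (rule D_rot[OF unit_op_free[OF n]])
  also have "chain.eqv \<dots> ((- norm_op c - unit_op A (ins_op (- 2) (mu A) (norm_op c)))
      - rot_op (- norm_op c - unit_op A (ins_op (- 2) (mu A) (norm_op c))))"
    by (rule rot_diff_cong[OF ins_unit_op[OF n]])
  also have "\<dots> = - connes_op A (D c)"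
    by (simp add: connes_op_def norm_D op_linear rot_norm)
  finally show ?thesis .
qed

lemma action_op_eqv:
  assumes f: "f \<in> cochains A p" and c: "c \<in> free_chains A N"
  shows "chain.eqv (action_op p f c) (koszul p (I p f c))"
proof -
  have "chain.eqv (action_word p f (m # r)) (koszul p (cap (- 2) (mu A) p f frag_of m r))" if w: "is_hword A (m # r)" for m r
  proof -
    let ?F = "\<lambda>u v x y z. koszul ((p + 1) * sdeg (m # u) + sdeg z * (sdeg (m # u @ v @ x @ y) + p + 1))
      (frag_of (letter (- 2) (mu A) (z @ m # u @ letter p f v # x) # y))"
    \<comment> \<open>\<open>mu\<close> has room for the head and the value of \<open>f\<close>
      only, so no other letter may enter its argument.\<close>
    let ?G = "\<lambda>u v x y z. if u = [] \<and> x = [] \<and> z = [] then ?F u v x y z else 0"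
    have "chain.eqv (cap (- 2) (mu A) p f frag_of m r) (split5 r ?G)"
      unfolding cap_def
    proof (rule chain.eqv_split5)
      fix u v x y z assume "r = u @ v @ x @ y @ z"
      with w have "chain.eqv (frag_of ([] @ (k, 0) # y)) 0" for k
        by (intro chain.slot_value_zero[OF mult_linear_frag_of]) auto
      from chain.eqv_koszul[OF this] show "chain.eqv (?F u v x y z) (?G u v x y z)"
        by (cases "u = [] \<and> x = [] \<and> z = []") (auto simp: letter_def mu_long neq_Nil_conv simp del: sdeg_append sdeg_Cons)
    qed
    also have "split5 r ?G = split2 r (\<lambda>v y. ?F [] v [] y [])"
    proof -
      have "split5 r ?G = split4 r (?G [])"
        unfolding split5_def by (rule split2_only_Nil_left) simp
      also have "\<dots> = split2 r (\<lambda>v y. ?F [] v [] y [])"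
        unfolding split4_def
      proof (rule split2_cong[OF refl])
        fix v s
        have "split3 s (?G [] v) = split2 s (?G [] v [])"
          unfolding split3_def by (rule split2_only_Nil_left) simp
        also have "\<dots> = ?G [] v [] s []"
          by (rule split2_only_Nil_right) simp
        finally show "split3 s (?G [] v) = ?F [] v [] s []" by simp
      qed
      finally show ?thesis .
    qed
    also have "chain.eqv \<dots> (split2 r (\<lambda>v y. koszul ((p + 1) * sdeg [m]) (koszul (fst m + 1) (frag_of ((fst m + (sdeg v + p), snd m * f v) # y)))))"
    proof (rule chain.eqv_split2)
      fix v y assume r: "r = v @ y"
      have "chain.eqv (frag_of ([] @ (fst m + (sdeg v + p), koszul (fst m + 1) (snd m * f v)) # y))
          (koszul (fst m + 1) (frag_of ([] @ (fst m + (sdeg v + p), snd m * f v) # y)))"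
        using w r f by (intro chain.slot_value_koszul[OF mult_linear_frag_of]) auto
      moreover have "letter (- 2) (mu A) [m, letter p f v] = (fst m + (sdeg v + p), koszul (fst m + 1) (snd m * f v))"
        using w r f by (simp add: letter_def)
      ultimately show "chain.eqv (?F [] v [] y []) (koszul ((p + 1) * sdeg [m]) (koszul (fst m + 1) (frag_of ((fst m + (sdeg v + p), snd m * f v) # y))))"
        using chain.eqv_koszul by simp
    qed
    also have "\<dots> = koszul p (action_word p f (m # r))"
      unfolding action_word_Cons by (simp add: split_linear koszul_norm)
    finally have "chain.eqv (koszul p (cap (- 2) (mu A) p f frag_of m r)) (koszul p (koszul p (action_word p f (m # r))))"
      by (rule chain.eqv_koszul)
    then show ?thesis
      unfolding koszul_twice by (rule chain.eqv_sym)
  qed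
  then have "chain.eqv (action_op p f c) (frag_extend (\<lambda>w. koszul p (at_head (cap (- 2) (mu A) p f frag_of) w)) c)"
    unfolding action_op_def
    by (intro frag_extend_eqv[OF c]) (auto elim!: chain_wordsE simp del: action_word.simps)
  then show ?thesis
    by (simp add: cap_op_def frag_extend_fun_koszul)
qed

lemma action_op_free:
  assumes f: "f \<in> cochains A p" and c: "c \<in> free_chains A N"
  shows "action_op p f c \<in> free_chains A (N + p)"
  unfolding action_op_def using f
  by (intro free_chains_frag_extend[OF c], elim chain_wordsE)
    (auto simp: action_word_Cons simp del: action_word.simps intro!: free_intros)

lemma action_op_cong:
  assumes f: "f \<in> cochains A p" and c: "c \<in> free_chains A N" and d: "d \<in> free_chains A N" and cd: "chain.eqv c d"
  shows "chain.eqv (action_op p f c) (action_op p f d)"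
  by (rule chain.eqv_trans[OF action_op_eqv[OF f c] chain.eqv_trans[OF chain.eqv_koszul[OF cap_op_cong[OF cd mu_cochain f]] chain.eqv_sym[OF action_op_eqv[OF f d]]]])

lemma D_free: "c \<in> free_chains A N \<Longrightarrow> D c \<in> free_chains A (N - 1)"
  using lie_op_free[OF _ mu_cochain] by fastforce

lemma D_action_op:
  assumes f: "f \<in> cochains A p" and c: "c \<in> free_chains A N"
  shows "chain.eqv (D (action_op p f c)) (koszul p (action_op p f (D c)) + action_op (p - 1) (cobd A p f) c)"
proof -
  have "chain.eqv (D (action_op p f c)) (D (koszul p (I p f c)))"
    by (rule lie_op_cong[OF action_op_eqv[OF f c] mu_cochain])
  also have "\<dots> = koszul p (D (I p f c))"
    by (simp add: op_linear)
  also have "chain.eqv \<dots> (koszul p (- koszul (p + 1) (I p f (D c)) - I (p - 1) (cobd A p f) c))"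
    by (rule chain.eqv_koszul[OF D_I[OF f c]])
  also have "\<dots> = koszul p (koszul p (I p f (D c))) + koszul (p - 1) (I (p - 1) (cobd A p f) c)"
    by (simp add: koszul_norm)
  also have "chain.eqv \<dots> (koszul p (action_op p f (D c)) + action_op (p - 1) (cobd A p f) c)"
    by (intro chain.eqv_add chain.eqv_koszul chain.eqv_sym[OF action_op_eqv[OF f D_free[OF c]]]
        chain.eqv_sym[OF action_op_eqv[OF cobd_cochain[OF f refl] c]])
  finally show ?thesis .
qed

text \<open>Tensor relations are defined degree by degree, so a congruence becomes membership in
  \<open>tensor_rel\<close> only once the degree of the chain is known.\<close>

lemma chain_diff_free:
  assumes c: "c \<in> free_chains A N"
  shows "chain_diff A c \<in> free_chains A (N - 1)"
proof -
  have h: "snd (hdiff A x) \<in> homog A (fst x - 1)" "fst (hdiff A x) = fst x - 1" if "snd x \<in> homog A (fst x)" for x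
    using that by (cases x; simp)+
  have h': "snd (hmult x y) \<in> homog A (fst x + fst y)" "fst (hmult x y) = fst x + fst y"
    if "snd x \<in> homog A (fst x)" "snd y \<in> homog A (fst y)" for x y :: "int \<times> 'a"
    using that by (cases x; cases y; simp)+
  have d: "is_hword A (diff_at A r i)" "sdeg (diff_at A r i) = sdeg r - 1" if "is_hword A r" "i < length r" for r i
  proof -
    have r: "r = take i r @ r ! i # drop (i + 1) r"
      using that by (simp add: id_take_nth_drop)
    with that(1) have hr: "is_hword A (take i r)" "snd (r ! i) \<in> homog A (fst (r ! i))" "is_hword A (drop (i + 1) r)"
      by (metis is_hword_append is_hword_Cons)+
    then show "is_hword A (diff_at A r i)"
      by (simp add: diff_at_def h)
    have "sdeg r = sdeg (take i r) + (fst (r ! i) + 1) + sdeg (drop (i + 1) r)"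
      by (subst r) (simp only: sdeg_append sdeg_Cons add.assoc)
    then show "sdeg (diff_at A r i) = sdeg r - 1"
      using hr by (simp add: diff_at_def h(2)[OF hr(2)])
  qed
  have e: "is_hword A (mult_at r i)" "sdeg (mult_at r i) = sdeg r - 1" if "is_hword A r" "i + 1 < length r" for r i
  proof -
    have r: "r = take i r @ r ! i # r ! (i + 1) # drop (i + 2) r"
      using that by (metis Cons_nth_drop_Suc Suc_eq_plus1 add_2_eq_Suc' add_lessD1 append_take_drop_id)
    with that(1) have hr: "is_hword A (take i r)" "snd (r ! i) \<in> homog A (fst (r ! i))"
        "snd (r ! (i + 1)) \<in> homog A (fst (r ! (i + 1)))" "is_hword A (drop (i + 2) r)"
      by (metis is_hword_append is_hword_Cons)+
    then show "is_hword A (mult_at r i)"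
      by (simp add: mult_at_def h')
    have "sdeg r = sdeg (take i r) + (fst (r ! i) + 1 + (fst (r ! (i + 1)) + 1)) + sdeg (drop (i + 2) r)"
      by (subst r) (simp only: sdeg_append sdeg_Cons add.assoc)
    then show "sdeg (mult_at r i) = sdeg r - 1"
      using hr by (simp add: mult_at_def h'(2)[OF hr(2) hr(3), simplified])
  qed
  have "chain_d0 A (m # r) + chain_d1 (m # r) \<in> free_chains A (N - 1)"
    if w: "is_hword A (m # r)" "sdeg (m # r) = N + 1" for m r
  proof -
    have "chain_d0 A (m # r) \<in> free_chains A (N - 1)"
      using w d by (auto simp: h intro!: free_intros free_chains_sum)
    moreover have "chain_d1 (m # r) \<in> free_chains A (N - 1)"
    proof (cases r)
      case (Cons a as)
      obtain b l where bl: "r = b @ [l]"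
        using Cons by (metis rev_exhaust list.distinct(1))
      have "koszul (fst m) (frag_of (hmult m a # as)) \<in> free_chains A (N - 1)"
        using w Cons by (auto simp: h' intro!: free_intros)
      moreover have "(\<Sum>i<length as. koszul (fst m + sdeg (take (i + 1) (a # as))) (frag_of (m # mult_at (a # as) i))) \<in> free_chains A (N - 1)"
        using w Cons e[of "a # as"] by (intro free_chains_sum free_chains_koszul free_chains_frag_of) auto
      moreover have "koszul (sdeg [last r] * (fst m + sdeg (butlast r))) (frag_of (hmult (last r) m # butlast r)) \<in> free_chains A (N - 1)"
        using w bl by (auto simp: h' intro!: free_intros)
      ultimately show ?thesis
        unfolding Cons by (simp only: chain_d1.simps) (intro free_chains_diff free_chains_add)
    qed (simp add: free_chains_zero)
    ultimately show ?thesis by (rule free_chains_add)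
  qed
  then show ?thesis
    unfolding chain_diff_def
    by (intro free_chains_frag_extend[OF c]) (auto elim!: chain_wordsE simp del: chain_d0.simps chain_d1.simps)
qed

section \<open>Cycles, boundaries and the operators on them\<close>

lemma chain_cycles_iff: "c \<in> chain_cycles A N \<longleftrightarrow> c \<in> free_chains A N \<and> chain.eqv (D c) 0"
proof -
  have "chain_diff A c \<in> chain_null A \<longleftrightarrow> D c \<in> chain_null A" if c: "c \<in> free_chains A N"
    using chain_diff_eqv[OF c] chain.null_diff[of "chain_diff A c + D c" "D c"] chain.null_diff[of "chain_diff A c + D c" "chain_diff A c"]
    by (auto simp: chain.eqv_def)
  then show ?thesis
    using chain_diff_free[of c N] by (auto simp: chain_cycles_def tensor_rel_iff chain.eqv_def)
qed

lemma chain_boundaries_iff: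
  "x \<in> chain_boundaries A N \<longleftrightarrow> x \<in> free_chains A N \<and> (\<exists>c\<in>free_chains A (N + 1). chain.eqv x (D c))"
proof
  assume "x \<in> chain_boundaries A N"
  then obtain c t where c: "c \<in> free_chains A (N + 1)" and t: "t \<in> tensor_rel A N" and x: "x = chain_diff A c + t"
    by (auto simp: chain_boundaries_def elim!: set_plus_elim)
  have "x \<in> free_chains A N"
    using chain_diff_free[OF c] tensor_rel_free[OF t] by (simp add: x free_chains_add)
  moreover have "chain.eqv t 0"
    using t by (simp add: chain.eqv_def tensor_rel_iff)
  then have "chain.eqv x (- D c + 0)"
    unfolding x by (intro chain.eqv_add chain_diff_eqv[OF c])
  then have "chain.eqv x (D (- c))"
    by (simp add: op_linear)
  ultimately show "x \<in> free_chains A N \<and> (\<exists>c\<in>free_chains A (N + 1). chain.eqv x (D c))"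
    using free_chains_uminus[OF c] by blast
next
  assume "x \<in> free_chains A N \<and> (\<exists>c\<in>free_chains A (N + 1). chain.eqv x (D c))"
  then obtain c where x: "x \<in> free_chains A N" and c: "c \<in> free_chains A (N + 1)" and xc: "chain.eqv x (D c)" by blast
  have c': "- c \<in> free_chains A (N + 1)"
    by (rule free_chains_uminus[OF c])
  have "chain.eqv x (chain_diff A (- c))"
    using chain.eqv_trans[OF xc chain.eqv_sym[OF chain_diff_eqv[OF c', unfolded op_linear minus_minus]]] .
  then have "x - chain_diff A (- c) \<in> tensor_rel A N"
    using x chain_diff_free[OF c'] by (simp add: chain.eqv_def tensor_rel_iff free_chains_diff)
  then have "chain_diff A (- c) + (x - chain_diff A (- c)) \<in> chain_boundaries A N"
    unfolding chain_boundaries_def using c' by (intro set_plus_intro imageI)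
  then show "x \<in> chain_boundaries A N" by simp
qed

lemma boundary_D: "c \<in> free_chains A M \<Longrightarrow> M = N + 1 \<Longrightarrow> D c \<in> chain_boundaries A N"
  using D_free[of c "N + 1"] unfolding chain_boundaries_iff by (auto intro!: bexI[of _ c])

lemma boundary_null: "chain.eqv x 0 \<Longrightarrow> x \<in> free_chains A N \<Longrightarrow> x \<in> chain_boundaries A N"
  unfolding chain_boundaries_iff by (auto intro!: bexI[of _ 0] simp: free_chains_zero lie_op_def)

lemma boundary_eqv: "chain.eqv x y \<Longrightarrow> x \<in> free_chains A N \<Longrightarrow> y \<in> chain_boundaries A N \<Longrightarrow> x \<in> chain_boundaries A N"
  unfolding chain_boundaries_iff using chain.eqv_trans by blast

lemma boundary_diff: "x \<in> chain_boundaries A N \<Longrightarrow> y \<in> chain_boundaries A N \<Longrightarrow> x - y \<in> chain_boundaries A N"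
  unfolding chain_boundaries_iff
  by (auto intro!: free_chains_diff) (metis chain.eqv_diff free_chains_diff op_linear(1))

lemma boundary_zero: "0 \<in> chain_boundaries A N"
  by (rule boundary_null[OF chain.eqv_refl free_chains_zero])

lemma boundary_uminus: "x \<in> chain_boundaries A N \<Longrightarrow> - x \<in> chain_boundaries A N"
  using boundary_diff[OF boundary_zero] by fastforce

lemma boundary_add: "x \<in> chain_boundaries A N \<Longrightarrow> y \<in> chain_boundaries A N \<Longrightarrow> x + y \<in> chain_boundaries A N"
  using boundary_diff[of x N "- y"] boundary_uminus[of y N] by simp

lemma boundary_koszul: "x \<in> chain_boundaries A N \<Longrightarrow> koszul n x \<in> chain_boundaries A N"
  by (simp add: koszul_def boundary_uminus)

lemma cycle_diff: "x \<in> chain_cycles A N \<Longrightarrow> y \<in> chain_cycles A N \<Longrightarrow> x - y \<in> chain_cycles A N"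
  unfolding chain_cycles_iff op_linear using chain.eqv_diff[of "D x" 0 "D y" 0] by (simp add: free_chains_diff)

lemma cycle_zero: "0 \<in> chain_cycles A N"
  by (simp add: chain_cycles_iff free_chains_zero lie_op_def)

lemma connes_op_cycle: "z \<in> chain_cycles A N \<Longrightarrow> connes_op A z \<in> chain_cycles A (N + 1)"
  unfolding chain_cycles_iff
  using chain.eqv_trans[OF D_connes_op chain.eqv_uminus[OF connes_op_cong], of z N 0] connes_op_free
  by simp

lemma connes_op_boundary:
  assumes "x \<in> chain_boundaries A N"
  shows "connes_op A x \<in> chain_boundaries A (N + 1)"
proof -
  obtain c where x: "x \<in> free_chains A N" and c: "c \<in> free_chains A (N + 1)" and xc: "chain.eqv x (D c)"
    using assms unfolding chain_boundaries_iff by blast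
  have "chain.eqv (connes_op A x) (connes_op A (D c))"
    by (rule connes_op_cong[OF xc])
  also have "chain.eqv \<dots> (- D (connes_op A c))"
    using chain.eqv_uminus[OF chain.eqv_sym[OF D_connes_op[OF c]]] by simp
  finally have "chain.eqv (connes_op A x) (- D (connes_op A c))" .
  then show ?thesis
    by (rule boundary_eqv) (auto intro!: connes_op_free x boundary_uminus boundary_D c)
qed

lemma action_op_zero:
  assumes c: "c \<in> free_chains A N"
  shows "chain.eqv (action_op p (\<lambda>w. 0) c) 0"
proof -
  have "chain.eqv (I p (\<lambda>w. 0) c) (frag_extend (\<lambda>w. 0) c)"
    unfolding cap_op_def
    by (rule frag_extend_eqv[OF c]) (auto elim!: chain_wordsE intro!: cap_zero2 mult_linear_frag_of mu_cochain)
  then have "chain.eqv (I p (\<lambda>w. 0) c) 0"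
    by (simp add: frag_extend_eq_0)
  from chain.eqv_trans[OF action_op_eqv[OF zero_cochain c] chain.eqv_koszul[OF this]] show ?thesis by simp
qed

lemma action_op_cycle:
  assumes f: "f \<in> cochains A p" and cf: "cobd A p f = (\<lambda>w. 0)" and z: "z \<in> chain_cycles A N"
  shows "action_op p f z \<in> chain_cycles A (N + p)"
proof -
  have zf: "z \<in> free_chains A N" and zc: "chain.eqv (D z) 0"
    using z by (auto simp: chain_cycles_iff)
  note a0 = action_op_zero[OF zf, of "p - 1"]
  have "chain.eqv (action_op p f (D z)) 0"
    using action_op_cong[OF f D_free[OF zf] free_chains_zero zc] by (simp add: action_op_def)
  then have "chain.eqv (D (action_op p f z)) (koszul p 0 + 0)"
    by (intro chain.eqv_trans[OF D_action_op[OF f zf]] chain.eqv_add chain.eqv_koszul) (simp_all add: cf a0)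
  then show ?thesis
    by (simp add: chain_cycles_iff action_op_free[OF f zf])
qed

lemma action_op_boundary:
  assumes f: "f \<in> cochains A p" and cf: "cobd A p f = (\<lambda>w. 0)" and x: "x \<in> chain_boundaries A N"
  shows "action_op p f x \<in> chain_boundaries A (N + p)"
proof -
  obtain c where xf: "x \<in> free_chains A N" and c: "c \<in> free_chains A (N + 1)" and xc: "chain.eqv x (D c)"
    using x unfolding chain_boundaries_iff by blast
  note a0 = action_op_zero[OF c, of "p - 1"]
  have "chain.eqv (action_op p f x) (action_op p f (D c))"
    using action_op_cong[OF f xf _ xc] D_free[OF c] by simp
  also have "chain.eqv \<dots> (koszul p (D (action_op p f c)))"
    using chain.eqv_koszul[OF chain.eqv_trans[OF D_action_op[OF f c, unfolded cf] chain.eqv_add[OF chain.eqv_refl a0]], of p]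
      chain.eqv_sym by (simp add: koszul_twice)
  finally have "chain.eqv (action_op p f x) (koszul p (D (action_op p f c)))" .
  then show ?thesis
    by (rule boundary_eqv) (auto intro!: action_op_free[OF f] xf boundary_koszul boundary_D c)
qed

lemma action_op_cobd:
  assumes h: "h \<in> cochains A (p + 1)" and z: "z \<in> chain_cycles A N"
  shows "action_op p (cobd A (p + 1) h) z \<in> chain_boundaries A (N + p)"
proof -
  have zf: "z \<in> free_chains A N" and zc: "chain.eqv (D z) 0"
    using z by (auto simp: chain_cycles_iff)
  have "chain.eqv (action_op (p + 1) h (D z)) 0"
    using action_op_cong[OF h D_free[OF zf] free_chains_zero zc] by (simp add: action_op_def)
  from chain.eqv_trans[OF D_action_op[OF h zf] chain.eqv_add[OF chain.eqv_koszul[OF this] chain.eqv_refl]]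
  have "chain.eqv (action_op p (cobd A (p + 1) h) z) (D (action_op (p + 1) h z))"
    using chain.eqv_sym by simp
  then show ?thesis
    by (rule boundary_eqv) (auto intro!: action_op_free zf boundary_D[OF action_op_free[OF h zf]] cobd_cochain h)
qed

text \<open>
  Cartan's homotopy formula. With \<open>S = slide_op p f\<close>, \<open>E = front_op p f\<close> and \<open>B = (1 - t) s N\<close>, the
  homotopy is \<open>(1 - t) s S - (-1)\<^sup>p E s N\<close>; the terms \<open>(1 - t) S\<close> left over by its two parts cancel.
\<close>

lemma cartan:
  assumes f: "f \<in> cochains A p" and cf: "cobd A p f = (\<lambda>w. 0)" and z: "z \<in> chain_cycles A N"
  shows "action_op p f (connes_op A z) - koszul p (connes_op A (action_op p f z)) - lie_op p f z
    \<in> chain_boundaries A (N + p + 1)"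
proof -
  have zf: "z \<in> free_chains A N" and zc: "chain.eqv (D z) 0"
    using z by (auto simp: chain_cycles_iff)
  let ?M = "ins_op (- 2) (mu A)" and ?S = "slide_op p f z"
  let ?a = "front_op p f (unit_op A (norm_op z))" and ?b = "unit_op A ?S - rot_op (unit_op A ?S)"
  note nf = norm_op_free[OF zf] and uf = unit_op_free[OF norm_op_free[OF zf]]
  have Sf: "?S \<in> free_chains A (N + p + 1)"
    by (rule slide_op_free[OF zf f])
  have op0: "slide_op p f 0 = 0" "norm_op 0 = 0" "unit_op A 0 = 0" "rot_op 0 = 0" "front_op p f 0 = 0"
    by (simp_all add: op_defs)
  have MN: "chain.eqv (?M (norm_op z)) 0"
    using norm_op_cong[OF zc] by (simp add: norm_D op0)
  have 1: "chain.eqv (?M (unit_op A (norm_op z))) (- norm_op z)"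
    using chain.eqv_trans[OF ins_unit_op[OF nf] chain.eqv_diff[OF chain.eqv_refl unit_op_cong[OF MN]]] by (simp add: op0)
  \<comment> \<open>\<open>connes_op A z\<close> is \<open>1 - t\<close> applied to
    \<open>s N z\<close>, so \<open>D_front\<close> expresses the action on it by
    \<open>E b' s N z\<close> and a boundary; on a cycle, \<open>b' s N z\<close> is congruent to
    \<open>- N z\<close>.\<close>
  have "chain.eqv (action_op p f (connes_op A z)) (koszul p (I p f (connes_op A z)))"
    by (rule action_op_eqv[OF f connes_op_free[OF zf]])
  also have "chain.eqv \<dots> (koszul p (koszul (p + 1) (front_op p f (?M (unit_op A (norm_op z)))) - D ?a))"
    using chain.eqv_diff[OF chain.eqv_refl[of "koszul (p + 1) (front_op p f (?M (unit_op A (norm_op z))))"] D_front[OF f uf cf]]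
    unfolding connes_op_def[symmetric] by (intro chain.eqv_koszul) (simp add: chain.eqv_sym)
  also have "chain.eqv \<dots> (koszul p (koszul (p + 1) (front_op p f (- norm_op z)) - D ?a))"
    by (intro chain.eqv_koszul chain.eqv_diff front_op_cong[OF 1 f] chain.eqv_refl)
  also have "\<dots> = lie_op p f z - (?S - rot_op ?S) - koszul p (D ?a)"
    by (simp add: op_linear front_norm[OF zf] koszul_norm)
  finally have A: "chain.eqv (action_op p f (connes_op A z)) (lie_op p f z - (?S - rot_op ?S) - koszul p (D ?a))" .
  have "chain.eqv (norm_op (I p f z)) (?M ?S - koszul (p + 1) (slide_op p f (D z)))"
    using chain.eqv_sym[OF chain.eqv_diff[OF ins_slide_op[OF f zf cf] chain.eqv_refl[of "koszul (p + 1) (slide_op p f (D z))"]]] by simp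
  also have "chain.eqv \<dots> (?M ?S - koszul (p + 1) 0)"
    using slide_op_cong[OF zc f] by (intro chain.eqv_diff chain.eqv_koszul chain.eqv_refl) (simp add: op0)
  finally have n: "chain.eqv (norm_op (I p f z)) (?M ?S)" by simp
  \<comment> \<open>The homotopy relation \<open>b' s = - 1 - s b'\<close>, solved for
    \<open>s b'\<close>.\<close>
  have u: "chain.eqv (unit_op A (?M ?S)) (- ?S - ?M (unit_op A ?S))"
    using chain.eqv_diff[OF chain.eqv_refl[of "- ?S - unit_op A (?M ?S) - ?M (unit_op A ?S) + unit_op A (?M ?S)"] chain.eqv_refl]
      chain.eqv_sym[OF chain.eqv_diff[OF chain.eqv_diff[OF chain.eqv_refl[of "- ?S"] ins_unit_op[OF Sf]] chain.eqv_refl[of 0]]]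
    by simp
  have "chain.eqv (koszul p (connes_op A (action_op p f z))) (koszul p (connes_op A (koszul p (I p f z))))"
    by (intro chain.eqv_koszul connes_op_cong action_op_eqv[OF f zf])
  also have "\<dots> = unit_op A (norm_op (I p f z)) - rot_op (unit_op A (norm_op (I p f z)))"
    by (simp only: connes_op_linear koszul_twice) (simp only: connes_op_def)
  also have "chain.eqv \<dots> (unit_op A (?M ?S) - rot_op (unit_op A (?M ?S)))"
    by (intro rot_diff_cong unit_op_cong n)
  also have "chain.eqv \<dots> ((- ?S - ?M (unit_op A ?S)) - rot_op (- ?S - ?M (unit_op A ?S)))"
    by (rule rot_diff_cong[OF u])
  also have "\<dots> = - (?S - rot_op ?S) - D ?b"
    unfolding D_rot[OF unit_op_free[OF Sf]] by (simp add: op_linear)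
  finally have B: "chain.eqv (koszul p (connes_op A (action_op p f z))) (- (?S - rot_op ?S) - D ?b)" .
  have "chain.eqv (action_op p f (connes_op A z) - koszul p (connes_op A (action_op p f z)) - lie_op p f z)
      ((lie_op p f z - (?S - rot_op ?S) - koszul p (D ?a)) - (- (?S - rot_op ?S) - D ?b) - lie_op p f z)"
    by (intro chain.eqv_diff A B chain.eqv_refl)
  also have "\<dots> = D (?b - koszul p ?a)"
    by (simp add: op_linear)
  finally have e: "chain.eqv (action_op p f (connes_op A z) - koszul p (connes_op A (action_op p f z)) - lie_op p f z) (D (?b - koszul p ?a))" .
  have fr: "action_op p f (connes_op A z) \<in> free_chains A (N + p + 1)" "connes_op A (action_op p f z) \<in> free_chains A (N + p + 1)"
    "lie_op p f z \<in> free_chains A (N + p + 1)" "?a \<in> free_chains A (N + p + 2)" "?b \<in> free_chains A (N + p + 2)"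
    using action_op_free[OF f connes_op_free[OF zf]] connes_op_free[OF action_op_free[OF f zf]] lie_op_free[OF zf f]
      front_op_free[OF uf f] unit_op_free[OF Sf] rot_op_free[OF unit_op_free[OF Sf]]
    by (auto simp: algebra_simps intro: free_chains_diff)
  show ?thesis
  proof (rule boundary_eqv[OF e])
    show "action_op p f (connes_op A z) - koszul p (connes_op A (action_op p f z)) - lie_op p f z \<in> free_chains A (N + p + 1)"
      by (intro free_chains_diff free_chains_koszul fr)
    show "D (?b - koszul p ?a) \<in> chain_boundaries A (N + p + 1)"
      by (rule boundary_D[of _ "N + p + 2"]) (intro free_chains_diff[of ?b] free_chains_koszul fr, simp)
  qed
qed

text \<open>\<open>L\<close> is the commutator of the action of \<open>f\<close> with
  \<open>B\<close>. Cartan's formula replaces it by \<open>lie_op p f\<close>, once on the image of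
  the action of \<open>g\<close> and once underneath that action; the commutator that remains is the
  one in \<open>I_gerst_bracket\<close>, whose homotopy term on \<open>D z\<close> is null for a
  cycle.\<close>

lemma action_op_gerst_bracket:
  assumes f: "f \<in> cochains A p" and cf: "cobd A p f = (\<lambda>w. 0)"
    and g: "g \<in> cochains A q" and cg: "cobd A q g = (\<lambda>w. 0)" and z: "z \<in> chain_cycles A N"
  defines "L \<equiv> \<lambda>z. action_op p f (connes_op A z) - koszul p (connes_op A (action_op p f z))"
  shows "L (action_op q g z) - koszul ((p + 1) * q) (action_op q g (L z))
    - action_op (p + q + 1) (gerst_bracket p q f g) z \<in> chain_boundaries A (N + p + q + 1)"
proof -
  have zf: "z \<in> free_chains A N" and zc: "chain.eqv (D z) 0"
    using z by (auto simp: chain_cycles_iff)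
  note gz = action_op_cycle[OF g cg z] and gzf = action_op_free[OF g zf]
  have br: "gerst_bracket p q f g \<in> cochains A (p + q + 1)"
    by (rule gerst_bracket_cochain[OF f g refl])
  have 1: "L (action_op q g z) - lie_op p f (action_op q g z) \<in> chain_boundaries A (N + p + q + 1)"
    using cartan[OF f cf gz] by (simp add: L_def algebra_simps)
  have 2: "action_op q g (L z) - action_op q g (lie_op p f z) \<in> chain_boundaries A (N + p + q + 1)"
    using action_op_boundary[OF g cg cartan[OF f cf z]] by (simp add: L_def action_op_linear algebra_simps)
  have lf: "lie_op p f z \<in> free_chains A (N + p + 1)" "lie_op p f (action_op q g z) \<in> free_chains A (N + p + q + 1)"
    using lie_op_free[OF zf f] lie_op_free[OF gzf f] by (auto simp: algebra_simps)
  have 3: "lie_op p f (action_op q g z) - koszul ((p + 1) * q) (action_op q g (lie_op p f z))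
    - action_op (p + q + 1) (gerst_bracket p q f g) z \<in> chain_boundaries A (N + p + q + 1)"
  proof -
    let ?T = "cap_op p f q g z"
    have Tf: "?T \<in> free_chains A (N + p + q + 2)"
      by (rule cap_op_free[OF zf f g])
    have "chain.eqv (action_op (p + q + 1) (gerst_bracket p q f g) z)
        (koszul (p + q + 1) (I (p + q + 1) (gerst_bracket p q f g) z))"
      by (rule action_op_eqv[OF br zf])
    also have "chain.eqv \<dots> (koszul (p + q + 1) (koszul (p + 1) (lie_op p f (I q g z)) - koszul ((p + 1) * (q + 1)) (I q g (lie_op p f z))
      + koszul (p + q) (cap_op p f q g (D z)) - D ?T))"
      by (intro chain.eqv_koszul I_gerst_bracket[OF f g zf cf cg])
    also have "\<dots> = lie_op p f (koszul q (I q g z)) - koszul ((p + 1) * q) (koszul q (I q g (lie_op p f z)))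
      - cap_op p f q g (D z) - koszul (p + q + 1) (D ?T)"
      by (simp add: op_linear koszul_norm)
    also have "chain.eqv \<dots> (lie_op p f (action_op q g z) - koszul ((p + 1) * q) (action_op q g (lie_op p f z))
      - 0 - koszul (p + q + 1) (D ?T))"
      using cap_op_cong[OF zc f g]
      by (intro chain.eqv_diff chain.eqv_refl chain.eqv_koszul lie_op_cong[OF chain.eqv_sym[OF action_op_eqv[OF g zf]] f]
        chain.eqv_sym[OF action_op_eqv[OF g lf(1)]]) (simp add: cap_op_def)
    finally have e: "chain.eqv (lie_op p f (action_op q g z) - koszul ((p + 1) * q) (action_op q g (lie_op p f z))
        - action_op (p + q + 1) (gerst_bracket p q f g) z) (koszul (p + q + 1) (D ?T))"
      using chain.eqv_diff[OF chain.eqv_refl[of "lie_op p f (action_op q g z) - koszul ((p + 1) * q) (action_op q g (lie_op p f z))"]]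
      by fastforce
    have m: "action_op q g (lie_op p f z) \<in> free_chains A (N + p + q + 1)"
      "action_op (p + q + 1) (gerst_bracket p q f g) z \<in> free_chains A (N + p + q + 1)"
      using action_op_free[OF g lf(1)] action_op_free[OF br zf] by (simp_all add: algebra_simps)
    show ?thesis
    proof (rule boundary_eqv[OF e])
      show "lie_op p f (action_op q g z) - koszul ((p + 1) * q) (action_op q g (lie_op p f z))
          - action_op (p + q + 1) (gerst_bracket p q f g) z \<in> free_chains A (N + p + q + 1)"
        by (intro free_chains_diff free_chains_koszul lf m)
      show "koszul (p + q + 1) (D ?T) \<in> chain_boundaries A (N + p + q + 1)"
        by (intro boundary_koszul boundary_D[OF Tf]) simp
    qed
  qed
  have "(L (action_op q g z) - lie_op p f (action_op q g z))
      - koszul ((p + 1) * q) (action_op q g (L z) - action_op q g (lie_op p f z))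
      + (lie_op p f (action_op q g z) - koszul ((p + 1) * q) (action_op q g (lie_op p f z))
        - action_op (p + q + 1) (gerst_bracket p q f g) z) \<in> chain_boundaries A (N + p + q + 1)"
    by (intro boundary_add boundary_diff boundary_koszul 1 2 3)
  then show ?thesis
    by (simp add: koszul_diff algebra_simps)
qed

end

lemma cup_split: "cup q f g w = split2 w (\<lambda>a b. koszul (q * sdeg a) (f a * g b))"
  by (simp add: cup_def split2_def)

lemma split2_times:
  fixes x :: "'a::ring"
  shows "split2 w F * x = split2 w (\<lambda>a b. F a b * x)" "x * split2 w F = split2 w (\<lambda>a b. x * F a b)"
  by (rule split2_hom; simp add: distrib_left distrib_right)+

lemma koszul_times: "koszul n x * y = koszul n (x * y)" "x * koszul n y = koszul n (x * y)" for x y :: "'a::ring"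
  by (simp_all add: koszul_def)

lemma cup_assoc: "cup r (cup q f g) h = cup (q + r) f (cup r g h)"
proof
  fix w
  show "cup r (cup q f g) h w = cup (q + r) f (cup r g h) w"
    unfolding cup_split by (simp add: split2_times koszul_times split_linear split_refine koszul_norm mult.assoc)
qed

context dg_algebra
begin

section \<open>Cochains modulo coboundaries\<close>

lemma cochain_add_closed: "f \<in> cochains A p \<Longrightarrow> g \<in> cochains A p \<Longrightarrow> f + g \<in> cochains A p"
  using cochain_diff_koszul[of f p g 1] by (simp add: koszul_1 plus_fun_def)

lemma cochain_zero_closed: "0 \<in> cochains A p"
  using zero_cochain by (simp add: zero_fun_def)

lemma cochain_uminus_closed: "f \<in> cochains A p \<Longrightarrow> - f \<in> cochains A p"
  using cochain_diff_koszul[OF zero_cochain, of f p 0] by (simp add: fun_Compl_def)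

lemma cochain_diff_closed: "f \<in> cochains A p \<Longrightarrow> g \<in> cochains A p \<Longrightarrow> f - g \<in> cochains A p"
  using cochain_diff_koszul[of f p g 0] by (simp add: fun_diff_def)

lemma cochain_koszul_closed: "f \<in> cochains A p \<Longrightarrow> koszul n f \<in> cochains A p"
  by (simp add: koszul_def cochain_uminus_closed)

lemma cochain_scal_closed': "f \<in> cochains A p \<Longrightarrow> cochain_scal A r f \<in> cochains A p"
  using cochain_scal_closed[of f p r] by (simp add: cochain_scal_def[abs_def])

lemma koszul_fun [simp]: "koszul n f w = koszul n (f w)"
  by (simp add: koszul_def)

lemma ins_add_letter:
  assumes "f \<in> cochains A p" "f' \<in> cochains A p" "g \<in> cochains A q"
  shows "ins p (f + f') g = ins p f g + ins p f' g"
proof (rule cochain_eqI)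
  fix w assume "is_hword A w"
  with assms show "ins p (f + f') g w = (ins p f g + ins p f' g) w"
    \<comment> \<open>The rule for signed differences with exponent 1 is the rule for sums.\<close>
    using cochain.ins_letter_diff[OF cochain_mult_linear[of g q], of w f p f' 1]
    by (simp add: koszul_1 plus_fun_def)
qed (use assms in \<open>auto intro!: ins_cochain cochain_add_closed\<close>)

lemma ins_scal_letter:
  assumes f: "f \<in> cochains A p" and g: "g \<in> cochains A q"
  shows "ins p (cochain_scal A r f) g = cochain_scal A r (ins p f g)"
proof (rule cochain_eqI)
  fix w assume w: "is_hword A w"
  have "ins p (cochain_scal A r f) g w = split3 w (\<lambda>u v x. scal A r (koszul ((p + 1) * sdeg u) (g (u @ letter p f v # x))))"
    unfolding ins_def
    by (rule split3_cong[OF refl]) (use w f in \<open>auto simp: letter_def cochain_scal_def scal_koszul cochain_scale[OF g]\<close>)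
  also have "\<dots> = scal A r (ins p f g w)"
    unfolding ins_def by (rule split3_hom[symmetric]) (simp_all add: scal.scale_right_distrib)
  finally show "ins p (cochain_scal A r f) g w = cochain_scal A r (ins p f g) w"
    by (simp add: cochain_scal_def)
qed (use assms in \<open>auto intro!: ins_cochain cochain_scal_closed'\<close>)

lemma ins_add: "ins p f (g + g') = ins p f g + ins p f g'"
  by (rule ext) (simp add: ins_def koszul_add split_linear)

lemma ins_scal: "ins p f (cochain_scal A r g) = cochain_scal A r (ins p f g)"
  by (rule ext) (simp add: ins_def cochain_scal_def scal_koszul[symmetric] split3_hom[of "scal A r"] scal.scale_right_distrib)

lemma gerst_bracket_add:
  assumes "f \<in> cochains A p" "f' \<in> cochains A p" "g \<in> cochains A q" "g' \<in> cochains A q"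
  shows "gerst_bracket p q (f + f') g = gerst_bracket p q f g + gerst_bracket p q f' g"
    "gerst_bracket p q f (g + g') = gerst_bracket p q f g + gerst_bracket p q f g'"
  using ins_add_letter[OF assms(1,2,3)] ins_add_letter[OF assms(3,4,1)]
  by (auto simp: gerst_bracket_def circ_eq ins_add koszul_add)

lemma gerst_bracket_scal:
  assumes "f \<in> cochains A p" "g \<in> cochains A q"
  shows "gerst_bracket p q (cochain_scal A r f) g = cochain_scal A r (gerst_bracket p q f g)"
    "gerst_bracket p q f (cochain_scal A r g) = cochain_scal A r (gerst_bracket p q f g)"
  using ins_scal_letter[OF assms] ins_scal_letter[OF assms(2,1)]
  by (auto simp: gerst_bracket_def circ_eq ins_scal fun_eq_iff cochain_scal_def scal.scale_right_diff_distrib scal_koszul)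

lemma cobd_add: "f \<in> cochains A p \<Longrightarrow> g \<in> cochains A p \<Longrightarrow> cobd A p (f + g) = cobd A p f + cobd A p g"
  using gerst_bracket_add(2)[OF mu_cochain mu_cochain] by (simp add: gerst_bracket_mu[symmetric])

lemma cobd_scal: "f \<in> cochains A p \<Longrightarrow> cobd A p (cochain_scal A r f) = cochain_scal A r (cobd A p f)"
  using gerst_bracket_scal(2)[OF mu_cochain] by (simp add: gerst_bracket_mu[symmetric])

lemma cobd_zero: "cobd A p 0 = 0"
  using cobd_add[OF cochain_zero_closed cochain_zero_closed, of p] by simp

lemma cobd_uminus: "f \<in> cochains A p \<Longrightarrow> cobd A p (- f) = - cobd A p f"
  using cobd_add[of f p "- f"] cochain_uminus_closed[of f p] by (simp add: cobd_zero eq_neg_iff_add_eq_0 add.commute)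

lemma cobd_diff: "f \<in> cochains A p \<Longrightarrow> g \<in> cochains A p \<Longrightarrow> cobd A p (f - g) = cobd A p f - cobd A p g"
  using cobd_add[of f p "- g"] cobd_uminus[of g p] cochain_uminus_closed[of g p] by simp

lemma cobd_koszul: "f \<in> cochains A p \<Longrightarrow> cobd A p (koszul n f) = koszul n (cobd A p f)"
  by (simp add: koszul_def cobd_uminus)

lemma cocycles_iff: "f \<in> cocycles A p \<longleftrightarrow> f \<in> cochains A p \<and> cobd A p f = 0"
  unfolding cocycles_def using cochain_diff_eq[of f p] by (auto simp: fun_eq_iff)

lemma cocycleD: "f \<in> cocycles A p \<Longrightarrow> f \<in> cochains A p" "f \<in> cocycles A p \<Longrightarrow> cobd A p f = (\<lambda>w. 0)"
  by (auto simp: cocycles_iff zero_fun_def)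

lemma coboundaries_iff: "f \<in> coboundaries A p \<longleftrightarrow> (\<exists>h\<in>cochains A (p + 1). f = cobd A (p + 1) h)"
proof -
  have "cochain_diff A (p + 1) h = cobd A (p + 1) (- h)" if "h \<in> cochains A (p + 1)" for h
    using cochain_diff_eq[OF that] cobd_uminus[OF that] by (auto simp: fun_eq_iff)
  then show ?thesis
    unfolding coboundaries_def using cochain_uminus_closed by (auto simp: image_iff) (metis minus_minus)+
qed

lemma coboundary_cobd: "h \<in> cochains A n \<Longrightarrow> n = p + 1 \<Longrightarrow> cobd A n h \<in> coboundaries A p"
  by (auto simp: coboundaries_iff)

lemma coboundary_zero: "0 \<in> coboundaries A p"
  using cobd_zero[of "p + 1"] cochain_zero_closed[of "p + 1"] by (auto simp: coboundaries_iff intro!: bexI[of _ 0])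

lemma coboundary_diff: "f \<in> coboundaries A p \<Longrightarrow> g \<in> coboundaries A p \<Longrightarrow> f - g \<in> coboundaries A p"
  unfolding coboundaries_iff using cobd_diff cochain_diff_closed by metis

lemma coboundary_uminus: "f \<in> coboundaries A p \<Longrightarrow> - f \<in> coboundaries A p"
  using coboundary_diff[OF coboundary_zero] by fastforce

lemma coboundary_add: "f \<in> coboundaries A p \<Longrightarrow> g \<in> coboundaries A p \<Longrightarrow> f + g \<in> coboundaries A p"
  using coboundary_diff[of f p "- g"] coboundary_uminus[of g p] by simp

lemma coboundary_koszul: "f \<in> coboundaries A p \<Longrightarrow> koszul n f \<in> coboundaries A p"
  by (simp add: koszul_def coboundary_uminus)

lemma coboundary_scal: "f \<in> coboundaries A p \<Longrightarrow> cochain_scal A r f \<in> coboundaries A p"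
  unfolding coboundaries_iff using cobd_scal cochain_scal_closed' by metis

lemma coboundary_cocycle: "f \<in> coboundaries A p \<Longrightarrow> f \<in> cocycles A p"
  using cobd_cobd[of _ "p + 1"] cobd_cochain[of _ "p + 1" p] unfolding coboundaries_iff cocycles_iff by fastforce

lemma cocycle_closed:
  "0 \<in> cocycles A p"
  "f \<in> cocycles A p \<Longrightarrow> g \<in> cocycles A p \<Longrightarrow> f + g \<in> cocycles A p"
  "f \<in> cocycles A p \<Longrightarrow> g \<in> cocycles A p \<Longrightarrow> f - g \<in> cocycles A p"
  "f \<in> cocycles A p \<Longrightarrow> cochain_scal A r f \<in> cocycles A p"
  by (auto simp: cocycles_iff cobd_add cobd_diff cobd_zero cobd_scal cochain_zero_closed cochain_add_closed
      cochain_diff_closed cochain_scal_closed') (simp add: cochain_scal_def[abs_def] zero_fun_def)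

lemma cobd_cup:
  assumes f: "f \<in> cochains A p" and g: "g \<in> cochains A q"
  shows "cobd A (p + q) (cup q f g) = cup q (cobd A p f) g + koszul p (cup (q - 1) f (cobd A q g))"
proof (rule cochain_eqI)
  note i2 = ins2_cochain[OF f g mu_cochain, of "p + q", simplified]
  show "cobd A (p + q) (cup q f g) \<in> cochains A (p + q - 1)"
    by (intro cobd_cochain cup_cochain f g) simp
  show "cup q (cobd A p f) g + koszul p (cup (q - 1) f (cobd A q g)) \<in> cochains A (p + q - 1)"
    using cup_cochain[OF cobd_cochain[OF f refl] g] cup_cochain[OF f cobd_cochain[OF g refl]]
    by (intro cochain_add_closed cochain_koszul_closed) (simp_all add: algebra_simps)
  fix w assume w: "is_hword A w"
  have "cup q f g = koszul (p + 1) (ins2 p f q g (mu A))"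
    by (rule ext) (simp add: cup_eq[OF f g])
  then have "cobd A (p + q) (cup q f g) w = koszul (p + 1) (cobd A (p + q) (ins2 p f q g (mu A)) w)"
    by (simp only: cobd_koszul[OF i2] koszul_fun)
  then show "cobd A (p + q) (cup q f g) w = (cup q (cobd A p f) g + koszul p (cup (q - 1) f (cobd A q g))) w"
    by (simp add: cobd_ins2[OF f g w] cup_eq[OF cobd_cochain[OF f refl] g] cup_eq[OF f cobd_cochain[OF g refl]]
        koszul_norm)
qed

lemma cup_zero [simp]: "cup q 0 g = 0" "cup q f 0 = 0"
  by (auto simp: cup_def fun_eq_iff)

lemma cup_add: "cup q (f + f') g = cup q f g + cup q f' g" "cup q f (g + g') = cup q f g + cup q f g'"
  by (auto simp: cup_split fun_eq_iff split_linear koszul_add distrib_left distrib_right)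

lemma cup_scal: "cup q (cochain_scal A r f) g = cochain_scal A r (cup q f g)" "cup q f (cochain_scal A r g) = cochain_scal A r (cup q f g)"
  by (auto simp: cup_split fun_eq_iff cochain_scal_def scal_mult_left scal_mult_right scal_koszul[symmetric]
      split2_hom[of "scal A r"] scal.scale_right_distrib)

lemma gerst_bracket_zero [simp]: "f \<in> cochains A p \<Longrightarrow> gerst_bracket q p 0 f = 0" "f \<in> cochains A p \<Longrightarrow> gerst_bracket p q f 0 = 0"
  using gerst_bracket_add[of 0 q 0 f p 0] gerst_bracket_add[of f p 0 0 q 0] by (auto simp: cochain_zero_closed)

lemma cup_cocycle: "f \<in> cocycles A p \<Longrightarrow> g \<in> cocycles A q \<Longrightarrow> cup q f g \<in> cocycles A (p + q)"
  by (auto simp: cocycles_iff cup_cochain cobd_cup)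

lemma cup_coboundary:
  "f \<in> coboundaries A p \<Longrightarrow> g \<in> cocycles A q \<Longrightarrow> cup q f g \<in> coboundaries A (p + q)"
  "f \<in> cocycles A p \<Longrightarrow> g \<in> coboundaries A q \<Longrightarrow> cup q f g \<in> coboundaries A (p + q)"
proof -
  assume "f \<in> coboundaries A p" and g: "g \<in> cocycles A q"
  then obtain h where h: "h \<in> cochains A (p + 1)" "f = cobd A (p + 1) h" by (auto simp: coboundaries_iff)
  have "cup q f g = cobd A (p + 1 + q) (cup q h g)"
    using g h cobd_cup[of h "p + 1" g q] by (simp add: cocycles_iff)
  also have "\<dots> \<in> coboundaries A (p + q)"
    using g h by (intro coboundary_cobd cup_cochain) (auto simp: cocycles_iff)
  finally show "cup q f g \<in> coboundaries A (p + q)" .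
next
  assume f: "f \<in> cocycles A p" and "g \<in> coboundaries A q"
  then obtain h where h: "h \<in> cochains A (q + 1)" "g = cobd A (q + 1) h" by (auto simp: coboundaries_iff)
  have "cobd A (p + (q + 1)) (cup (q + 1) f h) = koszul p (cup q f g)"
    using f h cobd_cup[of f p h "q + 1"] by (simp add: cocycles_iff)
  then have "cup q f g = koszul p (cobd A (p + (q + 1)) (cup (q + 1) f h))"
    by (simp add: koszul_twice)
  also have "\<dots> \<in> coboundaries A (p + q)"
    using f h by (intro coboundary_koszul coboundary_cobd cup_cochain) (auto simp: cocycles_iff)
  finally show "cup q f g \<in> coboundaries A (p + q)" .
qed

lemma cobd_gerst_bracket':
  assumes f: "f \<in> cochains A p" and g: "g \<in> cochains A q"
  shows "cobd A (p + q + 1) (gerst_bracket p q f g) =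
    gerst_bracket (p - 1) q (cobd A p f) g + koszul (p + 1) (gerst_bracket p (q - 1) f (cobd A q g))"
  by (rule ext) (simp add: cobd_gerst_bracket[OF assms])

lemma gerst_bracket_cocycle: "f \<in> cocycles A p \<Longrightarrow> g \<in> cocycles A q \<Longrightarrow> gerst_bracket p q f g \<in> cocycles A (p + q + 1)"
  by (auto simp: cocycles_iff gerst_bracket_cochain cobd_gerst_bracket')

lemma gerst_bracket_coboundary:
  "f \<in> coboundaries A p \<Longrightarrow> g \<in> cocycles A q \<Longrightarrow> gerst_bracket p q f g \<in> coboundaries A (p + q + 1)"
  "f \<in> cocycles A p \<Longrightarrow> g \<in> coboundaries A q \<Longrightarrow> gerst_bracket p q f g \<in> coboundaries A (p + q + 1)"
proof -
  assume "f \<in> coboundaries A p" and g: "g \<in> cocycles A q"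
  then obtain h where h: "h \<in> cochains A (p + 1)" "f = cobd A (p + 1) h" by (auto simp: coboundaries_iff)
  have "gerst_bracket p q f g = cobd A (p + 1 + q + 1) (gerst_bracket (p + 1) q h g)"
    using g h cobd_gerst_bracket'[of h "p + 1" g q] by (simp add: cocycles_iff)
  also have "\<dots> \<in> coboundaries A (p + q + 1)"
    using g h by (intro coboundary_cobd gerst_bracket_cochain) (auto simp: cocycles_iff)
  finally show "gerst_bracket p q f g \<in> coboundaries A (p + q + 1)" .
next
  assume f: "f \<in> cocycles A p" and "g \<in> coboundaries A q"
  then obtain h where h: "h \<in> cochains A (q + 1)" "g = cobd A (q + 1) h" by (auto simp: coboundaries_iff)
  have "cobd A (p + (q + 1) + 1) (gerst_bracket p (q + 1) f h) = koszul (p + 1) (gerst_bracket p q f g)"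
    using f h cobd_gerst_bracket'[of f p h "q + 1"] by (simp add: cocycles_iff)
  then have "gerst_bracket p q f g = koszul (p + 1) (cobd A (p + (q + 1) + 1) (gerst_bracket p (q + 1) f h))"
    by (simp add: koszul_twice)
  also have "\<dots> \<in> coboundaries A (p + q + 1)"
    using f h by (intro coboundary_koszul coboundary_cobd gerst_bracket_cochain) (auto simp: cocycles_iff)
  finally show "gerst_bracket p q f g \<in> coboundaries A (p + q + 1)" .
qed

text \<open>The homotopy is the circle product \<open>ins q g f\<close>: for cocycles, only the two
  terms with both cochains inside \<open>mu\<close> survive in \<open>cobd_ins\<close>.\<close>

lemma cup_commute:
  assumes f: "f \<in> cocycles A p" and g: "g \<in> cocycles A q"
  shows "cup q f g - koszul (p * q) (cup p g f) \<in> coboundaries A (p + q)"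
proof -
  note f' = cocycleD[OF f] and g' = cocycleD[OF g]
  have i: "ins q g f \<in> cochains A (p + q + 1)"
    by (rule ins_cochain[OF g'(1) f'(1)]) simp
  have "cup q f g - koszul (p * q) (cup p g f) = koszul p (cobd A (p + q + 1) (ins q g f))"
  proof (rule cochain_eqI)
    show "cup q f g - koszul (p * q) (cup p g f) \<in> cochains A (p + q)"
      using cup_cochain[OF f'(1) g'(1)] cup_cochain[OF g'(1) f'(1)]
      by (intro cochain_diff_closed cochain_koszul_closed) (simp_all add: add.commute)
    show "koszul p (cobd A (p + q + 1) (ins q g f)) \<in> cochains A (p + q)"
      by (intro cochain_koszul_closed cobd_cochain[OF i]) simp
    fix w assume w: "is_hword A w"
    have "ins q g (\<lambda>w. 0 :: 'a) w = 0" "ins (q - 1) (\<lambda>w. 0) f w = 0"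
      by (simp_all add: ins_def letter_def cochain_letter_0[OF f'(1)])
    then show "(cup q f g - koszul (p * q) (cup p g f)) w = koszul p (cobd A (p + q + 1) (ins q g f)) w"
      by (simp add: cup_eq[OF f'(1) g'(1)] cup_eq[OF g'(1) f'(1)] cobd_ins[OF f'(1) g'(1) w] f'(2) g'(2) koszul_norm)
  qed
  also have "\<dots> \<in> coboundaries A (p + q)"
    by (intro coboundary_koszul coboundary_cobd[OF i]) simp
  finally show ?thesis .
qed

text \<open>The homotopy is the brace \<open>f{g, h}\<close>, whose boundary is computed in
  \<open>cobd_brace\<close>.\<close>

lemma gerst_bracket_cup:
  assumes f: "f \<in> cocycles A p" and g: "g \<in> cocycles A q" and h: "h \<in> cocycles A r"
  shows "gerst_bracket p (q + r) f (cup r g h) - (cup r (gerst_bracket p q f g) h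
      + koszul ((p + 1) * q) (cup (p + r + 1) g (gerst_bracket p r f h))) \<in> coboundaries A (p + q + r + 1)"
proof -
  note f' = cocycleD[OF f] and g' = cocycleD[OF g] and h' = cocycleD[OF h]
  note fg = gerst_bracket_cochain[OF f'(1) g'(1) refl] and fh = gerst_bracket_cochain[OF f'(1) h'(1) refl]
  have i: "ins2 q g r h f \<in> cochains A (p + q + r + 2)"
    by (rule ins2_cochain[OF g'(1) h'(1) f'(1) refl])
  have m: "ins2 q g r h (mu A) \<in> cochains A (q + r)"
    by (rule ins2_cochain[OF g'(1) h'(1) mu_cochain]) simp
  have gh: "cup r g h = koszul (q + 1) (ins2 q g r h (mu A))"
    by (rule ext) (simp add: cup_eq[OF g'(1) h'(1)])
  have "gerst_bracket p (q + r) f (cup r g h) - (cup r (gerst_bracket p q f g) h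
      + koszul ((p + 1) * q) (cup (p + r + 1) g (gerst_bracket p r f h))) = koszul (p + q) (cobd A (p + q + r + 2) (ins2 q g r h f))"
  proof (rule cochain_eqI)
    show "gerst_bracket p (q + r) f (cup r g h) - (cup r (gerst_bracket p q f g) h
      + koszul ((p + 1) * q) (cup (p + r + 1) g (gerst_bracket p r f h))) \<in> cochains A (p + q + r + 1)"
      using cup_cochain[OF fg h'(1)] cup_cochain[OF g'(1) fh]
      by (intro cochain_diff_closed cochain_add_closed cochain_koszul_closed gerst_bracket_cochain[OF f'(1) cup_cochain[OF g'(1) h'(1)]])
        (simp_all add: algebra_simps)
    show "koszul (p + q) (cobd A (p + q + r + 2) (ins2 q g r h f)) \<in> cochains A (p + q + r + 1)"
      by (intro cochain_koszul_closed cobd_cochain[OF i]) simp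
    fix w assume w: "is_hword A w"
    have "gerst_bracket p (q + r) f (koszul (q + 1) (ins2 q g r h (mu A))) = koszul (q + 1) (gerst_bracket p (q + r) f (ins2 q g r h (mu A)))"
      using gerst_bracket_add(2)[OF f'(1) f'(1) m cochain_uminus_closed[OF m]] f'(1)
      by (auto simp: koszul_def eq_neg_iff_add_eq_0 add.commute)
    then show "(gerst_bracket p (q + r) f (cup r g h) - (cup r (gerst_bracket p q f g) h
      + koszul ((p + 1) * q) (cup (p + r + 1) g (gerst_bracket p r f h)))) w = koszul (p + q) (cobd A (p + q + r + 2) (ins2 q g r h f)) w"
      by (simp add: gh cobd_brace[OF f'(1) g'(1) h'(1) w f'(2) g'(2) h'(2)] cup_eq[OF fg h'(1)] cup_eq[OF g'(1) fh] koszul_norm)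
  qed
  also have "\<dots> \<in> coboundaries A (p + q + r + 1)"
    by (intro coboundary_koszul coboundary_cobd[OF i]) simp
  finally show ?thesis .
qed

lemma unit_cochain_cochain: "unit_cochain A \<in> cochains A 0"
  unfolding cochains_iff mlin_words_iff by (auto simp: unit_cochain_def unity_homog)

lemma cup_unit:
  assumes f: "f \<in> cochains A p"
  shows "cup p (unit_cochain A) f = f" "cup 0 f (unit_cochain A) = f"
proof -
  have "split2 w (\<lambda>a b. koszul (p * sdeg a) (unit_cochain A a * f b)) = f w" for w
    by (subst split2_only_Nil_left) (auto simp: unit_cochain_def unity_left)
  moreover have "split2 w (\<lambda>a b. koszul (0 * sdeg a) (f a * unit_cochain A b)) = f w" for w
    by (subst split2_only_Nil_right) (auto simp: unit_cochain_def unity_right)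
  ultimately show "cup p (unit_cochain A) f = f" "cup 0 f (unit_cochain A) = f"
    by (auto simp: cup_split fun_eq_iff)
qed

lemma unit_cochain_cocycle: "unit_cochain A \<in> cocycles A 0"
proof -
  have "cobd A 0 (unit_cochain A) w = 0" for w
  proof (cases "is_hword A w")
    case True
    have d: "unit_cochain A (diff_at A w i) = 0" "unit_cochain A (mult_at w i) = 0" for i
      by (auto simp: unit_cochain_def diff_at_def mult_at_def)
    show ?thesis
      unfolding cobd_def ins_mu[OF unit_cochain_cochain True] ins_into_mu[OF unit_cochain_cochain True] d
      by (cases w; cases "tl w") (auto simp: unit_cochain_def diff_unity unity_left unity_right koszul_1)
  next
    case False
    then show ?thesis
      using cochain_outside[OF cobd_cochain[OF unit_cochain_cochain refl]] by simp
  qed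
  then show ?thesis
    by (auto simp: cocycles_iff unit_cochain_cochain)
qed

section \<open>The action and scalar multiplication on chains\<close>

text \<open>Each action multiplies on the right of the head, so \<open>g\<close>, which acts first,
  ends up to the left of \<open>f\<close>: composition reverses the order of the product.\<close>

lemma action_op_cup:
  assumes f: "f \<in> cochains A p" and g: "g \<in> cochains A q" and c: "c \<in> free_chains A N"
  shows "chain.eqv (action_op p f (action_op q g c)) (koszul (p * q) (action_op (p + q) (cup p g f) c))"
proof -
  have "chain.eqv (koszul (p * q) (action_word (p + q) (cup p g f) (m # r))) (frag_extend (action_word p f) (action_word q g (m # r)))"
    if w: "is_hword A (m # r)" for m r
  proof -
    have "chain.eqv (action_word (p + q) (cup p g f) (m # r))
        (split2 r (\<lambda>v d. koszul (fst m * (p + q)) (split2 v (\<lambda>a b. koszul (p * sdeg a) (frag_of ((fst m + (sdeg v + (p + q)), snd m * (g a * f b)) # d))))))"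
      unfolding action_word_Cons
    proof (intro chain.eqv_split2 chain.eqv_koszul)
      fix v d assume r: "r = v @ d"
      have hom: "snd m * (g a * f b) \<in> homog A (fst m + (sdeg v + (p + q)))" if "v = a @ b" for a b
      proof -
        have "snd m * (g a * f b) \<in> homog A (fst m + ((sdeg a + q) + (sdeg b + p)))"
          using that w r f g by (intro mult_homog) auto
        then show ?thesis
          using that by (simp add: algebra_simps)
      qed
      have "snd m * cup p g f v = split2 v (\<lambda>a b. koszul (p * sdeg a) (snd m * (g a * f b)))"
        by (simp add: cup_split split2_times koszul_times)
      moreover have "chain.eqv (frag_of ([] @ (fst m + (sdeg v + (p + q)), split2 v (\<lambda>a b. koszul (p * sdeg a) (snd m * (g a * f b)))) # d))
          (split2 v (\<lambda>a b. frag_of ([] @ (fst m + (sdeg v + (p + q)), koszul (p * sdeg a) (snd m * (g a * f b))) # d)))"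
        using w r by (intro chain.slot_value_split2[OF mult_linear_frag_of] homog_koszul hom) auto
      moreover have "chain.eqv (split2 v (\<lambda>a b. frag_of ([] @ (fst m + (sdeg v + (p + q)), koszul (p * sdeg a) (snd m * (g a * f b))) # d)))
          (split2 v (\<lambda>a b. koszul (p * sdeg a) (frag_of ([] @ (fst m + (sdeg v + (p + q)), snd m * (g a * f b)) # d))))"
        using w r by (intro chain.eqv_split2 chain.slot_value_koszul[OF mult_linear_frag_of] hom) auto
      ultimately show "chain.eqv (frag_of ((fst m + (sdeg v + (p + q)), snd m * cup p g f v) # d))
          (split2 v (\<lambda>a b. koszul (p * sdeg a) (frag_of ((fst m + (sdeg v + (p + q)), snd m * (g a * f b)) # d))))"
        using chain.eqv_trans by simp
    qed
    from chain.eqv_koszul[OF this, of "p * q"]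
    show ?thesis
      unfolding action_word_Cons
      by (simp add: frag_extend_split frag_extend_koszul action_word_Cons split_linear split_refine koszul_norm mult.assoc
          del: action_word.simps) (simp add: ac_simps)
  qed
  then have "chain.eqv (frag_extend (\<lambda>w. koszul (p * q) (action_word (p + q) (cup p g f) w)) c)
      (frag_extend (\<lambda>w. frag_extend (action_word p f) (action_word q g w)) c)"
    by (intro frag_extend_eqv[OF c]) (auto elim!: chain_wordsE simp del: action_word.simps)
  then show ?thesis
    by (simp add: action_op_def frag_extend_comp frag_extend_fun_koszul chain.eqv_sym)
qed

lemma action_op_unit:
  assumes c: "c \<in> free_chains A N"
  shows "chain.eqv (action_op 0 (unit_cochain A) c) c"
proof -
  have "chain.eqv (action_word 0 (unit_cochain A) (m # r)) (frag_of (m # r))" if w: "is_hword A (m # r)" for m r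
  proof -
    have "chain.eqv (action_word 0 (unit_cochain A) (m # r)) (split2 r (\<lambda>a b. if a = [] then frag_of (m # b) else 0))"
      unfolding action_word_Cons
    proof (rule chain.eqv_split2)
      fix a b assume "r = a @ b"
      with w have "chain.eqv (frag_of ([] @ (k, 0) # b)) 0" for k
        by (intro chain.slot_value_zero[OF mult_linear_frag_of]) auto
      then show "chain.eqv (koszul (fst m * 0) (frag_of ((fst m + (sdeg a + 0), snd m * unit_cochain A a) # b))) (if a = [] then frag_of (m # b) else 0)"
        by (simp add: unit_cochain_def unity_right)
    qed
    also have "\<dots> = frag_of (m # r)"
      by (subst split2_only_Nil_left) auto
    finally show ?thesis .
  qed
  then have "chain.eqv (action_op 0 (unit_cochain A) c) (frag_extend frag_of c)"
    unfolding action_op_def by (intro frag_extend_eqv[OF c]) (auto elim!: chain_wordsE simp del: action_word.simps)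
  then show ?thesis
    by (simp flip: frag_expansion)
qed

lemma action_op_add:
  assumes f: "f \<in> cochains A p" and g: "g \<in> cochains A p" and c: "c \<in> free_chains A N"
  shows "chain.eqv (action_op p (f + g) c) (action_op p f c + action_op p g c)"
proof -
  have "chain.eqv (action_word p (f + g) (m # r)) (action_word p f (m # r) + action_word p g (m # r))" if w: "is_hword A (m # r)" for m r
    unfolding action_word_Cons split_linear[symmetric] koszul_add[symmetric]
  proof (intro chain.eqv_split2 chain.eqv_koszul)
    fix a b assume "r = a @ b"
    then show "chain.eqv (frag_of ((fst m + (sdeg a + p), snd m * (f + g) a) # b))
        (frag_of ((fst m + (sdeg a + p), snd m * f a) # b) + frag_of ((fst m + (sdeg a + p), snd m * g a) # b))"
      using chain.slot_value_add[OF mult_linear_frag_of, of "[]" b "snd m * f a" "fst m + (sdeg a + p)" "snd m * g a"] w f g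
      by (auto simp: distrib_left)
  qed
  then have "chain.eqv (action_op p (f + g) c) (frag_extend (\<lambda>w. action_word p f w + action_word p g w) c)"
    unfolding action_op_def by (intro frag_extend_eqv[OF c]) (auto elim!: chain_wordsE simp del: action_word.simps)
  then show ?thesis
    by (simp add: action_op_def frag_extend_fun_add)
qed

lemma action_op_scal:
  assumes f: "f \<in> cochains A p" and c: "c \<in> free_chains A N"
  shows "chain.eqv (action_op p (cochain_scal A r f) c) (chain_scal A r (action_op p f c))"
proof -
  have "chain.eqv (action_word p (cochain_scal A r f) (m # s)) (chain_scal A r (action_word p f (m # s)))" if w: "is_hword A (m # s)" for m s
    unfolding action_word_Cons chain.act_split2 chain.act_koszul
  proof (intro chain.eqv_split2 chain.eqv_koszul)
    fix a b assume "s = a @ b"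
    then show "chain.eqv (frag_of ((fst m + (sdeg a + p), snd m * cochain_scal A r f a) # b))
        (chain_scal A r (frag_of ((fst m + (sdeg a + p), snd m * f a) # b)))"
      by (simp add: cochain_scal_def scal_mult_right)
  qed
  then have "chain.eqv (action_op p (cochain_scal A r f) c) (frag_extend (\<lambda>w. chain_scal A r (action_word p f w)) c)"
    unfolding action_op_def by (intro frag_extend_eqv[OF c]) (auto elim!: chain_wordsE simp del: action_word.simps)
  then show ?thesis
    by (simp add: action_op_def chain_scal_def frag_extend_comp)
qed

lemma chain_scal_free:
  assumes c: "c \<in> free_chains A N"
  shows "chain_scal A r c \<in> free_chains A N"
  unfolding chain_scal_def
proof (rule free_chains_frag_extend[OF c])
  fix w assume "w \<in> chain_words A N"
  then show "frag_of (hscal A r (hd w) # tl w) \<in> free_chains A N"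
    by (elim chain_wordsE, cases "hd w") (auto intro!: free_chains_frag_of homog_scal)
qed

lemma action_op_chain_scal:
  assumes f: "f \<in> cochains A p" and c: "c \<in> free_chains A N"
  shows "chain.eqv (action_op p f (chain_scal A r c)) (chain_scal A r (action_op p f c))"
proof -
  have "chain.eqv (action_op p f (chain_scal A r c)) (koszul p (I p f (chain_scal A r c)))"
    by (rule action_op_eqv[OF f chain_scal_free[OF c]])
  also have "chain.eqv \<dots> (koszul p (chain_scal A r (I p f c)))"
    unfolding cap_op_def
    by (intro chain.eqv_koszul frag_extend_chain_scal[OF _ c] chain.mlin_cap mu_cochain f mult_linear_frag_of)
  also have "\<dots> = chain_scal A r (koszul p (I p f c))"
    by (simp add: chain.act_koszul)
  also have "chain.eqv \<dots> (chain_scal A r (action_op p f c))"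
    by (rule chain.eqv_act[OF chain.eqv_sym[OF action_op_eqv[OF f c]]])
  finally show ?thesis .
qed

lemma connes_op_chain_scal:
  assumes c: "c \<in> free_chains A N"
  shows "chain.eqv (connes_op A (chain_scal A r c)) (chain_scal A r (connes_op A c))"
proof -
  have n: "chain.eqv (norm_op (chain_scal A r c)) (chain_scal A r (norm_op c))"
    unfolding norm_op_def by (rule frag_extend_chain_scal[OF chain.mlin_norm[OF mult_linear_frag_of] c])
  have "chain.eqv (unit_op A (chain_scal A r (norm_op c))) (chain_scal A r (unit_op A (norm_op c)))"
    unfolding unit_op_def by (rule frag_extend_chain_scal[OF mult_linear_extra_degeneracy norm_op_free[OF c]])
  with unit_op_cong[OF n] have u: "chain.eqv (unit_op A (norm_op (chain_scal A r c))) (chain_scal A r (unit_op A (norm_op c)))"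
    by (rule chain.eqv_trans)
  have "chain.eqv (rot_op (chain_scal A r (unit_op A (norm_op c)))) (chain_scal A r (rot_op (unit_op A (norm_op c))))"
    unfolding rot_op_def by (rule frag_extend_chain_scal[OF chain.mlin_rot[OF mult_linear_frag_of] unit_op_free[OF norm_op_free[OF c]]])
  with rot_op_cong[OF u] have t: "chain.eqv (rot_op (unit_op A (norm_op (chain_scal A r c)))) (chain_scal A r (rot_op (unit_op A (norm_op c))))"
    by (rule chain.eqv_trans)
  show ?thesis
    unfolding connes_op_def chain.act_diff by (rule chain.eqv_diff[OF u t])
qed

lemma D_chain_scal:
  assumes c: "c \<in> free_chains A N"
  shows "chain.eqv (D (chain_scal A r c)) (chain_scal A r (D c))"
  unfolding lie_op_def by (rule frag_extend_chain_scal[OF chain.mlin_lie[OF mu_cochain mult_linear_frag_of] c])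

lemma cycle_chain_scal: "z \<in> chain_cycles A N \<Longrightarrow> chain_scal A r z \<in> chain_cycles A N"
  unfolding chain_cycles_iff
  using chain.eqv_trans[OF D_chain_scal chain.eqv_act[of "D z" 0 r]] chain_scal_free by auto

lemma boundary_chain_scal: "x \<in> chain_boundaries A N \<Longrightarrow> chain_scal A r x \<in> chain_boundaries A N"
  unfolding chain_boundaries_iff
  by (auto intro: chain_scal_free) (meson chain.eqv_act chain.eqv_sym chain.eqv_trans D_chain_scal chain_scal_free)

lemma chain_scal_module:
  assumes c: "c \<in> free_chains A N"
  shows "chain.eqv (chain_scal A (r + s) c) (chain_scal A r c + chain_scal A s c)"
    and "chain_scal A (r * s) c = chain_scal A r (chain_scal A s c)"
    and "chain_scal A 1 c = c"
proof -
  have "chain.eqv (frag_extend (\<lambda>w. frag_of (hscal A (r + s) (hd w) # tl w)) c)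
      (frag_extend (\<lambda>w. frag_of (hscal A r (hd w) # tl w) + frag_of (hscal A s (hd w) # tl w)) c)"
  proof (rule frag_extend_eqv[OF c])
    fix w assume "w \<in> chain_words A N"
    then obtain i x v where "w = (i, x) # v" "x \<in> homog A i" "is_hword A v"
      by (cases w) (auto simp: chain_words_def)
    then show "chain.eqv (frag_of (hscal A (r + s) (hd w) # tl w)) (frag_of (hscal A r (hd w) # tl w) + frag_of (hscal A s (hd w) # tl w))"
      using chain.slot_value_add[OF mult_linear_frag_of, of "[]" v "scal A r x" i "scal A s x"]
      by (simp add: scal.scale_left_distrib homog_scal)
  qed
  then show "chain.eqv (chain_scal A (r + s) c) (chain_scal A r c + chain_scal A s c)"
    by (simp add: chain_scal_def frag_extend_fun_add)
  show "chain_scal A (r * s) c = chain_scal A r (chain_scal A s c)"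
    unfolding chain_scal_def frag_extend_comp
    by (rule frag_extend_eq) (simp, metis hscal.simps prod.collapse scal.scale_scale)
  have "chain_scal A 1 c = frag_extend frag_of c"
    unfolding chain_scal_def
  proof (rule frag_extend_eq)
    fix w assume "w \<in> Poly_Mapping.keys c"
    with c have "w \<in> chain_words A N" by (auto simp: free_chains_def)
    then show "frag_of (hscal A 1 (hd w) # tl w) = frag_of w"
      by (elim chain_wordsE, cases "hd w") auto
  qed
  then show "chain_scal A 1 c = c"
    by (simp flip: frag_expansion)
qed

end

section \<open>Derived brackets in graded algebras\<close>

lemma (in abelian_group) minus_telescope:
  assumes "u \<in> carrier G" "x \<in> carrier G" "z \<in> carrier G"
  shows "(u \<ominus> x) \<oplus> (x \<ominus> z) = u \<ominus> z"
proof -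
  have "(u \<ominus> x) \<oplus> (x \<ominus> z) = (u \<ominus> z) \<oplus> (x \<ominus> x)"
    using assms by (simp only: a_minus_def a_ac a_inv_closed a_closed)
  then show ?thesis
    using assms by (simp add: a_minus_def r_neg)
qed

text \<open>The cancellation pattern of the Jacobi identity for commutators: \<open>a\<close>,
  \<open>b\<close>, \<open>c\<close>, \<open>d\<close> are the products on its left side, and
  \<open>x\<close>, \<open>y\<close> are those that occur twice on the right.\<close>

lemma (in abelian_group) minus_jacobi:
  assumes c: "a \<in> carrier G" "b \<in> carrier G" "c \<in> carrier G" "d \<in> carrier G" "x \<in> carrier G" "y \<in> carrier G"
  shows "(a \<ominus> b) \<ominus> (c \<ominus> d) = ((a \<ominus> x) \<ominus> (y \<ominus> d)) \<oplus> ((x \<ominus> c) \<ominus> (b \<ominus> y))"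
proof -
  have "((a \<ominus> x) \<ominus> (y \<ominus> d)) \<oplus> ((x \<ominus> c) \<ominus> (b \<ominus> y)) = ((a \<ominus> b) \<ominus> (c \<ominus> d)) \<oplus> (x \<ominus> x) \<oplus> (y \<ominus> y)"
    using c by (simp only: a_minus_def minus_add minus_minus a_ac a_inv_closed a_closed)
  then show ?thesis
    using c by (simp add: a_minus_def r_neg)
qed

locale signed_group = abelian_group M for M :: "('k, 'e) module" (structure)
begin

lemma gsgn_closed [simp, intro]: "x \<in> carrier M \<Longrightarrow> gsgn M n x \<in> carrier M"
  by (simp add: gsgn_def)

lemma gsgn_gsgn: "x \<in> carrier M \<Longrightarrow> gsgn M m (gsgn M n x) = gsgn M (m + n) x"
  by (auto simp: gsgn_def)

lemma gsgn_add: "x \<in> carrier M \<Longrightarrow> y \<in> carrier M \<Longrightarrow> gsgn M n (x \<oplus> y) = gsgn M n x \<oplus> gsgn M n y"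
  by (simp add: gsgn_def minus_add)

lemma gsgn_minus: "x \<in> carrier M \<Longrightarrow> y \<in> carrier M \<Longrightarrow> gsgn M n (x \<ominus> y) = gsgn M n x \<ominus> gsgn M n y"
  by (simp add: gsgn_def a_minus_def minus_add)

lemma a_inv_zero: "\<ominus> \<zero> = \<zero>"
  by (rule minus_equality) simp_all

lemma gsgn_zero [simp]: "gsgn M n \<zero> = \<zero>"
  by (simp add: gsgn_def a_inv_zero)

end

lemma gsgn_cong: "even (m - n) \<Longrightarrow> gsgn M m x = gsgn M n x"
  by (auto simp: gsgn_def)

lemma linear_map_closed: "linear_map R M N f \<Longrightarrow> x \<in> carrier M \<Longrightarrow> f x \<in> carrier N"
  by (auto simp: linear_map_def)

lemma linear_map_add:
  "linear_map R M N f \<Longrightarrow> x \<in> carrier M \<Longrightarrow> y \<in> carrier M \<Longrightarrow> f (x \<oplus>\<^bsub>M\<^esub> y) = f x \<oplus>\<^bsub>N\<^esub> f y"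
  by (auto simp: linear_map_def)

lemma linear_map_smult:
  "linear_map R M N f \<Longrightarrow> r \<in> carrier R \<Longrightarrow> x \<in> carrier M \<Longrightarrow> f (r \<odot>\<^bsub>M\<^esub> x) = r \<odot>\<^bsub>N\<^esub> f x"
  by (auto simp: linear_map_def)

lemma linear_mapI:
  assumes "\<And>x. x \<in> carrier M \<Longrightarrow> f x \<in> carrier N"
    and "\<And>x y. x \<in> carrier M \<Longrightarrow> y \<in> carrier M \<Longrightarrow> f (x \<oplus>\<^bsub>M\<^esub> y) = f x \<oplus>\<^bsub>N\<^esub> f y"
    and "\<And>r x. r \<in> carrier R \<Longrightarrow> x \<in> carrier M \<Longrightarrow> f (r \<odot>\<^bsub>M\<^esub> x) = r \<odot>\<^bsub>N\<^esub> f x"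
  shows "linear_map R M N f"
  using assms by (auto simp: linear_map_def)

lemma linear_map_a_inv:
  assumes f: "linear_map R M N f" and M: "abelian_group M" and N: "abelian_group N" and x: "x \<in> carrier M"
  shows "f (\<ominus>\<^bsub>M\<^esub> x) = \<ominus>\<^bsub>N\<^esub> f x"
proof -
  interpret M: abelian_group M by fact
  interpret N: abelian_group N by fact
  note cl = linear_map_closed[OF f]
  have z: "f \<zero>\<^bsub>M\<^esub> = \<zero>\<^bsub>N\<^esub>"
    using linear_map_add[OF f M.zero_closed M.zero_closed] cl[OF M.zero_closed]
    by (metis M.l_zero M.zero_closed N.add.r_cancel_one')
  have "f x \<oplus>\<^bsub>N\<^esub> f (\<ominus>\<^bsub>M\<^esub> x) = \<zero>\<^bsub>N\<^esub>"
    using linear_map_add[OF f x M.a_inv_closed[OF x]] x by (simp add: M.r_neg z)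
  then show ?thesis
    using cl x by (metis M.a_inv_closed N.add.m_comm N.minus_equality)
qed

lemma linear_map_gsgn:
  "linear_map R M N f \<Longrightarrow> abelian_group M \<Longrightarrow> abelian_group N \<Longrightarrow> x \<in> carrier M \<Longrightarrow> f (gsgn M n x) = gsgn N n (f x)"
  by (simp add: gsgn_def linear_map_a_inv)

lemma linear_map_minus:
  assumes f: "linear_map R M N f" and M: "abelian_group M" and N: "abelian_group N" and "x \<in> carrier M" "y \<in> carrier M"
  shows "f (x \<ominus>\<^bsub>M\<^esub> y) = f x \<ominus>\<^bsub>N\<^esub> f y"
  using assms abelian_group.a_inv_closed[OF M]
  by (simp add: a_minus_def linear_map_add[OF f] linear_map_a_inv[OF f M N])

context graded_algebra
begin

abbreviation "P \<equiv> gpart E"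

lemma gpart_abelian_group: "abelian_group (P i)"
  using gpart_module by (rule module.axioms)

sublocale gpart: signed_group "P i" for i
  using gpart_abelian_group by (simp add: signed_group_def)

lemma gmul_left: "b \<in> carrier (P j) \<Longrightarrow> linear_map R (P i) (P (i + j)) (\<lambda>x. gmul E i j x b)"
  using gmul_bilinear unfolding bilinear_map_def by blast

lemma gmul_right: "a \<in> carrier (P i) \<Longrightarrow> linear_map R (P j) (P (i + j)) (gmul E i j a)"
  using gmul_bilinear unfolding bilinear_map_def by blast

lemma gmul_closed: "a \<in> carrier (P i) \<Longrightarrow> b \<in> carrier (P j) \<Longrightarrow> n = i + j \<Longrightarrow> gmul E i j a b \<in> carrier (P n)"
  using linear_map_closed[OF gmul_right] by blast

definition tri :: "int \<Rightarrow> int \<Rightarrow> int \<Rightarrow> 'e \<Rightarrow> 'e \<Rightarrow> 'e \<Rightarrow> 'e"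
  where "tri i j k a b c = gmul E (i + j) k (gmul E i j a b) c"

lemma tri_closed:
  "a \<in> carrier (P i) \<Longrightarrow> b \<in> carrier (P j) \<Longrightarrow> c \<in> carrier (P k) \<Longrightarrow> n = i + j + k \<Longrightarrow> tri i j k a b c \<in> carrier (P n)"
  unfolding tri_def by (intro gmul_closed) auto

lemma gcomm_closed:
  assumes "a \<in> carrier (P i)" and "b \<in> carrier (P j)" and "n = i + j"
  shows "gcomm E i j a b \<in> carrier (P n)"
  using assms unfolding gcomm_def by (auto intro!: gpart.minus_closed gpart.gsgn_closed gmul_closed)

lemma gmul_gcomm_right:
  assumes "a \<in> carrier (P i)" and "b \<in> carrier (P j)" and "c \<in> carrier (P k)" and n: "n = i + j + k"
  shows "gmul E i (j + k) a (gcomm E j k b c) = tri i j k a b c \<ominus>\<^bsub>P n\<^esub> gsgn (P n) (j * k) (tri i k j a c b)"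
proof -
  note l = gmul_right[OF assms(1), of "j + k"]
  have bc: "gmul E j k b c \<in> carrier (P (j + k))" and cb: "gmul E k j c b \<in> carrier (P (j + k))"
    using assms by (auto intro!: gmul_closed)
  show ?thesis
    unfolding gcomm_def linear_map_minus[OF l gpart_abelian_group gpart_abelian_group bc gpart.gsgn_closed[OF cb]]
      linear_map_gsgn[OF l gpart_abelian_group gpart_abelian_group cb]
    using gmul_assoc[OF assms(1-3)] gmul_assoc[OF assms(1,3,2)] by (simp add: tri_def n ac_simps)
qed

lemma gmul_gcomm_left:
  assumes "a \<in> carrier (P i)" and "b \<in> carrier (P j)" and "c \<in> carrier (P k)" and n: "n = j + k + i"
  shows "gmul E (j + k) i (gcomm E j k b c) a = tri j k i b c a \<ominus>\<^bsub>P n\<^esub> gsgn (P n) (j * k) (tri k j i c b a)"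
proof -
  note l = gmul_left[OF assms(1), of "j + k"]
  have bc: "gmul E j k b c \<in> carrier (P (j + k))" and cb: "gmul E k j c b \<in> carrier (P (j + k))"
    using assms by (auto intro!: gmul_closed)
  show ?thesis
    unfolding gcomm_def linear_map_minus[OF l gpart_abelian_group gpart_abelian_group bc gpart.gsgn_closed[OF cb]]
      linear_map_gsgn[OF l gpart_abelian_group gpart_abelian_group cb]
    by (simp add: tri_def n add.commute)
qed

lemma gcomm_gmul:
  assumes "a \<in> carrier (P i)" and "b \<in> carrier (P j)" and "c \<in> carrier (P k)" and n: "n = i + j + k"
  shows "gcomm E i (j + k) a (gmul E j k b c) =
    gmul E (i + j) k (gcomm E i j a b) c \<oplus>\<^bsub>P n\<^esub> gsgn (P n) (i * j) (gmul E j (i + k) b (gcomm E i k a c))"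
proof -
  let ?s = "gsgn (P n)"
  have cl: "tri i j k a b c \<in> carrier (P n)" "tri j i k b a c \<in> carrier (P n)" "tri j k i b c a \<in> carrier (P n)"
    using assms by (auto intro!: tri_closed)
  have "gcomm E i (j + k) a (gmul E j k b c) = tri i j k a b c \<ominus>\<^bsub>P n\<^esub> ?s (i * (j + k)) (tri j k i b c a)"
    using gmul_assoc[OF assms(1-3)] by (simp add: gcomm_def tri_def n add.assoc)
  also have "\<dots> = (tri i j k a b c \<ominus>\<^bsub>P n\<^esub> ?s (i * j) (tri j i k b a c)) \<oplus>\<^bsub>P n\<^esub> (?s (i * j) (tri j i k b a c) \<ominus>\<^bsub>P n\<^esub> ?s (i * (j + k)) (tri j k i b c a))"
    using cl by (simp add: gpart.minus_telescope)
  also have "?s (i * j) (tri j i k b a c) \<ominus>\<^bsub>P n\<^esub> ?s (i * (j + k)) (tri j k i b c a) =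
      ?s (i * j) (tri j i k b a c \<ominus>\<^bsub>P n\<^esub> ?s (i * k) (tri j k i b c a))"
    using cl by (simp add: gpart.gsgn_minus gpart.gsgn_gsgn distrib_left)
  finally show ?thesis
    using assms by (simp add: gmul_gcomm_left[of c k a i b j n] gmul_gcomm_right[of b j a i c k n] ac_simps)
qed

lemma gcomm_jacobi:
  assumes "a \<in> carrier (P i)" and "b \<in> carrier (P j)" and "c \<in> carrier (P k)" and n: "n = i + j + k"
  shows "gcomm E i (j + k) a (gcomm E j k b c) =
    gcomm E (i + j) k (gcomm E i j a b) c \<oplus>\<^bsub>P n\<^esub> gsgn (P n) (i * j) (gcomm E j (i + k) b (gcomm E i k a c))"
proof -
  let ?s = "gsgn (P n)"
  let ?abc = "tri i j k a b c" and ?acb = "tri i k j a c b" and ?bac = "tri j i k b a c"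
    and ?bca = "tri j k i b c a" and ?cab = "tri k i j c a b" and ?cba = "tri k j i c b a"
  have cl: "?abc \<in> carrier (P n)" "?acb \<in> carrier (P n)" "?bac \<in> carrier (P n)" "?bca \<in> carrier (P n)"
    "?cab \<in> carrier (P n)" "?cba \<in> carrier (P n)"
    using assms by (auto intro!: tri_closed)
  \<comment> \<open>The same triple product is reached with different exponents on the two sides;
    their parities agree.\<close>
  have p: "even (i * j + (j * (i + k) + i * k) - (i + j) * k)" "even (i * j + i * k - i * (j + k))"
    "even (i * j + j * (i + k) - j * k)" "even ((i + j) * k + i * j - (i * (j + k) + j * k))"
    by (simp_all add: algebra_simps)
  have 1: "gcomm E i (j + k) a (gcomm E j k b c) =
      (?abc \<ominus>\<^bsub>P n\<^esub> ?s (j * k) ?acb) \<ominus>\<^bsub>P n\<^esub> ?s (i * (j + k)) (?bca \<ominus>\<^bsub>P n\<^esub> ?s (j * k) ?cba)"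
    unfolding gcomm_def[of E i] using assms by (simp add: gmul_gcomm_left[of a i b j c k n] gmul_gcomm_right[of a i b j c k n] ac_simps)
  have 2: "gcomm E (i + j) k (gcomm E i j a b) c =
      (?abc \<ominus>\<^bsub>P n\<^esub> ?s (i * j) ?bac) \<ominus>\<^bsub>P n\<^esub> ?s ((i + j) * k) (?cab \<ominus>\<^bsub>P n\<^esub> ?s (i * j) ?cba)"
    unfolding gcomm_def[of E "i + j"] using assms by (simp add: gmul_gcomm_left[of c k a i b j n] gmul_gcomm_right[of c k a i b j n] ac_simps)
  have 3: "gcomm E j (i + k) b (gcomm E i k a c) =
      (?bac \<ominus>\<^bsub>P n\<^esub> ?s (i * k) ?bca) \<ominus>\<^bsub>P n\<^esub> ?s (j * (i + k)) (?acb \<ominus>\<^bsub>P n\<^esub> ?s (i * k) ?cab)"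
    unfolding gcomm_def[of E j] using assms by (simp add: gmul_gcomm_left[of b j a i c k n] gmul_gcomm_right[of b j a i c k n] ac_simps)
  show ?thesis
    unfolding 1 2 3 using cl
    by (simp only: gpart.gsgn_minus gpart.gsgn_gsgn gpart.gsgn_closed gpart.minus_closed
        gsgn_cong[OF p(1)] gsgn_cong[OF p(2)] gsgn_cong[OF p(3)] gsgn_cong[OF p(4)])
      (rule gpart.minus_jacobi; simp)
qed

end

locale differential_graded_algebra = graded_algebra R E
  for R :: "'k ring" and E :: "('k, 'e) graded_alg" +
  fixes B :: 'e
  assumes B_closed: "B \<in> carrier (gpart E 1)"
    and B_B: "gmul E 1 1 B B = \<zero>\<^bsub>gpart E 2\<^esub>"
begin

lemma gmul_zero:
  "a \<in> carrier (P i) \<Longrightarrow> gmul E i j a \<zero>\<^bsub>P j\<^esub> = \<zero>\<^bsub>P (i + j)\<^esub>"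
  "b \<in> carrier (P j) \<Longrightarrow> gmul E i j \<zero>\<^bsub>P i\<^esub> b = \<zero>\<^bsub>P (i + j)\<^esub>"
  using linear_map_minus[OF gmul_right gpart_abelian_group gpart_abelian_group gpart.zero_closed gpart.zero_closed, of a i j]
    linear_map_minus[OF gmul_left gpart_abelian_group gpart_abelian_group gpart.zero_closed gpart.zero_closed, of b j i]
    linear_map_closed[OF gmul_right gpart.zero_closed, of a i j] linear_map_closed[OF gmul_left gpart.zero_closed, of b j i]
  by (simp_all add: a_minus_def gpart.r_neg)

text \<open>Two of the four products contain \<open>B B = 0\<close>; the other two are both
  \<open>B a B\<close>, with opposite signs.\<close>

lemma gcomm_gcomm_B:
  assumes a: "a \<in> carrier (P i)"
  shows "gcomm E (i + 1) 1 (gcomm E i 1 a B) B = \<zero>\<^bsub>P (i + 2)\<^esub>"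
proof -
  let ?x = "tri 1 i 1 B a B"
  have cl: "?x \<in> carrier (P (i + 2))"
    by (rule tri_closed[OF B_closed a B_closed]) simp
  have z: "tri i 1 1 a B B = \<zero>\<^bsub>P (i + 2)\<^esub>" "tri 1 1 i B B a = \<zero>\<^bsub>P (i + 2)\<^esub>"
    using gmul_assoc[OF a B_closed B_closed] gmul_zero(1)[OF a, of 2] gmul_zero(2)[OF a, of 2]
    by (simp_all add: tri_def B_B add.commute)
  have "gcomm E (i + 1) 1 (gcomm E i 1 a B) B =
      (\<zero>\<^bsub>P (i + 2)\<^esub> \<ominus>\<^bsub>P (i + 2)\<^esub> gsgn (P (i + 2)) i ?x) \<ominus>\<^bsub>P (i + 2)\<^esub> gsgn (P (i + 2)) (i + 1) (?x \<ominus>\<^bsub>P (i + 2)\<^esub> gsgn (P (i + 2)) i \<zero>\<^bsub>P (i + 2)\<^esub>)"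
    unfolding gcomm_def[of E "i + 1"]
    using gmul_gcomm_left[OF B_closed a B_closed, of "i + 2"] gmul_gcomm_right[OF B_closed a B_closed, of "i + 2"]
    by (simp add: z ac_simps)
  also have "\<dots> = \<zero>\<^bsub>P (i + 2)\<^esub>"
    using cl by (simp add: gsgn_def a_minus_def gpart.r_neg gpart.l_neg gpart.a_inv_zero)
  finally show ?thesis .
qed

lemma gcomm_zero: "b \<in> carrier (P j) \<Longrightarrow> gcomm E j k b \<zero>\<^bsub>P k\<^esub> = \<zero>\<^bsub>P (j + k)\<^esub>"
  by (simp add: gcomm_def gmul_zero a_minus_def add.commute[of k] gpart.a_inv_zero)

abbreviation "br \<equiv> derived_bracket E B"

lemma gcomm_B_closed: "a \<in> carrier (P i) \<Longrightarrow> gcomm E i 1 a B \<in> carrier (P (i + 1))"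
  by (rule gcomm_closed[OF _ B_closed refl])

text \<open>The Jacobi identity for \<open>[a, B]\<close>, \<open>b\<close> and \<open>B\<close>,
  whose last term contains \<open>[[a, B], B] = 0\<close>.\<close>

lemma br_gcomm_B:
  assumes a: "a \<in> carrier (P i)" and b: "b \<in> carrier (P j)"
  shows "gcomm E (i + 1) (j + 1) (gcomm E i 1 a B) (gcomm E j 1 b B) = gcomm E (i + j + 1) 1 (br i j a b) B"
proof -
  have cl: "gcomm E (i + j + 1) 1 (br i j a b) B \<in> carrier (P (i + j + 2))"
    unfolding derived_bracket_def by (intro gcomm_closed[OF _ B_closed] gcomm_closed[OF gcomm_B_closed[OF a] b]) auto
  show ?thesis
    using gcomm_jacobi[OF gcomm_B_closed[OF a] b B_closed refl] cl gcomm_gcomm_B[OF a]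
      gcomm_zero[OF b, of "i + 2"]
    by (simp add: derived_bracket_def ac_simps)
qed

lemma gcomm_bilinear: "bilinear_map R (P i) (P j) (P (i + j)) (gcomm E i j)"
proof -
  interpret m: Module.module R "P (i + j)" by (rule gpart_module)
  have sm: "r \<odot>\<^bsub>P n\<^esub> x \<in> carrier (P n)" if "r \<in> carrier R" "x \<in> carrier (P n)" for r x n
    using module.smult_closed[OF gpart_module] that .
  have gs: "r \<odot>\<^bsub>P (i + j)\<^esub> gsgn (P (i + j)) n x = gsgn (P (i + j)) n (r \<odot>\<^bsub>P (i + j)\<^esub> x)" if "r \<in> carrier R" "x \<in> carrier (P (i + j))" for r x n
    using that by (simp add: gsgn_def m.smult_r_minus)
  have ms: "r \<odot>\<^bsub>P (i + j)\<^esub> (x \<ominus>\<^bsub>P (i + j)\<^esub> y) = r \<odot>\<^bsub>P (i + j)\<^esub> x \<ominus>\<^bsub>P (i + j)\<^esub> r \<odot>\<^bsub>P (i + j)\<^esub> y"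
    if "r \<in> carrier R" "x \<in> carrier (P (i + j))" "y \<in> carrier (P (i + j))" for r x y
    using that by (simp add: a_minus_def m.smult_r_distr m.smult_r_minus)
  have am: "(x \<oplus>\<^bsub>P n\<^esub> y) \<ominus>\<^bsub>P n\<^esub> (z \<oplus>\<^bsub>P n\<^esub> w) = (x \<ominus>\<^bsub>P n\<^esub> z) \<oplus>\<^bsub>P n\<^esub> (y \<ominus>\<^bsub>P n\<^esub> w)"
    if "x \<in> carrier (P n)" "y \<in> carrier (P n)" "z \<in> carrier (P n)" "w \<in> carrier (P n)" for n x y z w
    using that by (simp add: a_minus_def gpart.minus_add gpart.a_ac)
  have l: "linear_map R (P i) (P (j + i)) (gmul E j i b)" "linear_map R (P i) (P (i + j)) (\<lambda>x. gmul E i j x b)" if "b \<in> carrier (P j)" for b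
    using that by (auto intro: gmul_left gmul_right)
  have r: "linear_map R (P j) (P (j + i)) (\<lambda>x. gmul E j i x a)" "linear_map R (P j) (P (i + j)) (gmul E i j a)" if "a \<in> carrier (P i)" for a
    using that by (auto intro: gmul_left gmul_right)
  have c: "gmul E i j a b \<in> carrier (P (i + j))" "gmul E j i b a \<in> carrier (P (i + j))" if "a \<in> carrier (P i)" "b \<in> carrier (P j)" for a b
    using that by (auto intro: gmul_closed)
  show ?thesis
    unfolding bilinear_map_def
    by (intro conjI ballI linear_mapI)
      (auto intro: gcomm_closed simp: gcomm_def linear_map_add[OF l(1)] linear_map_add[OF l(2)] linear_map_add[OF r(1)] linear_map_add[OF r(2)]
        linear_map_smult[OF l(1)] linear_map_smult[OF l(2)] linear_map_smult[OF r(1)] linear_map_smult[OF r(2)]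
        add.commute[of j i] gpart.gsgn_add am c ms gs sm)
qed

lemma derived_bracket_bilinear: "bilinear_map R (P i) (P j) (P (i + j + 1)) (br i j)"
proof -
  have 1: "linear_map R (P i) (P (i + 1)) (\<lambda>x. gcomm E i 1 x B)"
    using gcomm_bilinear[of i 1] B_closed unfolding bilinear_map_def by blast
  have 2: "linear_map R (P (i + 1)) (P (i + j + 1)) (\<lambda>x. gcomm E (i + 1) j x b)" if "b \<in> carrier (P j)" for b
    using gcomm_bilinear[of "i + 1" j] that unfolding bilinear_map_def by (simp add: ac_simps)
  have 3: "linear_map R (P j) (P (i + j + 1)) (gcomm E (i + 1) j x)" if "x \<in> carrier (P (i + 1))" for x
    using gcomm_bilinear[of "i + 1" j] that unfolding bilinear_map_def by (simp add: ac_simps)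
  show ?thesis
    unfolding bilinear_map_def derived_bracket_def
  proof (intro conjI ballI)
    show "linear_map R (P j) (P (i + j + 1)) (gcomm E (i + 1) j (gcomm E i 1 x B))" if "x \<in> carrier (P i)" for x
      by (rule 3[OF linear_map_closed[OF 1 that]])
    show "linear_map R (P i) (P (i + j + 1)) (\<lambda>x. gcomm E (i + 1) j (gcomm E i 1 x B) b)" if "b \<in> carrier (P j)" for b
      by (intro linear_mapI)
        (auto simp: linear_map_closed[OF 1] linear_map_add[OF 1] linear_map_smult[OF 1] linear_map_add[OF 2[OF that]]
          linear_map_smult[OF 2[OF that]] intro: linear_map_closed[OF 2[OF that]])
  qed
qed

lemma derived_lg_loday_gerstenhaber: "loday_gerstenhaber_algebra R (derived_lg E B)"
proof (intro loday_gerstenhaber_algebra.intro graded_algebra.intro loday_gerstenhaber_algebra_axioms.intro)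
  fix i j k a b c
  assume "a \<in> carrier (gpart (derived_lg E B) i)" "b \<in> carrier (gpart (derived_lg E B) j)" "c \<in> carrier (gpart (derived_lg E B) k)"
  then have a: "a \<in> carrier (P i)" and b: "b \<in> carrier (P j)" and c: "c \<in> carrier (P k)"
    by (simp_all add: derived_lg_def)
  show "gmul (derived_lg E B) (i + j) k (gmul (derived_lg E B) i j a b) c =
      gmul (derived_lg E B) i (j + k) a (gmul (derived_lg E B) j k b c)"
    using gmul_assoc[OF a b c] by (simp add: derived_lg_def)
  show "gbr (derived_lg E B) i (j + k + 1) a (gbr (derived_lg E B) j k b c) =
      gbr (derived_lg E B) (i + j + 1) k (gbr (derived_lg E B) i j a b) c
      \<oplus>\<^bsub>gpart (derived_lg E B) (i + j + k + 2)\<^esub>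
      gsgn (gpart (derived_lg E B) (i + j + k + 2)) ((i + 1) * (j + 1)) (gbr (derived_lg E B) j (i + k + 1) b (gbr (derived_lg E B) i k a c))"
    using gcomm_jacobi[OF gcomm_B_closed[OF a] gcomm_B_closed[OF b] c, of "i + j + k + 2"] br_gcomm_B[OF a b]
    by (simp add: derived_lg_def derived_bracket_def ac_simps)
  show "gbr (derived_lg E B) i (j + k) a (gmul (derived_lg E B) j k b c) =
      gmul (derived_lg E B) (i + j + 1) k (gbr (derived_lg E B) i j a b) c
      \<oplus>\<^bsub>gpart (derived_lg E B) (i + j + k + 1)\<^esub>
      gsgn (gpart (derived_lg E B) (i + j + k + 1)) ((i + 1) * j) (gmul (derived_lg E B) j (i + k + 1) b (gbr (derived_lg E B) i k a c))"
    using gcomm_gmul[OF gcomm_B_closed[OF a] b c, of "i + j + k + 1"]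
    by (simp add: derived_lg_def derived_bracket_def ac_simps)
qed (use gpart_module gmul_bilinear gone_closed gone_left gone_right derived_bracket_bilinear in \<open>simp_all add: derived_lg_def\<close>)

end

section \<open>Graded endomorphisms\<close>

lemma End_part_carrier:
  "\<phi> \<in> carrier (End_part R M i) \<longleftrightarrow> (\<forall>N. \<phi> N \<in> extensional (carrier (M N)) \<and> linear_map R (M N) (M (N + i)) (\<phi> N))"
  by (simp add: End_part_def)

lemma End_part_eqI:
  assumes "\<phi> \<in> carrier (End_part R M i)" "\<psi> \<in> carrier (End_part R M j)" and "\<And>N x. x \<in> carrier (M N) \<Longrightarrow> \<phi> N x = \<psi> N x"
  shows "\<phi> = \<psi>"
  using assms by (intro ext) (metis End_part_carrier extensionalityI)

lemma End_part_simps: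
  "x \<in> carrier (M N) \<Longrightarrow> (\<phi> \<oplus>\<^bsub>End_part R M i\<^esub> \<psi>) N x = \<phi> N x \<oplus>\<^bsub>M (N + i)\<^esub> \<psi> N x"
  "x \<in> carrier (M N) \<Longrightarrow> (r \<odot>\<^bsub>End_part R M i\<^esub> \<phi>) N x = r \<odot>\<^bsub>M (N + i)\<^esub> \<phi> N x"
  "x \<in> carrier (M N) \<Longrightarrow> \<zero>\<^bsub>End_part R M i\<^esub> N x = \<zero>\<^bsub>M (N + i)\<^esub>"
  by (simp_all add: End_part_def)

locale graded_module =
  fixes R :: "'k ring" and M :: "int \<Rightarrow> ('k, 'm) module"
  assumes M_module: "Module.module R (M i)"
begin

sublocale m: Module.module R "M i" for i
  by (rule M_module)

lemma End_closed: "\<phi> \<in> carrier (End_part R M i) \<Longrightarrow> x \<in> carrier (M N) \<Longrightarrow> n = N + i \<Longrightarrow> \<phi> N x \<in> carrier (M n)"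
  by (auto simp: End_part_carrier intro: linear_map_closed)

lemma End_add: "\<phi> \<in> carrier (End_part R M i) \<Longrightarrow> x \<in> carrier (M N) \<Longrightarrow> y \<in> carrier (M N) \<Longrightarrow> \<phi> N (x \<oplus>\<^bsub>M N\<^esub> y) = \<phi> N x \<oplus>\<^bsub>M (N + i)\<^esub> \<phi> N y"
  by (auto simp: End_part_carrier intro: linear_map_add)

lemma End_smult: "\<phi> \<in> carrier (End_part R M i) \<Longrightarrow> r \<in> carrier R \<Longrightarrow> x \<in> carrier (M N) \<Longrightarrow> \<phi> N (r \<odot>\<^bsub>M N\<^esub> x) = r \<odot>\<^bsub>M (N + i)\<^esub> \<phi> N x"
  by (auto simp: End_part_carrier intro: linear_map_smult)

lemma End_partI:
  assumes "\<And>N. \<phi> N \<in> extensional (carrier (M N))"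
    and "\<And>N x. x \<in> carrier (M N) \<Longrightarrow> \<phi> N x \<in> carrier (M (N + i))"
    and "\<And>N x y. x \<in> carrier (M N) \<Longrightarrow> y \<in> carrier (M N) \<Longrightarrow> \<phi> N (x \<oplus>\<^bsub>M N\<^esub> y) = \<phi> N x \<oplus>\<^bsub>M (N + i)\<^esub> \<phi> N y"
    and "\<And>N r x. r \<in> carrier R \<Longrightarrow> x \<in> carrier (M N) \<Longrightarrow> \<phi> N (r \<odot>\<^bsub>M N\<^esub> x) = r \<odot>\<^bsub>M (N + i)\<^esub> \<phi> N x"
  shows "\<phi> \<in> carrier (End_part R M i)"
  using assms by (auto simp: End_part_carrier intro!: linear_mapI)

lemma End_add_closed:
  assumes f: "\<phi> \<in> carrier (End_part R M i)" and g: "\<psi> \<in> carrier (End_part R M i)"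
  shows "\<phi> \<oplus>\<^bsub>End_part R M i\<^esub> \<psi> \<in> carrier (End_part R M i)"
proof (rule End_partI)
  show "(\<phi> \<oplus>\<^bsub>End_part R M i\<^esub> \<psi>) N \<in> extensional (carrier (M N))" for N
    by (simp add: End_part_def)
qed (simp_all add: End_part_simps End_closed[OF f] End_closed[OF g] End_add[OF f] End_add[OF g] End_smult[OF f] End_smult[OF g]
    m.smult_r_distr m.a_ac)

lemma End_smult_closed:
  assumes r: "r \<in> carrier R" and f: "\<phi> \<in> carrier (End_part R M i)"
  shows "r \<odot>\<^bsub>End_part R M i\<^esub> \<phi> \<in> carrier (End_part R M i)"
proof (rule End_partI)
  fix N s x assume s: "s \<in> carrier R" and x: "x \<in> carrier (M N)"
  have "r \<odot>\<^bsub>M (N + i)\<^esub> (s \<odot>\<^bsub>M (N + i)\<^esub> \<phi> N x) = s \<odot>\<^bsub>M (N + i)\<^esub> (r \<odot>\<^bsub>M (N + i)\<^esub> \<phi> N x)"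
    using r s End_closed[OF f x refl] by (simp add: m.smult_assoc1[symmetric] m.R.m_comm)
  then show "(r \<odot>\<^bsub>End_part R M i\<^esub> \<phi>) N (s \<odot>\<^bsub>M N\<^esub> x) = s \<odot>\<^bsub>M (N + i)\<^esub> (r \<odot>\<^bsub>End_part R M i\<^esub> \<phi>) N x"
    using s x by (simp add: End_part_simps End_smult[OF f])
next
  show "(r \<odot>\<^bsub>End_part R M i\<^esub> \<phi>) N \<in> extensional (carrier (M N))" for N
    by (simp add: End_part_def)
qed (simp_all add: End_part_simps r End_closed[OF f] End_add[OF f] m.smult_r_distr)

lemma End_part_module: "Module.module R (End_part R M i)"
proof (rule moduleI)
  show "cring R" by (rule m.R.cring_axioms)
  show "abelian_group (End_part R M i)"
  proof (rule abelian_groupI)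
    show z: "\<zero>\<^bsub>End_part R M i\<^esub> \<in> carrier (End_part R M i)"
      by (rule End_partI) (auto simp: End_part_def)
    fix \<phi> assume f: "\<phi> \<in> carrier (End_part R M i)"
    show "\<zero>\<^bsub>End_part R M i\<^esub> \<oplus>\<^bsub>End_part R M i\<^esub> \<phi> = \<phi>"
      by (rule End_part_eqI[OF End_add_closed[OF z f] f]) (simp add: End_part_simps End_closed[OF f])
    let ?n = "\<lambda>N. \<lambda>x\<in>carrier (M N). \<ominus>\<^bsub>M (N + i)\<^esub> \<phi> N x"
    have n: "?n \<in> carrier (End_part R M i)"
      by (rule End_partI) (auto simp: End_closed[OF f] End_add[OF f] End_smult[OF f] m.minus_add m.smult_r_minus)
    have "?n \<oplus>\<^bsub>End_part R M i\<^esub> \<phi> = \<zero>\<^bsub>End_part R M i\<^esub>"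
      by (rule End_part_eqI[OF End_add_closed[OF n f] z]) (simp add: End_part_simps End_closed[OF f] m.l_neg)
    with n show "\<exists>\<psi>\<in>carrier (End_part R M i). \<psi> \<oplus>\<^bsub>End_part R M i\<^esub> \<phi> = \<zero>\<^bsub>End_part R M i\<^esub>" by blast
  next
    fix \<phi> \<psi> assume f: "\<phi> \<in> carrier (End_part R M i)" and g: "\<psi> \<in> carrier (End_part R M i)"
    show "\<phi> \<oplus>\<^bsub>End_part R M i\<^esub> \<psi> = \<psi> \<oplus>\<^bsub>End_part R M i\<^esub> \<phi>"
      by (rule End_part_eqI[OF End_add_closed[OF f g] End_add_closed[OF g f]])
        (simp add: End_part_simps End_closed[OF f] End_closed[OF g] m.a_comm)
    fix \<chi> assume h: "\<chi> \<in> carrier (End_part R M i)"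
    show "\<phi> \<oplus>\<^bsub>End_part R M i\<^esub> \<psi> \<oplus>\<^bsub>End_part R M i\<^esub> \<chi> = \<phi> \<oplus>\<^bsub>End_part R M i\<^esub> (\<psi> \<oplus>\<^bsub>End_part R M i\<^esub> \<chi>)"
      by (rule End_part_eqI[OF End_add_closed[OF End_add_closed[OF f g] h] End_add_closed[OF f End_add_closed[OF g h]]])
        (simp add: End_part_simps End_closed[OF f] End_closed[OF g] End_closed[OF h] m.a_assoc)
  qed (rule End_add_closed)
next
  fix r s \<phi> assume r: "r \<in> carrier R" and s: "s \<in> carrier R" and f: "\<phi> \<in> carrier (End_part R M i)"
  show "(r \<oplus>\<^bsub>R\<^esub> s) \<odot>\<^bsub>End_part R M i\<^esub> \<phi> = r \<odot>\<^bsub>End_part R M i\<^esub> \<phi> \<oplus>\<^bsub>End_part R M i\<^esub> s \<odot>\<^bsub>End_part R M i\<^esub> \<phi>"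
    by (rule End_part_eqI[OF End_smult_closed[OF _ f] End_add_closed[OF End_smult_closed[OF r f] End_smult_closed[OF s f]]])
      (simp_all add: End_part_simps End_closed[OF f] r s m.smult_l_distr)
  show "(r \<otimes>\<^bsub>R\<^esub> s) \<odot>\<^bsub>End_part R M i\<^esub> \<phi> = r \<odot>\<^bsub>End_part R M i\<^esub> (s \<odot>\<^bsub>End_part R M i\<^esub> \<phi>)"
    by (rule End_part_eqI[OF End_smult_closed[OF _ f] End_smult_closed[OF r End_smult_closed[OF s f]]])
      (simp_all add: End_part_simps End_closed[OF f] r s m.smult_assoc1)
next
  fix r \<phi> \<psi> assume r: "r \<in> carrier R" and f: "\<phi> \<in> carrier (End_part R M i)" and g: "\<psi> \<in> carrier (End_part R M i)"
  show "r \<odot>\<^bsub>End_part R M i\<^esub> (\<phi> \<oplus>\<^bsub>End_part R M i\<^esub> \<psi>) = r \<odot>\<^bsub>End_part R M i\<^esub> \<phi> \<oplus>\<^bsub>End_part R M i\<^esub> r \<odot>\<^bsub>End_part R M i\<^esub> \<psi>"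
    by (rule End_part_eqI[OF End_smult_closed[OF r End_add_closed[OF f g]] End_add_closed[OF End_smult_closed[OF r f] End_smult_closed[OF r g]]])
      (simp add: End_part_simps End_closed[OF f] End_closed[OF g] r m.smult_r_distr)
next
  fix \<phi> assume f: "\<phi> \<in> carrier (End_part R M i)"
  show "\<one>\<^bsub>R\<^esub> \<odot>\<^bsub>End_part R M i\<^esub> \<phi> = \<phi>"
    by (rule End_part_eqI[OF End_smult_closed[OF _ f] f]) (simp_all add: End_part_simps End_closed[OF f])
qed (rule End_smult_closed)

lemma End_comp_closed:
  assumes f: "\<phi> \<in> carrier (End_part R M i)" and g: "\<psi> \<in> carrier (End_part R M j)" and n: "n = i + j"
  shows "gmul (End_alg R M) i j \<phi> \<psi> \<in> carrier (End_part R M n)"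
proof -
  have e: "N + n = N + j + i" for N by (simp add: n)
  show ?thesis
    by (rule End_partI)
      (auto simp: End_alg_def compose_def e End_closed[OF g] End_add[OF g] End_smult[OF g] End_add[OF f] End_smult[OF f] intro: End_closed[OF f])
qed

lemma End_comp_simps: "x \<in> carrier (M N) \<Longrightarrow> gmul (End_alg R M) i j \<phi> \<psi> N x = \<phi> (N + j) (\<psi> N x)"
  by (simp add: End_alg_def compose_def)

lemma gpart_End: "gpart (End_alg R M) = End_part R M"
  by (simp add: End_alg_def)

lemma End_one_closed: "gone (End_alg R M) \<in> carrier (End_part R M 0)"
  by (rule End_partI) (auto simp: End_alg_def)

lemma End_alg_graded_algebra: "graded_algebra R (End_alg R M)"
proof (rule graded_algebra.intro, unfold gpart_End)
  show "Module.module R (End_part R M i)" for i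
    by (rule End_part_module)
  show "bilinear_map R (End_part R M i) (End_part R M j) (End_part R M (i + j)) (gmul (End_alg R M) i j)" for i j
  proof -
    have e: "N + (i + j) = N + j + i" for N by simp
    show ?thesis
      unfolding bilinear_map_def
    proof (intro conjI ballI linear_mapI)
      fix \<phi> \<psi> \<chi> assume f: "\<phi> \<in> carrier (End_part R M i)" and g: "\<psi> \<in> carrier (End_part R M j)" and h: "\<chi> \<in> carrier (End_part R M j)"
      show "gmul (End_alg R M) i j \<phi> (\<psi> \<oplus>\<^bsub>End_part R M j\<^esub> \<chi>) = gmul (End_alg R M) i j \<phi> \<psi> \<oplus>\<^bsub>End_part R M (i + j)\<^esub> gmul (End_alg R M) i j \<phi> \<chi>"
        by (rule End_part_eqI[OF End_comp_closed[OF f End_add_closed[OF g h] refl] End_add_closed[OF End_comp_closed[OF f g refl] End_comp_closed[OF f h refl]]])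
          (simp add: End_part_simps End_comp_simps End_add[OF f] End_closed[OF g] End_closed[OF h] e)
    next
      fix \<phi> \<psi> r assume f: "\<phi> \<in> carrier (End_part R M i)" and g: "\<psi> \<in> carrier (End_part R M j)" and r: "r \<in> carrier R"
      show "gmul (End_alg R M) i j \<phi> (r \<odot>\<^bsub>End_part R M j\<^esub> \<psi>) = r \<odot>\<^bsub>End_part R M (i + j)\<^esub> gmul (End_alg R M) i j \<phi> \<psi>"
        by (rule End_part_eqI[OF End_comp_closed[OF f End_smult_closed[OF r g] refl] End_smult_closed[OF r End_comp_closed[OF f g refl]]])
          (simp add: End_part_simps End_comp_simps End_smult[OF f] End_closed[OF g] r e)
    next
      fix \<phi> \<psi> \<chi> assume g: "\<psi> \<in> carrier (End_part R M j)" and f: "\<phi> \<in> carrier (End_part R M i)" and h: "\<chi> \<in> carrier (End_part R M i)"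
      show "gmul (End_alg R M) i j (\<phi> \<oplus>\<^bsub>End_part R M i\<^esub> \<chi>) \<psi> = gmul (End_alg R M) i j \<phi> \<psi> \<oplus>\<^bsub>End_part R M (i + j)\<^esub> gmul (End_alg R M) i j \<chi> \<psi>"
        by (rule End_part_eqI[OF End_comp_closed[OF End_add_closed[OF f h] g refl] End_add_closed[OF End_comp_closed[OF f g refl] End_comp_closed[OF h g refl]]])
          (simp add: End_part_simps End_comp_simps End_closed[OF g] e)
    next
      fix \<phi> \<psi> r assume g: "\<psi> \<in> carrier (End_part R M j)" and r: "r \<in> carrier R" and f: "\<phi> \<in> carrier (End_part R M i)"
      show "gmul (End_alg R M) i j (r \<odot>\<^bsub>End_part R M i\<^esub> \<phi>) \<psi> = r \<odot>\<^bsub>End_part R M (i + j)\<^esub> gmul (End_alg R M) i j \<phi> \<psi>"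
        by (rule End_part_eqI[OF End_comp_closed[OF End_smult_closed[OF r f] g refl] End_smult_closed[OF r End_comp_closed[OF f g refl]]])
          (simp add: End_part_simps End_comp_simps End_closed[OF g] r e)
    qed (auto intro: End_comp_closed)
  qed
  show "gone (End_alg R M) \<in> carrier (End_part R M 0)"
    by (rule End_one_closed)
  fix i j k \<phi> \<psi> \<chi>
  assume f: "\<phi> \<in> carrier (End_part R M i)"
  show "gmul (End_alg R M) 0 i (gone (End_alg R M)) \<phi> = \<phi>"
    by (rule End_part_eqI[OF End_comp_closed[OF End_one_closed f refl] f]) (simp add: End_alg_def compose_def End_closed[OF f])
  show "gmul (End_alg R M) i 0 \<phi> (gone (End_alg R M)) = \<phi>"
    by (rule End_part_eqI[OF End_comp_closed[OF f End_one_closed refl] f]) (simp add: End_alg_def compose_def)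
  assume g: "\<psi> \<in> carrier (End_part R M j)" and h: "\<chi> \<in> carrier (End_part R M k)"
  show "gmul (End_alg R M) (i + j) k (gmul (End_alg R M) i j \<phi> \<psi>) \<chi> = gmul (End_alg R M) i (j + k) \<phi> (gmul (End_alg R M) j k \<psi> \<chi>)"
    by (rule End_part_eqI[OF End_comp_closed[OF End_comp_closed[OF f g refl] h refl] End_comp_closed[OF f End_comp_closed[OF g h refl] refl]])
      (simp add: End_comp_simps End_closed[OF h] ac_simps)
qed

end

context graded_module
begin

lemma End_a_inv:
  assumes f: "\<phi> \<in> carrier (End_part R M i)" and x: "x \<in> carrier (M N)"
  shows "(\<ominus>\<^bsub>End_part R M i\<^esub> \<phi>) N x = \<ominus>\<^bsub>M (N + i)\<^esub> \<phi> N x"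
proof -
  interpret e: Module.module R "End_part R M i" by (rule End_part_module)
  have n: "\<ominus>\<^bsub>End_part R M i\<^esub> \<phi> \<in> carrier (End_part R M i)"
    using f by simp
  have "\<phi> N x \<oplus>\<^bsub>M (N + i)\<^esub> (\<ominus>\<^bsub>End_part R M i\<^esub> \<phi>) N x = \<zero>\<^bsub>M (N + i)\<^esub>"
    using e.r_neg[OF f] End_part_simps(1)[where x = x and M = M and N = N and R = R and i = i and \<phi> = \<phi> and \<psi> = "\<ominus>\<^bsub>End_part R M i\<^esub> \<phi>"]
      End_part_simps(3)[where x = x and M = M and N = N and R = R and i = i] x by simp
  then show ?thesis
    using End_closed[OF f x refl] End_closed[OF n x refl]
    by (intro m.minus_equality[symmetric]) (simp_all add: m.a_comm)
qed

lemma End_gsgn: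
  "\<phi> \<in> carrier (End_part R M i) \<Longrightarrow> x \<in> carrier (M N) \<Longrightarrow> gsgn (End_part R M i) n \<phi> N x = gsgn (M (N + i)) n (\<phi> N x)"
  by (simp add: gsgn_def End_a_inv)

lemma End_gcomm:
  assumes f: "\<phi> \<in> carrier (End_part R M i)" and g: "\<psi> \<in> carrier (End_part R M j)" and x: "x \<in> carrier (M N)"
  shows "gcomm (End_alg R M) i j \<phi> \<psi> N x = \<phi> (N + j) (\<psi> N x) \<ominus>\<^bsub>M (N + (i + j))\<^esub> gsgn (M (N + (i + j))) (i * j) (\<psi> (N + i) (\<phi> N x))"
proof -
  interpret e: signed_group "End_part R M (i + j)"
    using End_part_module[of "i + j"] by (simp add: signed_group_def module_def)
  have c: "gmul (End_alg R M) j i \<psi> \<phi> \<in> carrier (End_part R M (i + j))"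
    by (rule End_comp_closed[OF g f]) simp
  show ?thesis
    using x by (simp add: gcomm_def gpart_End a_minus_def End_part_simps End_comp_simps
        End_a_inv[OF e.gsgn_closed[OF c]] End_gsgn[OF c])
qed

end

section \<open>Images of Gerstenhaber algebras\<close>

text \<open>Every element of \<open>N\<close> is a value of \<open>f\<close>, so each module law of
  \<open>N\<close> is the image of a law of \<open>M\<close>.\<close>

lemma module_image:
  assumes M: "Module.module R M" and N: "carrier N = f ` carrier M"
    and f_add: "\<And>x y. x \<in> carrier M \<Longrightarrow> y \<in> carrier M \<Longrightarrow> f (x \<oplus>\<^bsub>M\<^esub> y) = f x \<oplus>\<^bsub>N\<^esub> f y"
    and f_smult: "\<And>r x. r \<in> carrier R \<Longrightarrow> x \<in> carrier M \<Longrightarrow> f (r \<odot>\<^bsub>M\<^esub> x) = r \<odot>\<^bsub>N\<^esub> f x"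
    and f_zero: "f \<zero>\<^bsub>M\<^esub> = \<zero>\<^bsub>N\<^esub>"
  shows "Module.module R N"
proof -
  interpret Module.module R M by fact
  show ?thesis
  proof (rule moduleI)
    show "abelian_group N"
    proof (rule abelian_groupI)
      fix x assume "x \<in> carrier N"
      then obtain a where a: "a \<in> carrier M" "x = f a" by (auto simp: N)
      then show "\<zero>\<^bsub>N\<^esub> \<oplus>\<^bsub>N\<^esub> x = x"
        by (simp add: f_zero[symmetric] f_add[symmetric])
      show "\<exists>y\<in>carrier N. y \<oplus>\<^bsub>N\<^esub> x = \<zero>\<^bsub>N\<^esub>"
        using a f_add[of "\<ominus>\<^bsub>M\<^esub> a" a] by (auto simp: N l_neg f_zero intro!: bexI[of _ "f (\<ominus>\<^bsub>M\<^esub> a)"])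
    qed (auto simp: N f_add[symmetric] f_zero[symmetric] a_ac)
  qed (auto simp: N f_add[symmetric] f_smult[symmetric] smult_l_distr smult_r_distr smult_assoc1 R.cring_axioms)
qed

lemma gerstenhaber_lg_image:
  fixes E :: "('k, 'e) lg_alg" and F :: "('k, 'f) lg_alg"
  assumes E: "gerstenhaber_algebra R E" and mor: "lg_morphism R E F \<phi>"
  shows "gerstenhaber_algebra R (lg_image E F \<phi>)"
proof -
  interpret E: gerstenhaber_algebra R E by fact
  interpret lg_morphism R E F \<phi> by fact
  let ?I = "lg_image E F \<phi>"
  have I: "gmul ?I = gmul F" "gone ?I = gone F" "gbr ?I = gbr F" "carrier (gpart ?I i) = \<phi> i ` carrier (gpart E i)"
    "(\<oplus>\<^bsub>gpart ?I i\<^esub>) = (\<oplus>\<^bsub>gpart F i\<^esub>)" "(\<odot>\<^bsub>gpart ?I i\<^esub>) = (\<odot>\<^bsub>gpart F i\<^esub>)" "\<zero>\<^bsub>gpart ?I i\<^esub> = \<zero>\<^bsub>gpart F i\<^esub>" for i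
    by (simp_all add: lg_image_def)
  have \<phi>_zero: "\<phi> i \<zero>\<^bsub>gpart E i\<^esub> = \<zero>\<^bsub>gpart F i\<^esub>" for i
    using linear_map_minus[OF mor_linear E.gpart_abelian_group target.gpart_abelian_group E.gpart.zero_closed E.gpart.zero_closed, of i]
      linear_map_closed[OF mor_linear E.gpart.zero_closed, of i]
    by (simp add: a_minus_def E.gpart.r_neg target.gpart.r_neg)
  have mod: "Module.module R (gpart ?I i)" for i
    by (rule module_image[OF E.gpart_module I(4)])
      (simp_all add: I \<phi>_zero linear_map_add[OF mor_linear] linear_map_smult[OF mor_linear])
  have ab: "abelian_group (gpart ?I i)" for i
    using mod by (rule module.axioms)
  have lin: "linear_map R (gpart E i) (gpart ?I i) (\<phi> i)" for i
    by (rule linear_mapI) (simp_all add: I linear_map_add[OF mor_linear] linear_map_smult[OF mor_linear])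
  note lin_simps = linear_map_add[OF lin, symmetric] linear_map_smult[OF lin, symmetric]
    linear_map_gsgn[OF lin E.gpart_abelian_group ab, symmetric] linear_map_a_inv[OF lin E.gpart_abelian_group ab, symmetric]
  have mul: "gmul ?I i j (\<phi> i a) (\<phi> j b) = \<phi> (i + j) (gmul E i j a b)" if "a \<in> carrier (gpart E i)" "b \<in> carrier (gpart E j)" for i j a b
    using mor_mul[OF that] by (simp add: I)
  have br: "gbr ?I i j (\<phi> i a) (\<phi> j b) = \<phi> (i + j + 1) (gbr E i j a b)" if "a \<in> carrier (gpart E i)" "b \<in> carrier (gpart E j)" for i j a b
    using mor_br[OF that] by (simp add: I)
  have br_closed: "gbr E i j a b \<in> carrier (gpart E n)" if "a \<in> carrier (gpart E i)" "b \<in> carrier (gpart E j)" "n = i + j + 1" for i j n a b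
    using E.gbr_bilinear that unfolding bilinear_map_def by (blast intro: linear_map_closed)
  have surj: "\<exists>a\<in>carrier (gpart E i). x = \<phi> i a" if "x \<in> carrier (gpart ?I i)" for x i
    using that by (auto simp: I)
  have bil: "bilinear_map R (gpart ?I i) (gpart ?I j) (gpart ?I n) h'"
    if h: "bilinear_map R (gpart E i) (gpart E j) (gpart E n) h"
      and hh: "\<And>a b. a \<in> carrier (gpart E i) \<Longrightarrow> b \<in> carrier (gpart E j) \<Longrightarrow> h' (\<phi> i a) (\<phi> j b) = \<phi> n (h a b)" for i j n h h'
  proof -
    have 1: "linear_map R (gpart E j) (gpart E n) (h a)" if "a \<in> carrier (gpart E i)" for a
      using h that unfolding bilinear_map_def by blast
    have 2: "linear_map R (gpart E i) (gpart E n) (\<lambda>a. h a b)" if "b \<in> carrier (gpart E j)" for b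
      using h that unfolding bilinear_map_def by blast
    show ?thesis
      unfolding bilinear_map_def
    proof (intro conjI ballI linear_mapI)
      fix x y z assume "x \<in> carrier (gpart ?I i)" "y \<in> carrier (gpart ?I j)" "z \<in> carrier (gpart ?I j)"
      then obtain a b c where "a \<in> carrier (gpart E i)" "b \<in> carrier (gpart E j)" "c \<in> carrier (gpart E j)" "x = \<phi> i a" "y = \<phi> j b" "z = \<phi> j c"
        by (meson surj)
      then show "h' x (y \<oplus>\<^bsub>gpart ?I j\<^esub> z) = h' x y \<oplus>\<^bsub>gpart ?I n\<^esub> h' x z"
        by (simp add: hh lin_simps linear_map_add[OF 1] linear_map_closed[OF 1])
    next
      fix x y r assume r: "r \<in> carrier R" and "x \<in> carrier (gpart ?I i)" "y \<in> carrier (gpart ?I j)"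
      then obtain a b where "a \<in> carrier (gpart E i)" "b \<in> carrier (gpart E j)" "x = \<phi> i a" "y = \<phi> j b"
        by (meson surj)
      then show "h' x (r \<odot>\<^bsub>gpart ?I j\<^esub> y) = r \<odot>\<^bsub>gpart ?I n\<^esub> h' x y" "h' (r \<odot>\<^bsub>gpart ?I i\<^esub> x) y = r \<odot>\<^bsub>gpart ?I n\<^esub> h' x y"
        using r module.smult_closed[OF E.gpart_module]
        by (simp_all add: hh lin_simps linear_map_smult[OF 1] linear_map_smult[OF 2] linear_map_closed[OF 1])
    next
      fix x y z assume "x \<in> carrier (gpart ?I i)" "y \<in> carrier (gpart ?I i)" "z \<in> carrier (gpart ?I j)"
      then obtain a b c where "a \<in> carrier (gpart E i)" "b \<in> carrier (gpart E i)" "c \<in> carrier (gpart E j)" "x = \<phi> i a" "y = \<phi> i b" "z = \<phi> j c"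
        by (meson surj)
      then show "h' (x \<oplus>\<^bsub>gpart ?I i\<^esub> y) z = h' x z \<oplus>\<^bsub>gpart ?I n\<^esub> h' y z"
        by (simp add: hh lin_simps linear_map_add[OF 2] linear_map_closed[OF 2])
    next
      fix x y assume "x \<in> carrier (gpart ?I i)" "y \<in> carrier (gpart ?I j)"
      then obtain a b where "a \<in> carrier (gpart E i)" "b \<in> carrier (gpart E j)" "x = \<phi> i a" "y = \<phi> j b"
        by (meson surj)
      then show "h' x y \<in> carrier (gpart ?I n)" "h' x y \<in> carrier (gpart ?I n)"
        by (simp_all add: hh I linear_map_closed[OF 1])
    qed
  qed
  show ?thesis
  proof (intro gerstenhaber_algebra.intro loday_gerstenhaber_algebra.intro graded_algebra.intro
      loday_gerstenhaber_algebra_axioms.intro gerstenhaber_algebra_axioms.intro)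
    show "bilinear_map R (gpart ?I i) (gpart ?I j) (gpart ?I (i + j)) (gmul ?I i j)" for i j
      by (rule bil[OF E.gmul_bilinear mul])
    show "bilinear_map R (gpart ?I i) (gpart ?I j) (gpart ?I (i + j + 1)) (gbr ?I i j)" for i j
      by (rule bil[OF E.gbr_bilinear br])
    have one: "gone ?I = \<phi> 0 (gone E)"
      by (simp add: I mor_one)
    then show "gone ?I \<in> carrier (gpart ?I 0)"
      using E.gone_closed by (simp add: I(4))
    fix i j k x y z
    assume "x \<in> carrier (gpart ?I i)"
    then obtain a where a: "a \<in> carrier (gpart E i)" "x = \<phi> i a"
      using surj by blast
    show "gmul ?I 0 i (gone ?I) x = x" "gmul ?I i 0 x (gone ?I) = x"
      using a mul[OF E.gone_closed a(1)] mul[OF a(1) E.gone_closed] by (simp_all add: one E.gone_left E.gone_right)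
    assume "y \<in> carrier (gpart ?I j)"
    then obtain b where b: "b \<in> carrier (gpart E j)" "y = \<phi> j b"
      using surj by blast
    have ba: "gmul E j i b a \<in> carrier (gpart E (i + j))" "gbr E j i b a \<in> carrier (gpart E (i + j + 1))"
      by (auto intro!: E.gmul_closed br_closed a b)
    show "gmul ?I i j x y = gsgn (gpart ?I (i + j)) (i * j) (gmul ?I j i y x)"
      using a b ba E.gmul_commute[OF a(1) b(1)] by (simp add: mul lin_simps add.commute[of j i])
    show "gbr ?I i j x y = \<ominus>\<^bsub>gpart ?I (i + j + 1)\<^esub> gsgn (gpart ?I (i + j + 1)) ((i + 1) * (j + 1)) (gbr ?I j i y x)"
      using a b ba E.gbr_antisym[OF a(1) b(1)] by (simp add: br lin_simps add.commute[of j i])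
    assume "z \<in> carrier (gpart ?I k)"
    then obtain c where c: "c \<in> carrier (gpart E k)" "z = \<phi> k c"
      using surj by blast
    show "gmul ?I (i + j) k (gmul ?I i j x y) z = gmul ?I i (j + k) x (gmul ?I j k y z)"
      using a b c E.gmul_assoc[OF a(1) b(1) c(1)] by (simp add: mul E.gmul_closed add.assoc)
    have 1: "gbr E j k b c \<in> carrier (gpart E (j + k + 1))" "gbr E i j a b \<in> carrier (gpart E (i + j + 1))"
      "gbr E i k a c \<in> carrier (gpart E (i + k + 1))" "gmul E j k b c \<in> carrier (gpart E (j + k))"
      by (auto intro!: br_closed E.gmul_closed a b c)
    have 2: "gbr E i (j + k + 1) a (gbr E j k b c) \<in> carrier (gpart E (i + j + k + 2))"
      "gbr E (i + j + 1) k (gbr E i j a b) c \<in> carrier (gpart E (i + j + k + 2))"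
      "gbr E j (i + k + 1) b (gbr E i k a c) \<in> carrier (gpart E (i + j + k + 2))"
      "gmul E (i + j + 1) k (gbr E i j a b) c \<in> carrier (gpart E (i + j + k + 1))"
      "gmul E j (i + k + 1) b (gbr E i k a c) \<in> carrier (gpart E (i + j + k + 1))"
      using 1 a b c by (auto intro!: br_closed E.gmul_closed)
    \<comment> \<open>\<open>\<phi>\<close> is indexed by the degree, so equal degrees that arise in
      different forms have to be unified before the axioms of \<open>E\<close> apply.\<close>
    have d: "\<phi> (i + (j + k + 1) + 1) = \<phi> (i + j + k + 2)" "\<phi> (i + j + 1 + k + 1) = \<phi> (i + j + k + 2)"
      "\<phi> (j + (i + k + 1) + 1) = \<phi> (i + j + k + 2)" "\<phi> (i + (j + k) + 1) = \<phi> (i + j + k + 1)"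
      "\<phi> (i + j + 1 + k) = \<phi> (i + j + k + 1)" "\<phi> (j + (i + k + 1)) = \<phi> (i + j + k + 1)"
      by (simp_all add: algebra_simps)
    show "gbr ?I i (j + k + 1) x (gbr ?I j k y z) = gbr ?I (i + j + 1) k (gbr ?I i j x y) z
        \<oplus>\<^bsub>gpart ?I (i + j + k + 2)\<^esub> gsgn (gpart ?I (i + j + k + 2)) ((i + 1) * (j + 1)) (gbr ?I j (i + k + 1) y (gbr ?I i k x z))"
      unfolding a(2) b(2) c(2) br[OF a(1) b(1)] br[OF b(1) c(1)] br[OF a(1) c(1)] br[OF a(1) 1(1)] br[OF 1(2) c(1)] br[OF b(1) 1(3)] d
      using 2 E.gbr_jacobi[OF a(1) b(1) c(1)] by (simp add: lin_simps)
    show "gbr ?I i (j + k) x (gmul ?I j k y z) = gmul ?I (i + j + 1) k (gbr ?I i j x y) z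
        \<oplus>\<^bsub>gpart ?I (i + j + k + 1)\<^esub> gsgn (gpart ?I (i + j + k + 1)) ((i + 1) * j) (gmul ?I j (i + k + 1) y (gbr ?I i k x z))"
      unfolding a(2) b(2) c(2) br[OF a(1) b(1)] mul[OF b(1) c(1)] br[OF a(1) c(1)] br[OF a(1) 1(4)] mul[OF 1(2) c(1)] mul[OF b(1) 1(3)] d
      using 2 E.gbr_leibniz[OF a(1) b(1) c(1)] by (simp add: lin_simps)
  qed (rule mod)
qed

section \<open>Subquotients\<close>

text \<open>The module laws are asked for only on \<open>Z\<close> and modulo \<open>B\<close>,
  because for chains the distributive law in the scalar holds only up to tensor relations, which lie
  in the boundaries.\<close>

locale subquotient_data =
  fixes act :: "'k::comm_ring_1 \<Rightarrow> 'b::ab_group_add \<Rightarrow> 'b" and Z B :: "'b set"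
  assumes Z_zero: "0 \<in> Z" and Z_diff: "x \<in> Z \<Longrightarrow> y \<in> Z \<Longrightarrow> x - y \<in> Z"
    and B_zero: "0 \<in> B" and B_diff: "x \<in> B \<Longrightarrow> y \<in> B \<Longrightarrow> x - y \<in> B"
    and act_plus: "act r (x + y) = act r x + act r y"
    and act_Z: "x \<in> Z \<Longrightarrow> act r x \<in> Z" and act_B: "x \<in> B \<Longrightarrow> act r x \<in> B"
    and act_distrib: "x \<in> Z \<Longrightarrow> act (r + s) x - (act r x + act s x) \<in> B"
    and act_assoc: "x \<in> Z \<Longrightarrow> act (r * s) x - act r (act s x) \<in> B"
    and act_one: "x \<in> Z \<Longrightarrow> act 1 x - x \<in> B"
begin

lemma Z_uminus: "x \<in> Z \<Longrightarrow> - x \<in> Z"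
  using Z_diff[OF Z_zero] by fastforce

lemma Z_add: "x \<in> Z \<Longrightarrow> y \<in> Z \<Longrightarrow> x + y \<in> Z"
  using Z_diff[of x "- y"] Z_uminus[of y] by simp

lemma B_uminus: "x \<in> B \<Longrightarrow> - x \<in> B"
  using B_diff[OF B_zero] by fastforce

lemma B_add: "x \<in> B \<Longrightarrow> y \<in> B \<Longrightarrow> x + y \<in> B"
  using B_diff[of x "- y"] B_uminus[of y] by simp

lemma mem_coset: "y \<in> x +o B \<longleftrightarrow> y - x \<in> B"
  by (force simp: elt_set_plus_def algebra_simps)

lemma coset_eq: "x +o B = y +o B \<longleftrightarrow> x - y \<in> B"
proof
  assume "x +o B = y +o B"
  with mem_coset[of x x] B_zero show "x - y \<in> B"
    by (simp add: mem_coset)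
next
  assume *: "x - y \<in> B"
  show "x +o B = y +o B"
  proof (rule Set.set_eqI)
    fix z
    show "z \<in> x +o B \<longleftrightarrow> z \<in> y +o B"
      using B_add[OF _ *, of "z - x"] B_diff[OF _ *, of "z - y"] by (auto simp: mem_coset)
  qed
qed

text \<open>Maps on classes are encoded as unions over representatives. If the value moves only
  within \<open>B\<close>, all cosets in the union coincide.\<close>

lemma UN_coset:
  assumes "z \<in> S" and "\<And>x. x \<in> S \<Longrightarrow> F x - F z \<in> B"
  shows "(\<Union>x\<in>S. F x +o B) = F z +o B"
  using assms coset_eq by blast

abbreviation (input) "Q \<equiv> subquotient act Z B"

lemma carrierE:
  assumes "U \<in> carrier Q"
  obtains z where "z \<in> Z" "U = z +o B"
  using assms by (auto simp: subquotient_def)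

lemma coset_closed: "z \<in> Z \<Longrightarrow> z +o B \<in> carrier Q"
  by (simp add: subquotient_def)

lemma coset_add: "(x +o B) \<oplus>\<^bsub>Q\<^esub> (y +o B) = (x + y) +o B"
proof -
  have "B + B = B"
    using B_add B_zero by (auto simp: set_plus_def) (metis add.right_neutral)
  then have "(x +o B) + (y +o B) = (x + y) +o B"
    by (simp add: set_plus_rearrange)
  then show ?thesis
    by (simp add: subquotient_def)
qed

lemma act_diff: "act r (x - y) = act r x - act r y"
  using act_plus[of r "x - y" y] by (simp add: algebra_simps)

lemma coset_smult: "r \<odot>\<^bsub>Q\<^esub> (x +o B) = act r x +o B"
proof -
  have "(\<Union>y\<in>x +o B. act r y +o B) = act r x +o B"
    by (rule UN_coset) (auto simp: mem_coset B_zero act_diff[symmetric] act_B)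
  then show ?thesis
    by (simp add: subquotient_def)
qed

lemma coset_zero: "\<zero>\<^bsub>Q\<^esub> = 0 +o B"
  by (simp add: subquotient_def)

lemma subquotient_module: "Module.module ring_of_type_algebra Q"
proof (rule moduleI)
  show "cring (ring_of_type_algebra :: 'k ring)" by (rule cring_from_type_algebra)
  show "abelian_group Q"
  proof (rule abelian_groupI)
    fix U assume "U \<in> carrier Q"
    then obtain z where z: "z \<in> Z" "U = z +o B" by (rule carrierE)
    then show "\<exists>V\<in>carrier Q. V \<oplus>\<^bsub>Q\<^esub> U = \<zero>\<^bsub>Q\<^esub>"
      by (auto intro!: bexI[of _ "- z +o B"] simp: coset_add coset_zero coset_closed Z_uminus)
  next
    show "\<zero>\<^bsub>Q\<^esub> \<in> carrier Q"
      using coset_closed[OF Z_zero] by (simp add: subquotient_def)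
    fix U assume "U \<in> carrier Q"
    then obtain z where "z \<in> Z" "U = z +o B" by (rule carrierE)
    then show "\<zero>\<^bsub>Q\<^esub> \<oplus>\<^bsub>Q\<^esub> U = U"
      unfolding coset_zero by (simp only: coset_add add_0_left)
  qed (auto elim!: carrierE simp: coset_add coset_closed Z_add ac_simps)
qed ((erule carrierE)+, simp add: coset_add coset_smult coset_closed act_Z act_plus ring_of_type_algebra_def coset_eq
    act_distrib act_assoc act_one B_zero)+

lemma coset_a_inv: "x \<in> Z \<Longrightarrow> \<ominus>\<^bsub>Q\<^esub> (x +o B) = - x +o B"
proof -
  interpret q: Module.module ring_of_type_algebra Q by (rule subquotient_module)
  assume "x \<in> Z"
  then show ?thesis
    by (intro q.minus_equality) (auto simp: coset_add coset_zero coset_closed Z_uminus)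
qed

lemma coset_gsgn: "x \<in> Z \<Longrightarrow> gsgn Q n (x +o B) = koszul n x +o B"
  by (simp add: gsgn_def koszul_def coset_a_inv)

lemma coset_minus: "y \<in> Z \<Longrightarrow> (x +o B) \<ominus>\<^bsub>Q\<^esub> (y +o B) = (x - y) +o B"
  by (simp add: a_minus_def coset_a_inv coset_add)

end

section \<open>Hochschild homology and cohomology\<close>

lemma UN_UN_const:
  assumes "u \<in> U" and "v \<in> V" and "\<And>x y. x \<in> U \<Longrightarrow> y \<in> V \<Longrightarrow> h x y = c"
  shows "(\<Union>x\<in>U. \<Union>y\<in>V. h x y) = c"
  using assms by auto

context dg_algebra
begin

lemma cycle_free: "z \<in> chain_cycles A N \<Longrightarrow> z \<in> free_chains A N"
  by (simp add: chain_cycles_iff)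

sublocale hom: subquotient_data "chain_scal A" "chain_cycles A N" "chain_boundaries A N" for N
proof
  show "chain_scal A (r + s) x - (chain_scal A r x + chain_scal A s x) \<in> chain_boundaries A N" if "x \<in> chain_cycles A N" for r s x
  proof (rule boundary_null)
    have x: "x \<in> free_chains A N" using that by (simp add: chain_cycles_iff)
    show "chain.eqv (chain_scal A (r + s) x - (chain_scal A r x + chain_scal A s x)) 0"
      using chain_scal_module(1)[OF x] by (simp add: chain.eqv_def)
    show "chain_scal A (r + s) x - (chain_scal A r x + chain_scal A s x) \<in> free_chains A N"
      by (intro free_chains_diff free_chains_add chain_scal_free x)
  qed
qed (auto simp: chain_scal_module(2,3)[OF cycle_free] boundary_zero chain.act_add
    intro: cycle_zero cycle_diff boundary_diff cycle_chain_scal boundary_chain_scal)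

sublocale cohom: subquotient_data "cochain_scal A" "cocycles A p" "coboundaries A p" for p
proof
  show "cochain_scal A (r + s) f - (cochain_scal A r f + cochain_scal A s f) \<in> coboundaries A p" for r s f
  proof -
    have "cochain_scal A (r + s) f - (cochain_scal A r f + cochain_scal A s f) = 0"
      by (simp add: fun_eq_iff cochain_scal_def scal.scale_left_distrib)
    then show ?thesis by (simp add: coboundary_zero)
  qed
  show "cochain_scal A (r * s) f - cochain_scal A r (cochain_scal A s f) \<in> coboundaries A p" "cochain_scal A 1 f - f \<in> coboundaries A p" for r s f
    using coboundary_zero by (simp_all add: cochain_scal_def[abs_def] zero_fun_def fun_diff_def)
qed (auto simp: cocycle_closed coboundary_zero coboundary_diff coboundary_scal cochain_scal_def fun_eq_iff
      scal.scale_right_distrib)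

lemma HH_hom_eq: "HH_hom A N = subquotient (chain_scal A) (chain_cycles A N) (chain_boundaries A N)"
  by (simp add: HH_hom_def)

lemma HH_cohom_eq: "HH_cohom A p = subquotient (cochain_scal A) (cocycles A p) (coboundaries A p)"
  by (simp add: HH_cohom_def)

sublocale HH: graded_module ring_of_type_algebra "HH_hom A"
  by (rule graded_module.intro) (simp add: HH_hom_eq hom.subquotient_module)

lemma homE:
  assumes "U \<in> carrier (HH_hom A N)"
  obtains z where "z \<in> chain_cycles A N" "U = z +o chain_boundaries A N"
  using assms unfolding HH_hom_eq by (rule hom.carrierE)

lemma cohomE:
  assumes "U \<in> carrier (HH_cohom A p)"
  obtains f where "f \<in> cocycles A p" "U = f +o coboundaries A p"
  using assms unfolding HH_cohom_eq by (rule cohom.carrierE)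

lemma hom_closed: "z \<in> chain_cycles A N \<Longrightarrow> z +o chain_boundaries A N \<in> carrier (HH_hom A N)"
  by (simp add: HH_hom_eq hom.coset_closed)

lemma cohom_closed: "f \<in> cocycles A p \<Longrightarrow> f +o coboundaries A p \<in> carrier (HH_cohom A p)"
  by (simp add: HH_cohom_eq cohom.coset_closed)

lemma boundary_free: "z \<in> chain_boundaries A N \<Longrightarrow> z \<in> free_chains A N"
  by (simp add: chain_boundaries_iff)

lemma coset_free:
  assumes "z \<in> chain_cycles A N" and "x \<in> z +o chain_boundaries A N"
  shows "x \<in> free_chains A N"
  using free_chains_add[OF boundary_free cycle_free, of "x - z" N z] assms by (simp add: hom.mem_coset)

lemma connes_coset:
  assumes z: "z \<in> chain_cycles A N"
  shows "connes A N (z +o chain_boundaries A N) = connes_op A z +o chain_boundaries A (N + 1)"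
proof -
  have "(\<Union>x\<in>z +o chain_boundaries A N. connes_chain A x +o chain_boundaries A (N + 1)) = connes_chain A z +o chain_boundaries A (N + 1)"
  proof (rule hom.UN_coset)
    show "z \<in> z +o chain_boundaries A N"
      by (simp add: hom.mem_coset boundary_zero)
    fix x assume x: "x \<in> z +o chain_boundaries A N"
    then show "connes_chain A x - connes_chain A z \<in> chain_boundaries A (N + 1)"
      unfolding connes_chain_eq[OF coset_free[OF z x]] connes_chain_eq[OF cycle_free[OF z]]
      by (simp add: hom.mem_coset connes_op_boundary flip: connes_op_linear)
  qed
  then show ?thesis
    using z by (simp add: connes_def hom_closed connes_chain_eq[OF cycle_free[OF z]])
qed

lemma action_op_coboundary:
  assumes "h \<in> coboundaries A p" and z: "z \<in> chain_cycles A N"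
  shows "action_op p h z \<in> chain_boundaries A (N + p)"
  using assms action_op_cobd by (auto simp: coboundaries_iff)

lemma action_coset:
  assumes f: "f \<in> cocycles A p" and z: "z \<in> chain_cycles A N"
  shows "HH_action A p (f +o coboundaries A p) N (z +o chain_boundaries A N) = action_op p f z +o chain_boundaries A (N + p)"
proof -
  let ?B = "chain_boundaries A (N + p)"
  have *: "action_op p f' x - action_op p f z \<in> ?B"
    if f': "f' \<in> f +o coboundaries A p" and x: "x \<in> z +o chain_boundaries A N" for f' x
  proof -
    define h where "h = f' - f"
    have h: "h \<in> coboundaries A p" "h \<in> cocycles A p"
      using f' coboundary_cocycle by (auto simp: h_def cohom.mem_coset)
    have xz: "x - z \<in> chain_boundaries A N"
      using x by (simp add: hom.mem_coset)
    have xf: "x \<in> free_chains A N"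
      by (rule coset_free[OF z x])
    have "chain.eqv (action_op p (f + h) x) (action_op p f x + action_op p h x)"
      using f h(2) xf by (intro action_op_add) (auto simp: cocycles_iff)
    \<comment> \<open>Independence of both choices at once: the first two terms are cocycles acting
      on a boundary, the last is a coboundary acting on a cycle.\<close>
    then have "chain.eqv (action_op p f' x - action_op p f z) (action_op p f (x - z) + (action_op p h (x - z) + action_op p h z))"
      by (simp add: h_def chain.eqv_def action_op_linear algebra_simps)
    moreover have "action_op p f (x - z) + (action_op p h (x - z) + action_op p h z) \<in> ?B"
      by (intro boundary_add action_op_boundary action_op_coboundary xz z h cocycleD f)
    moreover have "action_op p f' x - action_op p f z \<in> free_chains A (N + p)"
    proof (intro free_chains_diff action_op_free xf cycle_free[OF z] cocycleD[OF f])
      show "f' \<in> cochains A p"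
        using cochain_add_closed[OF cocycleD(1)[OF f] cocycleD(1)[OF h(2)]] by (simp add: h_def)
    qed
    ultimately show ?thesis
      using boundary_eqv by blast
  qed
  have ne: "f \<in> f +o coboundaries A p" "z \<in> z +o chain_boundaries A N"
    by (simp_all add: hom.mem_coset cohom.mem_coset boundary_zero coboundary_zero)
  have "(\<Union>y\<in>z +o chain_boundaries A N. frag_extend (action_word p f') y +o ?B) = action_op p f z +o ?B" if "f' \<in> f +o coboundaries A p" for f'
    using *[OF that] ne(2) unfolding action_op_def[symmetric] by (auto simp flip: hom.coset_eq)
  then have "(\<Union>f'\<in>f +o coboundaries A p. \<Union>y\<in>z +o chain_boundaries A N. frag_extend (action_word p f') y +o ?B) = action_op p f z +o ?B"
    using ne(1) by auto
  then show ?thesis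
    using z by (simp add: HH_action_def hom_closed)
qed

lemma connes_End: "connes A \<in> carrier (End_part ring_of_type_algebra (HH_hom A) 1)"
proof (rule HH.End_partI)
  show "connes A N \<in> extensional (carrier (HH_hom A N))" for N
    by (simp add: connes_def)
next
  fix N U assume "U \<in> carrier (HH_hom A N)"
  then show "connes A N U \<in> carrier (HH_hom A (N + 1))"
    by (elim homE) (simp add: connes_coset hom_closed connes_op_cycle)
next
  fix N U V assume "U \<in> carrier (HH_hom A N)" "V \<in> carrier (HH_hom A N)"
  then show "connes A N (U \<oplus>\<^bsub>HH_hom A N\<^esub> V) = connes A N U \<oplus>\<^bsub>HH_hom A (N + 1)\<^esub> connes A N V"
    by (elim homE) (simp add: connes_coset HH_hom_eq hom.coset_add hom.Z_add connes_op_linear)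
next
  fix N r U assume "U \<in> carrier (HH_hom A N)"
  then obtain z where z: "z \<in> chain_cycles A N" "U = z +o chain_boundaries A N"
    by (rule homE)
  have "connes_op A (chain_scal A r z) - chain_scal A r (connes_op A z) \<in> chain_boundaries A (N + 1)"
    using connes_op_chain_scal[OF cycle_free[OF z(1)]] z(1)
    by (intro boundary_null free_chains_diff connes_op_free chain_scal_free cycle_free) (auto simp: chain.eqv_def)
  then show "connes A N (r \<odot>\<^bsub>HH_hom A N\<^esub> U) = r \<odot>\<^bsub>HH_hom A (N + 1)\<^esub> connes A N U"
    using z by (simp add: connes_coset HH_hom_eq hom.coset_smult cycle_chain_scal hom.coset_eq)
qed

lemma connes_connes: "gmul (End_alg ring_of_type_algebra (HH_hom A)) 1 1 (connes A) (connes A) =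
  \<zero>\<^bsub>End_part ring_of_type_algebra (HH_hom A) 2\<^esub>"
proof (rule End_part_eqI)
  show "gmul (End_alg ring_of_type_algebra (HH_hom A)) 1 1 (connes A) (connes A) \<in> carrier (End_part ring_of_type_algebra (HH_hom A) 2)"
    by (rule HH.End_comp_closed[OF connes_End connes_End]) simp
  show "\<zero>\<^bsub>End_part ring_of_type_algebra (HH_hom A) 2\<^esub> \<in> carrier (End_part ring_of_type_algebra (HH_hom A) 2)"
  proof -
    interpret e: Module.module ring_of_type_algebra "End_part ring_of_type_algebra (HH_hom A) 2"
      by (rule HH.End_part_module)
    show ?thesis by (rule e.zero_closed)
  qed
  fix N U assume U: "U \<in> carrier (HH_hom A N)"
  then obtain z where z: "z \<in> chain_cycles A N" "U = z +o chain_boundaries A N"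
    by (rule homE)
  have "connes A (N + 1) (connes A N U) = 0 +o chain_boundaries A (N + 1 + 1)"
    unfolding z(2) connes_coset[OF z(1)] connes_coset[OF connes_op_cycle[OF z(1)]]
    by (simp only: connes_op_connes_op[OF cycle_free[OF z(1)]])
  also have "\<dots> = \<zero>\<^bsub>HH_hom A (N + 2)\<^esub>"
    by (simp only: HH_hom_eq hom.coset_zero) (simp add: add.assoc)
  finally show "gmul (End_alg ring_of_type_algebra (HH_hom A)) 1 1 (connes A) (connes A) N U = \<zero>\<^bsub>End_part ring_of_type_algebra (HH_hom A) 2\<^esub> N U"
    using U by (simp add: HH.End_comp_simps End_part_simps)
qed

sublocale End_HH: differential_graded_algebra ring_of_type_algebra "End_alg ring_of_type_algebra (HH_hom A)" "connes A"
  by (intro differential_graded_algebra.intro differential_graded_algebra_axioms.intro HH.End_alg_graded_algebra)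
    (simp_all add: HH.gpart_End connes_End connes_connes)

lemma End_HH_loday_gerstenhaber: "loday_gerstenhaber_algebra ring_of_type_algebra (End_HH_lg A)"
  unfolding End_HH_lg_def by (rule End_HH.derived_lg_loday_gerstenhaber)

lemma cup_coset:
  assumes f: "f \<in> cocycles A p" and g: "g \<in> cocycles A q"
  shows "gmul (HH_cohom_lg A) p q (f +o coboundaries A p) (g +o coboundaries A q) = cup q f g +o coboundaries A (p + q)"
proof -
  have *: "cup q f' g' +o coboundaries A (p + q) = cup q f g +o coboundaries A (p + q)"
    if "f' \<in> f +o coboundaries A p" "g' \<in> g +o coboundaries A q" for f' g'
  proof -
    define h k where "h = f' - f" and "k = g' - g"
    then have hk: "h \<in> coboundaries A p" "k \<in> coboundaries A q" "f' = f + h" "g' = g + k"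
      using that by (auto simp: cohom.mem_coset)
    have "cup q f' g' - cup q f g = cup q h (g + k) + cup q f k"
      unfolding hk by (simp add: cup_add)
    also have "\<dots> \<in> coboundaries A (p + q)"
      by (intro coboundary_add cup_coboundary hk f g cocycle_closed coboundary_cocycle)
    finally show ?thesis by (simp add: cohom.coset_eq)
  qed
  have "f \<in> f +o coboundaries A p" "g \<in> g +o coboundaries A q"
    by (simp_all add: cohom.mem_coset coboundary_zero)
  from UN_UN_const[OF this *] show ?thesis
    by (simp add: HH_cohom_lg_def)
qed

lemma bracket_coset:
  assumes f: "f \<in> cocycles A p" and g: "g \<in> cocycles A q"
  shows "gbr (HH_cohom_lg A) p q (f +o coboundaries A p) (g +o coboundaries A q) = gerst_bracket p q f g +o coboundaries A (p + q + 1)"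
proof -
  have *: "gerst_bracket p q f' g' +o coboundaries A (p + q + 1) = gerst_bracket p q f g +o coboundaries A (p + q + 1)"
    if "f' \<in> f +o coboundaries A p" "g' \<in> g +o coboundaries A q" for f' g'
  proof -
    define h k where "h = f' - f" and "k = g' - g"
    then have hk: "h \<in> coboundaries A p" "k \<in> coboundaries A q" "f' = f + h" "g' = g + k"
      using that by (auto simp: cohom.mem_coset)
    note cl = cocycleD(1)[OF f] cocycleD(1)[OF g] cocycleD(1)[OF coboundary_cocycle[OF hk(1)]] cocycleD(1)[OF coboundary_cocycle[OF hk(2)]]
    have "gerst_bracket p q f' g' - gerst_bracket p q f g = gerst_bracket p q h (g + k) + gerst_bracket p q f k"
      unfolding hk using cl by (simp add: gerst_bracket_add(1)[of f p h "g + k" q] gerst_bracket_add(2)[of f p f g q k] cochain_add_closed)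
    also have "\<dots> \<in> coboundaries A (p + q + 1)"
      by (intro coboundary_add gerst_bracket_coboundary hk f g cocycle_closed coboundary_cocycle)
    finally show ?thesis by (simp add: cohom.coset_eq)
  qed
  have "f \<in> f +o coboundaries A p" "g \<in> g +o coboundaries A q"
    by (simp_all add: cohom.mem_coset coboundary_zero)
  from UN_UN_const[OF this *] show ?thesis
    by (simp add: HH_cohom_lg_def)
qed

lemma gpart_HH_cohom: "gpart (HH_cohom_lg A) = HH_cohom A"
  by (simp add: HH_cohom_lg_def)

lemma gone_HH_cohom: "gone (HH_cohom_lg A) = unit_cochain A +o coboundaries A 0"
  by (simp add: HH_cohom_lg_def)

lemma cohom_koszul: "f \<in> cocycles A p \<Longrightarrow> koszul n f \<in> cocycles A p"
  by (simp add: koszul_def cohom.Z_uminus)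

text \<open>Units, associativity, antisymmetry and the Jacobi identity hold already for cochains.
  Only commutativity and the Leibniz rule need coboundaries, from \<open>cup_commute\<close> and
  \<open>gerst_bracket_cup\<close>.\<close>

lemma HH_cohom_gerstenhaber: "gerstenhaber_algebra ring_of_type_algebra (HH_cohom_lg A)"
proof (intro gerstenhaber_algebra.intro loday_gerstenhaber_algebra.intro graded_algebra.intro
    loday_gerstenhaber_algebra_axioms.intro gerstenhaber_algebra_axioms.intro, unfold gpart_HH_cohom)
  show "Module.module ring_of_type_algebra (HH_cohom A i)" for i
    unfolding HH_cohom_eq by (rule cohom.subquotient_module)
  show "bilinear_map ring_of_type_algebra (HH_cohom A i) (HH_cohom A j) (HH_cohom A (i + j)) (gmul (HH_cohom_lg A) i j)" for i j
    unfolding bilinear_map_def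
    by (intro conjI ballI linear_mapI; elim cohomE)
      (simp_all add: cup_coset cohom_closed cup_cocycle, simp_all add: HH_cohom_eq cup_coset cohom.coset_add cohom.coset_smult cocycle_closed cup_add cup_scal)
  show "bilinear_map ring_of_type_algebra (HH_cohom A i) (HH_cohom A j) (HH_cohom A (i + j + 1)) (gbr (HH_cohom_lg A) i j)" for i j
    unfolding bilinear_map_def
    by (intro conjI ballI linear_mapI; elim cohomE)
      (simp_all add: bracket_coset cohom_closed gerst_bracket_cocycle, simp_all add: HH_cohom_eq bracket_coset cohom.coset_add cohom.coset_smult
        cocycle_closed gerst_bracket_add[OF cocycleD(1) cocycleD(1) cocycleD(1) cocycleD(1)] gerst_bracket_scal[OF cocycleD(1) cocycleD(1)])
  show "gone (HH_cohom_lg A) \<in> carrier (HH_cohom A 0)"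
    by (simp add: gone_HH_cohom cohom_closed unit_cochain_cocycle)
  fix i j k a b c
  assume "a \<in> carrier (HH_cohom A i)"
  then obtain f where f: "f \<in> cocycles A i" "a = f +o coboundaries A i" by (rule cohomE)
  show "gmul (HH_cohom_lg A) 0 i (gone (HH_cohom_lg A)) a = a" "gmul (HH_cohom_lg A) i 0 a (gone (HH_cohom_lg A)) = a"
    using f cup_coset[OF unit_cochain_cocycle f(1)] cup_coset[OF f(1) unit_cochain_cocycle]
    by (simp_all add: gone_HH_cohom cup_unit[OF cocycleD(1)[OF f(1)]])
  assume "b \<in> carrier (HH_cohom A j)"
  then obtain g where g: "g \<in> cocycles A j" "b = g +o coboundaries A j" by (rule cohomE)
  have fg: "cup i g f \<in> cocycles A (i + j)" "gerst_bracket j i g f \<in> cocycles A (i + j + 1)"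
    using cup_cocycle[OF g(1) f(1)] gerst_bracket_cocycle[OF g(1) f(1)] by (simp_all add: add.commute)
  show "gmul (HH_cohom_lg A) i j a b = gsgn (HH_cohom A (i + j)) (i * j) (gmul (HH_cohom_lg A) j i b a)"
    using cup_commute[OF f(1) g(1)] fg
    by (simp add: f(2) g(2) cup_coset[OF f(1) g(1)] cup_coset[OF g(1) f(1)] HH_cohom_eq add.commute[of j i] cohom.coset_gsgn cohom.coset_eq)
  have "gerst_bracket i j f g = - koszul ((i + 1) * (j + 1)) (gerst_bracket j i g f)"
    by (auto simp: gerst_bracket_eq fun_eq_iff koszul_norm)
  then show "gbr (HH_cohom_lg A) i j a b = \<ominus>\<^bsub>HH_cohom A (i + j + 1)\<^esub> gsgn (HH_cohom A (i + j + 1)) ((i + 1) * (j + 1)) (gbr (HH_cohom_lg A) j i b a)"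
    using fg
    by (simp add: f(2) g(2) bracket_coset[OF f(1) g(1)] bracket_coset[OF g(1) f(1)] HH_cohom_eq add.commute[of j i] cohom.coset_gsgn
        cohom.coset_a_inv cohom_koszul)
  assume "c \<in> carrier (HH_cohom A k)"
  then obtain h where h: "h \<in> cocycles A k" "c = h +o coboundaries A k" by (rule cohomE)
  show "gmul (HH_cohom_lg A) (i + j) k (gmul (HH_cohom_lg A) i j a b) c = gmul (HH_cohom_lg A) i (j + k) a (gmul (HH_cohom_lg A) j k b c)"
    unfolding f(2) g(2) h(2) cup_coset[OF f(1) g(1)] cup_coset[OF g(1) h(1)] cup_coset[OF cup_cocycle[OF f(1) g(1)] h(1)]
      cup_coset[OF f(1) cup_cocycle[OF g(1) h(1)]]
    by (simp add: cup_assoc add.assoc)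
  note fg' = gerst_bracket_cocycle[OF f(1) g(1)] and gh' = gerst_bracket_cocycle[OF g(1) h(1)] and fh' = gerst_bracket_cocycle[OF f(1) h(1)]
  have d: "coboundaries A (i + (j + k + 1) + 1) = coboundaries A (i + j + k + 2)" "coboundaries A (i + j + 1 + k + 1) = coboundaries A (i + j + k + 2)"
    "coboundaries A (j + (i + k + 1) + 1) = coboundaries A (i + j + k + 2)" "coboundaries A (i + (j + k) + 1) = coboundaries A (i + j + k + 1)"
    "coboundaries A (i + j + 1 + k) = coboundaries A (i + j + k + 1)" "coboundaries A (j + (i + k + 1)) = coboundaries A (i + j + k + 1)"
    by (simp_all add: algebra_simps)
  have cl: "gerst_bracket j (i + k + 1) g (gerst_bracket i k f h) \<in> cocycles A (i + j + k + 2)"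
    "cup (i + k + 1) g (gerst_bracket i k f h) \<in> cocycles A (i + j + k + 1)"
    using gerst_bracket_cocycle[OF g(1) fh'] cup_cocycle[OF g(1) fh'] by (simp_all add: algebra_simps)
  have jac: "gerst_bracket i (j + k + 1) f (gerst_bracket j k g h) = gerst_bracket (i + j + 1) k (gerst_bracket i j f g) h
      + koszul ((i + 1) * (j + 1)) (gerst_bracket j (i + k + 1) g (gerst_bracket i k f h))"
    by (rule ext) (simp add: gerst_bracket_jacobi[OF cocycleD(1)[OF f(1)] cocycleD(1)[OF g(1)] cocycleD(1)[OF h(1)]])
  show "gbr (HH_cohom_lg A) i (j + k + 1) a (gbr (HH_cohom_lg A) j k b c) = gbr (HH_cohom_lg A) (i + j + 1) k (gbr (HH_cohom_lg A) i j a b) c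
      \<oplus>\<^bsub>HH_cohom A (i + j + k + 2)\<^esub> gsgn (HH_cohom A (i + j + k + 2)) ((i + 1) * (j + 1)) (gbr (HH_cohom_lg A) j (i + k + 1) b (gbr (HH_cohom_lg A) i k a c))"
    unfolding f(2) g(2) h(2) bracket_coset[OF f(1) g(1)] bracket_coset[OF g(1) h(1)] bracket_coset[OF f(1) h(1)]
      bracket_coset[OF f(1) gh'] bracket_coset[OF fg' h(1)] bracket_coset[OF g(1) fh'] d jac HH_cohom_eq
    by (simp only: cohom.coset_gsgn[OF cl(1)] cohom.coset_add)
  show "gbr (HH_cohom_lg A) i (j + k) a (gmul (HH_cohom_lg A) j k b c) = gmul (HH_cohom_lg A) (i + j + 1) k (gbr (HH_cohom_lg A) i j a b) c
      \<oplus>\<^bsub>HH_cohom A (i + j + k + 1)\<^esub> gsgn (HH_cohom A (i + j + k + 1)) ((i + 1) * j) (gmul (HH_cohom_lg A) j (i + k + 1) b (gbr (HH_cohom_lg A) i k a c))"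
    unfolding f(2) g(2) h(2) bracket_coset[OF f(1) g(1)] cup_coset[OF g(1) h(1)] bracket_coset[OF f(1) h(1)]
      bracket_coset[OF f(1) cup_cocycle[OF g(1) h(1)]] cup_coset[OF fg' h(1)] cup_coset[OF g(1) fh'] d HH_cohom_eq
    by (simp only: cohom.coset_gsgn[OF cl(2)] cohom.coset_add cohom.coset_eq gerst_bracket_cup[OF f(1) g(1) h(1)])
qed

lemma action_End:
  assumes "U \<in> carrier (HH_cohom A p)"
  shows "HH_action A p U \<in> carrier (End_part ring_of_type_algebra (HH_hom A) p)"
proof -
  obtain f where f: "f \<in> cocycles A p" "U = f +o coboundaries A p"
    using assms by (rule cohomE)
  note f' = cocycleD[OF f(1)]
  show ?thesis
  proof (rule HH.End_partI)
    show "HH_action A p U N \<in> extensional (carrier (HH_hom A N))" for N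
      by (simp add: HH_action_def)
  next
    fix N V assume "V \<in> carrier (HH_hom A N)"
    then show "HH_action A p U N V \<in> carrier (HH_hom A (N + p))"
      by (elim homE) (simp add: f(2) action_coset[OF f(1)] hom_closed action_op_cycle[OF f'])
  next
    fix N V W assume "V \<in> carrier (HH_hom A N)" "W \<in> carrier (HH_hom A N)"
    then show "HH_action A p U N (V \<oplus>\<^bsub>HH_hom A N\<^esub> W) = HH_action A p U N V \<oplus>\<^bsub>HH_hom A (N + p)\<^esub> HH_action A p U N W"
      by (elim homE) (simp add: f(2) action_coset[OF f(1)] HH_hom_eq hom.coset_add hom.Z_add action_op_linear)
  next
    fix N r V assume "V \<in> carrier (HH_hom A N)"
    then obtain z where z: "z \<in> chain_cycles A N" "V = z +o chain_boundaries A N"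
      by (rule homE)
    have "action_op p f (chain_scal A r z) - chain_scal A r (action_op p f z) \<in> chain_boundaries A (N + p)"
      using action_op_chain_scal[OF f'(1) cycle_free[OF z(1)]] z(1)
      by (intro boundary_null free_chains_diff action_op_free[OF f'(1)] chain_scal_free cycle_free) (auto simp: chain.eqv_def)
    then show "HH_action A p U N (r \<odot>\<^bsub>HH_hom A N\<^esub> V) = r \<odot>\<^bsub>HH_hom A (N + p)\<^esub> HH_action A p U N V"
      using z by (simp add: f(2) action_coset[OF f(1)] HH_hom_eq hom.coset_smult cycle_chain_scal hom.coset_eq)
  qed
qed

text \<open>Composition produces the cup product in the opposite order. The two orders differ by a
  coboundary up to sign, and coboundaries send cycles to boundaries.\<close>

lemma action_op_cup_boundary:
  assumes f: "f \<in> cocycles A p" and g: "g \<in> cocycles A q" and z: "z \<in> chain_cycles A N"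
  shows "action_op (p + q) (cup q f g) z - action_op p f (action_op q g z) \<in> chain_boundaries A (N + (p + q))"
proof -
  note f' = cocycleD[OF f] and g' = cocycleD[OF g] and zf = cycle_free[OF z]
  let ?h = "cup q f g - koszul (p * q) (cup p g f)" and ?k = "koszul (p * q) (cup p g f)"
  have gf: "cup p g f \<in> cochains A (p + q)"
    using cup_cochain[OF g'(1) f'(1)] by (simp add: add.commute)
  have h: "?h \<in> cochains A (p + q)"
    by (intro cochain_diff_closed cochain_koszul_closed gf cup_cochain f' g')
  have k: "chain.eqv (action_op (p + q) ?k z) (koszul (p * q) (action_op (p + q) (cup p g f) z))"
  proof (cases "even (p * q)")
    \<comment> \<open>The action is linear in the cochain only up to congruence, so even a sign is
      pulled out by way of \<open>- F + F = 0\<close>.\<close>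
    case False
    have n: "- cup p g f + cup p g f = (\<lambda>w. 0)"
      by (simp add: zero_fun_def)
    have "chain.eqv (action_op (p + q) (- cup p g f) z + action_op (p + q) (cup p g f) z) 0"
      using chain.eqv_trans[OF chain.eqv_sym[OF action_op_add[OF cochain_uminus_closed[OF gf] gf zf, unfolded n]] action_op_zero[OF zf]] .
    then show ?thesis
      using False by (simp add: koszul_def chain.eqv_def)
  qed (simp add: koszul_def)
  have "chain.eqv (action_op (p + q) (?h + ?k) z) (action_op (p + q) ?h z + action_op (p + q) ?k z)"
    by (rule action_op_add[OF h cochain_koszul_closed[OF gf] zf])
  also have "chain.eqv \<dots> (action_op (p + q) ?h z + action_op p f (action_op q g z))"
    by (intro chain.eqv_add chain.eqv_refl chain.eqv_trans[OF k chain.eqv_sym[OF action_op_cup[OF f'(1) g'(1) zf]]])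
  finally have "chain.eqv (action_op (p + q) (cup q f g) z - action_op p f (action_op q g z)) (action_op (p + q) ?h z)"
    by (simp add: chain.eqv_def algebra_simps)
  then show ?thesis
  proof (rule boundary_eqv)
    show "action_op (p + q) (cup q f g) z - action_op p f (action_op q g z) \<in> free_chains A (N + (p + q))"
      using action_op_free[OF f'(1) action_op_free[OF g'(1) zf]]
      by (intro free_chains_diff action_op_free cup_cochain f' g' zf) (simp add: algebra_simps)
    show "action_op (p + q) ?h z \<in> chain_boundaries A (N + (p + q))"
      by (intro action_op_coboundary cup_commute f g z)
  qed
qed

lemma HH_action_morphism: "lg_morphism ring_of_type_algebra (HH_cohom_lg A) (End_HH_lg A) (HH_action A)"
proof (rule lg_morphism.intro)
  show "loday_gerstenhaber_algebra ring_of_type_algebra (HH_cohom_lg A)"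
    using HH_cohom_gerstenhaber by (simp add: gerstenhaber_algebra_def)
  show "loday_gerstenhaber_algebra ring_of_type_algebra (End_HH_lg A)"
    by (rule End_HH_loday_gerstenhaber)
  let ?E = "End_part ring_of_type_algebra (HH_hom A)" and ?G = "End_alg ring_of_type_algebra (HH_hom A)"
  have G: "gpart (End_HH_lg A) = ?E" "gmul (End_HH_lg A) = gmul ?G" "gone (End_HH_lg A) = gone ?G"
    "gbr (End_HH_lg A) = derived_bracket ?G (connes A)"
    by (simp_all add: End_HH_lg_def derived_lg_def HH.gpart_End)
  show "lg_morphism_axioms ring_of_type_algebra (HH_cohom_lg A) (End_HH_lg A) (HH_action A)"
  proof (rule lg_morphism_axioms.intro, unfold gpart_HH_cohom G)
    show "linear_map ring_of_type_algebra (HH_cohom A i) (?E i) (HH_action A i)" for i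
    proof (rule linear_mapI)
      fix U V assume UV: "U \<in> carrier (HH_cohom A i)" "V \<in> carrier (HH_cohom A i)"
      then obtain f g where f: "f \<in> cocycles A i" "U = f +o coboundaries A i" and g: "g \<in> cocycles A i" "V = g +o coboundaries A i"
        by (elim cohomE)
      have s: "U \<oplus>\<^bsub>HH_cohom A i\<^esub> V = (f + g) +o coboundaries A i"
        by (simp add: f(2) g(2) HH_cohom_eq cohom.coset_add)
      show "HH_action A i (U \<oplus>\<^bsub>HH_cohom A i\<^esub> V) = HH_action A i U \<oplus>\<^bsub>?E i\<^esub> HH_action A i V"
        unfolding s
      proof (rule End_part_eqI)
        show "HH_action A i ((f + g) +o coboundaries A i) \<in> carrier (?E i)"
          by (intro action_End cohom_closed cocycle_closed f g)
        show "HH_action A i U \<oplus>\<^bsub>?E i\<^esub> HH_action A i V \<in> carrier (?E i)"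
          by (intro HH.End_add_closed action_End UV)
        fix N W assume W: "W \<in> carrier (HH_hom A N)"
        then obtain z where z: "z \<in> chain_cycles A N" "W = z +o chain_boundaries A N"
          by (rule homE)
        note f' = cocycleD(1)[OF f(1)] and g' = cocycleD(1)[OF g(1)] and zf = cycle_free[OF z(1)]
        have "action_op i (f + g) z - (action_op i f z + action_op i g z) \<in> chain_boundaries A (N + i)"
          using action_op_add[OF f' g' zf]
          by (intro boundary_null free_chains_diff free_chains_add action_op_free cochain_add_closed f' g' zf) (simp add: chain.eqv_def)
        then show "HH_action A i ((f + g) +o coboundaries A i) N W = (HH_action A i U \<oplus>\<^bsub>?E i\<^esub> HH_action A i V) N W"
          unfolding End_part_simps(1)[where M = "HH_hom A", OF W]
          unfolding f(2) g(2) z(2)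
            action_coset[OF f(1) z(1)] action_coset[OF g(1) z(1)] action_coset[OF cocycle_closed(2)[OF f(1) g(1)] z(1)]
          by (simp add: HH_hom_eq hom.coset_add hom.coset_eq)
      qed
    next
      fix r U assume U: "U \<in> carrier (HH_cohom A i)" and r: "r \<in> carrier (ring_of_type_algebra :: 'k ring)"
      then obtain f where f: "f \<in> cocycles A i" "U = f +o coboundaries A i"
        by (elim cohomE)
      have s: "r \<odot>\<^bsub>HH_cohom A i\<^esub> U = cochain_scal A r f +o coboundaries A i"
        by (simp add: f(2) HH_cohom_eq cohom.coset_smult)
      show "HH_action A i (r \<odot>\<^bsub>HH_cohom A i\<^esub> U) = r \<odot>\<^bsub>?E i\<^esub> HH_action A i U"
        unfolding s
      proof (rule End_part_eqI)
        show "HH_action A i (cochain_scal A r f +o coboundaries A i) \<in> carrier (?E i)"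
          by (intro action_End cohom_closed cocycle_closed f)
        show "r \<odot>\<^bsub>?E i\<^esub> HH_action A i U \<in> carrier (?E i)"
          by (intro HH.End_smult_closed action_End U r)
        fix N W assume W: "W \<in> carrier (HH_hom A N)"
        then obtain z where z: "z \<in> chain_cycles A N" "W = z +o chain_boundaries A N"
          by (rule homE)
        note f' = cocycleD(1)[OF f(1)] and zf = cycle_free[OF z(1)]
        have "action_op i (cochain_scal A r f) z - chain_scal A r (action_op i f z) \<in> chain_boundaries A (N + i)"
          using action_op_scal[OF f' zf]
          by (intro boundary_null free_chains_diff action_op_free chain_scal_free cochain_scal_closed' f' zf) (simp add: chain.eqv_def)
        then show "HH_action A i (cochain_scal A r f +o coboundaries A i) N W = (r \<odot>\<^bsub>?E i\<^esub> HH_action A i U) N W"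
          unfolding End_part_simps(2)[where M = "HH_hom A", OF W]
          unfolding f(2) z(2)
            action_coset[OF f(1) z(1)] action_coset[OF cocycle_closed(4)[OF f(1)] z(1)]
          by (simp add: HH_hom_eq hom.coset_smult hom.coset_eq)
      qed
    qed (rule action_End)
    show "HH_action A 0 (gone (HH_cohom_lg A)) = gone ?G"
      unfolding gone_HH_cohom
    proof (rule End_part_eqI)
      show "HH_action A 0 (unit_cochain A +o coboundaries A 0) \<in> carrier (?E 0)"
        by (intro action_End cohom_closed unit_cochain_cocycle)
      show "gone ?G \<in> carrier (?E 0)"
        by (rule HH.End_one_closed)
      fix N W assume W: "W \<in> carrier (HH_hom A N)"
      then obtain z where z: "z \<in> chain_cycles A N" "W = z +o chain_boundaries A N"
        by (rule homE)
      have "action_op 0 (unit_cochain A) z - z \<in> chain_boundaries A N"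
        using action_op_unit[OF cycle_free[OF z(1)]] action_op_free[OF unit_cochain_cochain cycle_free[OF z(1)]]
        by (intro boundary_null free_chains_diff cycle_free[OF z(1)]) (simp_all add: chain.eqv_def)
      then show "HH_action A 0 (unit_cochain A +o coboundaries A 0) N W = gone ?G N W"
        using W action_coset[OF unit_cochain_cocycle z(1)] by (simp add: z(2) End_alg_def hom.coset_eq)
    qed
    fix i j a b
    assume a: "a \<in> carrier (HH_cohom A i)" and b: "b \<in> carrier (HH_cohom A j)"
    then obtain f g where f: "f \<in> cocycles A i" "a = f +o coboundaries A i" and g: "g \<in> cocycles A j" "b = g +o coboundaries A j"
      by (elim cohomE)
    note f' = cocycleD[OF f(1)] and g' = cocycleD[OF g(1)] and A = action_End[OF a] and B = action_End[OF b]
    show "HH_action A (i + j) (gmul (HH_cohom_lg A) i j a b) = gmul ?G i j (HH_action A i a) (HH_action A j b)"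
    proof (rule End_part_eqI)
      show "HH_action A (i + j) (gmul (HH_cohom_lg A) i j a b) \<in> carrier (?E (i + j))"
        by (simp add: f(2) g(2) cup_coset[OF f(1) g(1)] action_End cohom_closed cup_cocycle[OF f(1) g(1)])
      show "gmul ?G i j (HH_action A i a) (HH_action A j b) \<in> carrier (?E (i + j))"
        by (rule HH.End_comp_closed[OF A B refl])
      fix N W assume W: "W \<in> carrier (HH_hom A N)"
      then obtain z where z: "z \<in> chain_cycles A N" "W = z +o chain_boundaries A N"
        by (rule homE)
      show "HH_action A (i + j) (gmul (HH_cohom_lg A) i j a b) N W = gmul ?G i j (HH_action A i a) (HH_action A j b) N W"
        unfolding HH.End_comp_simps[OF W]
        unfolding f(2) g(2) z(2) cup_coset[OF f(1) g(1)] action_coset[OF cup_cocycle[OF f(1) g(1)] z(1)]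
          action_coset[OF g(1) z(1)] action_coset[OF f(1) action_op_cycle[OF g' z(1)]]
        using action_op_cup_boundary[OF f(1) g(1) z(1)] by (simp add: add.assoc add.commute[of j i] hom.coset_eq)
    qed
    show "HH_action A (i + j + 1) (gbr (HH_cohom_lg A) i j a b) = derived_bracket ?G (connes A) i j (HH_action A i a) (HH_action A j b)"
    proof (rule End_part_eqI)
      note fg = gerst_bracket_cocycle[OF f(1) g(1)]
      show "HH_action A (i + j + 1) (gbr (HH_cohom_lg A) i j a b) \<in> carrier (?E (i + j + 1))"
        by (simp add: f(2) g(2) bracket_coset[OF f(1) g(1)] action_End cohom_closed fg)
      have C: "gcomm ?G i 1 (HH_action A i a) (connes A) \<in> carrier (?E (i + 1))"
        using End_HH.gcomm_closed[of "HH_action A i a" i "connes A" 1] A connes_End by (simp add: HH.gpart_End)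
      show "derived_bracket ?G (connes A) i j (HH_action A i a) (HH_action A j b) \<in> carrier (?E (i + j + 1))"
        using End_HH.gcomm_closed[of "gcomm ?G i 1 (HH_action A i a) (connes A)" "i + 1" "HH_action A j b" j "i + j + 1"] C B
        by (simp add: HH.gpart_End derived_bracket_def)
      \<comment> \<open>A representative of the commutator of \<open>HH_action A i a\<close> with
        \<open>connes A\<close>, in the form used by \<open>action_op_gerst_bracket\<close>.\<close>
      define L where "L z = action_op i f (connes_op A z) - koszul i (connes_op A (action_op i f z))" for z
      have Lc: "L z \<in> chain_cycles A (N + (i + 1))" if "z \<in> chain_cycles A N" for z N
        unfolding L_def using action_op_cycle[OF f' connes_op_cycle[OF that]] connes_op_cycle[OF action_op_cycle[OF f' that]]
        by (intro cycle_diff) (auto simp: koszul_def hom.Z_uminus algebra_simps)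
      have L: "gcomm ?G i 1 (HH_action A i a) (connes A) N (z +o chain_boundaries A N) = L z +o chain_boundaries A (N + (i + 1))"
        if z: "z \<in> chain_cycles A N" for z N
      proof -
        have n: "N + 1 + i = N + (i + 1)" "N + i + 1 = N + (i + 1)" by simp_all
        have c: "connes_op A (action_op i f z) \<in> chain_cycles A (N + (i + 1))"
          using connes_op_cycle[OF action_op_cycle[OF f' z]] by (simp add: n)
        have k: "koszul i (connes_op A (action_op i f z)) \<in> chain_cycles A (N + (i + 1))"
          using c by (simp add: koszul_def hom.Z_uminus)
        show ?thesis
          unfolding HH.End_gcomm[OF A connes_End hom_closed[OF z]]
          unfolding f(2) connes_coset[OF z] action_coset[OF f(1) z] action_coset[OF f(1) connes_op_cycle[OF z]]
            connes_coset[OF action_op_cycle[OF f' z]] n HH_hom_eq hom.coset_gsgn[OF c] mult_1_right hom.coset_minus[OF k] L_def ..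
      qed
      fix N W assume W: "W \<in> carrier (HH_hom A N)"
      then obtain z where z: "z \<in> chain_cycles A N" "W = z +o chain_boundaries A N"
        by (rule homE)
      have n: "N + j + (i + 1) = N + (i + j + 1)" "N + (i + 1) + j = N + (i + j + 1)" "N + (i + 1 + j) = N + (i + j + 1)" by simp_all
      have c: "action_op j g (L z) \<in> chain_cycles A (N + (i + j + 1))"
        using action_op_cycle[OF g' Lc[OF z(1)]] by (simp add: n)
      have k: "koszul ((i + 1) * j) (action_op j g (L z)) \<in> chain_cycles A (N + (i + j + 1))"
        using c by (simp add: koszul_def hom.Z_uminus)
      have "derived_bracket ?G (connes A) i j (HH_action A i a) (HH_action A j b) N W =
          (L (action_op j g z) - koszul ((i + 1) * j) (action_op j g (L z))) +o chain_boundaries A (N + (i + j + 1))"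
        unfolding derived_bracket_def HH.End_gcomm[OF C B W]
        unfolding z(2) L[OF z(1)]
        unfolding g(2) action_coset[OF g(1) z(1)] L[OF action_op_cycle[OF g' z(1)]] action_coset[OF g(1) Lc[OF z(1)]]
          n HH_hom_eq hom.coset_gsgn[OF c] hom.coset_minus[OF k] ..
      also have "\<dots> = action_op (i + j + 1) (gerst_bracket i j f g) z +o chain_boundaries A (N + (i + j + 1))"
        using action_op_gerst_bracket[OF f' g' z(1)] by (simp add: hom.coset_eq L_def add.assoc)
      finally show "HH_action A (i + j + 1) (gbr (HH_cohom_lg A) i j a b) N W =
          derived_bracket ?G (connes A) i j (HH_action A i a) (HH_action A j b) N W"
        by (simp add: f(2) g(2) z(2) bracket_coset[OF f(1) g(1)] action_coset[OF fg z(1)])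
    qed
  qed
qed

end

theorem theorem67:
  fixes A :: "('k::comm_ring_1, 'a::ring) dga"
  assumes "dg_algebra A"
  shows "loday_gerstenhaber_algebra ring_of_type_algebra (End_HH_lg A)
    \<and> lg_morphism ring_of_type_algebra (HH_cohom_lg A) (End_HH_lg A) (HH_action A)
    \<and> gerstenhaber_algebra ring_of_type_algebra
        (lg_image (HH_cohom_lg A) (End_HH_lg A) (HH_action A))"
proof -
  interpret dg_algebra A by fact
  show ?thesis
    using End_HH_loday_gerstenhaber HH_action_morphism gerstenhaber_lg_image[OF HH_cohom_gerstenhaber HH_action_morphism]
    by blast
qed

end
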